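(* Let $k\in\mathbb N$ with $k>1$. The functions $\{\mathbb P^{\mathfrak z}_{2-2k,n}:\ \mathfrak z\in\mathbb H,\ n\in\mathbb Z\}$ span $\mathscr H_{2-2k}$, and for fixed $\mathfrak z\in\mathbb H$ the functions $\{\mathbb P^{\mathfrak z}_{2-2k,n}:\ n\in\mathbb Z\}$ span $\mathscr H^{\mathfrak z}_{2-2k}$. Moreover, with $\mathfrak y=\mathrm{Im}(\mathfrak z)$, \[D^{2k-1}\big(\mathbb P^{\mathfrak z}_{2-2k,n}\big)=-(2k-2)!\Big(\frac{\mathfrak y}{\pi}\Big)^{2k-1}\Psi^{\mathfrak z}_{2k,n+1-2k},\qquad \xi_{2-2k}\big(\mathbb P^{\mathfrak z}_{2-2k,n}\big)=(4\mathfrak y)^{2k-1}\Psi^{\mathfrak z}_{2k,-n-1}.\] The functions $\mathbb P^{\mathfrak z}_{2-2k,n}$ vanish unless $n\equiv k-1\pmod{\omega_{\mathfrak z}}$, in which case their principal parts at $\mathfrak z$ equal \[2\omega_{\mathfrak z}(z-\overline{\mathfrak z})^{2k-2}X_{\mathfrak z}^n(z)\cdot\begin{cases}\beta_0(1-r_{\mathfrak z}^2(z);2k-1,-n)&\text{if }n>2k-2,\\ \beta(1-r_{\mathfrak z}^2(z);2k-1,-n)&\text{if }0\le n\le2k-2,\\ \mathcal C_{2k-1,-n}&\text{if }n<0.\end{cases}\]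
   Context: $\mathbb H$ is the upper half-plane, $z=x+iy$. For $M=\begin{psmallmatrix}a&b\\c&d\end{psmallmatrix}\in\mathrm{SL}_2(\mathbb Z)$, $(f|_{\kappa}M)(z):=(cz+d)^{-\kappa}f(Mz)$. $\Delta_{2\kappa}:=-y^2(\partial_x^2+\partial_y^2)+2i\kappa y(\partial_x+i\partial_y)$; $\xi_{2\kappa}(f):=2iy^{2\kappa}\overline{\partial f/\partial\overline z}$; $D^{2k-1}:=\big(\frac1{2\pi i}\frac{\partial}{\partial z}\big)^{2k-1}$. For $\varrho\in\mathbb H$, $X_\varrho(z):=\frac{z-\varrho}{z-\overline\varrho}$, $r_\varrho(z):=|X_\varrho(z)|$; $\omega_{\mathfrak z}$ is the order of the stabilizer of $\mathfrak z$ in $\mathrm{PSL}_2(\mathbb Z)$. For $0\le Z<1$, $a\in\mathbb N$, $b\in\mathbb Z$: $\beta(Z;a,b):=\int_0^Zt^{a-1}(1-t)^{b-1}dt$, $\mathcal C_{a,b}:=\sum_{0\le j\le a-1,\ j\ne-b}\binom{a-1}{j}\frac{(-1)^j}{j+b}$, $\beta_0(Z;a,b):=\beta(Z;a,b)-\mathcal C_{a,b}$. A polar harmonic Maass form of weight $2\kappa$ is $F:\mathbb H\to\mathbb C$, real analytic outside a discrete set, with $F|_{2\kappa}M=F$ for all $M\in\mathrm{SL}_2(\mathbb Z)$, $\Delta_{2\kappa}F=0$, such that for every $\mathfrak z\in\mathbb H$ there is $n\in\mathbb N_0$ with $(z-\mathfrak z)^nF(z)$ bounded near $\mathfrak z$,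 and $F(z)=O(e^{Cy})$ as $y\to\infty$ for some $C>0$. $\mathscr H_{2-2k}$ is the space of those of weight $2-2k$ which are bounded at $i\infty$, and $\mathscr H^{\mathfrak z}_{2-2k}$ its subspace of forms whose singularities in $\mathbb H$ lie only at points $\mathrm{SL}_2(\mathbb Z)$-equivalent to $\mathfrak z$. Poincaré series: $\Psi^{\mathfrak z}_{2k,n}(z):=\sum_{M\in\mathrm{SL}_2(\mathbb Z)}\big((z-\overline{\mathfrak z})^{-2k}X_{\mathfrak z}^n(z)\big)\big|_{2k}M$ and $\mathbb P^{\mathfrak z}_{2-2k,n}(z):=\sum_{M\in\mathrm{SL}_2(\mathbb Z)}\big((z-\overline{\mathfrak z})^{2k-2}\beta(1-r_{\mathfrak z}^2(z);2k-1,-n)X_{\mathfrak z}^n(z)\big)\big|_{2-2k}M$. The principal part of such a function at $\mathfrak z$ is the singular part of its elliptic expansion around $\mathfrak z$, i.e. the displayed function is such that $\mathbb P^{\mathfrak z}_{2-2k,n}$ minus it is bounded in a neighbourhood of $\mathfrak z$. *)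

theory Defs
  imports "HOL-Analysis.Analysis" "HOL-Library.Function_Algebras"
    "HOL-Library.Landau_Symbols" "HOL-Number_Theory.Cong"
begin

section \<open>The modular group and the slash action\<close>

definition uhp :: "complex set" where
  "uhp = {z. Im z > 0}"

definition SL2Z :: "(int^2^2) set" where
  "SL2Z = {M. det M = 1}"

definition moebius :: "int^2^2 \<Rightarrow> complex \<Rightarrow> complex" where
  "moebius M z = (of_int (M$1$1) * z + of_int (M$1$2)) / (of_int (M$2$1) * z + of_int (M$2$2))"

definition slash :: "int \<Rightarrow> (complex \<Rightarrow> complex) \<Rightarrow> int^2^2 \<Rightarrow> complex \<Rightarrow> complex" where
  "slash \<kappa> f M z = (of_int (M$2$1) * z + of_int (M$2$2)) powi (-\<kappa>) * f (moebius M z)"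

definition modular_orbit :: "complex \<Rightarrow> complex set" where
  "modular_orbit \<zz> = {moebius M \<zz> | M. M \<in> SL2Z}"

definition stabilizer :: "complex \<Rightarrow> (int^2^2) set" where
  "stabilizer \<zz> = {M \<in> SL2Z. moebius M \<zz> = \<zz>}"

text \<open>Elements of \<open>PSL\<^sub>2(\<int>)\<close> are the classes \<open>{M, -M}\<close>.\<close>

definition PSL_stabilizer_order :: "complex \<Rightarrow> nat" where
  "PSL_stabilizer_order \<zz> = card (stabilizer \<zz> // {(M, N). N = M \<or> N = - M})"


section \<open>Differential operators\<close>

definition partial_x :: "(complex \<Rightarrow> complex) \<Rightarrow> complex \<Rightarrow> complex" where
  "partial_x f z = vector_derivative (\<lambda>t. f (z + of_real t)) (at 0)"

definition partial_y :: "(complex \<Rightarrow> complex) \<Rightarrow> complex \<Rightarrow> complex" where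
  "partial_y f z = vector_derivative (\<lambda>t. f (z + \<i> * of_real t)) (at 0)"

definition partial_z :: "(complex \<Rightarrow> complex) \<Rightarrow> complex \<Rightarrow> complex" where
  "partial_z f z = (partial_x f z - \<i> * partial_y f z) / 2"

definition partial_zbar :: "(complex \<Rightarrow> complex) \<Rightarrow> complex \<Rightarrow> complex" where
  "partial_zbar f z = (partial_x f z + \<i> * partial_y f z) / 2"

definition D_op :: "(complex \<Rightarrow> complex) \<Rightarrow> complex \<Rightarrow> complex" where
  "D_op f z = 1 / (2 * of_real pi * \<i>) * partial_z f z"

text \<open>In the next two definitions the argument \<open>\<kappa>\<close> stands for weight \<open>2\<kappa>\<close>.\<close>

definition hyp_laplacian :: "int \<Rightarrow> (complex \<Rightarrow> complex) \<Rightarrow> complex \<Rightarrow> complex" where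
  "hyp_laplacian \<kappa> f z =
     - (of_real (Im z))\<^sup>2 * (partial_x (partial_x f) z + partial_y (partial_y f) z)
     + 2 * \<i> * of_int \<kappa> * of_real (Im z) * (partial_x f z + \<i> * partial_y f z)"

definition xi_op :: "int \<Rightarrow> (complex \<Rightarrow> complex) \<Rightarrow> complex \<Rightarrow> complex" where
  "xi_op \<kappa> f z = 2 * \<i> * of_real (Im z powi (2 * \<kappa>)) * cnj (partial_zbar f z)"


section \<open>Elliptic variable and incomplete beta functions\<close>

definition ell_X :: "complex \<Rightarrow> complex \<Rightarrow> complex" where
  "ell_X \<rho> z = (z - \<rho>) / (z - cnj \<rho>)"

definition ell_r :: "complex \<Rightarrow> complex \<Rightarrow> real" where
  "ell_r \<rho> z = norm (ell_X \<rho> z)"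

definition inc_beta :: "real \<Rightarrow> nat \<Rightarrow> int \<Rightarrow> real" where
  "inc_beta Z a b = integral {0..Z} (\<lambda>t. t ^ (a - 1) * (1 - t) powi (b - 1))"

definition beta_const :: "nat \<Rightarrow> int \<Rightarrow> real" where
  "beta_const a b =
     (\<Sum>j | j \<le> a - 1 \<and> int j \<noteq> - b. real ((a - 1) choose j) * ((-1) ^ j / of_int (int j + b)))"

definition inc_beta0 :: "real \<Rightarrow> nat \<Rightarrow> int \<Rightarrow> real" where
  "inc_beta0 Z a b = inc_beta Z a b - beta_const a b"


section \<open>Polar harmonic Maass forms\<close>

definition real_analytic_at :: "(complex \<Rightarrow> complex) \<Rightarrow> complex \<Rightarrow> bool" where
  "real_analytic_at f w \<longleftrightarrow>
     (\<exists>(c :: nat \<Rightarrow> nat \<Rightarrow> complex) r. r > 0 \<and>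
        (\<forall>h. norm h < r \<longrightarrow>
           ((\<lambda>(i, j). c i j * of_real (Re h ^ i * Im h ^ j)) has_sum f (w + h)) UNIV))"

text \<open>
  A polar harmonic Maass form is really a function on the complement in \<^const>\<open>uhp\<close> of a discrete
  set. It is represented here by a total function whose values on the discrete exceptional set
  (and outside \<^const>\<open>uhp\<close>) are arbitrary. All conditions below are therefore imposed
  off a set without accumulation points in \<^const>\<open>uhp\<close>, which is what the quantifier
  \<open>\<forall>\<^sub>\<approx>z\<in>uhp\<close> expresses, and all of them are invariant under \<open>same_on_uhp\<close>.
\<close>

definition same_on_uhp :: "(complex \<Rightarrow> complex) \<Rightarrow> (complex \<Rightarrow> complex) \<Rightarrow> bool" where
  "same_on_uhp F G \<longleftrightarrow> (\<forall>\<^sub>\<approx>z\<in>uhp. F z = G z)"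

definition polar_harmonic_maass_form :: "int \<Rightarrow> (complex \<Rightarrow> complex) \<Rightarrow> bool" where
  "polar_harmonic_maass_form \<kappa> F \<longleftrightarrow>
     (\<forall>\<^sub>\<approx>z\<in>uhp. real_analytic_at F z) \<and>
     (\<forall>M\<in>SL2Z. \<forall>\<^sub>\<approx>z\<in>uhp. slash (2 * \<kappa>) F M z = F z) \<and>
     (\<forall>\<^sub>\<approx>z\<in>uhp. hyp_laplacian \<kappa> F z = 0) \<and>
     (\<forall>\<zz>\<in>uhp. \<exists>n::nat. (\<lambda>z. (z - \<zz>) ^ n * F z) \<in> O[at \<zz>](\<lambda>_. 1)) \<and>
     (\<exists>C>0. \<exists>B Y. \<forall>\<^sub>\<approx>z\<in>uhp. Im z > Y \<longrightarrow> norm (F z) \<le> B * exp (C * Im z))"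

definition bounded_at_cusp :: "(complex \<Rightarrow> complex) \<Rightarrow> bool" where
  "bounded_at_cusp F \<longleftrightarrow> (\<exists>B Y. \<forall>\<^sub>\<approx>z\<in>uhp. Im z > Y \<longrightarrow> norm (F z) \<le> B)"

text \<open>Since the value at a single point is immaterial, removable singularities do not count.\<close>

definition singular_at :: "(complex \<Rightarrow> complex) \<Rightarrow> complex \<Rightarrow> bool" where
  "singular_at F w \<longleftrightarrow> \<not> (\<exists>G. real_analytic_at G w \<and> (\<forall>\<^sub>F z in at w. F z = G z))"

definition maass_space :: "nat \<Rightarrow> (complex \<Rightarrow> complex) set" where
  "maass_space k = {F. polar_harmonic_maass_form (1 - int k) F \<and> bounded_at_cusp F}"

definition maass_space_at :: "nat \<Rightarrow> complex \<Rightarrow> (complex \<Rightarrow> complex) set" where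
  "maass_space_at k \<zz> =
     {F \<in> maass_space k. \<forall>w\<in>uhp. singular_at F w \<longrightarrow> w \<in> modular_orbit \<zz>}"

interpretation complex_fun: vector_space "\<lambda>(c::complex) (f :: complex \<Rightarrow> complex) z. c * f z"
  by unfold_locales (simp_all add: fun_eq_iff algebra_simps)

text \<open>The functions represented by a finite complex linear combination of elements of \<open>S\<close>.\<close>

definition spanned_forms :: "(complex \<Rightarrow> complex) set \<Rightarrow> (complex \<Rightarrow> complex) set" where
  "spanned_forms S = {F. \<exists>G \<in> complex_fun.span S. same_on_uhp F G}"


section \<open>Poincare series\<close>

text \<open>Both series are only meaningful at points of \<^const>\<open>uhp\<close> outside \<open>modular_orbit \<zz>\<close>
  (\<open>poincare_Psi\<close> with \<open>n \<ge> 0\<close> also at the points of the orbit).\<close>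

definition poincare_Psi :: "nat \<Rightarrow> complex \<Rightarrow> int \<Rightarrow> complex \<Rightarrow> complex" where
  "poincare_Psi k \<zz> n z =
     (\<Sum>\<^sub>\<infinity>M\<in>SL2Z. slash (2 * int k)
        (\<lambda>w. (w - cnj \<zz>) powi (- 2 * int k) * ell_X \<zz> w powi n) M z)"

definition poincare_P :: "nat \<Rightarrow> complex \<Rightarrow> int \<Rightarrow> complex \<Rightarrow> complex" where
  "poincare_P k \<zz> n z =
     (\<Sum>\<^sub>\<infinity>M\<in>SL2Z. slash (2 - 2 * int k)
        (\<lambda>w. (w - cnj \<zz>) powi (2 * int k - 2)
              * of_real (inc_beta (1 - (ell_r \<zz> w)\<^sup>2) (2 * k - 1) (- n))
              * ell_X \<zz> w powi n) M z)"

definition poincare_P_principal_part :: "nat \<Rightarrow> complex \<Rightarrow> int \<Rightarrow> complex \<Rightarrow> complex" where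
  "poincare_P_principal_part k \<zz> n z =
     2 * of_nat (PSL_stabilizer_order \<zz>) * (z - cnj \<zz>) powi (2 * int k - 2) * ell_X \<zz> z powi n
     * of_real
        (if n > 2 * int k - 2 then inc_beta0 (1 - (ell_r \<zz> z)\<^sup>2) (2 * k - 1) (- n)
         else if n \<ge> 0 then inc_beta (1 - (ell_r \<zz> z)\<^sup>2) (2 * k - 1) (- n)
         else beta_const (2 * k - 1) (- n))"

text \<open>\<open>G\<close> is the principal part of \<open>F\<close> at \<open>\<zz>\<close>, up to terms bounded near \<open>\<zz>\<close>.\<close>

definition has_principal_part_at ::
    "(complex \<Rightarrow> complex) \<Rightarrow> (complex \<Rightarrow> complex) \<Rightarrow> complex \<Rightarrow> bool" where
  "has_principal_part_at F G \<zz> \<longleftrightarrow> (\<lambda>z. F z - G z) \<in> O[at \<zz>](\<lambda>_. 1)"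

end

theory Submission
  imports Defs "HOL-Complex_Analysis.Complex_Analysis"
begin

text \<open>
  Put \<open>m = 2k - 2\<close>. A function \<open>F\<close> is harmonic of weight \<open>-m\<close> iff \<open>\<partial>F/\<partial>(cnj z) = y ^ m * cnj g\<close> with \<open>g\<close>
  holomorphic, and then locally \<open>F = f + (\<Sum>j\<le>m. z ^ j * cnj (H j))\<close> with holomorphic \<open>f\<close>, \<open>H j\<close>; in particular
  \<open>D ^ (m + 1)\<close> only sees \<open>f\<close>, and locally uniformly convergent sums may be treated termwise. The terms of
  the Poincare series depend on the linear forms \<open>(cz + d) * (Mz - \<zz>)\<close> and \<open>(cz + d) * (Mz - cnj \<zz>)\<close>
  only, whence the formulas for \<open>\<xi>\<close> and \<open>D ^ (2k - 1)\<close>. A matrix in the stabilizer of \<open>\<zz>\<close> multiplies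
  these forms by \<open>v\<close> and \<open>cnj v\<close>, where \<open>v\<close> runs through the roots of unity of order \<open>2\<omega>\<close>; this gives the vanishing
  and the principal parts.

  For the spanning statements, expand a form \<open>F\<close> at a singular point \<open>\<zz>\<close>: after removing finitely many
  multiples of terms of Poincare series it is regular there, and averaging over the stabilizer shows that
  the same combination of the Poincare series removes the singularity of \<open>F\<close> along the whole orbit. Only
  finitely many orbits are singular because \<open>F\<close> is bounded at the cusp. A form of weight \<open>-m < 0\<close>
  without singularities vanishes by a maximum principle for \<open>y ^ (-m) * |F|\<^sup>2\<close>, which tends to \<open>0\<close> at the cusp:
  in the disc model the value of \<open>F\<close> at the centre is the mean of \<open>F * (1 - X) ^ m\<close> over circles.
\<close>

section \<open>Wirtinger derivatives\<close>

text \<open>The series converges because the two linear forms \<open>l\<close>, \<open>u\<close> of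
  any matrix satisfy \<open>norm l ^ 2 - norm u ^ 2 = 4 * Im \<zz> * Im z\<close>: the argument
  \<open>1 - r ^ 2\<close> of the incomplete beta function is of order
  \<open>1 / norm l ^ 2\<close>, which outweighs the growing factor \<open>l ^ m\<close> and leaves
  \<open>norm l ^ (m + 2)\<close> in the denominator; \<open>k > 1\<close> makes this exponent at
  least 4. The obstacle at a singular point is that the terms with \<open>n \<ge> 0\<close> bring in
  negative powers of \<open>cnj X\<close> and logarithms, so coefficients cannot be read off from
  \<open>F\<close> directly. They are found in two rounds. The pole of the holomorphic function
  \<open>g\<close> fixes the terms with \<open>n \<ge> 0\<close>. Then \<open>g\<close> is regular,
  what remains singular is a single-valued holomorphic function, and its pole fixes the terms with
  \<open>n < 0\<close>, whose leading constants \<open>beta_const\<close> are positive. The first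
  round needs the pole order of \<open>g\<close> in terms of the growth of \<open>F\<close>; this
  comes from a Cauchy estimate in the disc model. Since a form is a total function with arbitrary
  values on a discrete set, the intermediate notions refer to punctured neighbourhoods.\<close>

definition has_wirtinger :: "(complex \<Rightarrow> complex) \<Rightarrow> complex \<Rightarrow> complex \<Rightarrow> complex \<Rightarrow> bool" where
  "has_wirtinger f p q z \<longleftrightarrow> (f has_derivative (\<lambda>v. p * v + q * cnj v)) (at z)"

lemma has_wirtinger_partial_x:
  assumes "has_wirtinger f p q z" shows "partial_x f z = p + q"
proof -
  have "((\<lambda>t::real. f (z + of_real t)) has_derivative (\<lambda>t. p * of_real t + q * cnj (of_real t))) (at 0)"
    using assms unfolding has_wirtinger_def
    by (intro has_derivative_compose[where f = "\<lambda>t. z + of_real t" and g = f]) (auto intro!: derivative_eq_intros)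
  then show ?thesis
    unfolding partial_x_def
    by (intro vector_derivative_at) (simp add: has_vector_derivative_def scaleR_conv_of_real algebra_simps)
qed

lemma has_wirtinger_partial_y:
  assumes "has_wirtinger f p q z" shows "partial_y f z = \<i> * (p - q)"
proof -
  have "((\<lambda>t::real. f (z + \<i> * of_real t)) has_derivative (\<lambda>t. p * (\<i> * of_real t) + q * cnj (\<i> * of_real t))) (at 0)"
    using assms unfolding has_wirtinger_def
    by (intro has_derivative_compose[where f = "\<lambda>t. z + \<i> * of_real t" and g = f]) (auto intro!: derivative_eq_intros)
  then show ?thesis
    unfolding partial_y_def
    by (intro vector_derivative_at) (simp add: has_vector_derivative_def scaleR_conv_of_real algebra_simps)
qed

lemma has_wirtinger_partial_z:
  assumes "has_wirtinger f p q z" shows "partial_z f z = p"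
  unfolding partial_z_def has_wirtinger_partial_x[OF assms] has_wirtinger_partial_y[OF assms]
  by (simp add: algebra_simps)

lemma has_wirtinger_partial_zbar:
  assumes "has_wirtinger f p q z" shows "partial_zbar f z = q"
  unfolding partial_zbar_def has_wirtinger_partial_x[OF assms] has_wirtinger_partial_y[OF assms]
  by (simp add: algebra_simps)

lemma has_wirtinger_unique:
  assumes "has_wirtinger f p q z" "has_wirtinger f p' q' z" shows "p = p'" "q = q'"
  using assms has_wirtinger_partial_z has_wirtinger_partial_zbar by blast+

lemma has_wirtinger_D_op:
  assumes "has_wirtinger f p q z" shows "D_op f z = p / (2 * of_real pi * \<i>)"
  by (simp add: D_op_def has_wirtinger_partial_z[OF assms])

lemma has_wirtinger_holo:
  assumes "(f has_field_derivative p) (at z)" shows "has_wirtinger f p 0 z"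
  using assms by (simp add: has_wirtinger_def has_field_derivative_def)

lemma has_wirtinger_holoD:
  assumes "has_wirtinger f p 0 z" shows "(f has_field_derivative p) (at z)"
  using assms by (simp add: has_wirtinger_def has_field_derivative_def)

lemma has_wirtinger_const: "has_wirtinger (\<lambda>z. c) 0 0 z"
  by (simp add: has_wirtinger_def)

lemma has_wirtinger_cnj:
  assumes "has_wirtinger f p q z" shows "has_wirtinger (\<lambda>z. cnj (f z)) (cnj q) (cnj p) z"
  using has_derivative_cnj[OF assms[unfolded has_wirtinger_def]]
  by (simp add: has_wirtinger_def algebra_simps)

lemma has_wirtinger_add:
  assumes "has_wirtinger f p q z" "has_wirtinger g p' q' z"
  shows "has_wirtinger (\<lambda>z. f z + g z) (p + p') (q + q') z"
  using has_derivative_add[OF assms[unfolded has_wirtinger_def]]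
  by (simp add: has_wirtinger_def algebra_simps)

lemma has_wirtinger_diff:
  assumes "has_wirtinger f p q z" "has_wirtinger g p' q' z"
  shows "has_wirtinger (\<lambda>z. f z - g z) (p - p') (q - q') z"
  using has_derivative_diff[OF assms[unfolded has_wirtinger_def]]
  by (simp add: has_wirtinger_def algebra_simps)

lemma has_wirtinger_mult:
  assumes "has_wirtinger f p q z" "has_wirtinger g p' q' z"
  shows "has_wirtinger (\<lambda>z. f z * g z) (f z * p' + p * g z) (f z * q' + q * g z) z"
  using has_derivative_mult[OF assms[unfolded has_wirtinger_def]]
  by (simp add: has_wirtinger_def algebra_simps)

lemma has_wirtinger_cmult:
  assumes "has_wirtinger f p q z"
  shows "has_wirtinger (\<lambda>z. c * f z) (c * p) (c * q) z"
  using has_wirtinger_mult[OF has_wirtinger_const assms, of c] by simp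

lemma has_wirtinger_sum:
  assumes "\<And>i. i \<in> I \<Longrightarrow> has_wirtinger (f i) (p i) (q i) z"
  shows "has_wirtinger (\<lambda>z. \<Sum>i\<in>I. f i z) (\<Sum>i\<in>I. p i) (\<Sum>i\<in>I. q i) z"
  using has_derivative_sum[of I f "\<lambda>i v. p i * v + q i * cnj v" "at z"] assms
  by (simp add: has_wirtinger_def algebra_simps sum_distrib_left sum.distrib)

lemma has_wirtinger_chain:
  assumes "has_wirtinger f p q (h z)" "(h has_field_derivative d) (at z)"
  shows "has_wirtinger (\<lambda>z. f (h z)) (p * d) (q * cnj d) z"
  using has_derivative_compose[OF assms(2)[unfolded has_field_derivative_def] assms(1)[unfolded has_wirtinger_def]]
  by (simp add: has_wirtinger_def algebra_simps)

lemma has_wirtinger_cong_open: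
  assumes "has_wirtinger f p q z" "open S" "z \<in> S" "\<And>w. w \<in> S \<Longrightarrow> f w = g w"
  shows "has_wirtinger g p q z"
  using has_derivative_transform_within_open[of f _ z UNIV S g] assms by (simp add: has_wirtinger_def)

lemma has_wirtinger_isCont: "has_wirtinger f p q z \<Longrightarrow> isCont f z"
  unfolding has_wirtinger_def using has_derivative_continuous by blast

text \<open>The differential of a real-valued function takes real values only, so the real chain
  rule applies to it and multiplies both Wirtinger coefficients by \<open>d\<close>.\<close>

lemma has_wirtinger_of_real:
  assumes "has_wirtinger (\<lambda>z. of_real (f z)) p q z" "(h has_field_derivative d) (at (f z))"
  shows "has_wirtinger (\<lambda>z. of_real (h (f z))) (of_real d * p) (of_real d * q) z"
proof -
  have "((\<lambda>z. Re (of_real (f z))) has_derivative (\<lambda>v. Re (p * v + q * cnj v))) (at z)"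
    by (rule has_derivative_Re[OF assms(1)[unfolded has_wirtinger_def]])
  then have f: "(f has_derivative (\<lambda>v. Re (p * v + q * cnj v))) (at z)" by simp
  have "((\<lambda>z. of_real (f z)) has_derivative (\<lambda>v. complex_of_real (Re (p * v + q * cnj v)))) (at z)"
    by (rule has_derivative_of_real[OF f])
  then have eq: "(\<lambda>v. complex_of_real (Re (p * v + q * cnj v))) = (\<lambda>v. p * v + q * cnj v)"
    using assms(1) has_derivative_unique unfolding has_wirtinger_def by blast
  have "((\<lambda>z. h (f z)) has_derivative (\<lambda>v. d * Re (p * v + q * cnj v))) (at z)"
    using has_derivative_compose[OF f assms(2)[unfolded has_field_derivative_def]] .
  then have "((\<lambda>z. of_real (h (f z))) has_derivative (\<lambda>v. complex_of_real (d * Re (p * v + q * cnj v)))) (at z)"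
    by (rule has_derivative_of_real)
  moreover have "(\<lambda>v. complex_of_real (d * Re (p * v + q * cnj v))) = (\<lambda>v. (of_real d * p) * v + (of_real d * q) * cnj v)"
  proof
    fix v show "complex_of_real (d * Re (p * v + q * cnj v)) = (of_real d * p) * v + (of_real d * q) * cnj v"
      using fun_cong[OF eq, of v] by (simp only: of_real_mult) (simp add: algebra_simps)
  qed
  ultimately show ?thesis by (simp add: has_wirtinger_def)
qed

text \<open>A conjugate-holomorphic factor is a constant for \<open>partial_z\<close>, so iterating
  \<open>D_op\<close> differentiates the factors \<open>a j\<close> alone.\<close>

lemma D_op_iterate_holo_cnj:
  assumes "open S" "finite J" "\<And>j. j \<in> J \<Longrightarrow> a j holomorphic_on S" "\<And>j. j \<in> J \<Longrightarrow> b j holomorphic_on S"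
    and "\<And>z. z \<in> S \<Longrightarrow> F z = (\<Sum>j\<in>J. a j z * cnj (b j z))" and "z \<in> S"
  shows "(D_op ^^ n) F z = (1 / (2 * of_real pi * \<i>)) ^ n * (\<Sum>j\<in>J. (deriv ^^ n) (a j) z * cnj (b j z))"
  using \<open>z \<in> S\<close>
proof (induction n arbitrary: z)
  case 0
  then show ?case using assms(5) by simp
next
  case (Suc n)
  let ?c = "1 / (2 * of_real pi * \<i>) :: complex"
  have "has_wirtinger (\<lambda>z. (deriv ^^ n) (a j) z * cnj (b j z))
      ((deriv ^^ Suc n) (a j) z * cnj (b j z)) ((deriv ^^ n) (a j) z * cnj (deriv (b j) z)) z" if "j \<in> J" for j
  proof -
    have "((deriv ^^ n) (a j) has_field_derivative (deriv ^^ Suc n) (a j) z) (at z)"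
      using holomorphic_derivI[OF holomorphic_higher_deriv[OF assms(3)[OF that] assms(1)] assms(1) Suc.prems] by simp
    moreover have "(b j has_field_derivative deriv (b j) z) (at z)"
      using holomorphic_derivI[OF assms(4)[OF that] assms(1) Suc.prems] .
    ultimately show ?thesis
      using has_wirtinger_mult[OF has_wirtinger_holo has_wirtinger_cnj[OF has_wirtinger_holo]] by force
  qed
  from has_wirtinger_cmult[OF has_wirtinger_sum[where I = J, OF this]]
  have "has_wirtinger (\<lambda>z. ?c ^ n * (\<Sum>j\<in>J. (deriv ^^ n) (a j) z * cnj (b j z)))
      (?c ^ n * (\<Sum>j\<in>J. (deriv ^^ Suc n) (a j) z * cnj (b j z)))
      (?c ^ n * (\<Sum>j\<in>J. (deriv ^^ n) (a j) z * cnj (deriv (b j) z))) z" by simp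
  from has_wirtinger_cong_open[OF this assms(1) Suc.prems, of "(D_op ^^ n) F"] Suc.IH
  have "has_wirtinger ((D_op ^^ n) F)
      (?c ^ n * (\<Sum>j\<in>J. (deriv ^^ Suc n) (a j) z * cnj (b j z)))
      (?c ^ n * (\<Sum>j\<in>J. (deriv ^^ n) (a j) z * cnj (deriv (b j) z))) z" by simp
  from has_wirtinger_D_op[OF this] show ?case by (simp add: power_divide)
qed

section \<open>Weighted harmonic functions\<close>

text \<open>The weights \<open>y ^ m\<close> on the upper half-plane and \<open>(1 - r\<^sup>2) ^ m\<close> on the disc both have the shape
  \<open>\<Sum>j\<le>m. z ^ j * cnj (P j z)\<close> with entire \<open>P j\<close>, so they can be treated together.\<close>

definition wharm :: "nat \<Rightarrow> (nat \<Rightarrow> complex \<Rightarrow> complex) \<Rightarrow> (complex \<Rightarrow> complex) \<Rightarrow> (complex \<Rightarrow> complex) \<Rightarrow> complex set \<Rightarrow> bool" where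
  "wharm m P F g S \<longleftrightarrow> open S \<and> g holomorphic_on S \<and>
     (\<forall>z\<in>S. \<exists>p. has_wirtinger F p ((\<Sum>j\<le>m. z ^ j * cnj (P j z)) * cnj (g z)) z)"

lemma wharmE:
  assumes "wharm m P F g S" "z \<in> S"
  obtains p where "has_wirtinger F p ((\<Sum>j\<le>m. z ^ j * cnj (P j z)) * cnj (g z)) z"
  using assms unfolding wharm_def by blast

lemma wharm_open: "wharm m P F g S \<Longrightarrow> open S"
  and wharm_holomorphic: "wharm m P F g S \<Longrightarrow> g holomorphic_on S"
  by (simp_all add: wharm_def)

lemma has_wirtinger_power_cnj_sum:
  assumes "\<And>j. (H j has_field_derivative D j) (at z)"
  shows "has_wirtinger (\<lambda>z. \<Sum>j\<le>m. z ^ j * cnj (H j z))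
    (\<Sum>j\<le>m. of_nat j * z ^ (j - 1) * cnj (H j z)) (\<Sum>j\<le>m. z ^ j * cnj (D j)) z"
proof (rule has_wirtinger_sum)
  fix j
  have "has_wirtinger (\<lambda>z. z ^ j) (of_nat j * z ^ (j - 1)) 0 z"
    by (rule has_wirtinger_holo) (auto intro!: derivative_eq_intros)
  from has_wirtinger_mult[OF this has_wirtinger_cnj[OF has_wirtinger_holo[OF assms[of j]]]]
  show "has_wirtinger (\<lambda>z. z ^ j * cnj (H j z)) (of_nat j * z ^ (j - 1) * cnj (H j z)) (z ^ j * cnj (D j)) z"
    by simp
qed

text \<open>The subtracted sum has the same \<open>cnj z\<close>-derivative as \<open>F\<close>,
  because only its factors \<open>cnj (H j z)\<close> contribute; what is left satisfies the
  Cauchy-Riemann equations.\<close>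

lemma wharm_remainder_holomorphic:
  assumes F: "wharm m P F g S" and H: "\<And>j z. z \<in> S \<Longrightarrow> (H j has_field_derivative P j z * g z) (at z)"
  shows "(\<lambda>z. F z - (\<Sum>j\<le>m. z ^ j * cnj (H j z))) holomorphic_on S"
proof -
  have "\<exists>d. ((\<lambda>z. F z - (\<Sum>j\<le>m. z ^ j * cnj (H j z))) has_field_derivative d) (at z)" if z: "z \<in> S" for z
  proof -
    obtain p where p: "has_wirtinger F p ((\<Sum>j\<le>m. z ^ j * cnj (P j z)) * cnj (g z)) z"
      using F z by (auto simp: wharm_def)
    from has_wirtinger_diff[OF p has_wirtinger_power_cnj_sum[of H "\<lambda>j. P j z * g z" z m, OF H[OF z]]]
    have "\<exists>d. has_wirtinger (\<lambda>z. F z - (\<Sum>j\<le>m. z ^ j * cnj (H j z))) d 0 z"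
      by (auto simp: sum_distrib_right mult.assoc intro!: exI)
    then show ?thesis using has_wirtinger_holoD by blast
  qed
  then have "(\<lambda>z. F z - (\<Sum>j\<le>m. z ^ j * cnj (H j z))) field_differentiable at z within S" if "z \<in> S" for z
    using that field_differentiable_at_within unfolding field_differentiable_def by blast
  then show ?thesis by (simp add: holomorphic_on_def)
qed

text \<open>The weight is a finite sum of products \<open>z ^ j * cnj (P j z)\<close>, so on a
  convex set it can be integrated in \<open>cnj z\<close> by taking primitives of
  \<open>P j * g\<close>. The normalization at \<open>z0\<close> lets \<open>g\<close> control every
  \<open>H j\<close>. The last identity holds for all \<open>z\<close>, since \<open>f\<close> is
  defined as the difference.\<close>

lemma wharm_rep:
  assumes F: "wharm m P F g S" and P: "\<And>j. P j holomorphic_on UNIV" and S: "convex S" and z0: "z0 \<in> S"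
  obtains f H where "f holomorphic_on S" "\<And>j z. z \<in> S \<Longrightarrow> (H j has_field_derivative P j z * g z) (at z)"
    "\<And>j. H j z0 = 0" "\<And>z. F z = f z + (\<Sum>j\<le>m. z ^ j * cnj (H j z))"
proof -
  have oS: "open S" using F by (simp add: wharm_def)
  have "\<exists>h. \<forall>z\<in>S. (h has_field_derivative P j z * g z) (at z)" for j
  proof -
    have "(\<lambda>z. P j z * g z) holomorphic_on S"
      using F holomorphic_on_subset[OF P subset_UNIV, of j S] by (intro holomorphic_on_mult) (simp_all add: wharm_def)
    from holomorphic_convex_primitive'[OF S oS this] show ?thesis
      by (metis at_within_open oS)
  qed
  then obtain h where h: "\<And>j z. z \<in> S \<Longrightarrow> (h j has_field_derivative P j z * g z) (at z)" by metis
  define H where "H j z = h j z - h j z0" for j z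
  have H: "(H j has_field_derivative P j z * g z) (at z)" if "z \<in> S" for j z
    unfolding H_def using h[OF that] by (auto intro!: derivative_eq_intros)
  show thesis
  proof (rule that[of _ H])
    show "(\<lambda>z. F z - (\<Sum>j\<le>m. z ^ j * cnj (H j z))) holomorphic_on S"
      by (rule wharm_remainder_holomorphic[OF F H])
    show "(H j has_field_derivative P j z * g z) (at z)" if "z \<in> S" for j z
      using H[OF that] .
  qed (simp_all add: H_def)
qed

lemma wharmI_rep:
  assumes "open S" "g holomorphic_on S" "f holomorphic_on S"
    and H: "\<And>j z. z \<in> S \<Longrightarrow> (H j has_field_derivative P j z * g z) (at z)"
    and F: "\<And>z. z \<in> S \<Longrightarrow> F z = f z + (\<Sum>j\<le>m. z ^ j * cnj (H j z))"
  shows "wharm m P F g S"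
  unfolding wharm_def
proof (intro conjI assms ballI)
  fix z assume z: "z \<in> S"
  have eq: "(\<Sum>j\<le>m. z ^ j * cnj (P j z * g z)) = (\<Sum>j\<le>m. z ^ j * cnj (P j z)) * cnj (g z)"
    by (simp add: sum_distrib_right mult.assoc)
  have "has_wirtinger (\<lambda>z. f z + (\<Sum>j\<le>m. z ^ j * cnj (H j z)))
      (deriv f z + (\<Sum>j\<le>m. of_nat j * z ^ (j - 1) * cnj (H j z))) (0 + (\<Sum>j\<le>m. z ^ j * cnj (P j z * g z))) z"
    by (intro has_wirtinger_add has_wirtinger_holo holomorphic_derivI[OF assms(3,1) z] has_wirtinger_power_cnj_sum H z)
  from has_wirtinger_cong_open[OF this assms(1) z, of F]
  show "\<exists>p. has_wirtinger F p ((\<Sum>j\<le>m. z ^ j * cnj (P j z)) * cnj (g z)) z"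
    unfolding eq add_0 using F by (metis (no_types, lifting))
qed

lemma wharm_add:
  assumes "wharm m P F g S" "wharm m P F' g' S"
  shows "wharm m P (\<lambda>z. F z + F' z) (\<lambda>z. g z + g' z) S"
  unfolding wharm_def
proof (intro conjI ballI)
  fix z assume z: "z \<in> S"
  obtain p where p: "has_wirtinger F p ((\<Sum>j\<le>m. z ^ j * cnj (P j z)) * cnj (g z)) z"
    using wharmE[OF assms(1) z] .
  obtain p' where p': "has_wirtinger F' p' ((\<Sum>j\<le>m. z ^ j * cnj (P j z)) * cnj (g' z)) z"
    using wharmE[OF assms(2) z] .
  from has_wirtinger_add[OF p p']
  show "\<exists>p. has_wirtinger (\<lambda>z. F z + F' z) p ((\<Sum>j\<le>m. z ^ j * cnj (P j z)) * cnj (g z + g' z)) z"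
    by (intro exI[of _ "p + p'"]) (simp only: complex_cnj_add distrib_left)
qed (auto intro!: holomorphic_intros wharm_open[OF assms(1)] wharm_holomorphic[OF assms(1)] wharm_holomorphic[OF assms(2)])

lemma wharm_cmult:
  assumes "wharm m P F g S"
  shows "wharm m P (\<lambda>z. c * F z) (\<lambda>z. cnj c * g z) S"
  unfolding wharm_def
proof (intro conjI ballI)
  fix z assume z: "z \<in> S"
  obtain p where "has_wirtinger F p ((\<Sum>j\<le>m. z ^ j * cnj (P j z)) * cnj (g z)) z"
    using wharmE[OF assms z] .
  from has_wirtinger_cmult[OF this, of c]
  show "\<exists>p. has_wirtinger (\<lambda>z. c * F z) p ((\<Sum>j\<le>m. z ^ j * cnj (P j z)) * cnj (cnj c * g z)) z"
    by (intro exI[of _ "c * p"]) (simp only: complex_cnj_mult complex_cnj_cnj mult.left_commute[of c])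
qed (auto intro!: holomorphic_intros wharm_open[OF assms(1)] wharm_holomorphic[OF assms(1)])

lemma wharm_subset: "wharm m P F g S \<Longrightarrow> open T \<Longrightarrow> T \<subseteq> S \<Longrightarrow> wharm m P F g T"
  unfolding wharm_def using holomorphic_on_subset by blast

lemma wharm_cong:
  assumes "wharm m P F g S" "\<And>z. z \<in> S \<Longrightarrow> F z = F' z" "\<And>z. z \<in> S \<Longrightarrow> g z = g' z"
  shows "wharm m P F' g' S"
  unfolding wharm_def
proof (intro conjI ballI)
  show "open S" using assms wharm_open by blast
  show "g' holomorphic_on S" using assms(3) wharm_holomorphic[OF assms(1)] holomorphic_cong[of S S g g'] by simp
  fix z assume z: "z \<in> S"
  obtain p where "has_wirtinger F p ((\<Sum>j\<le>m. z ^ j * cnj (P j z)) * cnj (g z)) z"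
    using wharmE[OF assms(1) z] .
  from has_wirtinger_cong_open[OF this \<open>open S\<close> z assms(2)] assms(3)[OF z]
  show "\<exists>p. has_wirtinger F' p ((\<Sum>j\<le>m. z ^ j * cnj (P j z)) * cnj (g' z)) z" by auto
qed

lemma wharm_holo: "open S \<Longrightarrow> f holomorphic_on S \<Longrightarrow> wharm m P f (\<lambda>_. 0) S"
  by (rule wharmI_rep[where f = f and H = "\<lambda>_ _. 0"]) auto

lemma wharm_isCont: "wharm m P F g S \<Longrightarrow> z \<in> S \<Longrightarrow> isCont F z"
  using has_wirtinger_isCont unfolding wharm_def by blast

section \<open>Dominated sums and termwise differentiation\<close>

lemma higher_deriv_sum:
  assumes "open S" "finite I" "\<And>i. i \<in> I \<Longrightarrow> f i holomorphic_on S" "z \<in> S"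
  shows "(deriv ^^ n) (\<lambda>z. \<Sum>i\<in>I. f i z) z = (\<Sum>i\<in>I. (deriv ^^ n) (f i) z)"
  using assms(2,3)
proof (induction I rule: finite_induct)
  case (insert i I)
  have "(deriv ^^ n) (\<lambda>z. f i z + (\<Sum>i\<in>I. f i z)) z = (deriv ^^ n) (f i) z + (deriv ^^ n) (\<lambda>z. \<Sum>i\<in>I. f i z) z"
    using insert.prems by (intro higher_deriv_add[OF _ _ assms(1,4)] holomorphic_on_sum) simp_all
  then show ?case using insert by simp
qed simp

lemma has_sum_swap_sum:
  fixes f :: "'j \<Rightarrow> 'a \<Rightarrow> 'b :: topological_comm_monoid_add"
  assumes "finite J" "\<And>j. j \<in> J \<Longrightarrow> (f j has_sum s j) A"
  shows "((\<lambda>i. \<Sum>j\<in>J. f j i) has_sum (\<Sum>j\<in>J. s j)) A"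
  using assms by (induction J rule: finite_induct) (auto intro: has_sum_add has_sum_0)

lemma summable_on_swap_sum:
  fixes f :: "'j \<Rightarrow> 'a \<Rightarrow> 'b :: {topological_comm_monoid_add, t2_space}"
  assumes "finite J" "\<And>j. j \<in> J \<Longrightarrow> f j summable_on A"
  shows "(\<lambda>i. \<Sum>j\<in>J. f j i) summable_on A"
  using has_sum_imp_summable[OF has_sum_swap_sum[OF assms(1) has_sum_infsum[OF assms(2)]]] .

lemma summable_on_dominated:
  fixes f :: "'a \<Rightarrow> complex"
  assumes "g summable_on A" "\<And>x. x \<in> A \<Longrightarrow> norm (f x) \<le> g x"
  shows "f summable_on A"
  by (rule abs_summable_summable, rule Infinite_Sum.abs_summable_on_comparison_test'[OF assms])

text \<open>Weierstrass' theorem for unordered sums: the majorant makes the finite partial sums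
  converge uniformly, and derivatives of all orders pass to a uniform limit of holomorphic
  functions.\<close>

lemma holomorphic_infsum:
  fixes f :: "'a \<Rightarrow> complex \<Rightarrow> complex"
  assumes "open A" and holo: "\<And>i. i \<in> I \<Longrightarrow> f i holomorphic_on A"
    and bd: "\<And>i z. i \<in> I \<Longrightarrow> z \<in> A \<Longrightarrow> norm (f i z) \<le> a i" and a: "a summable_on I"
  shows "(\<lambda>z. \<Sum>\<^sub>\<infinity>i\<in>I. f i z) holomorphic_on A"
    and "z \<in> A \<Longrightarrow> ((\<lambda>i. (deriv ^^ n) (f i) z) has_sum (deriv ^^ n) (\<lambda>z. \<Sum>\<^sub>\<infinity>i\<in>I. f i z) z) I"
proof -
  let ?F = "finite_subsets_at_top I"
  have ul: "uniform_limit A (\<lambda>X y. \<Sum>x\<in>X. f x y) (\<lambda>y. \<Sum>\<^sub>\<infinity>x\<in>I. f x y) ?F"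
    using bd a by (rule Weierstrass_m_test_general)
  have ev: "eventually (\<lambda>X. finite X \<and> X \<subseteq> I) ?F"
    by (simp add: eventually_finite_subsets_at_top_weakI)
  have hev: "eventually (\<lambda>X. (\<lambda>y. \<Sum>x\<in>X. f x y) holomorphic_on A) ?F"
    using ev by eventually_elim (auto intro!: holomorphic_intros holo)
  show "(\<lambda>z. \<Sum>\<^sub>\<infinity>i\<in>I. f i z) holomorphic_on A"
  proof (rule analytic_imp_holomorphic, unfold analytic_on_def, intro ballI)
    fix z assume "z \<in> A"
    then obtain r where r: "r > 0" "cball z r \<subseteq> A" using assms(1) open_contains_cball by blast
    have "eventually (\<lambda>X. continuous_on (cball z r) (\<lambda>y. \<Sum>x\<in>X. f x y) \<and> (\<lambda>y. \<Sum>x\<in>X. f x y) holomorphic_on ball z r) ?F"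
      using hev
    proof eventually_elim
      case (elim X)
      then show ?case
        using r holomorphic_on_subset holomorphic_on_imp_continuous_on ball_subset_cball
        by (metis subset_trans)
    qed
    from holomorphic_uniform_limit[OF this uniform_limit_on_subset[OF ul r(2)]] r
    show "\<exists>\<epsilon>>0. (\<lambda>z. \<Sum>\<^sub>\<infinity>i\<in>I. f i z) holomorphic_on ball z \<epsilon>" by auto
  qed
  assume z: "z \<in> A"
  have "((\<lambda>X. (deriv ^^ n) (\<lambda>y. \<Sum>x\<in>X. f x y) z) \<longlongrightarrow> (deriv ^^ n) (\<lambda>z. \<Sum>\<^sub>\<infinity>i\<in>I. f i z) z) ?F"
    by (rule higher_deriv_complex_uniform_limit[OF ul hev _ assms(1) z]) simp
  moreover have "eventually (\<lambda>X. (deriv ^^ n) (\<lambda>y. \<Sum>x\<in>X. f x y) z = (\<Sum>x\<in>X. (deriv ^^ n) (f x) z)) ?F"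
    using ev by eventually_elim (auto intro!: higher_deriv_sum[OF assms(1) _ _ z] holo)
  ultimately show "((\<lambda>i. (deriv ^^ n) (f i) z) has_sum (deriv ^^ n) (\<lambda>z. \<Sum>\<^sub>\<infinity>i\<in>I. f i z) z) I"
    unfolding has_sum_def using tendsto_cong by fast
qed

text \<open>The derivative of order \<open>m + 1\<close> kills every \<open>z ^ j\<close> with
  \<open>j \<le> m\<close>, so the mixed terms disappear and only \<open>f\<close> survives.\<close>

lemma wharm_D_op_iterate:
  assumes "open S" "f holomorphic_on S" "\<And>j. H j holomorphic_on S"
    and "\<And>z. z \<in> S \<Longrightarrow> F z = f z + (\<Sum>j\<le>m. z ^ j * cnj (H j z))" and "z \<in> S"
  shows "(D_op ^^ (m + 1)) F z = (1 / (2 * of_real pi * \<i>)) ^ (m + 1) * (deriv ^^ (m + 1)) f z"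
proof -
  \<comment> \<open>\<open>f\<close> is filed as the summand with the extra index
    \<open>Suc m\<close>, paired with the constant 1, so that the whole representation is one sum of
    products.\<close>
  define a where "a j = (if j = Suc m then f else (\<lambda>z. z ^ j))" for j
  define b where "b j = (if j = Suc m then (\<lambda>_. 1) else H j)" for j
  have "(D_op ^^ (m + 1)) F z = (1 / (2 * of_real pi * \<i>)) ^ (m + 1) *
      (\<Sum>j\<le>Suc m. (deriv ^^ (m + 1)) (a j) z * cnj (b j z))"
    by (rule D_op_iterate_holo_cnj[OF assms(1)]) (use assms in \<open>auto simp: a_def b_def intro!: holomorphic_intros\<close>)
  also have "(\<Sum>j\<le>Suc m. (deriv ^^ (m + 1)) (a j) z * cnj (b j z)) = (deriv ^^ (m + 1)) f z"
  proof -
    have "(deriv ^^ (m + 1)) (a j) z = 0" if "j \<le> m" for j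
    proof -
      \<comment> \<open>The subtraction on \<open>nat\<close> truncates to 0 for
        \<open>j \<le> m\<close>, and a rising factorial that starts at 0 vanishes.\<close>
      have *: "pochhammer (of_nat (Suc j - (m + 1))) (m + 1) = (0::complex)"
        using that by (simp add: pochhammer_0_left)
      have "(deriv ^^ (m + 1)) (\<lambda>w. (w - 0) ^ j) z = 0"
        unfolding higher_deriv_power * by simp
      then show ?thesis using that by (simp add: a_def)
    qed
    then show ?thesis by (simp add: a_def b_def)
  qed
  finally show ?thesis .
qed

text \<open>Primitives based at the centre of the ball keep the conjugate-holomorphic parts summable.\<close>

lemma wharm_infsum:
  assumes R: "R > 0" and P: "\<And>j. P j holomorphic_on UNIV"
    and harm: "\<And>i. i \<in> I \<Longrightarrow> wharm m P (\<phi> i) (\<gamma> i) (ball z0 R)"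
    and a: "\<And>i z. i \<in> I \<Longrightarrow> z \<in> ball z0 R \<Longrightarrow> norm (\<phi> i z) \<le> a i" "a summable_on I"
    and b: "\<And>i z. i \<in> I \<Longrightarrow> z \<in> ball z0 R \<Longrightarrow> norm (\<gamma> i z) \<le> b i" "b summable_on I"
  shows "wharm m P (\<lambda>z. \<Sum>\<^sub>\<infinity>i\<in>I. \<phi> i z) (\<lambda>z. \<Sum>\<^sub>\<infinity>i\<in>I. \<gamma> i z) (ball z0 R)" (is ?harm)
    and "z \<in> ball z0 R \<Longrightarrow> ((\<lambda>i. (D_op ^^ (m + 1)) (\<phi> i) z) has_sum (D_op ^^ (m + 1)) (\<lambda>z. \<Sum>\<^sub>\<infinity>i\<in>I. \<phi> i z) z) I"
proof -
  let ?B = "ball z0 R"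
  have ex: "\<exists>f H. f holomorphic_on ?B \<and> (\<forall>j. \<forall>z\<in>?B. (H j has_field_derivative P j z * \<gamma> i z) (at z)) \<and>
      (\<forall>j. H j z0 = 0) \<and> (\<forall>z. \<phi> i z = f z + (\<Sum>j\<le>m. z ^ j * cnj (H j z)))" if i: "i \<in> I" for i
  proof (rule wharm_rep[OF harm[OF i] P convex_ball])
    show "z0 \<in> ?B" using R by simp
  next
    fix f H
    assume "f holomorphic_on ?B" "\<And>j z. z \<in> ?B \<Longrightarrow> (H j has_field_derivative P j z * \<gamma> i z) (at z)"
      "\<And>j. H j z0 = 0" "\<And>z. \<phi> i z = f z + (\<Sum>j\<le>m. z ^ j * cnj (H j z))"
    then show ?thesis by (intro exI[of _ f] exI[of _ H]) simp
  qed
  define pr where "pr i fH \<longleftrightarrow> fst fH holomorphic_on ?B \<and> (\<forall>j. \<forall>z\<in>?B. (snd fH j has_field_derivative P j z * \<gamma> i z) (at z)) \<and>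
      (\<forall>j. snd fH j z0 = 0) \<and> (\<forall>z. \<phi> i z = fst fH z + (\<Sum>j\<le>m. z ^ j * cnj (snd fH j z)))"
    for i and fH :: "(complex \<Rightarrow> complex) \<times> (nat \<Rightarrow> complex \<Rightarrow> complex)"
  have "\<forall>i\<in>I. \<exists>fH. pr i fH" using ex by (force simp: pr_def)
  then obtain fH where fH: "\<And>i. i \<in> I \<Longrightarrow> pr i (fH i)" by metis
  define f where "f i = fst (fH i)" for i
  define H where "H i = snd (fH i)" for i
  have f: "f i holomorphic_on ?B" if "i \<in> I" for i using fH[OF that] by (simp add: pr_def f_def)
  have H: "(H i j has_field_derivative P j z * \<gamma> i z) (at z)" if "i \<in> I" "z \<in> ?B" for i j z
    using fH[OF that(1)] that by (simp add: pr_def H_def)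
  have H0: "H i j z0 = 0" if "i \<in> I" for i j using fH[OF that] by (simp add: pr_def H_def)
  have \<phi>: "\<phi> i z = f i z + (\<Sum>j\<le>m. z ^ j * cnj (H i j z))" if "i \<in> I" for i z
    using fH[OF that] by (simp add: pr_def H_def f_def)
  have "\<exists>C. \<forall>z\<in>?B. norm (P j z) \<le> C" for j
  proof -
    have "continuous_on (cball z0 R) (P j)"
      using P holomorphic_on_imp_continuous_on continuous_on_subset by blast
    then have "bounded (P j ` cball z0 R)" by (intro compact_imp_bounded compact_continuous_image) auto
    then show ?thesis unfolding bounded_iff by (metis ball_subset_cball imageI subsetD)
  qed
  then obtain C where C: "\<And>j z. z \<in> ?B \<Longrightarrow> norm (P j z) \<le> C j" by metis
  have C0: "C j \<ge> 0" for j using C[of z0 j] R by (meson centre_in_ball norm_ge_zero order_trans)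
  have Hb: "norm (H i j z) \<le> C j * b i * R" if i: "i \<in> I" and z: "z \<in> ?B" for i j z
  proof -
    have b0: "b i \<ge> 0" using b(1)[OF i z] by (meson norm_ge_zero order_trans)
    have "norm (H i j z - H i j z0) \<le> (C j * b i) * norm (z - z0)"
    proof (rule field_differentiable_bound[of ?B])
      show "(H i j has_field_derivative P j w * \<gamma> i w) (at w within ?B)" if "w \<in> ?B" for w
        using H[OF i that] has_field_derivative_at_within by blast
      show "norm (P j w * \<gamma> i w) \<le> C j * b i" if "w \<in> ?B" for w
        unfolding norm_mult using C[OF that] b(1)[OF i that] C0 by (intro mult_mono) auto
    qed (use z R in auto)
    also have "\<dots> \<le> (C j * b i) * R"
      using z C0 b0 by (intro mult_left_mono) (auto simp: dist_norm norm_minus_commute)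
    finally show ?thesis using H0[OF i] by simp
  qed
  have Hsummable: "(\<lambda>i. C j * b i * R) summable_on I" for j
    by (intro summable_on_cmult_right summable_on_cmult_left b)
  define h where "h j z = (\<Sum>\<^sub>\<infinity>i\<in>I. H i j z)" for j z
  have Hh: "H i j holomorphic_on ?B" if "i \<in> I" for i j
    unfolding holomorphic_on_open[OF open_ball] using H[OF that] by blast
  have hholo: "h j holomorphic_on ?B" for j
    unfolding h_def by (rule holomorphic_infsum(1)[OF _ Hh Hb Hsummable]) auto
  have \<gamma>sum: "(\<lambda>i. \<gamma> i z) summable_on I" if "z \<in> ?B" for z
    by (rule summable_on_dominated[OF b(2) b(1)[OF _ that]])
  have hder: "(h j has_field_derivative P j z * (\<Sum>\<^sub>\<infinity>i\<in>I. \<gamma> i z)) (at z)" if z: "z \<in> ?B" for j z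
  proof -
    have "((\<lambda>i. (deriv ^^ 1) (H i j) z) has_sum (deriv ^^ 1) (h j) z) I"
      unfolding h_def using holomorphic_infsum(2)[OF open_ball Hh Hb Hsummable z] .
    moreover have "deriv (H i j) z = P j z * \<gamma> i z" if "i \<in> I" for i
      using H[OF that z] by (rule DERIV_imp_deriv)
    ultimately have "((\<lambda>i. P j z * \<gamma> i z) has_sum deriv (h j) z) I"
      using has_sum_cong[of I "\<lambda>i. deriv (H i j) z" "\<lambda>i. P j z * \<gamma> i z"] by simp
    moreover have "((\<lambda>i. P j z * \<gamma> i z) has_sum P j z * (\<Sum>\<^sub>\<infinity>i\<in>I. \<gamma> i z)) I"
      by (intro has_sum_cmult_right has_sum_infsum \<gamma>sum z)
    ultimately have "deriv (h j) z = P j z * (\<Sum>\<^sub>\<infinity>i\<in>I. \<gamma> i z)" by (rule has_sum_unique)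
    then show ?thesis using holomorphic_derivI[OF hholo open_ball z, of j] by simp
  qed
  \<comment> \<open>The holomorphic part is \<open>\<phi> i\<close> minus the mixed terms and
    inherits a majorant from both.\<close>
  define Q where "Q i = a i + (\<Sum>j\<le>m. (norm z0 + R) ^ j * (C j * b i * R))" for i
  have fb: "norm (f i z) \<le> Q i" if i: "i \<in> I" and z: "z \<in> ?B" for i z
  proof -
    have nz: "norm z \<le> norm z0 + R"
    proof -
      have "norm (z - z0) < R" using z by (simp add: dist_norm norm_minus_commute)
      then show ?thesis using norm_triangle_ineq[of "z - z0" z0] by simp
    qed
    have "norm (f i z) \<le> norm (\<phi> i z) + norm (\<Sum>j\<le>m. z ^ j * cnj (H i j z))"
      using norm_triangle_ineq4[of "\<phi> i z" "\<Sum>j\<le>m. z ^ j * cnj (H i j z)"] \<phi>[OF i, of z] by simp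
    also have "norm (\<Sum>j\<le>m. z ^ j * cnj (H i j z)) \<le> (\<Sum>j\<le>m. (norm z0 + R) ^ j * (C j * b i * R))"
    proof (rule sum_norm_le)
      fix j
      have "norm (z ^ j * cnj (H i j z)) = norm z ^ j * norm (H i j z)" by (simp add: norm_mult norm_power)
      also have "\<dots> \<le> (norm z0 + R) ^ j * (C j * b i * R)"
        using nz Hb[OF i z] by (intro mult_mono power_mono) (use R in auto)
      finally show "norm (z ^ j * cnj (H i j z)) \<le> (norm z0 + R) ^ j * (C j * b i * R)" .
    qed
    finally show ?thesis using a(1)[OF i z] by (simp add: Q_def)
  qed
  have Qs: "Q summable_on I"
    unfolding Q_def
    by (intro summable_on_add a summable_on_swap_sum summable_on_cmult_right Hsummable) simp
  define F where "F z = (\<Sum>\<^sub>\<infinity>i\<in>I. f i z)" for z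
  have Fholo: "F holomorphic_on ?B"
    unfolding F_def by (rule holomorphic_infsum(1)[OF _ f fb Qs]) auto
  have rep: "(\<Sum>\<^sub>\<infinity>i\<in>I. \<phi> i z) = F z + (\<Sum>j\<le>m. z ^ j * cnj (h j z))" if z: "z \<in> ?B" for z
  proof (rule infsumI)
    have "(\<lambda>i. f i z) summable_on I"
      by (rule summable_on_dominated[OF Qs fb[OF _ z]])
    then have 1: "((\<lambda>i. f i z) has_sum F z) I" unfolding F_def by simp
    have "(\<lambda>i. H i j z) summable_on I" for j
      by (rule summable_on_dominated[OF Hsummable Hb[OF _ z]])
    then have "((\<lambda>i. H i j z) has_sum h j z) I" for j unfolding h_def by simp
    then have "((\<lambda>i. z ^ j * cnj (H i j z)) has_sum z ^ j * cnj (h j z)) I" for j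
      by (intro has_sum_cmult_right) (simp add: has_sum_cnj_iff)
    then have "((\<lambda>i. \<Sum>j\<le>m. z ^ j * cnj (H i j z)) has_sum (\<Sum>j\<le>m. z ^ j * cnj (h j z))) I"
      by (intro has_sum_swap_sum) auto
    from has_sum_add[OF 1 this] show "((\<lambda>i. \<phi> i z) has_sum F z + (\<Sum>j\<le>m. z ^ j * cnj (h j z))) I"
      using has_sum_cong[of I "\<lambda>i. \<phi> i z" "\<lambda>i. f i z + (\<Sum>j\<le>m. z ^ j * cnj (H i j z))"] \<phi> by simp
  qed
  have \<gamma>h: "(\<lambda>z. \<Sum>\<^sub>\<infinity>i\<in>I. \<gamma> i z) holomorphic_on ?B"
    by (rule holomorphic_infsum(1)[OF open_ball wharm_holomorphic[OF harm] b])
  show ?harm by (rule wharmI_rep[OF open_ball \<gamma>h Fholo hder rep])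
  assume z: "z \<in> ?B"
  have "((\<lambda>i. (deriv ^^ (m + 1)) (f i) z) has_sum (deriv ^^ (m + 1)) F z) I"
    unfolding F_def using holomorphic_infsum(2)[OF open_ball f fb Qs z] .
  from has_sum_cmult_right[OF this, of "(1 / (2 * of_real pi * \<i>)) ^ (m + 1)"]
  have "((\<lambda>i. (D_op ^^ (m + 1)) (\<phi> i) z) has_sum (1 / (2 * of_real pi * \<i>)) ^ (m + 1) * (deriv ^^ (m + 1)) F z) I"
    by (rule has_sum_cong[THEN iffD1, rotated]) (rule wharm_D_op_iterate[OF open_ball f Hh \<phi> z, symmetric])
  then show "((\<lambda>i. (D_op ^^ (m + 1)) (\<phi> i) z) has_sum (D_op ^^ (m + 1)) (\<lambda>z. \<Sum>\<^sub>\<infinity>i\<in>I. \<phi> i z) z) I"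
    by (simp only: wharm_D_op_iterate[OF open_ball Fholo hholo rep z])
qed

section \<open>Real analytic functions\<close>

definition ra_expansion :: "(complex \<Rightarrow> complex) \<Rightarrow> complex \<Rightarrow> (nat \<Rightarrow> nat \<Rightarrow> complex) \<Rightarrow> real \<Rightarrow> bool" where
  "ra_expansion f w c r \<longleftrightarrow> r > 0 \<and>
     (\<forall>h. norm h < r \<longrightarrow> ((\<lambda>(i, j). c i j * of_real (Re h ^ i * Im h ^ j)) has_sum f (w + h)) UNIV)"

lemma real_analytic_at_iff: "real_analytic_at f w \<longleftrightarrow> (\<exists>c r. ra_expansion f w c r)"
  by (simp add: real_analytic_at_def ra_expansion_def)

lemma ra_expansionD:
  "ra_expansion f w c r \<Longrightarrow> norm h < r \<Longrightarrow> ((\<lambda>(i, j). c i j * of_real (Re h ^ i * Im h ^ j)) has_sum f (w + h)) UNIV"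
  by (simp add: ra_expansion_def)

text \<open>Unordered convergence of complex families is absolute convergence, which makes the
  family of all products summable.\<close>

lemma has_sum_times_complex:
  fixes f :: "'a \<Rightarrow> complex" and g :: "'b \<Rightarrow> complex"
  assumes f: "(f has_sum a) A" and g: "(g has_sum b) B"
  shows "((\<lambda>(x, y). f x * g y) has_sum a * b) (A \<times> B)"
proof (rule has_sum_SigmaI)
  show "((\<lambda>y. case (x, y) of (x, y) \<Rightarrow> f x * g y) has_sum f x * b) B" for x
    using has_sum_cmult_right[OF g] by simp
  show "((\<lambda>x. f x * b) has_sum a * b) A" using has_sum_cmult_left[OF f] .
  have gs: "(\<lambda>y. norm (g y)) summable_on B" and fs: "(\<lambda>x. norm (f x)) summable_on A"
    using f g has_sum_imp_summable summable_on_iff_abs_summable_on_complex by blast+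
  have inf: "infsum (\<lambda>y. norm (f x * g y)) B = norm (f x) * infsum (\<lambda>y. norm (g y)) B" for x
    by (simp add: norm_mult infsum_cmult_right')
  have "(\<lambda>p. norm (case p of (x, y) \<Rightarrow> f x * g y)) summable_on (A \<times> B)"
    unfolding Infinite_Sum.abs_summable_on_Sigma_iff
  proof (intro conjI ballI)
    show "(\<lambda>y. norm (case (x, y) of (x, y) \<Rightarrow> f x * g y)) summable_on B" for x
      using summable_on_cmult_right[OF gs, of "norm (f x)"] by (simp add: norm_mult)
    have "infsum (\<lambda>y. norm (g y)) B \<ge> 0" by (intro infsum_nonneg) simp
    then show "(\<lambda>x. norm (\<Sum>\<^sub>\<infinity>y\<in>B. norm (case (x, y) of (x, y) \<Rightarrow> f x * g y))) summable_on A"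
      using summable_on_cmult_left[OF fs] by (simp add: inf abs_mult)
  qed
  then show "(\<lambda>(x, y). f x * g y) summable_on (A \<times> B)" by (rule abs_summable_summable)
qed

text \<open>Cauchy product in two variables: the products of the terms are regrouped along the
  fibres of the addition of exponent pairs.\<close>

lemma real_analytic_at_mult:
  assumes "real_analytic_at f w" "real_analytic_at g w"
  shows "real_analytic_at (\<lambda>z. f z * g z) w"
proof -
  obtain c r d s where c: "ra_expansion f w c r" and d: "ra_expansion g w d s"
    using assms by (auto simp: real_analytic_at_iff)
  define fib where "fib p = (\<lambda>(i, k). ((i, k), (fst p - i, snd p - k))) ` ({..fst p} \<times> {..snd p})" for p :: "nat \<times> nat"
  define e where "e i j = (\<Sum>((a, b), (a', b'))\<in>fib (i, j). c a b * d a' b')" for i j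
  have "ra_expansion (\<lambda>z. f z * g z) w e (min r s)"
    unfolding ra_expansion_def
  proof (intro conjI allI impI)
    show "min r s > 0" using c d by (simp add: ra_expansion_def)
    fix h :: complex assume h: "norm h < min r s"
    let ?t = "\<lambda>((a, b), (a', b')). (c a b * of_real (Re h ^ a * Im h ^ b)) * (d a' b' * of_real (Re h ^ a' * Im h ^ b'))"
    from has_sum_times_complex[OF ra_expansionD[OF c, of h] ra_expansionD[OF d, of h]] h
    have 1: "(?t has_sum f (w + h) * g (w + h)) (UNIV \<times> UNIV)"
      by (simp add: case_prod_unfold)
    let ?\<pi> = "\<lambda>((a, b), (a', b')). (a + a', b + b' :: nat) :: nat \<times> nat"
    have 2: "((\<lambda>(p, q). ?t q) has_sum f (w + h) * g (w + h)) (Sigma UNIV fib)"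
    proof (rule has_sum_reindex_bij_witness[THEN iffD1, OF _ _ _ _ _ refl 1])
      show "snd ((\<lambda>q. (?\<pi> q, q)) a) = a" for a :: "(nat \<times> nat) \<times> (nat \<times> nat)" by simp
      show "(\<lambda>q. (?\<pi> q, q)) a \<in> Sigma UNIV fib" for a :: "(nat \<times> nat) \<times> (nat \<times> nat)"
        by (auto simp: fib_def image_iff split: prod.splits)
      show "(\<lambda>q. (?\<pi> q, q)) (snd b) = b" if "b \<in> Sigma UNIV fib" for b
        using that by (auto simp: fib_def)
    qed auto
    have "((\<lambda>p. \<Sum>q\<in>fib p. ?t q) has_sum f (w + h) * g (w + h)) UNIV"
    proof (rule has_sum_SigmaD[OF 2])
      fix p
      have "finite (fib p)" by (simp add: fib_def)
      then show "((\<lambda>y. case (p, y) of (p, q) \<Rightarrow> ?t q) has_sum (\<Sum>q\<in>fib p. ?t q)) (fib p)" by simp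
    qed
    moreover have "(\<lambda>p. \<Sum>q\<in>fib p. ?t q) = (\<lambda>(i, j). e i j * of_real (Re h ^ i * Im h ^ j))"
    proof (intro ext, clarify)
      fix i j
      show "(\<Sum>q\<in>fib (i, j). ?t q) = e i j * of_real (Re h ^ i * Im h ^ j)"
      unfolding e_def sum_distrib_right
    proof (rule sum.cong[OF refl], clarify)
      fix a b a' b' assume "((a, b), (a', b')) \<in> fib (i, j)"
      then have "i = a + a'" "j = b + b'" by (auto simp: fib_def)
      then show "(c a b * of_real (Re h ^ a * Im h ^ b)) * (d a' b' * of_real (Re h ^ a' * Im h ^ b'))
          = c a b * d a' b' * of_real (Re h ^ i * Im h ^ j)"
        by (simp add: power_add)
      qed
    qed
    ultimately show "((\<lambda>(i, j). e i j * of_real (Re h ^ i * Im h ^ j)) has_sum f (w + h) * g (w + h)) UNIV"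
      by simp
  qed
  then show ?thesis by (auto simp: real_analytic_at_iff)
qed

lemma real_analytic_at_add:
  assumes "real_analytic_at f w" "real_analytic_at g w"
  shows "real_analytic_at (\<lambda>z. f z + g z) w"
proof -
  obtain c r d s where c: "ra_expansion f w c r" and d: "ra_expansion g w d s"
    using assms by (auto simp: real_analytic_at_iff)
  have "ra_expansion (\<lambda>z. f z + g z) w (\<lambda>i j. c i j + d i j) (min r s)"
    unfolding ra_expansion_def
  proof (intro conjI allI impI)
    fix h :: complex assume h: "norm h < min r s"
    from has_sum_add[OF ra_expansionD[OF c, of h] ra_expansionD[OF d, of h]] h
    show "((\<lambda>(i, j). (c i j + d i j) * of_real (Re h ^ i * Im h ^ j)) has_sum f (w + h) + g (w + h)) UNIV"
      by (simp add: case_prod_unfold distrib_right)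
  qed (use c d in \<open>simp add: ra_expansion_def\<close>)
  then show ?thesis by (auto simp: real_analytic_at_iff)
qed

lemma real_analytic_at_cnj:
  assumes "real_analytic_at f w" shows "real_analytic_at (\<lambda>z. cnj (f z)) w"
proof -
  obtain c r where c: "ra_expansion f w c r" using assms by (auto simp: real_analytic_at_iff)
  have "ra_expansion (\<lambda>z. cnj (f z)) w (\<lambda>i j. cnj (c i j)) r"
    unfolding ra_expansion_def
  proof (intro conjI allI impI)
    fix h :: complex assume h: "norm h < r"
    have "((\<lambda>x. cnj ((\<lambda>(i, j). c i j * of_real (Re h ^ i * Im h ^ j)) x)) has_sum cnj (f (w + h))) UNIV"
      using ra_expansionD[OF c h] by (subst has_sum_cnj_iff)
    then show "((\<lambda>(i, j). cnj (c i j) * of_real (Re h ^ i * Im h ^ j)) has_sum cnj (f (w + h))) UNIV"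
      by (simp add: case_prod_unfold)
  qed (use c in \<open>simp add: ra_expansion_def\<close>)
  then show ?thesis by (auto simp: real_analytic_at_iff)
qed

text \<open>Each \<open>a n * (x + \<i> * y) ^ n\<close> is expanded by the binomial theorem. The
  rearranged double series converges absolutely as long as
  \<open>\<bar>x\<bar> + \<bar>y\<bar> < R\<close>, which explains the radius
  \<open>R / 2\<close>.\<close>

lemma real_analytic_at_holomorphic:
  assumes "f holomorphic_on S" "open S" "w \<in> S" shows "real_analytic_at f w"
proof -
  obtain R where R: "R > 0" "ball w R \<subseteq> S" using assms open_contains_ball by blast
  have hol: "f holomorphic_on ball w R" using assms(1) R(2) holomorphic_on_subset by blast
  define a where "a n = (deriv ^^ n) f w / fact n" for n
  define c where "c i j = a (i + j) * of_nat ((i + j) choose i) * \<i> ^ j" for i j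
  have sums: "(\<lambda>n. a n * h ^ n) sums f (w + h)" if "norm h < R" for h
    using holomorphic_power_series[OF hol, of "w + h"] that by (simp add: a_def dist_norm)
  have "ra_expansion f w c (R / 2)"
    unfolding ra_expansion_def
  proof (intro conjI allI impI)
    show "R / 2 > 0" using R by simp
    fix h :: complex assume h: "norm h < R / 2"
    define x where "x = Re h" define y where "y = Im h"
    define t where "t = \<bar>x\<bar> + \<bar>y\<bar>"
    have t: "t < R" "t \<ge> 0"
      using h abs_Re_le_cmod[of h] abs_Im_le_cmod[of h] by (auto simp: t_def x_def y_def)
    obtain t' where t': "t < t'" "t' < R" using dense t(1) by blast
    have "summable (\<lambda>n. a n * (of_real t') ^ n)"
      using sums[of "of_real t'"] t t' by (auto simp: sums_iff)
    then have "summable (\<lambda>n. norm (a n * (of_real t) ^ n))"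
      by (rule powser_insidea) (use t t' in simp)
    then have at: "(\<lambda>n. norm (a n) * t ^ n) summable_on UNIV"
      using t(2) by (intro norm_summable_imp_summable_on) (simp add: norm_mult norm_power)
    define g where "g = (\<lambda>(n, i). a n * (of_nat (n choose i) * of_real x ^ i * (\<i> * of_real y) ^ (n - i)))"
    have "(\<lambda>p. norm (g p)) summable_on (SIGMA n:UNIV. {..n})"
      unfolding Infinite_Sum.abs_summable_on_Sigma_iff
    proof (intro conjI ballI)
      have "(\<Sum>\<^sub>\<infinity>i\<in>{..n}. norm (g (n, i))) = norm (a n) * t ^ n" for n
      proof -
        have "(\<Sum>\<^sub>\<infinity>i\<in>{..n}. norm (g (n, i))) = norm (a n) * (\<Sum>i\<le>n. of_nat (n choose i) * \<bar>x\<bar> ^ i * \<bar>y\<bar> ^ (n - i))"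
          by (simp add: g_def norm_mult norm_power sum_distrib_left)
        then show ?thesis by (simp add: t_def binomial_ring)
      qed
      then show "(\<lambda>n. norm (\<Sum>\<^sub>\<infinity>i\<in>{..n}. norm (g (n, i)))) summable_on UNIV"
        using at t(2) by simp
    qed auto
    then have gs: "g summable_on (SIGMA n:UNIV. {..n})" by (rule abs_summable_summable)
    have "summable (\<lambda>n. norm (a n * h ^ n))"
    proof (rule powser_insidea[of _ "of_real (R / 2)"])
      show "summable (\<lambda>n. a n * of_real (R / 2) ^ n)" using sums[of "of_real (R / 2)"] R by (auto simp: sums_iff)
    qed (use h in simp)
    then have ah: "((\<lambda>n. a n * h ^ n) has_sum f (w + h)) UNIV"
      using norm_summable_imp_has_sum[OF _ sums] h R by simp
    have "(g has_sum f (w + h)) (SIGMA n:UNIV. {..n})"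
    proof (rule has_sum_SigmaI[OF _ ah gs])
      fix n
      have "h = of_real x + \<i> * of_real y" by (simp add: x_def y_def complex_eq)
      then have "a n * h ^ n = (\<Sum>i\<le>n. g (n, i))"
        by (simp add: binomial_ring g_def sum_distrib_left)
      then show "((\<lambda>i. g (n, i)) has_sum a n * h ^ n) {..n}" by simp
    qed
    then show "((\<lambda>(i, j). c i j * of_real (Re h ^ i * Im h ^ j)) has_sum f (w + h)) UNIV"
      by (rule iffD1[OF has_sum_reindex_bij_witness[where i = "\<lambda>(i, j). (i + j, i)" and j = "\<lambda>(n, i). (i, n - i)"], rotated -1])
        (auto simp: c_def g_def x_def y_def power_mult_distrib)
  qed
  then show ?thesis by (auto simp: real_analytic_at_iff)
qed

text \<open>At the diagonal point \<open>Complex \<rho> \<rho>\<close> the monomial with exponents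
  \<open>i\<close>, \<open>j\<close> has the value \<open>\<rho> ^ (i + j)\<close>, and this point
  lies inside the disc because \<open>sqrt 2 < 2\<close>.\<close>

lemma ra_expansion_summable:
  assumes "ra_expansion f w c r" "0 \<le> \<rho>" "\<rho> \<le> r / 2"
  shows "(\<lambda>(i, j). norm (c i j) * \<rho> ^ (i + j)) summable_on UNIV"
proof -
  have r: "r > 0" using assms by (simp add: ra_expansion_def)
  let ?h = "Complex \<rho> \<rho>"
  have "norm ?h = \<rho> * sqrt 2"
    using assms(2) by (simp add: cmod_def real_sqrt_mult flip: mult_2)
  also have "\<dots> \<le> (r / 2) * sqrt 2" using assms by (intro mult_right_mono) auto
  also have "\<dots> < r" using r sqrt2_less_2 by simp
  finally have "(\<lambda>(i, j). c i j * of_real (\<rho> ^ i * \<rho> ^ j)) summable_on UNIV"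
    using ra_expansionD[OF assms(1), of ?h] has_sum_imp_summable by fastforce
  then have "(\<lambda>p. norm ((\<lambda>(i, j). c i j * of_real (\<rho> ^ i * \<rho> ^ j)) p)) summable_on UNIV"
    by (simp only: summable_on_iff_abs_summable_on_complex)
  then show ?thesis using assms(2) by (simp add: case_prod_unfold norm_mult norm_power power_add)
qed

text \<open>The terms of degree at least 2 are bounded by \<open>(norm h / \<rho>)\<^sup>2\<close>
  times a convergent sum, so the linear terms give the differential.\<close>

lemma ra_expansion_has_wirtinger:
  assumes c: "ra_expansion f w c r"
  shows "has_wirtinger f ((c 1 0 - \<i> * c 0 1) / 2) ((c 1 0 + \<i> * c 0 1) / 2) w"
proof -
  have r: "r > 0" using c by (simp add: ra_expansion_def)
  define \<rho> where "\<rho> = r / 2"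
  have \<rho>: "\<rho> > 0" using r by (simp add: \<rho>_def)
  define u where "u = (\<lambda>(i, j). norm (c i j) * \<rho> ^ (i + j))"
  have us: "u summable_on UNIV" unfolding u_def using ra_expansion_summable[OF c, of \<rho>] \<rho> by (simp add: \<rho>_def)
  define K where "K = infsum u UNIV"
  define L where "L v = ((c 1 0 - \<i> * c 0 1) / 2) * v + ((c 1 0 + \<i> * c 0 1) / 2) * cnj v" for v
  have L: "L v = c 1 0 * of_real (Re v) + c 0 1 * of_real (Im v)" for v
    unfolding L_def by (rule complex_eqI) (simp_all add: field_simps)
  have f0: "f w = c 0 0"
  proof -
    have "((\<lambda>(i, j). c i j * of_real (Re 0 ^ i * Im 0 ^ j)) has_sum f (w + 0)) UNIV"
      using ra_expansionD[OF c, of 0] r by simp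
    moreover have "((\<lambda>(i, j). c i j * of_real (Re 0 ^ i * Im 0 ^ j)) has_sum c 0 0) UNIV"
      by (rule has_sum_finite_neutralI[of "{(0, 0)}"]) (auto simp: power_0_left split: if_splits)
    ultimately show ?thesis using has_sum_unique by force
  qed
  have bd: "norm (f (w + h) - f w - L h) \<le> (norm h / \<rho>)\<^sup>2 * K" if h: "norm h < \<rho>" for h
  proof -
    let ?t = "\<lambda>(i, j). c i j * of_real (Re h ^ i * Im h ^ j)"
    let ?E = "{(0, 0), (1, 0), (0, 1)} :: (nat \<times> nat) set"
    have "(?t has_sum f (w + h)) UNIV" using ra_expansionD[OF c, of h] h r by (simp add: \<rho>_def)
    then have "(?t has_sum (f (w + h) - (\<Sum>p\<in>?E. ?t p))) (UNIV - ?E)"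
      by (intro has_sum_Diff) (auto intro: has_sum_finiteI)
    moreover have "(\<Sum>p\<in>?E. ?t p) = f w + L h" by (simp add: f0 L)
    ultimately have 1: "(?t has_sum (f (w + h) - f w - L h)) (UNIV - ?E)" by (simp add: algebra_simps)
    have us': "u summable_on (UNIV - ?E)" using us summable_on_subset_banach by blast
    have 2: "((\<lambda>p. (norm h / \<rho>)\<^sup>2 * u p) has_sum (norm h / \<rho>)\<^sup>2 * infsum u (UNIV - ?E)) (UNIV - ?E)"
      by (intro has_sum_cmult_right has_sum_infsum us')
    have "norm (f (w + h) - f w - L h) \<le> (norm h / \<rho>)\<^sup>2 * infsum u (UNIV - ?E)"
    proof (rule norm_infsum_le[OF 1 2])
      fix p :: "nat \<times> nat" assume p: "p \<in> UNIV - ?E"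
      obtain i j where ij: "p = (i, j)" by (cases p)
      have n2: "i + j \<ge> 2"
      proof (rule ccontr)
        assume "\<not> i + j \<ge> 2"
        then have "i = 0 \<and> j = 0 \<or> i = 1 \<and> j = 0 \<or> i = 0 \<and> j = 1" by arith
        then show False using p ij by auto
      qed
      have "norm (?t p) \<le> norm (c i j) * (norm h ^ i * norm h ^ j)"
        unfolding ij
        using abs_Re_le_cmod[of h] abs_Im_le_cmod[of h]
        by (simp add: norm_mult norm_power abs_mult power_abs) (intro mult_left_mono mult_mono power_mono; simp)
      also have "\<dots> = norm (c i j) * ((norm h / \<rho>) ^ (i + j) * \<rho> ^ (i + j))"
        using \<rho> by (simp add: power_add power_divide)
      also have "\<dots> \<le> norm (c i j) * ((norm h / \<rho>)\<^sup>2 * \<rho> ^ (i + j))"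
        using h \<rho> n2 by (intro mult_left_mono mult_right_mono power_decreasing) auto
      finally show "norm (?t p) \<le> (norm h / \<rho>)\<^sup>2 * u p" by (simp add: ij u_def mult_ac)
    qed
    also have "infsum u (UNIV - ?E) \<le> K"
      unfolding K_def by (rule infsum_mono2[OF us' us]) (use \<rho> in \<open>auto simp: u_def\<close>)
    finally show ?thesis by (simp add: mult_left_mono)
  qed
  have "(f has_derivative L) (at w)"
  proof (rule has_derivativeI_sandwich[OF \<rho>])
    show "bounded_linear L"
      unfolding L_def by (intro bounded_linear_add bounded_linear_const_mult bounded_linear_ident bounded_linear_cnj)
    show "norm ((f y - f w) - L (y - w)) / norm (y - w) \<le> norm (y - w) * (K / \<rho>\<^sup>2)"
      if "y \<noteq> w" "dist y w < \<rho>" for y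
      using bd[of "y - w"] that by (simp add: dist_norm field_simps power2_eq_square)
    show "((\<lambda>y. norm (y - w) * (K / \<rho>\<^sup>2)) \<longlongrightarrow> 0) (at w)"
      by (rule tendsto_eq_intros refl | simp)+
  qed
  then show ?thesis unfolding has_wirtinger_def L_def .
qed

text \<open>With the imaginary part frozen, the expansion is a power series in one variable
  \<open>X\<close> that may be taken complex; termwise differentiation then follows from the
  holomorphic case.\<close>

lemma ra_expansion_partial_x:
  assumes c: "ra_expansion f w c r"
  shows "ra_expansion (partial_x f) w (\<lambda>i j. of_nat (i + 1) * c (i + 1) j) (r / 2)"
  unfolding ra_expansion_def
proof (intro conjI allI impI)
  have r: "r > 0" using c by (simp add: ra_expansion_def)
  then show "r / 2 > 0" by simp
  fix h :: complex assume h: "norm h < r / 2"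
  define \<rho> where "\<rho> = r / 2"
  have \<rho>: "\<rho> > 0" using r by (simp add: \<rho>_def)
  define x where "x = Re h" define y where "y = Im h"
  have xy: "\<bar>x\<bar> < \<rho>" "\<bar>y\<bar> < \<rho>"
    using h abs_Re_le_cmod[of h] abs_Im_le_cmod[of h] by (auto simp: \<rho>_def x_def y_def)
  define \<phi> where "\<phi> = (\<lambda>(i, j) X. c i j * X ^ i * of_real y ^ j)"
  define S where "S X = (\<Sum>\<^sub>\<infinity>p. \<phi> p X)" for X
  have hol: "\<phi> p holomorphic_on ball 0 \<rho>" for p
    by (cases p) (auto simp: \<phi>_def intro!: holomorphic_intros)
  have bd: "norm (\<phi> p X) \<le> (\<lambda>(i, j). norm (c i j) * \<rho> ^ (i + j)) p" if "X \<in> ball 0 \<rho>" for p X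
  proof -
    obtain i j where ij: "p = (i, j)" by (cases p)
    have "norm (\<phi> p X) = norm (c i j) * (norm X ^ i * \<bar>y\<bar> ^ j)"
      by (simp add: \<phi>_def ij norm_mult norm_power mult.assoc)
    also have "\<dots> \<le> norm (c i j) * (\<rho> ^ i * \<rho> ^ j)"
      using that xy by (intro mult_left_mono mult_mono power_mono) auto
    finally show ?thesis by (simp add: ij power_add)
  qed
  have us: "(\<lambda>(i, j). norm (c i j) * \<rho> ^ (i + j)) summable_on UNIV"
    using ra_expansion_summable[OF c, of \<rho>] \<rho> by (simp add: \<rho>_def)
  have xin: "complex_of_real x \<in> ball 0 \<rho>" using xy by simp
  have "S holomorphic_on ball 0 \<rho>"
    unfolding S_def by (rule holomorphic_infsum(1)[OF open_ball hol bd us])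
  then have dS: "(S has_field_derivative deriv S (of_real x)) (at (of_real x))"
    using holomorphic_derivI[OF _ open_ball xin] by blast
  have hs: "((\<lambda>p. (deriv ^^ 1) (\<phi> p) (of_real x)) has_sum (deriv ^^ 1) S (of_real x)) UNIV"
    unfolding S_def by (rule holomorphic_infsum(2)[OF open_ball hol bd us xin])
  have der: "(deriv ^^ 1) (\<phi> p) (of_real x) = (\<lambda>(i, j). c i j * (of_nat i * of_real x ^ (i - 1)) * of_real y ^ j) p" for p
    by (cases p) (auto simp: \<phi>_def intro!: DERIV_imp_deriv derivative_eq_intros)
  have S_eq: "S (of_real X) = f (w + Complex X y)" if "norm (Complex X y) < r" for X
    unfolding S_def using infsumI[OF ra_expansionD[OF c that]] by (simp add: \<phi>_def case_prod_unfold mult.assoc)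
  have px: "partial_x f (w + h) = deriv S (of_real x)"
  proof -
    have vd: "((\<lambda>t::real. S (of_real (x + t))) has_vector_derivative deriv S (of_real x)) (at 0)"
    proof -
      have "(S has_derivative (\<lambda>v. deriv S (of_real x) * v)) (at (of_real (x + 0)))"
        using dS by (simp add: has_field_derivative_def)
      moreover have "((\<lambda>t::real. complex_of_real (x + t)) has_derivative of_real) (at 0)"
        by (auto intro!: derivative_eq_intros)
      ultimately have "((\<lambda>t::real. S (of_real (x + t))) has_derivative (\<lambda>v. deriv S (of_real x) * of_real v)) (at 0)"
        by (rule has_derivative_compose[where f = "\<lambda>t. complex_of_real (x + t)" and g = S, rotated])
      then show ?thesis by (simp add: has_vector_derivative_def scaleR_conv_of_real mult.commute)
    qed
    have ev: "eventually (\<lambda>t. S (of_real (x + t)) = f (w + h + of_real t)) (nhds 0)"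
    proof -
      have "isCont (\<lambda>t. norm (Complex (x + t) y)) 0"
        by (auto simp: Complex_eq intro!: continuous_intros)
      moreover have "norm (Complex (x + 0) y) < r" using h r by (simp add: x_def y_def)
      ultimately have "eventually (\<lambda>t. norm (Complex (x + t) y) < r) (nhds 0)"
        by (intro order_tendstoD(2)[OF tendsto_at_iff_tendsto_nhds[THEN iffD1, OF isCont_def[THEN iffD1]]])
      then show ?thesis
      proof eventually_elim
        case (elim t)
        have "w + Complex (x + t) y = w + h + of_real t" by (simp add: complex_eq_iff x_def y_def)
        then show ?case using S_eq[OF elim] by (simp add: add.assoc)
      qed
    qed
    have "((\<lambda>t::real. f (w + h + of_real t)) has_vector_derivative deriv S (of_real x)) (at 0)"
      by (rule has_vector_derivative_cong_ev[THEN iffD1, OF _ _ vd])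
        (use ev eventually_nhds_x_imp_x[OF ev] in \<open>auto elim!: eventually_mono\<close>)
    then show ?thesis unfolding partial_x_def by (rule vector_derivative_at)
  qed
  have "((\<lambda>(i, j). c i j * (of_nat i * of_real x ^ (i - 1)) * of_real y ^ j) has_sum partial_x f (w + h)) UNIV"
    using hs px der by (simp add: case_prod_unfold)
  then have "((\<lambda>(i, j). c i j * (of_nat i * of_real x ^ (i - 1)) * of_real y ^ j) has_sum partial_x f (w + h)) ({1..} \<times> UNIV)"
    by (rule has_sum_cong_neutral[THEN iffD1, rotated -1]) (auto simp: not_le)
  then show "((\<lambda>(i, j). (of_nat (i + 1) * c (i + 1) j) * of_real (Re h ^ i * Im h ^ j)) has_sum partial_x f (w + h)) UNIV"
    by (rule iffD1[OF has_sum_reindex_bij_witness[where i = "\<lambda>(i, j). (i + 1, j)" and j = "\<lambda>(i, j). (i - 1, j)"], rotated -1])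
       (auto simp: x_def y_def)
qed

text \<open>The reflection \<open>z \<mapsto> \<i> * cnj z\<close> exchanges real and imaginary part
  and so transports facts about \<open>partial_x\<close> to \<open>partial_y\<close>.\<close>

lemma ra_expansion_swap:
  assumes "ra_expansion f w c r"
  shows "ra_expansion (\<lambda>z. f (\<i> * cnj z)) (\<i> * cnj w) (\<lambda>i j. c j i) r"
  unfolding ra_expansion_def
proof (intro conjI allI impI)
  fix h :: complex assume h: "norm h < r"
  have "((\<lambda>(i, j). c i j * of_real (Re (\<i> * cnj h) ^ i * Im (\<i> * cnj h) ^ j)) has_sum f (w + \<i> * cnj h)) UNIV"
    by (rule ra_expansionD[OF assms]) (use h in \<open>simp add: norm_mult\<close>)
  then have 1: "((\<lambda>(i, j). c i j * of_real (Im h ^ i * Re h ^ j)) has_sum f (\<i> * cnj (\<i> * cnj w + h))) UNIV"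
    by (simp add: algebra_simps)
  show "((\<lambda>(i, j). c j i * of_real (Re h ^ i * Im h ^ j)) has_sum f (\<i> * cnj (\<i> * cnj w + h))) UNIV"
    using 1 by (rule iffD1[OF has_sum_reindex_bij_witness[where i = prod.swap and j = prod.swap], rotated -1])
      (auto simp: mult.commute)
qed (use assms in \<open>simp add: ra_expansion_def\<close>)

lemma ra_expansion_partial_y:
  assumes "ra_expansion f w c r"
  shows "ra_expansion (partial_y f) w (\<lambda>i j. of_nat (j + 1) * c i (j + 1)) (r / 2)"
proof -
  have "partial_y f = (\<lambda>z. partial_x (\<lambda>z. f (\<i> * cnj z)) (\<i> * cnj z))"
  proof
    fix z
    have "\<i> * cnj (\<i> * cnj z + of_real t) = z + \<i> * of_real t" for t
      by (simp add: algebra_simps)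
    then show "partial_y f z = partial_x (\<lambda>z. f (\<i> * cnj z)) (\<i> * cnj z)"
      by (simp only: partial_x_def partial_y_def)
  qed
  then show ?thesis
    using ra_expansion_swap[OF ra_expansion_partial_x[OF ra_expansion_swap[OF assms]]] by simp
qed

text \<open>The first Wirtinger coefficient of \<open>partial_zbar f\<close> is a quarter of the
  Laplacian of \<open>f\<close>. In this way the differential equation of second order becomes a
  condition on \<open>partial_zbar f\<close>.\<close>

lemma ra_expansion_partial_zbar:
  assumes c: "ra_expansion f w c r"
  shows "\<exists>b. has_wirtinger (partial_zbar f) ((c 2 0 + c 0 2) / 2) b w"
    and "partial_x (partial_x f) w = 2 * c 2 0" and "partial_y (partial_y f) w = 2 * c 0 2"
proof -
  have x: "has_wirtinger (partial_x f) ((2 * c 2 0 - \<i> * c 1 1) / 2) ((2 * c 2 0 + \<i> * c 1 1) / 2) w"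
    using ra_expansion_has_wirtinger[OF ra_expansion_partial_x[OF c]] by (simp add: numeral_2_eq_2)
  have y: "has_wirtinger (partial_y f) ((c 1 1 - \<i> * (2 * c 0 2)) / 2) ((c 1 1 + \<i> * (2 * c 0 2)) / 2) w"
    using ra_expansion_has_wirtinger[OF ra_expansion_partial_y[OF c]] by (simp add: numeral_2_eq_2)
  have "partial_zbar f = (\<lambda>z. (1/2) * (partial_x f z + \<i> * partial_y f z))"
    by (simp add: fun_eq_iff partial_zbar_def)
  with has_wirtinger_cmult[OF has_wirtinger_add[OF x has_wirtinger_cmult[OF y, of \<i>]], of "1/2"]
  show "\<exists>b. has_wirtinger (partial_zbar f) ((c 2 0 + c 0 2) / 2) b w"
    by (auto simp: algebra_simps add_divide_distrib diff_divide_distrib)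
  show "partial_x (partial_x f) w = 2 * c 2 0" using has_wirtinger_partial_x[OF x] by (simp add: field_simps)
  show "partial_y (partial_y f) w = 2 * c 0 2" using has_wirtinger_partial_y[OF y] by (simp add: field_simps)
qed

lemma wharm_rep_ex:
  assumes "wharm m P F g S" "\<And>j. P j holomorphic_on UNIV" "convex S" "z0 \<in> S"
  shows "\<exists>f H. f holomorphic_on S \<and> (\<forall>j z. z \<in> S \<longrightarrow> (H j has_field_derivative P j z * g z) (at z)) \<and>
    (\<forall>j. H j z0 = 0) \<and> (\<forall>z. F z = f z + (\<Sum>j\<le>m. z ^ j * cnj (H j z)))"
proof (rule wharm_rep[OF assms])
  fix f H
  assume "f holomorphic_on S" "\<And>j z. z \<in> S \<Longrightarrow> (H j has_field_derivative P j z * g z) (at z)"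
    "\<And>j. H j z0 = 0" "\<And>z. F z = f z + (\<Sum>j\<le>m. z ^ j * cnj (H j z))"
  then show ?thesis by (intro exI[of _ f] exI[of _ H]) simp
qed

section \<open>Harmonic functions of weight \<open>-m\<close> on the upper half-plane\<close>

text \<open>\<open>harm m F g S\<close> says that \<open>F\<close> satisfies \<open>\<partial>F/\<partial>(cnj z) = y ^ m * cnj g\<close> with holomorphic \<open>g\<close>;
  up to a constant \<open>g\<close> is the image of \<open>F\<close> under \<open>\<xi>\<close>.\<close>

definition hp_coeff :: "nat \<Rightarrow> nat \<Rightarrow> complex \<Rightarrow> complex" where
  "hp_coeff m j z = of_nat (m choose j) * (- z) ^ (m - j) / (- 2 * \<i>) ^ m"

text \<open>Binomial expansion of the power \<open>m\<close> of
  \<open>Im z = (z - cnj z) / (2 * \<i>)\<close>, which is where the coefficients come from.\<close>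

lemma hp_coeff_weight: "(\<Sum>j\<le>m. z ^ j * cnj (hp_coeff m j z)) = of_real (Im z) ^ m"
proof -
  have "(\<Sum>j\<le>m. z ^ j * cnj (hp_coeff m j z)) = (\<Sum>j\<le>m. of_nat (m choose j) * z ^ j * (- cnj z) ^ (m - j)) / (2 * \<i>) ^ m"
    unfolding sum_divide_distrib by (intro sum.cong) (simp_all add: hp_coeff_def)
  also have "\<dots> = (z + - cnj z) ^ m / (2 * \<i>) ^ m"
    by (simp only: binomial_ring)
  also have "\<dots> = ((z - cnj z) / (2 * \<i>)) ^ m"
    by (simp only: power_divide add_uminus_conv_diff)
  also have "(z - cnj z) / (2 * \<i>) = of_real (Im z)"
    by (simp add: complex_eq_iff)
  finally show ?thesis .
qed

lemma hp_coeff_holomorphic: "hp_coeff m j holomorphic_on A"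
  unfolding hp_coeff_def by (intro holomorphic_intros) auto

definition harm :: "nat \<Rightarrow> (complex \<Rightarrow> complex) \<Rightarrow> (complex \<Rightarrow> complex) \<Rightarrow> complex set \<Rightarrow> bool" where
  "harm m F g S \<longleftrightarrow> S \<subseteq> uhp \<and> wharm m (hp_coeff m) F g S"

lemma harm_iff: "harm m F g S \<longleftrightarrow> S \<subseteq> uhp \<and> open S \<and> g holomorphic_on S \<and>
    (\<forall>z\<in>S. \<exists>p. has_wirtinger F p (of_real (Im z) ^ m * cnj (g z)) z)"
  unfolding harm_def wharm_def hp_coeff_weight by blast

lemma harmE:
  assumes "harm m F g S" "z \<in> S"
  obtains p where "has_wirtinger F p (of_real (Im z) ^ m * cnj (g z)) z"
  using assms unfolding harm_iff by blast

lemma harm_open: "harm m F g S \<Longrightarrow> open S" and harm_uhp: "harm m F g S \<Longrightarrow> S \<subseteq> uhp"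
  and harm_holomorphic: "harm m F g S \<Longrightarrow> g holomorphic_on S"
  by (simp_all add: harm_iff)

lemma harm_add: "harm m F g S \<Longrightarrow> harm m F' g' S \<Longrightarrow> harm m (\<lambda>z. F z + F' z) (\<lambda>z. g z + g' z) S"
  unfolding harm_def using wharm_add by blast

lemma harm_cmult: "harm m F g S \<Longrightarrow> harm m (\<lambda>z. c * F z) (\<lambda>z. cnj c * g z) S"
  unfolding harm_def using wharm_cmult by blast

lemma harm_subset: "harm m F g S \<Longrightarrow> open T \<Longrightarrow> T \<subseteq> S \<Longrightarrow> harm m F g T"
  unfolding harm_def using wharm_subset by blast

lemma harm_cong:
  "harm m F g S \<Longrightarrow> (\<And>z. z \<in> S \<Longrightarrow> F z = F' z) \<Longrightarrow> (\<And>z. z \<in> S \<Longrightarrow> g z = g' z) \<Longrightarrow> harm m F' g' S"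
  unfolding harm_def using wharm_cong by blast

lemma harm_holo: "open S \<Longrightarrow> S \<subseteq> uhp \<Longrightarrow> f holomorphic_on S \<Longrightarrow> harm m f (\<lambda>_. 0) S"
  unfolding harm_def using wharm_holo by blast

lemma harm_isCont: "harm m F g S \<Longrightarrow> z \<in> S \<Longrightarrow> isCont F z"
  unfolding harm_def using wharm_isCont by blast

lemma harm_sum:
  assumes "finite I" "open S" "S \<subseteq> uhp" "\<And>i. i \<in> I \<Longrightarrow> harm m (F i) (g i) S"
  shows "harm m (\<lambda>z. \<Sum>i\<in>I. F i z) (\<lambda>z. \<Sum>i\<in>I. g i z) S"
  using assms(1,4)
proof (induction I rule: finite_induct)
  case empty
  show ?case using harm_holo[OF assms(2,3) holomorphic_on_const[of 0]] by simp
next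
  case (insert i I)
  then show ?case using harm_add[of m "F i" "g i" S] by simp
qed

lemma open_uhp: "open uhp"
  unfolding uhp_def by (rule open_halfspace_Im_gt)

lemma harm_partial_zbar:
  assumes "harm m F g S" "z \<in> S" shows "partial_zbar F z = of_real (Im z) ^ m * cnj (g z)"
  using harmE[OF assms] has_wirtinger_partial_zbar by blast

text \<open>For \<open>m = 2 * k - 2\<close> the power of \<open>Im z\<close> in
  \<open>xi_op\<close> cancels the weight \<open>Im z ^ m\<close> exactly.\<close>

lemma harm_xi:
  assumes F: "harm (2 * k - 2) F g S" and z: "z \<in> S" and k: "k \<ge> 1"
  shows "xi_op (1 - int k) F z = 2 * \<i> * g z"
proof -
  have y: "Im z > 0" using F z by (auto simp: harm_iff uhp_def)
  have "Im z powi (2 * (1 - int k)) * Im z ^ (2 * k - 2) = 1"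
  proof -
    have "Im z ^ (2 * k - 2) = Im z powi (int (2 * k - 2))" by (simp only: power_int_of_nat)
    then show ?thesis using y k by (simp add: of_nat_diff flip: power_int_add)
  qed
  then have "complex_of_real (Im z powi (2 * (1 - int k))) * of_real (Im z) ^ (2 * k - 2) = 1"
    by (metis of_real_1 of_real_mult of_real_power)
  then show ?thesis
    unfolding xi_op_def harm_partial_zbar[OF F z] by (simp add: mult.assoc[symmetric])
qed

text \<open>The local representation displays \<open>F\<close> as a finite sum of products of
  holomorphic and conjugate-holomorphic functions.\<close>

lemma harm_real_analytic:
  assumes F: "harm m F g S" and z: "z \<in> S"
  shows "real_analytic_at F z"
proof -
  obtain e where e: "e > 0" "ball z e \<subseteq> S" using harm_open[OF F] z open_contains_ball by blast
  have w: "wharm m (hp_coeff m) F g (ball z e)"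
    using F e(2) wharm_subset[OF _ open_ball] unfolding harm_def by blast
  have zin: "z \<in> ball z e" using e by simp
  obtain f H where f: "f holomorphic_on ball z e"
    and H: "\<And>j w. w \<in> ball z e \<Longrightarrow> (H j has_field_derivative hp_coeff m j w * g w) (at w)"
    and rep: "\<And>w. F w = f w + (\<Sum>j\<le>m. w ^ j * cnj (H j w))"
    using wharm_rep_ex[OF w hp_coeff_holomorphic convex_ball zin] by blast
  have Hh: "H j holomorphic_on ball z e" for j
    unfolding holomorphic_on_open[OF open_ball] using H by blast
  have mono: "real_analytic_at (\<lambda>w. w ^ j * cnj (H j w)) z" for j
    by (intro real_analytic_at_mult real_analytic_at_cnj real_analytic_at_holomorphic[OF _ open_ball zin] Hh holomorphic_intros)
  have "real_analytic_at (\<lambda>w. \<Sum>j\<in>J. w ^ j * cnj (H j w)) z" if "finite J" for J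
    using that
  proof (induction J rule: finite_induct)
    case empty
    show ?case using real_analytic_at_holomorphic[OF _ open_ball zin, of "\<lambda>_. 0"] by simp
  next
    case (insert j J)
    then show ?case using real_analytic_at_add[OF mono[of j]] by simp
  qed
  then have "real_analytic_at (\<lambda>w. f w + (\<Sum>j\<le>m. w ^ j * cnj (H j w))) z"
    by (intro real_analytic_at_add real_analytic_at_holomorphic[OF f open_ball zin]) simp
  then show ?thesis using rep by presburger
qed

lemma has_wirtinger_Im: "has_wirtinger (\<lambda>z. of_real (Im z)) (1 / (2 * \<i>)) (- 1 / (2 * \<i>)) z"
proof -
  have "has_wirtinger (\<lambda>z. 1 / (2 * \<i>) * (z - cnj z)) (1 / (2 * \<i>) * (1 - cnj 0)) (1 / (2 * \<i>) * (0 - cnj 1)) z"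
    by (intro has_wirtinger_cmult has_wirtinger_diff has_wirtinger_cnj has_wirtinger_holo) simp_all
  moreover have "(\<lambda>z. 1 / (2 * \<i>) * (z - cnj z)) = (\<lambda>z. of_real (Im z))"
    by (auto simp: fun_eq_iff complex_eq_iff)
  ultimately show ?thesis by simp
qed

lemma hyp_laplacian_expansion:
  assumes "ra_expansion F z c r"
  shows "hyp_laplacian \<kappa> F z = - (of_real (Im z))\<^sup>2 * (2 * c 2 0 + 2 * c 0 2)
    + 4 * \<i> * of_int \<kappa> * of_real (Im z) * partial_zbar F z"
  unfolding hyp_laplacian_def ra_expansion_partial_zbar(2,3)[OF assms] partial_zbar_def by simp

text \<open>Two expressions for the first Wirtinger coefficient of \<open>partial_zbar F\<close> are
  compared: a quarter of the Laplacian, from the power series, and the derivative of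
  \<open>Im z ^ m * cnj (g z)\<close>, to which only the power of \<open>Im z\<close>
  contributes.\<close>

lemma harm_laplacian:
  assumes F: "harm (2 * k - 2) F g S" and z: "z \<in> S" and k: "k \<ge> 1"
  shows "hyp_laplacian (1 - int k) F z = 0"
proof -
  let ?m = "2 * k - 2" let ?y = "complex_of_real (Im z)"
  have y: "?y \<noteq> 0" using F z by (auto simp: harm_iff uhp_def)
  obtain c r where c: "ra_expansion F z c r"
    using harm_real_analytic[OF F z] by (auto simp: real_analytic_at_iff)
  obtain b where b: "has_wirtinger (partial_zbar F) ((c 2 0 + c 0 2) / 2) b z"
    using ra_expansion_partial_zbar(1)[OF c] by blast
  have "has_wirtinger (\<lambda>z. of_real (Im z ^ ?m) * cnj (g z))
      (of_real (Im z ^ ?m) * cnj 0 + of_real (real ?m * Im z ^ (?m - 1)) * (1 / (2 * \<i>)) * cnj (g z))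
      (of_real (Im z ^ ?m) * cnj (deriv g z) + of_real (real ?m * Im z ^ (?m - 1)) * (- 1 / (2 * \<i>)) * cnj (g z)) z"
    by (intro has_wirtinger_mult has_wirtinger_cnj has_wirtinger_holo
        holomorphic_derivI[OF harm_holomorphic[OF F] harm_open[OF F] z] has_wirtinger_of_real[OF has_wirtinger_Im])
      (auto intro!: derivative_eq_intros)
  from has_wirtinger_cong_open[OF this harm_open[OF F] z, of "partial_zbar F"] harm_partial_zbar[OF F]
  have "has_wirtinger (partial_zbar F) (of_real (real ?m * Im z ^ (?m - 1)) * (1 / (2 * \<i>)) * cnj (g z))
      (of_real (Im z ^ ?m) * cnj (deriv g z) + of_real (real ?m * Im z ^ (?m - 1)) * (- 1 / (2 * \<i>)) * cnj (g z)) z"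
    by simp
  from has_wirtinger_unique(1)[OF b this]
  have "(c 2 0 + c 0 2) / 2 = of_nat ?m * ?y ^ (?m - 1) * (1 / (2 * \<i>)) * cnj (g z)" by simp
  then have "4 * ((c 2 0 + c 0 2) / 2) = 4 * (of_nat ?m * ?y ^ (?m - 1) * (1 / (2 * \<i>)) * cnj (g z))" by (rule arg_cong)
  also have "\<dots> = of_nat ?m * ?y ^ (?m - 1) * (2 / \<i>) * cnj (g z)" by (simp add: field_simps)
  also have "4 * ((c 2 0 + c 0 2) / 2) = 2 * c 2 0 + 2 * c 0 2" by (simp add: algebra_simps)
  finally have a: "2 * c 2 0 + 2 * c 0 2 = of_nat ?m * ?y ^ (?m - 1) * (2 / \<i>) * cnj (g z)" .
  have m: "of_int (1 - int k) = - (of_nat ?m / 2 :: complex)" using k by (simp add: of_nat_diff field_simps)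
  show ?thesis
  \<comment> \<open>The case 0 is separate because the exponent \<open>?m - 1\<close> is a truncated
    difference.\<close>
  proof (cases "?m = 0")
    case True
    then show ?thesis unfolding hyp_laplacian_expansion[OF c] a m by simp
  next
    case False
    then have "?m = Suc (?m - 1)" by simp
    then have "?y ^ ?m = ?y * ?y ^ (?m - 1)" by (metis power_Suc)
    then show ?thesis
      unfolding hyp_laplacian_expansion[OF c] a m harm_partial_zbar[OF F z]
      by (simp add: power2_eq_square field_simps)
  qed
qed

text \<open>The equation \<open>hyp_laplacian (1 - int k) F z = 0\<close> says that
  \<open>partial_z\<close> annihilates \<open>partial_zbar F z / Im z ^ (2 * k - 2)\<close>, that
  is, the conjugate of this quotient is holomorphic.\<close>

lemma harm_of_laplacian:
  assumes S: "open S" "S \<subseteq> uhp" and k: "k \<ge> 1"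
    and ra: "\<And>z. z \<in> S \<Longrightarrow> real_analytic_at F z"
    and lap: "\<And>z. z \<in> S \<Longrightarrow> hyp_laplacian (1 - int k) F z = 0"
  shows "harm (2 * k - 2) F (\<lambda>z. cnj (partial_zbar F z * of_real (1 / Im z ^ (2 * k - 2)))) S"
  unfolding harm_iff
proof (intro conjI S ballI)
  let ?m = "2 * k - 2"
  have pos: "Im z > 0" if "z \<in> S" for z using that S by (auto simp: uhp_def)
  have "\<exists>d. ((\<lambda>z. cnj (partial_zbar F z * of_real (1 / Im z ^ ?m))) has_field_derivative d) (at z)" if z: "z \<in> S" for z
  proof -
    let ?y = "complex_of_real (Im z)"
    have y: "?y \<noteq> 0" using pos[OF z] by simp
    obtain c r where c: "ra_expansion F z c r" using ra[OF z] by (auto simp: real_analytic_at_iff)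
    obtain b where b: "has_wirtinger (partial_zbar F) ((c 2 0 + c 0 2) / 2) b z"
      using ra_expansion_partial_zbar(1)[OF c] by blast
    define d where "d = - real ?m / Im z ^ (?m + 1)"
    have "((\<lambda>x. 1 / x ^ ?m) has_field_derivative d) (at (Im z))"
    proof (cases "?m")
      case (Suc n)
      have "((\<lambda>x. inverse (x ^ Suc n)) has_field_derivative - (real (Suc n) * Im z ^ (Suc n - Suc 0) * inverse ((Im z ^ Suc n) ^ Suc (Suc 0)))) (at (Im z))"
        by (rule DERIV_inverse_fun[OF DERIV_pow]) (use pos[OF z] in simp)
      moreover have "- (real (Suc n) * Im z ^ (Suc n - Suc 0) * inverse ((Im z ^ Suc n) ^ Suc (Suc 0))) = d"
        unfolding d_def Suc using pos[OF z] by (simp add: field_simps)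
      ultimately show ?thesis unfolding Suc by (simp only: inverse_eq_divide)
    qed (simp add: d_def)
    from has_wirtinger_mult[OF b has_wirtinger_of_real[OF has_wirtinger_Im this]]
    have "has_wirtinger (\<lambda>z. partial_zbar F z * of_real (1 / Im z ^ ?m))
       (partial_zbar F z * (of_real d * (1 / (2 * \<i>))) + (c 2 0 + c 0 2) / 2 * of_real (1 / Im z ^ ?m))
       (partial_zbar F z * (of_real d * (- 1 / (2 * \<i>))) + b * of_real (1 / Im z ^ ?m)) z" .
    moreover have "partial_zbar F z * (of_real d * (1 / (2 * \<i>))) + (c 2 0 + c 0 2) / 2 * of_real (1 / Im z ^ ?m) = 0"
    proof -
      have m: "of_int (1 - int k) = - (of_nat ?m / 2 :: complex)" using k by (simp add: of_nat_diff field_simps)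
      have "?y * (?y * (2 * c 2 0 + 2 * c 0 2) + 2 * \<i> * of_nat ?m * partial_zbar F z) = 0"
      proof -
        have "?y * (?y * (2 * c 2 0 + 2 * c 0 2) + 2 * \<i> * of_nat ?m * partial_zbar F z) = - hyp_laplacian (1 - int k) F z"
          unfolding hyp_laplacian_expansion[OF c] m by (simp add: power2_eq_square algebra_simps)
        then show ?thesis using lap[OF z] by simp
      qed
      then have "?y * (2 * c 2 0 + 2 * c 0 2) = - (2 * \<i> * of_nat ?m * partial_zbar F z)"
        using y by (metis eq_neg_iff_add_eq_0 mult_eq_0_iff)
      moreover have "?y * ((c 2 0 + c 0 2) / 2) = (?y * (2 * c 2 0 + 2 * c 0 2)) / 4" by (simp add: field_simps)
      ultimately have "?y * ((c 2 0 + c 0 2) / 2) = - (\<i> * of_nat ?m / 2 * partial_zbar F z)" by simp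
      then have *: "(c 2 0 + c 0 2) / 2 = - (\<i> * of_nat ?m / 2 * partial_zbar F z) / ?y"
        using y by (simp add: field_simps)
      show ?thesis unfolding * d_def using y by (simp add: field_simps)
    qed
    ultimately have "has_wirtinger (\<lambda>z. partial_zbar F z * of_real (1 / Im z ^ ?m)) 0
       (partial_zbar F z * (of_real d * (- 1 / (2 * \<i>))) + b * of_real (1 / Im z ^ ?m)) z" by (simp only:)
    from has_wirtinger_holoD[OF has_wirtinger_cnj[OF this, simplified complex_cnj_zero]] show ?thesis by blast
  qed
  then show "(\<lambda>z. cnj (partial_zbar F z * of_real (1 / Im z ^ ?m))) holomorphic_on S"
    unfolding holomorphic_on_open[OF S(1)] by blast
  fix z assume z: "z \<in> S"
  obtain c r where c: "ra_expansion F z c r" using ra[OF z] by (auto simp: real_analytic_at_iff)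
  have "has_wirtinger F ((c 1 0 - \<i> * c 0 1) / 2) (partial_zbar F z) z"
    unfolding has_wirtinger_partial_zbar[OF ra_expansion_has_wirtinger[OF c]]
    by (rule ra_expansion_has_wirtinger[OF c])
  then obtain p where "has_wirtinger F p (partial_zbar F z) z" by blast
  then show "\<exists>p. has_wirtinger F p (of_real (Im z) ^ ?m * cnj (cnj (partial_zbar F z * of_real (1 / Im z ^ ?m)))) z"
    using pos[OF z] by (auto simp: field_simps intro!: exI[of _ p])
qed

unbundle no Formal_Power_Series.fps_syntax

section \<open>The modular group\<close>

definition aut :: "int^2^2 \<Rightarrow> complex \<Rightarrow> complex" where
  "aut M z = of_int (M$2$1) * z + of_int (M$2$2)"

definition mat2 :: "int \<Rightarrow> int \<Rightarrow> int \<Rightarrow> int \<Rightarrow> int^2^2" where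
  "mat2 a b c d = vector [vector [a, b], vector [c, d]]"

lemma mat2_simps [simp]: "mat2 a b c d $ 1 $ 1 = a" "mat2 a b c d $ 1 $ 2 = b"
    "mat2 a b c d $ 2 $ 1 = c" "mat2 a b c d $ 2 $ 2 = d"
  by (simp_all add: mat2_def)

lemma mat2_eq_iff: "M = N \<longleftrightarrow> M$1$1 = N$1$1 \<and> M$1$2 = N$1$2 \<and> M$2$1 = N$2$1 \<and> M$2$2 = N$2$2"
  for M N :: "int^2^2"
  by (auto simp: vec_eq_iff forall_2)

lemma SL2Z_iff: "M \<in> SL2Z \<longleftrightarrow> M$1$1 * M$2$2 - M$1$2 * M$2$1 = 1"
  by (simp add: SL2Z_def det_2)

lemma mat_mult_simps: fixes M N :: "int^2^2"
  shows "(M ** N) $ i $ j = M$i$1 * N$1$j + M$i$2 * N$2$j"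
  by (simp add: matrix_matrix_mult_def sum_2)

lemma SL2Z_mult: "M \<in> SL2Z \<Longrightarrow> N \<in> SL2Z \<Longrightarrow> M ** N \<in> SL2Z"
  by (simp add: SL2Z_def det_mul)

lemma SL2Z_one: "mat 1 \<in> SL2Z" by (simp add: SL2Z_def)

lemma SL2Z_uminus: "M \<in> SL2Z \<Longrightarrow> - M \<in> SL2Z"
  by (simp add: SL2Z_iff)

definition minv :: "int^2^2 \<Rightarrow> int^2^2" where
  "minv M = mat2 (M$2$2) (- M$1$2) (- M$2$1) (M$1$1)"

lemma minv_SL2Z: "M \<in> SL2Z \<Longrightarrow> minv M \<in> SL2Z"
  by (simp add: SL2Z_iff minv_def algebra_simps)

lemma minv_mult: assumes "M \<in> SL2Z" shows "M ** minv M = mat 1" "minv M ** M = mat 1"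
  using assms by (auto simp: mat2_eq_iff mat_mult_simps minv_def SL2Z_iff mat_def algebra_simps)

lemma bij_betw_SL2Z_right: "N \<in> SL2Z \<Longrightarrow> bij_betw (\<lambda>M. M ** N) SL2Z SL2Z"
  by (rule bij_betw_byWitness[where f' = "\<lambda>M. M ** minv N"])
    (auto simp: matrix_mul_assoc[symmetric] minv_mult SL2Z_mult minv_SL2Z)

lemma bij_betw_SL2Z_left: "N \<in> SL2Z \<Longrightarrow> bij_betw (\<lambda>M. N ** M) SL2Z SL2Z"
  by (rule bij_betw_byWitness[where f' = "\<lambda>M. minv N ** M"])
    (auto simp: matrix_mul_assoc minv_mult SL2Z_mult minv_SL2Z)

lemma uhp_iff: "z \<in> uhp \<longleftrightarrow> Im z > 0" by (simp add: uhp_def)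

lemma aut_nonzero:
  assumes "M \<in> SL2Z" "z \<in> uhp" shows "aut M z \<noteq> 0"
proof
  assume 0: "aut M z = 0"
  then have "Im (aut M z) = 0" by simp
  then have c: "M$2$1 = 0" using assms(2) by (simp add: aut_def uhp_iff)
  then have "M$2$2 = 0" using 0 by (simp add: aut_def)
  then show False using assms(1) c by (simp add: SL2Z_iff)
qed

lemma moebius_eq: "moebius M z = (of_int (M$1$1) * z + of_int (M$1$2)) / aut M z"
  by (simp add: moebius_def aut_def)

lemma slash_eq: "slash \<kappa> f M z = aut M z powi (- \<kappa>) * f (moebius M z)"
  by (simp add: slash_def aut_def)

lemma Im_moebius:
  assumes "M \<in> SL2Z" "z \<in> uhp" shows "Im (moebius M z) = Im z / (norm (aut M z))\<^sup>2"
proof -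
  have d: "real_of_int (M$1$1) * of_int (M$2$2) - of_int (M$1$2) * of_int (M$2$1) = 1"
    using assms(1) by (simp add: SL2Z_iff flip: of_int_mult of_int_diff)
  have "Im ((of_int (M$1$1) * z + of_int (M$1$2)) * cnj (aut M z)) =
      (of_int (M$1$1) * of_int (M$2$2) - of_int (M$1$2) * of_int (M$2$1)) * Im z"
    by (simp add: aut_def algebra_simps)
  then show ?thesis unfolding moebius_eq complex_div_cnj[of _ "aut M z"] d
    by (simp add: Im_divide_of_real flip: of_real_power)
qed

lemma moebius_uhp: "M \<in> SL2Z \<Longrightarrow> z \<in> uhp \<Longrightarrow> moebius M z \<in> uhp"
  using Im_moebius aut_nonzero by (simp add: uhp_iff)

lemma aut_mult:
  assumes "N \<in> SL2Z" "z \<in> uhp" shows "aut (M ** N) z = aut M (moebius N z) * aut N z"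
  unfolding moebius_eq aut_def[of M] using aut_nonzero[OF assms]
  by (simp add: mat_mult_simps field_simps) (simp add: aut_def mat_mult_simps algebra_simps)

lemma moebius_mult:
  assumes "M \<in> SL2Z" "N \<in> SL2Z" "z \<in> uhp" shows "moebius (M ** N) z = moebius M (moebius N z)"
proof -
  have n: "aut N z \<noteq> 0" "aut M (moebius N z) \<noteq> 0"
    using aut_nonzero moebius_uhp assms by blast+
  have "(of_int (M$1$1) * moebius N z + of_int (M$1$2)) * aut N z = of_int ((M ** N)$1$1) * z + of_int ((M ** N)$1$2)"
    unfolding moebius_eq using n(1) by (simp add: mat_mult_simps field_simps) (simp add: aut_def algebra_simps)
  then show ?thesis
    unfolding moebius_eq[of "M ** N"] moebius_eq[of M] aut_mult[OF assms(2,3)] using n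
    by (metis mult_divide_mult_cancel_right)
qed

lemma moebius_one [simp]: "moebius (mat 1) z = z" by (simp add: moebius_def mat_def)

lemma aut_one [simp]: "aut (mat 1) z = 1" by (simp add: aut_def mat_def)

lemma moebius_minv:
  assumes "M \<in> SL2Z" "z \<in> uhp"
  shows "moebius (minv M) (moebius M z) = z" "moebius M (moebius (minv M) z) = z"
  using moebius_mult[OF minv_SL2Z[OF assms(1)] assms(1,2)] moebius_mult[OF assms(1) minv_SL2Z[OF assms(1)] assms(2)]
  by (simp_all add: minv_mult[OF assms(1)])

lemma continuous_on_moebius: "M \<in> SL2Z \<Longrightarrow> continuous_on uhp (moebius M)"
  unfolding moebius_eq aut_def using aut_nonzero[of M]
  by (intro continuous_intros) (auto simp: aut_def)

lemma moebius_has_derivative: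
  assumes "M \<in> SL2Z" "z \<in> uhp"
  shows "(moebius M has_field_derivative 1 / (aut M z)\<^sup>2) (at z)"
proof -
  have n: "aut M z \<noteq> 0" using aut_nonzero assms by blast
  have d: "of_int (M$1$1) * of_int (M$2$2) - of_int (M$1$2) * of_int (M$2$1) = (1::complex)"
    using assms(1) by (simp add: SL2Z_iff flip: of_int_mult of_int_diff)
  have "(of_int (M$1$1) * aut M z - (of_int (M$1$1) * z + of_int (M$1$2)) * of_int (M$2$1)) =
      of_int (M$1$1) * of_int (M$2$2) - of_int (M$1$2) * (of_int (M$2$1) :: complex)"
    by (simp add: aut_def algebra_simps)
  then have e: "(of_int (M$1$1) * aut M z - (of_int (M$1$1) * z + of_int (M$1$2)) * of_int (M$2$1)) / (aut M z * aut M z) = 1 / (aut M z)\<^sup>2"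
    using d by (simp add: power2_eq_square)
  have "((\<lambda>z. (of_int (M$1$1) * z + of_int (M$1$2)) / aut M z) has_field_derivative
      (of_int (M$1$1) * aut M z - (of_int (M$1$1) * z + of_int (M$1$2)) * of_int (M$2$1)) / (aut M z * aut M z)) (at z)"
    using n unfolding aut_def by (auto intro!: derivative_eq_intros)
  then show ?thesis unfolding e by (simp add: moebius_eq[abs_def])
qed

section \<open>The linear forms of the Poincare series\<close>

text \<open>\<open>lin w M z\<close> is \<open>(cz + d) * (Mz - w)\<close>; the Poincare series are built from \<open>w = \<zz>\<close> and \<open>w = cnj \<zz>\<close>.\<close>

definition lin :: "complex \<Rightarrow> int^2^2 \<Rightarrow> complex \<Rightarrow> complex" where
  "lin w M z = (of_int (M$1$1) - of_int (M$2$1) * w) * z + (of_int (M$1$2) - of_int (M$2$2) * w)"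

text \<open>For \<open>M\<close> in the stabilizer of \<open>w\<close> this leading coefficient of
  \<open>lin w M\<close> is the root of unity \<open>v\<close> by which \<open>M\<close> multiplies
  the linear forms.\<close>

definition slope :: "complex \<Rightarrow> int^2^2 \<Rightarrow> complex" where
  "slope w M = of_int (M$1$1) - of_int (M$2$1) * w"

lemma lin_eq:
  assumes "M \<in> SL2Z" "z \<in> uhp" shows "lin w M z = aut M z * (moebius M z - w)"
  unfolding moebius_eq using aut_nonzero[OF assms] by (simp add: right_diff_distrib lin_def) (simp add: aut_def algebra_simps)

lemma lin_mult:
  assumes "M \<in> SL2Z" "N \<in> SL2Z" "z \<in> uhp" shows "lin w (M ** N) z = aut N z * lin w M (moebius N z)"
  using assms moebius_uhp by (simp add: lin_eq SL2Z_mult moebius_mult aut_mult)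

lemma lin_diff: "lin w M z - lin w M z' = slope w M * (z - z')"
  by (simp add: lin_def slope_def algebra_simps)

text \<open>Since the determinant is 1, the value does not depend on \<open>M\<close>. Divided by
  the square of \<open>norm (lin (cnj \<zz>) M z)\<close> it is \<open>1 - r ^ 2\<close> at the
  point \<open>moebius M z\<close>, the argument of the incomplete beta function.\<close>

lemma norm_lin_cnj_minus:
  assumes "M \<in> SL2Z"
  shows "(norm (lin (cnj \<zz>) M z))\<^sup>2 - (norm (lin \<zz> M z))\<^sup>2 = 4 * Im \<zz> * Im z"
proof -
  define a b c d where "a = real_of_int (M$1$1)" and "b = real_of_int (M$1$2)"
    and "c = real_of_int (M$2$1)" and "d = real_of_int (M$2$2)"
  have det: "a * d - b * c = 1"
    using assms by (simp add: a_def b_def c_def d_def SL2Z_iff flip: of_int_mult of_int_diff)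
  have "(norm (lin (cnj \<zz>) M z))\<^sup>2 - (norm (lin \<zz> M z))\<^sup>2 = 4 * Im \<zz> * Im z * (a * d - b * c)"
    unfolding cmod_power2 by (simp add: lin_def a_def b_def c_def d_def power2_eq_square algebra_simps)
  then show ?thesis using det by simp
qed

lemma slope_nonzero:
  assumes "M \<in> SL2Z" "Im w \<noteq> 0" shows "slope w M \<noteq> 0"
proof
  assume "slope w M = 0"
  then have "Im (slope w M) = 0" "Re (slope w M) = 0" by auto
  then have "M$2$1 = 0" "M$1$1 = 0" using assms(2) by (auto simp: slope_def)
  then show False using assms(1) by (simp add: SL2Z_iff)
qed

text \<open>Integrality: either the lower left entry vanishes and the upper left one is a nonzero
  integer, or the lower left entry contributes at least \<open>\<bar>Im w\<bar>\<close> to the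
  imaginary part.\<close>

lemma norm_slope_ge:
  assumes "M \<in> SL2Z" shows "norm (slope w M) \<ge> min 1 \<bar>Im w\<bar>"
proof (cases "M$2$1 = 0")
  case True
  then have "M$1$1 \<noteq> 0" using assms by (auto simp: SL2Z_iff)
  then have "\<bar>real_of_int (M$1$1)\<bar> \<ge> 1" by linarith
  then show ?thesis using True by (simp add: slope_def min_def)
next
  case False
  then have "\<bar>real_of_int (M$2$1)\<bar> \<ge> 1" by linarith
  then have "\<bar>Im w\<bar> \<le> \<bar>real_of_int (M$2$1)\<bar> * \<bar>Im w\<bar>" by (simp add: mult_le_cancel_right1)
  also have "\<dots> = \<bar>Im (slope w M)\<bar>" by (simp add: slope_def abs_mult)
  also have "\<dots> \<le> norm (slope w M)" by (rule abs_Im_le_cmod)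
  finally show ?thesis by simp
qed

text \<open>The zero \<open>- \<theta>\<close> of the form is the image of \<open>cnj \<zz>\<close>
  under the inverse matrix and hence lies in the lower half-plane.\<close>

lemma lin_cnj_factor:
  assumes M: "M \<in> SL2Z" and \<zz>: "\<zz> \<in> uhp"
  obtains \<theta> where "Im \<theta> > 0" "\<And>z. lin (cnj \<zz>) M z = slope (cnj \<zz>) M * (z + \<theta>)"
proof -
  let ?s = "slope (cnj \<zz>) M"
  define \<theta> where "\<theta> = (of_int (M$1$2) - of_int (M$2$2) * cnj \<zz>) / ?s"
  have s: "?s \<noteq> 0" using slope_nonzero[OF M] \<zz> by (simp add: uhp_iff)
  have d: "real_of_int (M$1$1) * of_int (M$2$2) - of_int (M$1$2) * of_int (M$2$1) = 1"
    using M by (simp add: SL2Z_iff flip: of_int_mult of_int_diff)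
  have "Im ((of_int (M$1$2) - of_int (M$2$2) * cnj \<zz>) * cnj ?s) =
     (real_of_int (M$1$1) * of_int (M$2$2) - of_int (M$1$2) * of_int (M$2$1)) * Im \<zz>"
    by (simp add: slope_def algebra_simps)
  then have "Im \<theta> = Im \<zz> / (norm ?s)\<^sup>2"
    unfolding \<theta>_def complex_div_cnj[of _ ?s] d by (simp add: Im_divide_of_real flip: of_real_power)
  then have "Im \<theta> > 0" using s \<zz> by (simp add: uhp_iff)
  moreover have "lin (cnj \<zz>) M z = ?s * (z + \<theta>)" for z
    using s by (simp add: \<theta>_def distrib_left) (simp add: lin_def slope_def)
  ultimately show thesis using that by blast
qed

lemma norm_lin_ge_slope:
  assumes "M \<in> SL2Z" "\<zz> \<in> uhp" "z \<in> uhp" shows "norm (lin (cnj \<zz>) M z) \<ge> norm (slope (cnj \<zz>) M) * Im z"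
proof -
  obtain \<theta> where \<theta>: "Im \<theta> > 0" "\<And>z. lin (cnj \<zz>) M z = slope (cnj \<zz>) M * (z + \<theta>)"
    using lin_cnj_factor[OF assms(1,2)] by blast
  have "Im z \<le> Im (z + \<theta>)" using \<theta> by simp
  also have "\<dots> \<le> norm (z + \<theta>)" using abs_Im_le_cmod[of "z + \<theta>"] by linarith
  finally show ?thesis unfolding \<theta>(2) norm_mult by (intro mult_left_mono) auto
qed

lemma norm_lin_ge:
  assumes "M \<in> SL2Z" "\<zz> \<in> uhp" "z \<in> uhp" shows "norm (lin (cnj \<zz>) M z) \<ge> min 1 (Im \<zz>) * Im z"
proof -
  have "min 1 (Im \<zz>) * Im z \<le> norm (slope (cnj \<zz>) M) * Im z"
    using norm_slope_ge[OF assms(1), of "cnj \<zz>"] assms(2,3) by (intro mult_right_mono) (auto simp: uhp_iff)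
  then show ?thesis using norm_lin_ge_slope[OF assms] by simp
qed

lemma lin_cnj_nonzero: "M \<in> SL2Z \<Longrightarrow> \<zz> \<in> uhp \<Longrightarrow> z \<in> uhp \<Longrightarrow> lin (cnj \<zz>) M z \<noteq> 0"
  using norm_lin_ge[of M \<zz> z] by (auto simp: uhp_iff min_def split: if_splits) (smt (verit) mult_pos_pos)

text \<open>On this ball the form changes by at most half of its modulus at the centre, so that
  bounds at \<open>z0\<close> serve for all points of the ball up to powers of 2.\<close>

lemma norm_lin_ball:
  assumes "M \<in> SL2Z" "\<zz> \<in> uhp" "z0 \<in> uhp" "dist z0 z \<le> Im z0 / 2"
  shows "norm (lin (cnj \<zz>) M z) \<ge> norm (lin (cnj \<zz>) M z0) / 2"
    and "norm (lin (cnj \<zz>) M z) \<le> 2 * norm (lin (cnj \<zz>) M z0)"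
proof -
  have "norm (lin (cnj \<zz>) M z - lin (cnj \<zz>) M z0) \<le> norm (slope (cnj \<zz>) M) * (Im z0 / 2)"
    unfolding lin_diff norm_mult using assms(4) by (intro mult_left_mono) (auto simp: dist_norm norm_minus_commute)
  also have "\<dots> \<le> norm (lin (cnj \<zz>) M z0) / 2"
    using norm_lin_ge_slope[OF assms(1-3)] by simp
  finally have *: "norm (lin (cnj \<zz>) M z - lin (cnj \<zz>) M z0) \<le> norm (lin (cnj \<zz>) M z0) / 2" .
  show "norm (lin (cnj \<zz>) M z) \<ge> norm (lin (cnj \<zz>) M z0) / 2"
    using * norm_triangle_ineq2[of "lin (cnj \<zz>) M z0" "lin (cnj \<zz>) M z"] by (simp add: norm_minus_commute)
  show "norm (lin (cnj \<zz>) M z) \<le> 2 * norm (lin (cnj \<zz>) M z0)"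
    using * norm_triangle_ineq2[of "lin (cnj \<zz>) M z" "lin (cnj \<zz>) M z0"] norm_ge_zero[of "lin (cnj \<zz>) M z0"] by linarith
qed

section \<open>Summability over the modular group\<close>

lemma int_translate_sum_le:
  fixes x Y :: real
  assumes "finite T" "Y > 0"
  shows "(\<Sum>t\<in>T. 1 / ((x + of_int t)\<^sup>2 + Y\<^sup>2)) \<le> (2 + 2 / Y\<^sup>2) * pi / Y"
proof -
  \<comment> \<open>The sum is compared with the telescoping sum of the increments of
    \<open>arctan (s / Y)\<close> over unit intervals, whose total is at most
    \<open>pi\<close>.\<close>
  define f where "f s = arctan (s / Y)" for s
  define K where "K = (2 + 2 / Y\<^sup>2) / Y"
  have K: "K > 0" using assms(2) by (simp add: K_def add_pos_nonneg)
  have mono: "f s \<le> f (s + 1)" for s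
    using assms(2) by (simp add: f_def arctan_le_iff divide_right_mono)
  have term_le: "1 / (s\<^sup>2 + Y\<^sup>2) \<le> K * (f (s + 1) - f s)" for s
  proof -
    have "\<exists>u>s. u < s + 1 \<and> f (s + 1) - f s = (s + 1 - s) * (inverse (1 + (u / Y)\<^sup>2) * (1 / Y))"
      by (rule MVT2) (use assms(2) in \<open>auto simp: f_def intro!: derivative_eq_intros\<close>)
    then obtain u where u: "s < u" "u < s + 1" "f (s + 1) - f s = inverse (1 + (u / Y)\<^sup>2) * (1 / Y)" by auto
    have e: "f (s + 1) - f s = Y / (u\<^sup>2 + Y\<^sup>2)"
      unfolding u(3) using assms(2) by (simp add: field_simps power2_eq_square)
    \<comment> \<open>Passing from the intermediate point \<open>u\<close> back to \<open>s\<close>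
      costs the factor \<open>2 + 2 / Y\<^sup>2\<close>.\<close>
    have "(u - s)\<^sup>2 \<le> 1\<^sup>2" using u by (intro power_mono) auto
    moreover have "u\<^sup>2 \<le> 2 * s\<^sup>2 + 2 * (u - s)\<^sup>2"
      using zero_le_power2[of "u - 2 * s"] by (simp add: power2_eq_square algebra_simps)
    ultimately have "u\<^sup>2 + Y\<^sup>2 \<le> 2 * s\<^sup>2 + 2 + Y\<^sup>2" by simp
    also have "\<dots> \<le> (2 + 2 / Y\<^sup>2) * (s\<^sup>2 + Y\<^sup>2)"
      using assms(2) by (simp add: field_simps)
    finally have le: "u\<^sup>2 + Y\<^sup>2 \<le> (2 + 2 / Y\<^sup>2) * (s\<^sup>2 + Y\<^sup>2)" .
    have p: "s\<^sup>2 + Y\<^sup>2 > 0" "u\<^sup>2 + Y\<^sup>2 > 0" using assms(2) by (simp_all add: add_nonneg_pos)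
    have "1 / (s\<^sup>2 + Y\<^sup>2) \<le> (2 + 2 / Y\<^sup>2) / (u\<^sup>2 + Y\<^sup>2)"
      using le p by (simp add: divide_simps mult.commute)
    then show ?thesis unfolding e K_def using assms(2) by simp
  qed
  have tele: "(\<Sum>t\<in>{- int N..<int N}. f (x + of_int t + 1) - f (x + of_int t)) = f (x + real N) - f (x - real N)" for N
  proof (induction N)
    case (Suc N)
    have "{- int (Suc N)..<int (Suc N)} = insert (- int (Suc N)) (insert (int N) {- int N..<int N})" by auto
    then show ?case using Suc by (simp add: algebra_simps)
  qed simp
  obtain N where N: "T \<subseteq> {- int N..<int N}"
  proof -
    have "\<exists>N. T \<subseteq> {- int N..<int N}" using assms(1)
    proof (induction T rule: finite_induct)
      case (insert t T)
      then obtain N where "T \<subseteq> {- int N..<int N}" by blast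
      then have "insert t T \<subseteq> {- int (N + nat \<bar>t\<bar> + 1)..<int (N + nat \<bar>t\<bar> + 1)}" by force
      then show ?case by blast
    qed simp
    then show thesis using that by blast
  qed
  have "(\<Sum>t\<in>T. 1 / ((x + of_int t)\<^sup>2 + Y\<^sup>2)) \<le> (\<Sum>t\<in>T. K * (f (x + of_int t + 1) - f (x + of_int t)))"
    by (intro sum_mono term_le)
  also have "\<dots> \<le> (\<Sum>t\<in>{- int N..<int N}. K * (f (x + of_int t + 1) - f (x + of_int t)))"
    using N mono K by (intro sum_mono2) auto
  also have "\<dots> = K * (f (x + real N) - f (x - real N))" by (simp only: tele flip: sum_distrib_left)
  also have "\<dots> \<le> K * pi"
  proof (intro mult_left_mono)
    show "f (x + real N) - f (x - real N) \<le> pi"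
      using arctan_ubound[of "(x + real N) / Y"] arctan_lbound[of "(x - real N) / Y"] unfolding f_def by linarith
  qed (use K in simp)
  finally show ?thesis by (simp add: K_def)
qed

text \<open>The positive definite form \<open>norm (a - c * w) ^ 2\<close> dominates a multiple of
  \<open>a ^ 2 + c ^ 2\<close> and, at integer pairs other than the origin, also one of
  \<open>1 + a ^ 2 + c ^ 2\<close>. Its square therefore dominates a multiple of
  \<open>(1 + a ^ 2) * (1 + c ^ 2)\<close>, which reduces the double sum to a product of two single
  sums.\<close>

lemma lattice_sum_le:
  assumes "Im w \<noteq> 0"
  obtains C where "\<And>G. finite G \<Longrightarrow> (0, 0) \<notin> G \<Longrightarrow> (\<Sum>(a, c)\<in>G. 1 / norm (of_int a - of_int c * w) ^ 4) \<le> C"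
proof -
  define u v where "u = Re w" and "v = Im w"
  define K where "K = 2 + (2 * u\<^sup>2 + 1) / v\<^sup>2"
  have v: "v \<noteq> 0" using assms by (simp add: v_def)
  have K: "K > 0" unfolding K_def by (intro add_pos_nonneg) auto
  have le: "1 / norm (of_int a - of_int c * w) ^ 4 \<le> 4 * K\<^sup>2 * ((1 / (1 + (of_int a)\<^sup>2)) * (1 / (1 + (of_int c)\<^sup>2)))"
    if "(a, c) \<noteq> (0, 0)" for a c :: int
  proof -
    define A C where "A = real_of_int a" and "C = real_of_int c"
    define N where "N = (norm (of_int a - of_int c * w))\<^sup>2"
    have N: "N = (A - C * u)\<^sup>2 + (C * v)\<^sup>2"
      unfolding N_def cmod_power2 by (simp add: A_def C_def u_def v_def)
    have "A\<^sup>2 \<le> 2 * (A - C * u)\<^sup>2 + 2 * (C * u)\<^sup>2"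
      using zero_le_power2[of "A - 2 * (C * u)"] by (simp add: power2_eq_square algebra_simps)
    then have "A\<^sup>2 + C\<^sup>2 \<le> 2 * (A - C * u)\<^sup>2 + (2 * u\<^sup>2 + 1) * C\<^sup>2"
      by (simp add: power_mult_distrib algebra_simps)
    also have "\<dots> = 2 * (A - C * u)\<^sup>2 + (2 * u\<^sup>2 + 1) / v\<^sup>2 * (C * v)\<^sup>2"
      using v by (simp add: power_mult_distrib)
    also have "\<dots> \<le> K * N"
    proof -
      have "0 \<le> (2 * u\<^sup>2 + 1) / v\<^sup>2 * (A - C * u)\<^sup>2 + 2 * (C * v)\<^sup>2" by simp
      then show ?thesis unfolding K_def N by (simp add: algebra_simps)
    qed
    finally have 1: "A\<^sup>2 + C\<^sup>2 \<le> K * N" .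
    have "a\<^sup>2 + c\<^sup>2 \<ge> 1" using that by (smt (verit) Pair_inject power2_eq_iff_nonneg zero_le_power2 zero_power2 power_eq_0_iff)
    then have "A\<^sup>2 + C\<^sup>2 \<ge> 1" unfolding A_def C_def by (metis of_int_1_le_iff of_int_add of_int_power)
    then have 2: "1 + A\<^sup>2 + C\<^sup>2 \<le> 2 * (K * N)" using 1 by simp
    have "(1 + A\<^sup>2 + C\<^sup>2)\<^sup>2 - (1 + A\<^sup>2) * (1 + C\<^sup>2) = A\<^sup>2 + C\<^sup>2 + A\<^sup>2 * A\<^sup>2 + A\<^sup>2 * C\<^sup>2 + C\<^sup>2 * C\<^sup>2"
      by (simp add: power2_eq_square algebra_simps)
    moreover have "A\<^sup>2 + C\<^sup>2 + A\<^sup>2 * A\<^sup>2 + A\<^sup>2 * C\<^sup>2 + C\<^sup>2 * C\<^sup>2 \<ge> 0" by simp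
    ultimately have "(1 + A\<^sup>2) * (1 + C\<^sup>2) \<le> (1 + A\<^sup>2 + C\<^sup>2)\<^sup>2" by linarith
    also have "\<dots> \<le> (2 * (K * N))\<^sup>2" using 2 by (intro power_mono) auto
    finally have 3: "(1 + A\<^sup>2) * (1 + C\<^sup>2) \<le> 4 * K\<^sup>2 * N\<^sup>2" by (simp add: power_mult_distrib)
    have p: "(1 + A\<^sup>2) * (1 + C\<^sup>2) > 0" by (simp add: add_pos_nonneg)
    then have "N\<^sup>2 > 0" using 3 K by (smt (verit) zero_less_power2 zero_le_power2 mult_eq_0_iff)
    then have "1 / N\<^sup>2 \<le> 4 * K\<^sup>2 / ((1 + A\<^sup>2) * (1 + C\<^sup>2))"
      using 3 p by (simp add: divide_simps mult.commute)
    moreover have "norm (of_int a - of_int c * w) ^ 4 = N\<^sup>2" unfolding N_def by simp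
    ultimately show ?thesis by (simp add: A_def C_def)
  qed
  \<comment> \<open>This is the bound for integer translates with \<open>x = 0\<close> and
    \<open>Y = 1\<close>.\<close>
  define B where "B = 4 * pi"
  have B: "(\<Sum>a\<in>X. 1 / (1 + (real_of_int a)\<^sup>2)) \<le> B" if "finite X" for X
    using int_translate_sum_le[OF that, of 1 0] by (simp add: B_def add.commute)
  show thesis
  proof (rule that)
    fix G :: "(int \<times> int) set" assume G: "finite G" "(0, 0) \<notin> G"
    let ?h = "\<lambda>(a, c). (1 / (1 + (real_of_int a)\<^sup>2)) * (1 / (1 + (real_of_int c)\<^sup>2))"
    have "(\<Sum>(a, c)\<in>G. 1 / norm (of_int a - of_int c * w) ^ 4) \<le> (\<Sum>p\<in>G. 4 * K\<^sup>2 * ?h p)"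
    proof (rule sum_mono)
      fix p assume p: "p \<in> G"
      obtain a c where ac: "p = (a, c)" by (cases p)
      with p G(2) have "(a, c) \<noteq> (0, 0)" by metis
      from le[OF this] show "(case p of (a, c) \<Rightarrow> 1 / norm (of_int a - of_int c * w) ^ 4) \<le> 4 * K\<^sup>2 * ?h p"
        by (simp only: ac prod.case)
    qed
    also have "\<dots> = 4 * K\<^sup>2 * (\<Sum>p\<in>G. ?h p)" by (simp add: sum_distrib_left)
    also have "(\<Sum>p\<in>G. ?h p) \<le> (\<Sum>p\<in>fst ` G \<times> snd ` G. ?h p)"
      using G(1) by (intro sum_mono2) (auto intro: image_eqI[where x = "(_, _)"])
    also have "\<dots> = (\<Sum>a\<in>fst ` G. 1 / (1 + (real_of_int a)\<^sup>2)) * (\<Sum>c\<in>snd ` G. 1 / (1 + (real_of_int c)\<^sup>2))"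
      by (simp add: sum_product sum.cartesian_product)
    also have "\<dots> \<le> B * B" using G(1) by (intro mult_mono B) (auto intro!: sum_nonneg simp: B_def)
    finally show "(\<Sum>(a, c)\<in>G. 1 / norm (of_int a - of_int c * w) ^ 4) \<le> 4 * K\<^sup>2 * (B * B)"
      by (simp add: mult_left_mono)
  qed
qed

text \<open>Matrices with the same first column differ by right multiplication by a translation, so the
  sum over the group is a sum over columns of sums over integer translates.\<close>

lemma SL2Z_sum_le:
  assumes \<zz>: "\<zz> \<in> uhp"
  obtains C where "C > 0" "\<And>z F. z \<in> uhp \<Longrightarrow> finite F \<Longrightarrow> F \<subseteq> SL2Z \<Longrightarrow>
    (\<Sum>M\<in>F. 1 / norm (lin (cnj \<zz>) M z) ^ 4) \<le> C * (2 + 2 / (Im z)\<^sup>2) / Im z ^ 3"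
proof -
  have "Im (cnj \<zz>) \<noteq> 0" using \<zz> by (simp add: uhp_iff)
  then obtain C0 where C0: "\<And>G. finite G \<Longrightarrow> (0, 0) \<notin> G \<Longrightarrow> (\<Sum>(a, c)\<in>G. 1 / norm (of_int a - of_int c * cnj \<zz>) ^ 4) \<le> C0"
    using lattice_sum_le by metis
  have C0': "C0 \<ge> 0" using C0[of "{}"] by simp
  show thesis
  proof (rule that[of "C0 * pi + 1"])
    show "C0 * pi + 1 > 0" using C0' by (simp add: add_nonneg_pos)
    fix z F assume z: "z \<in> uhp" and F: "finite F" "F \<subseteq> SL2Z"
    define y where "y = Im z"
    have y: "y > 0" using z by (simp add: y_def uhp_iff)
    define L where "L = (2 + 2 / y\<^sup>2) * pi / y"
    have L: "L \<ge> 0" using y by (simp add: L_def)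
    define col where "col M = (M$1$1, M$2$1)" for M :: "int^2^2"
    have fib: "(\<Sum>M\<in>{M\<in>F. col M = p}. 1 / norm (lin (cnj \<zz>) M z) ^ 4) \<le> (L / y\<^sup>2) * (\<lambda>(a, c). 1 / norm (of_int a - of_int c * cnj \<zz>) ^ 4) p"
      if p: "p \<in> col ` F" for p
    proof -
      obtain M0 where M0: "M0 \<in> F" "col M0 = p" using p by auto
      have M0S: "M0 \<in> SL2Z" using M0 F by auto
      obtain \<theta> where \<theta>: "Im \<theta> > 0" "\<And>z. lin (cnj \<zz>) M0 z = slope (cnj \<zz>) M0 * (z + \<theta>)"
        using lin_cnj_factor[OF M0S \<zz>] by blast
      define s where "s = slope (cnj \<zz>) M0"
      have s: "s \<noteq> 0" unfolding s_def using slope_nonzero[OF M0S] \<zz> by (simp add: uhp_iff)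
      define x where "x = Re (z + \<theta>)"
      \<comment> \<open>\<open>M\<close> is \<open>M0\<close> multiplied on the right by the
        translation by \<open>\<tau> M\<close>; Cramer's rule recovers this integer from the second
        columns.\<close>
      define \<tau> where "\<tau> M = M0$2$2 * M$1$2 - M0$1$2 * M$2$2" for M :: "int^2^2"
      let ?E = "{M\<in>F. col M = p}"
      have E: "M$1$1 = M0$1$1" "M$2$1 = M0$2$1" "M$1$2 = M0$1$2 + \<tau> M * M0$1$1" "M$2$2 = M0$2$2 + \<tau> M * M0$2$1"
        if "M \<in> ?E" for M
      proof -
        show c: "M$1$1 = M0$1$1" "M$2$1 = M0$2$1" using that M0(2) by (auto simp: col_def)
        have d: "M0$1$1 * M$2$2 - M$1$2 * M0$2$1 = 1" "M0$1$1 * M0$2$2 - M0$1$2 * M0$2$1 = 1"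
          using that F(2) M0S c by (auto simp: SL2Z_iff)
        have "M$1$2 = M$1$2 * (M0$1$1 * M0$2$2 - M0$1$2 * M0$2$1)" "M0$1$2 = M0$1$2 * (M0$1$1 * M$2$2 - M$1$2 * M0$2$1)"
          using d by simp_all
        then show "M$1$2 = M0$1$2 + \<tau> M * M0$1$1" by (simp add: \<tau>_def algebra_simps)
        have "M$2$2 = M$2$2 * (M0$1$1 * M0$2$2 - M0$1$2 * M0$2$1)" "M0$2$2 = M0$2$2 * (M0$1$1 * M$2$2 - M$1$2 * M0$2$1)"
          using d by simp_all
        then show "M$2$2 = M0$2$2 + \<tau> M * M0$2$1" by (simp add: \<tau>_def algebra_simps)
      qed
      have inj: "inj_on \<tau> ?E" by (rule inj_onI, unfold mat2_eq_iff) (simp only: E)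
      have term_le: "1 / norm (lin (cnj \<zz>) M z) ^ 4 \<le> 1 / (norm s ^ 4 * y\<^sup>2) * (1 / ((x + of_int (\<tau> M))\<^sup>2 + y\<^sup>2))"
        if "M \<in> ?E" for M
      proof -
        have "lin (cnj \<zz>) M z = lin (cnj \<zz>) M0 z + of_int (\<tau> M) * s"
          unfolding lin_def s_def slope_def E[OF that] by (simp add: algebra_simps)
        also have "\<dots> = s * (z + \<theta> + of_int (\<tau> M))" by (simp add: \<theta>(2) s_def algebra_simps)
        finally have l: "lin (cnj \<zz>) M z = s * (z + \<theta> + of_int (\<tau> M))" .
        define q where "q = (norm (z + \<theta> + of_int (\<tau> M)))\<^sup>2"
        have "y\<^sup>2 \<le> (Im (z + \<theta>))\<^sup>2" using \<theta>(1) y by (intro power_mono) (auto simp: y_def)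
        then have q: "q \<ge> (x + of_int (\<tau> M))\<^sup>2 + y\<^sup>2" unfolding q_def cmod_power2 x_def by simp
        have q2: "q \<ge> y\<^sup>2" using q by (smt (verit) zero_le_power2)
        have qp: "q > 0" using q2 y by (meson less_le_trans zero_less_power)
        have p: "(x + of_int (\<tau> M))\<^sup>2 + y\<^sup>2 > 0" using y by (simp add: add_nonneg_pos)
        have "norm (lin (cnj \<zz>) M z) ^ 4 = norm s ^ 4 * (q * q)"
          unfolding l norm_mult power_mult_distrib q_def by (simp add: power2_eq_square power4_eq_xxxx)
        \<comment> \<open>One factor \<open>q\<close> is kept for the summation over the translates,
          the other one is bounded below by \<open>y\<^sup>2\<close>.\<close>
        moreover have "norm s ^ 4 * (q * q) \<ge> norm s ^ 4 * (y\<^sup>2 * ((x + of_int (\<tau> M))\<^sup>2 + y\<^sup>2))"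
          using q q2 p y by (intro mult_left_mono mult_mono) auto
        ultimately have "1 / norm (lin (cnj \<zz>) M z) ^ 4 \<le> 1 / (norm s ^ 4 * (y\<^sup>2 * ((x + of_int (\<tau> M))\<^sup>2 + y\<^sup>2)))"
          using s y p qp by (intro divide_left_mono mult_pos_pos) auto
        then show ?thesis by (simp add: mult.assoc)
      qed
      have "(\<Sum>M\<in>?E. 1 / norm (lin (cnj \<zz>) M z) ^ 4) \<le> (\<Sum>M\<in>?E. 1 / (norm s ^ 4 * y\<^sup>2) * (1 / ((x + of_int (\<tau> M))\<^sup>2 + y\<^sup>2)))"
        by (intro sum_mono term_le)
      also have "\<dots> = 1 / (norm s ^ 4 * y\<^sup>2) * (\<Sum>t\<in>\<tau> ` ?E. 1 / ((x + of_int t)\<^sup>2 + y\<^sup>2))"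
        by (simp only: sum.reindex[OF inj] o_def sum_distrib_left)
      also have "\<dots> \<le> 1 / (norm s ^ 4 * y\<^sup>2) * L"
        unfolding L_def using F(1) y by (intro mult_left_mono int_translate_sum_le) auto
      finally show ?thesis using M0(2) by (auto simp: s_def slope_def col_def)
    qed
    have "(\<Sum>M\<in>F. 1 / norm (lin (cnj \<zz>) M z) ^ 4) = (\<Sum>p\<in>col ` F. \<Sum>M\<in>{M\<in>F. col M = p}. 1 / norm (lin (cnj \<zz>) M z) ^ 4)"
      using F(1) by (intro sum.group[symmetric]) auto
    also have "\<dots> \<le> (\<Sum>p\<in>col ` F. (L / y\<^sup>2) * (\<lambda>(a, c). 1 / norm (of_int a - of_int c * cnj \<zz>) ^ 4) p)"
      by (intro sum_mono fib)
    also have "\<dots> = (L / y\<^sup>2) * (\<Sum>(a, c)\<in>col ` F. 1 / norm (of_int a - of_int c * cnj \<zz>) ^ 4)"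
      by (simp only: sum_distrib_left)
    also have "\<dots> \<le> (L / y\<^sup>2) * C0"
    proof (intro mult_left_mono C0)
      show "(0, 0) \<notin> col ` F" using F(2) by (force simp: col_def SL2Z_iff)
    qed (use F L y in auto)
    also have "\<dots> = (C0 * pi) * ((2 + 2 / y\<^sup>2) / y ^ 3)" using y by (simp add: L_def power3_eq_cube power2_eq_square field_simps)
    also have "\<dots> \<le> (C0 * pi + 1) * ((2 + 2 / y\<^sup>2) / y ^ 3)"
      using y by (intro mult_right_mono) auto
    finally show "(\<Sum>M\<in>F. 1 / norm (lin (cnj \<zz>) M z) ^ 4) \<le> (C0 * pi + 1) * (2 + 2 / (Im z)\<^sup>2) / Im z ^ 3"
      by (simp add: y_def)
  qed
qed

text \<open>The exponents beyond 4 are absorbed by the bound \<open>\<delta> * Im z\<close> for the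
  form from below. For \<open>p = m + 2\<close> the resulting decay \<open>Im z ^ (m + 1)\<close>
  balances the growth of the terms of the Poincare series at the cusp.\<close>

lemma lin_power_sum_le:
  assumes \<zz>: "\<zz> \<in> uhp" and p: "p \<ge> 4"
  obtains K where "K > 0" "\<And>z F. z \<in> uhp \<Longrightarrow> Im z \<ge> 1 \<Longrightarrow> finite F \<Longrightarrow> F \<subseteq> SL2Z \<Longrightarrow>
    (\<Sum>M\<in>F. 1 / norm (lin (cnj \<zz>) M z) ^ p) \<le> K / Im z ^ (p - 1)"
    and "\<And>z. z \<in> uhp \<Longrightarrow> (\<lambda>M. 1 / norm (lin (cnj \<zz>) M z) ^ p) summable_on SL2Z"
proof -
  obtain C where C: "C > 0" "\<And>z F. z \<in> uhp \<Longrightarrow> finite F \<Longrightarrow> F \<subseteq> SL2Z \<Longrightarrow>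
    (\<Sum>M\<in>F. 1 / norm (lin (cnj \<zz>) M z) ^ 4) \<le> C * (2 + 2 / (Im z)\<^sup>2) / Im z ^ 3"
    using SL2Z_sum_le[OF \<zz>] by blast
  define \<delta> where "\<delta> = min 1 (Im \<zz>)"
  have \<delta>: "\<delta> > 0" using \<zz> by (simp add: \<delta>_def uhp_iff)
  have le: "(\<Sum>M\<in>F. 1 / norm (lin (cnj \<zz>) M z) ^ p) \<le> 1 / (\<delta> * Im z) ^ (p - 4) * (C * (2 + 2 / (Im z)\<^sup>2) / Im z ^ 3)"
    if z: "z \<in> uhp" and F: "finite F" "F \<subseteq> SL2Z" for z F
  proof -
    have y: "Im z > 0" using z by (simp add: uhp_iff)
    have "1 / norm (lin (cnj \<zz>) M z) ^ p \<le> 1 / (\<delta> * Im z) ^ (p - 4) * (1 / norm (lin (cnj \<zz>) M z) ^ 4)" if "M \<in> F" for M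
    proof -
      have l: "norm (lin (cnj \<zz>) M z) \<ge> \<delta> * Im z"
        using norm_lin_ge[of M \<zz> z] that F(2) \<zz> z by (auto simp: \<delta>_def)
      have l0: "norm (lin (cnj \<zz>) M z) > 0" using lin_cnj_nonzero[of M \<zz> z] that F(2) \<zz> z by auto
      have "norm (lin (cnj \<zz>) M z) ^ p = norm (lin (cnj \<zz>) M z) ^ (p - 4) * norm (lin (cnj \<zz>) M z) ^ 4"
        using p by (simp flip: power_add)
      moreover have "norm (lin (cnj \<zz>) M z) ^ (p - 4) * norm (lin (cnj \<zz>) M z) ^ 4 \<ge> (\<delta> * Im z) ^ (p - 4) * norm (lin (cnj \<zz>) M z) ^ 4"
        using l \<delta> y by (intro mult_right_mono power_mono) auto
      ultimately have "1 / norm (lin (cnj \<zz>) M z) ^ p \<le> 1 / ((\<delta> * Im z) ^ (p - 4) * norm (lin (cnj \<zz>) M z) ^ 4)"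
        using \<delta> y l0 by (intro divide_left_mono) auto
      then show ?thesis by simp
    qed
    then have "(\<Sum>M\<in>F. 1 / norm (lin (cnj \<zz>) M z) ^ p) \<le> 1 / (\<delta> * Im z) ^ (p - 4) * (\<Sum>M\<in>F. 1 / norm (lin (cnj \<zz>) M z) ^ 4)"
      unfolding sum_distrib_left by (rule sum_mono)
    also have "\<dots> \<le> 1 / (\<delta> * Im z) ^ (p - 4) * (C * (2 + 2 / (Im z)\<^sup>2) / Im z ^ 3)"
      using \<delta> y C(2)[OF z F] by (intro mult_left_mono) auto
    finally show ?thesis .
  qed
  show thesis
  proof (rule that[of "4 * C / \<delta> ^ (p - 4)"])
    show "4 * C / \<delta> ^ (p - 4) > 0" using C \<delta> by simp
    show "(\<lambda>M. 1 / norm (lin (cnj \<zz>) M z) ^ p) summable_on SL2Z" if "z \<in> uhp" for z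
      using le[OF that] by (intro nonneg_bdd_above_summable_on bdd_aboveI2) auto
    fix z F assume z: "z \<in> uhp" "Im z \<ge> 1" and F: "finite F" "F \<subseteq> SL2Z"
    have "1 / (Im z)\<^sup>2 \<le> 1" using z by simp
    then have "2 + 2 / (Im z)\<^sup>2 \<le> 4" by simp
    then have "1 / (\<delta> * Im z) ^ (p - 4) * (C * (2 + 2 / (Im z)\<^sup>2) / Im z ^ 3) \<le> 1 / (\<delta> * Im z) ^ (p - 4) * (C * 4 / Im z ^ 3)"
      using \<delta> C z by (intro mult_left_mono divide_right_mono) auto
    also have "\<dots> = 4 * C / \<delta> ^ (p - 4) / (Im z ^ (p - 4) * Im z ^ 3)"
      by (simp add: power_mult_distrib mult_ac)
    also have "Im z ^ (p - 4) * Im z ^ 3 = Im z ^ (p - 1)" using p by (simp flip: power_add)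
    finally show "(\<Sum>M\<in>F. 1 / norm (lin (cnj \<zz>) M z) ^ p) \<le> 4 * C / \<delta> ^ (p - 4) / Im z ^ (p - 1)"
      using le[OF z(1) F] by simp
  qed
qed

text \<open>Every such matrix contributes at least \<open>1 / B ^ 4\<close> to sums with a common
  bound.\<close>

lemma finite_lin_le:
  assumes "\<zz> \<in> uhp" "z \<in> uhp" shows "finite {M \<in> SL2Z. norm (lin (cnj \<zz>) M z) \<le> B}"
proof (rule ccontr)
  assume inf: "infinite {M \<in> SL2Z. norm (lin (cnj \<zz>) M z) \<le> B}"
  obtain C where C: "\<And>F. finite F \<Longrightarrow> F \<subseteq> SL2Z \<Longrightarrow> (\<Sum>M\<in>F. 1 / norm (lin (cnj \<zz>) M z) ^ 4) \<le> C"
    using SL2Z_sum_le[OF assms(1)] assms(2) by metis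
  obtain n where n: "real n > C * B ^ 4" using reals_Archimedean2 by blast
  obtain F where F: "finite F" "card F = n" "F \<subseteq> {M \<in> SL2Z. norm (lin (cnj \<zz>) M z) \<le> B}"
    using infinite_arbitrarily_large[OF inf] by blast
  have "real n * (1 / B ^ 4) = (\<Sum>M\<in>F. 1 / B ^ 4)" using F by simp
  also have "\<dots> \<le> (\<Sum>M\<in>F. 1 / norm (lin (cnj \<zz>) M z) ^ 4)"
  proof (rule sum_mono)
    fix M assume M: "M \<in> F"
    then have p: "norm (lin (cnj \<zz>) M z) > 0" "norm (lin (cnj \<zz>) M z) \<le> B"
      using F lin_cnj_nonzero[of M \<zz> z] assms by auto
    then have "B > 0" by linarith
    with p show "1 / B ^ 4 \<le> 1 / norm (lin (cnj \<zz>) M z) ^ 4"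
      by (intro divide_left_mono power_mono mult_pos_pos zero_less_power) auto
  qed
  also have "\<dots> \<le> C" using C F by auto
  finally have 1: "real n * (1 / B ^ 4) \<le> C" .
  obtain M where M: "M \<in> {M \<in> SL2Z. norm (lin (cnj \<zz>) M z) \<le> B}" using infinite_imp_nonempty[OF inf] by blast
  then have "norm (lin (cnj \<zz>) M z) > 0" "norm (lin (cnj \<zz>) M z) \<le> B"
    using lin_cnj_nonzero[of M \<zz> z] assms by auto
  then have "B > 0" by linarith
  then show False using 1 n by (simp add: field_simps)
qed

text \<open>The matrices whose term in the Poincare series may be singular near \<open>z0\<close>.\<close>

definition near_set :: "complex \<Rightarrow> complex \<Rightarrow> (int^2^2) set" where
  "near_set \<zz> z0 = {M \<in> SL2Z. \<exists>z\<in>ball z0 (Im z0 / 2). norm (lin \<zz> M z) < norm (lin (cnj \<zz>) M z) / 2}"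

lemma half_ball_uhp: "z0 \<in> uhp \<Longrightarrow> z \<in> ball z0 (Im z0 / 2) \<Longrightarrow> Im z \<ge> Im z0 / 2 \<and> Im z \<le> 3 * Im z0 / 2 \<and> z \<in> uhp"
  using abs_Im_le_cmod[of "z0 - z"] by (auto simp: uhp_iff dist_norm)

lemma near_set_subset: "near_set \<zz> z0 \<subseteq> SL2Z" by (auto simp: near_set_def)

lemma finite_near_set:
  assumes "\<zz> \<in> uhp" "z0 \<in> uhp" shows "finite (near_set \<zz> z0)"
proof (rule finite_subset)
  \<comment> \<open>At a point of the ball where the form for \<open>\<zz>\<close> is smaller than
    half of the other form \<open>l\<close>, the identity for the difference of squares gives
    \<open>norm l ^ 2 \<le> 8 * Im \<zz> * Im z0\<close>; passing to the centre doubles the bound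
    for \<open>norm l\<close>.\<close>
  define B where "B = 2 * sqrt (8 * Im \<zz> * Im z0)"
  show "finite {M \<in> SL2Z. norm (lin (cnj \<zz>) M z0) \<le> B}" by (rule finite_lin_le[OF assms])
  show "near_set \<zz> z0 \<subseteq> {M \<in> SL2Z. norm (lin (cnj \<zz>) M z0) \<le> B}"
  proof
    fix M assume "M \<in> near_set \<zz> z0"
    then obtain z where M: "M \<in> SL2Z" and z: "z \<in> ball z0 (Im z0 / 2)" and lt: "norm (lin \<zz> M z) < norm (lin (cnj \<zz>) M z) / 2"
      by (auto simp: near_set_def)
    have "(norm (lin \<zz> M z))\<^sup>2 \<le> (norm (lin (cnj \<zz>) M z) / 2)\<^sup>2" using lt by (intro power_mono) auto
    then have "(norm (lin (cnj \<zz>) M z))\<^sup>2 * (3/4) \<le> 4 * Im \<zz> * Im z"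
      using norm_lin_cnj_minus[OF M, of \<zz> z] by (simp add: power_divide)
    also have "\<dots> \<le> 4 * Im \<zz> * (3 * Im z0 / 2)"
      using half_ball_uhp[OF assms(2) z] assms(1) by (intro mult_left_mono) (auto simp: uhp_iff)
    finally have "(norm (lin (cnj \<zz>) M z))\<^sup>2 \<le> 8 * Im \<zz> * Im z0" by simp
    then have "norm (lin (cnj \<zz>) M z) \<le> sqrt (8 * Im \<zz> * Im z0)" by (rule real_le_rsqrt)
    moreover have "norm (lin (cnj \<zz>) M z) \<ge> norm (lin (cnj \<zz>) M z0) / 2"
      using norm_lin_ball(1)[OF M assms] z by simp
    ultimately show "M \<in> {M \<in> SL2Z. norm (lin (cnj \<zz>) M z0) \<le> B}" using M by (simp add: B_def)
  qed
qed

lemma modular_orbit_iff: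
  assumes "\<zz> \<in> uhp" "z \<in> uhp"
  shows "z \<in> modular_orbit \<zz> \<longleftrightarrow> (\<exists>M\<in>SL2Z. moebius M z = \<zz>)"
    and "z \<in> modular_orbit \<zz> \<longleftrightarrow> (\<exists>M\<in>SL2Z. lin \<zz> M z = 0)"
proof -
  show 1: "z \<in> modular_orbit \<zz> \<longleftrightarrow> (\<exists>M\<in>SL2Z. moebius M z = \<zz>)"
  proof
    assume "z \<in> modular_orbit \<zz>"
    then obtain M where "M \<in> SL2Z" "z = moebius M \<zz>" unfolding modular_orbit_def by blast
    then show "\<exists>M\<in>SL2Z. moebius M z = \<zz>"
      using moebius_minv(1)[OF _ assms(1)] minv_SL2Z by blast
  next
    assume "\<exists>M\<in>SL2Z. moebius M z = \<zz>"
    then obtain M where "M \<in> SL2Z" "moebius M z = \<zz>" by blast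
    then have "minv M \<in> SL2Z" "z = moebius (minv M) \<zz>"
      using moebius_minv(1)[OF _ assms(2)] minv_SL2Z by auto
    then show "z \<in> modular_orbit \<zz>" unfolding modular_orbit_def by blast
  qed
  show "z \<in> modular_orbit \<zz> \<longleftrightarrow> (\<exists>M\<in>SL2Z. lin \<zz> M z = 0)"
    unfolding 1 using lin_eq[OF _ assms(2)] aut_nonzero[OF _ assms(2)] by (metis eq_iff_diff_eq_0 mult_eq_0_iff)
qed

lemma finite_modular_orbit_ball:
  assumes "\<zz> \<in> uhp" "z0 \<in> uhp" shows "finite (modular_orbit \<zz> \<inter> ball z0 (Im z0 / 2))"
proof (rule finite_subset)
  show "finite ((\<lambda>M. moebius (minv M) \<zz>) ` near_set \<zz> z0)" using finite_near_set[OF assms] by simp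
  show "modular_orbit \<zz> \<inter> ball z0 (Im z0 / 2) \<subseteq> (\<lambda>M. moebius (minv M) \<zz>) ` near_set \<zz> z0"
  proof
    fix z assume z: "z \<in> modular_orbit \<zz> \<inter> ball z0 (Im z0 / 2)"
    then have zu: "z \<in> uhp" using half_ball_uhp assms by blast
    obtain M where M: "M \<in> SL2Z" "moebius M z = \<zz>" using modular_orbit_iff(1)[OF assms(1) zu] z by blast
    then have "lin \<zz> M z = 0" using lin_eq[OF M(1) zu] by simp
    then have "M \<in> near_set \<zz> z0"
      using M(1) z lin_cnj_nonzero[OF M(1) assms(1) zu] unfolding near_set_def
      by (intro CollectI conjI bexI[of _ z]) auto
    moreover have "z = moebius (minv M) \<zz>" using moebius_minv(1)[OF M(1) zu] M(2) by simp
    ultimately show "z \<in> (\<lambda>M. moebius (minv M) \<zz>) ` near_set \<zz> z0" by blast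
  qed
qed

lemma eventually_not_finite: "finite S \<Longrightarrow> eventually (\<lambda>z. z \<notin> S) (at (z0 :: complex))"
  using islimpt_finite islimpt_iff_eventually by blast

lemma eventually_not_orbit:
  assumes "\<zz> \<in> uhp" "z0 \<in> uhp" shows "eventually (\<lambda>z. z \<notin> modular_orbit \<zz>) (at z0)"
proof -
  have "Im z0 / 2 > 0" using assms by (simp add: uhp_iff)
  then have "eventually (\<lambda>z. z \<in> ball z0 (Im z0 / 2)) (at z0)"
    by (intro eventually_at_in_open') auto
  with eventually_not_finite[OF finite_modular_orbit_ball[OF assms], of z0] show ?thesis
    by eventually_elim blast
qed

lemma open_uhp_minus_orbit:
  assumes "\<zz> \<in> uhp" shows "open (uhp - modular_orbit \<zz>)"
proof -
  have "\<exists>e>0. ball z e \<subseteq> uhp - modular_orbit \<zz>" if z: "z \<in> uhp - modular_orbit \<zz>" for z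
  proof -
    have "eventually (\<lambda>w. w \<notin> modular_orbit \<zz>) (nhds z)"
      using eventually_not_orbit[OF assms, of z] z by (simp add: eventually_nhds_conv_at)
    moreover have "eventually (\<lambda>w. w \<in> uhp) (nhds z)"
      using z open_uhp by (intro eventually_nhds_in_open) auto
    ultimately have "eventually (\<lambda>w. w \<in> uhp - modular_orbit \<zz>) (nhds z)" by eventually_elim blast
    then show ?thesis by (auto simp: eventually_nhds_metric subset_iff dist_commute)
  qed
  then show ?thesis by (simp add: open_contains_ball)
qed

text \<open>The imaginary part is maximized over the orbit, where only the finitely many values with
  \<open>norm (aut M z) \<le> 1\<close> compete. After a translation the inversion cannot increase
  it, so \<open>norm w \<ge> 1\<close>; together with \<open>\<bar>Re w\<bar> \<le> 1 / 2\<close>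
  this gives more than the rough bound \<open>1 / 2\<close>.\<close>

lemma reduction:
  assumes z: "z \<in> uhp"
  obtains M where "M \<in> SL2Z" "\<bar>Re (moebius M z)\<bar> \<le> 1 / 2" "Im (moebius M z) \<ge> 1 / 2"
proof -
  have y: "Im z > 0" using z by (simp add: uhp_iff)
  let ?V = "(\<lambda>M. Im (moebius M z)) ` {M \<in> SL2Z. norm (aut M z) \<le> 1}"
  have "finite ?V"
  proof (rule finite_subset)
    define A where "A = \<lceil>1 / Im z\<rceil>"
    define B where "B = \<lceil>1 + real_of_int A * norm z\<rceil>"
    let ?U = "(\<lambda>(c, d). Im z / (norm (of_int c * z + of_int d))\<^sup>2) ` ({-A..A} \<times> {-B..B})"
    show "finite ?U" by simp
    show "?V \<subseteq> ?U"
    proof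
      fix v assume "v \<in> ?V"
      then obtain M where M: "M \<in> SL2Z" "norm (aut M z) \<le> 1" "v = Im (moebius M z)" by auto
      define c d where "c = M$2$1" and "d = M$2$2"
      have "\<bar>real_of_int c\<bar> * Im z = \<bar>Im (aut M z)\<bar>" using y by (simp add: aut_def c_def abs_mult)
      also have "\<dots> \<le> 1" using abs_Im_le_cmod[of "aut M z"] M(2) by linarith
      finally have c1: "\<bar>real_of_int c\<bar> \<le> 1 / Im z" using y by (simp add: field_simps)
      then have cA: "\<bar>real_of_int c\<bar> \<le> real_of_int A" unfolding A_def by linarith
      have "norm (complex_of_int d) \<le> norm (aut M z) + norm (of_int c * z)"
        using norm_triangle_ineq4[of "aut M z" "of_int c * z"] by (simp add: aut_def c_def d_def)
      also have "\<dots> \<le> 1 + real_of_int A * norm z"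
        using M(2) cA by (intro add_mono) (auto simp: norm_mult intro!: mult_right_mono)
      finally have "\<bar>real_of_int d\<bar> \<le> real_of_int B" unfolding B_def by simp linarith
      then have "(c, d) \<in> {-A..A} \<times> {-B..B}" using cA by auto
      moreover have "v = (\<lambda>(c, d). Im z / (norm (of_int c * z + of_int d))\<^sup>2) (c, d)"
        using Im_moebius[OF M(1) z] M(3) by (simp add: aut_def c_def d_def)
      ultimately show "v \<in> ?U" by blast
    qed
  qed
  moreover have "Im z \<in> ?V" using SL2Z_one by (force intro!: image_eqI[of _ _ "mat 1"])
  ultimately obtain v where v: "v \<in> ?V" "\<And>u. u \<in> ?V \<Longrightarrow> u \<le> v"
    using Max_in[of ?V] Max_ge[of ?V] that by blast
  then obtain N where N: "N \<in> SL2Z" "v = Im (moebius N z)" by auto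
  have max: "Im (moebius M z) \<le> v" if "M \<in> SL2Z" for M
  proof (cases "norm (aut M z) \<le> 1")
    case True
    then show ?thesis using v(2) that by blast
  next
    case False
    then have "Im (moebius M z) \<le> Im z"
    proof -
      have "(norm (aut M z))\<^sup>2 \<ge> 1\<^sup>2" using False by (intro power_mono) auto
      then show ?thesis unfolding Im_moebius[OF that z] using y
        by (simp add: divide_le_eq mult_le_cancel_left1)
    qed
    then show ?thesis using v(2) \<open>Im z \<in> ?V\<close> by force
  qed
  define r where "r = round (Re (moebius N z))"
  define T where "T = mat2 1 (- r) 0 1"
  define S where "S = mat2 0 (- 1) 1 0"
  have TS: "T \<in> SL2Z" "S \<in> SL2Z" by (simp_all add: T_def S_def SL2Z_iff)
  define w where "w = moebius (T ** N) z"
  have wu: "w \<in> uhp" unfolding w_def using moebius_uhp SL2Z_mult TS N z by blast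
  have w: "w = moebius N z - of_int r"
    unfolding w_def moebius_mult[OF TS(1) N(1) z] by (simp add: T_def moebius_def)
  have re: "\<bar>Re w\<bar> \<le> 1 / 2"
    using of_int_round_abs_le[of "Re (moebius N z)"] by (simp add: w r_def abs_minus_commute)
  have imw: "Im w = v" by (simp add: w N)
  have "moebius S w = moebius (S ** (T ** N)) z" unfolding w_def using moebius_mult TS SL2Z_mult N z by metis
  then have "Im (moebius S w) \<le> v" using max TS SL2Z_mult N by metis
  moreover have "Im (moebius S w) = Im w / (norm w)\<^sup>2"
    unfolding Im_moebius[OF TS(2) wu] by (simp add: S_def aut_def)
  ultimately have "Im w / (norm w)\<^sup>2 \<le> Im w" using imw by simp
  moreover have "Im w > 0" "norm w > 0" using wu by (auto simp: uhp_iff)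
  ultimately have "(norm w)\<^sup>2 \<ge> 1" by (simp add: field_simps)
  then have "(Re w)\<^sup>2 + (Im w)\<^sup>2 \<ge> 1" by (simp add: cmod_power2)
  moreover have "(Re w)\<^sup>2 \<le> (1 / 2)\<^sup>2" using re by (metis abs_ge_zero power2_abs power_mono)
  ultimately have "(Im w)\<^sup>2 \<ge> (1 / 2)\<^sup>2" by (simp add: power2_eq_square)
  then have "Im w \<ge> 1 / 2" using \<open>Im w > 0\<close> by (meson less_eq_real_def power2_le_imp_le)
  with re show thesis using that[OF SL2Z_mult[OF TS(1) N(1)]] by (simp add: w_def)
qed

section \<open>The terms of the Poincare series\<close>

definition altbin :: "nat \<Rightarrow> nat \<Rightarrow> real" where
  "altbin m i = real (m choose i) * (-1) ^ i"

lemma altbin_sum: "(\<Sum>i\<le>m. of_real (altbin m i) * x ^ i) = (1 - x) ^ m" for x :: "'a :: {real_field}"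
proof -
  have "(1 - x) ^ m = (- x + 1) ^ m" by simp
  also have "\<dots> = (\<Sum>i\<le>m. of_real (altbin m i) * x ^ i)"
    unfolding binomial_ring
    by (intro sum.cong) (simp_all add: altbin_def power_minus[of x])
  finally show ?thesis by simp
qed

lemma altbin_sum_real: "(\<Sum>i\<le>m. altbin m i * x ^ i) = (1 - x) ^ m"
  using altbin_sum[where 'a = real, of m x] by simp

text \<open>\<open>tau e s\<close> is the integral of \<open>t powi (e - 1)\<close> from \<open>s\<close> to \<open>1\<close>.\<close>

definition tau :: "int \<Rightarrow> real \<Rightarrow> real" where
  "tau e s = (if e = 0 then - ln s else (1 - s powi e) / of_int e)"

lemma tau_deriv:
  assumes "s > 0" shows "(tau e has_field_derivative - (s powi (e - 1))) (at s)"
proof (cases "e = 0")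
  case True
  then have "tau e = (\<lambda>s. - ln s)" by (simp add: tau_def fun_eq_iff)
  moreover have "s powi (e - 1) = 1 / s" using True by (simp add: power_int_minus_divide)
  ultimately show ?thesis using assms by (auto intro!: derivative_eq_intros)
next
  case False
  then have "tau e = (\<lambda>s. (1 - s powi e) / of_int e)" by (simp add: tau_def fun_eq_iff)
  moreover have "((\<lambda>s. (1 - s powi e) / of_int e) has_field_derivative (0 - of_int e * s powi (e - 1) * 1) / of_int e) (at s)"
    using assms by (auto intro!: derivative_eq_intros)
  ultimately show ?thesis using False by simp
qed

text \<open>With \<open>t = 1 - (1 - t)\<close> the power \<open>t ^ m\<close> is expanded in powers
  of \<open>1 - t\<close> and integrated; \<open>tau\<close> includes the exponent -1, where the
  primitive is a logarithm.\<close>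

lemma inc_beta_has_integral:
  assumes "0 \<le> Z" "Z < 1"
  shows "((\<lambda>t. t ^ m * (1 - t) powi (- n - 1)) has_integral (\<Sum>i\<le>m. altbin m i * tau (int i - n) (1 - Z))) {0..Z}"
proof -
  define W where "W t = (\<Sum>i\<le>m. altbin m i * tau (int i - n) (1 - t))" for t
  have "((\<lambda>t. t ^ m * (1 - t) powi (- n - 1)) has_integral (W Z - W 0)) {0..Z}"
  proof (rule fundamental_theorem_of_calculus[OF assms(1)])
    fix t assume t: "t \<in> {0..Z}"
    then have p: "1 - t > 0" using assms by simp
    have "((\<lambda>t. tau (int i - n) (1 - t)) has_field_derivative (- ((1 - t) powi (int i - n - 1)) * (-1))) (at t)" for i
      by (rule DERIV_chain2[where f = "tau (int i - n)" and g = "\<lambda>t. 1 - t", OF tau_deriv[OF p]])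
        (auto intro!: derivative_eq_intros)
    then have "(W has_field_derivative (\<Sum>i\<le>m. altbin m i * (- ((1 - t) powi (int i - n - 1)) * (-1)))) (at t)"
      unfolding W_def by (intro DERIV_sum DERIV_cmult)
    also have "(\<Sum>i\<le>m. altbin m i * (- ((1 - t) powi (int i - n - 1)) * (-1))) = t ^ m * (1 - t) powi (- n - 1)"
    proof -
      have "(1 - t) powi (int i - n - 1) = (1 - t) ^ i * (1 - t) powi (- n - 1)" for i
      proof -
        have "int i - n - 1 = int i + (- n - 1)" by simp
        then have "(1 - t) powi (int i - n - 1) = (1 - t) powi (int i) * (1 - t) powi (- n - 1)"
          using p by (metis power_int_add less_irrefl)
        then show ?thesis by simp
      qed
      then have "(\<Sum>i\<le>m. altbin m i * (- ((1 - t) powi (int i - n - 1)) * (-1))) = (\<Sum>i\<le>m. altbin m i * (1 - t) ^ i) * (1 - t) powi (- n - 1)"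
        by (simp add: sum_distrib_right mult.assoc)
      then show ?thesis by (simp add: altbin_sum_real)
    qed
    finally show "(W has_vector_derivative t ^ m * (1 - t) powi (- n - 1)) (at t within {0..Z})"
      using has_real_derivative_iff_has_vector_derivative has_vector_derivative_at_within by blast
  qed
  moreover have "tau e 1 = 0" for e by (simp add: tau_def)
  then have "W 0 = 0" by (simp add: W_def)
  ultimately show ?thesis by (simp add: W_def)
qed

lemma inc_beta_closed:
  assumes "0 < s" "s \<le> 1"
  shows "inc_beta (1 - s) (m + 1) (- n) = (\<Sum>i\<le>m. altbin m i * tau (int i - n) s)"
  unfolding inc_beta_def using integral_unique[OF inc_beta_has_integral[of "1 - s" m n]] assms by simp

text \<open>For \<open>Z \<le> 3/4\<close> the base \<open>1 - t\<close> stays above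
  \<open>1/4\<close>, whence the constant 4. The factor \<open>Z ^ (m + 1)\<close> is what makes the
  Poincare series converge.\<close>

lemma abs_inc_beta_le:
  assumes "0 \<le> Z" "Z \<le> 3/4"
  shows "\<bar>inc_beta Z (m + 1) (- n)\<bar> \<le> 4 ^ nat \<bar>- n - 1\<bar> * Z ^ (m + 1)"
proof -
  have "norm (inc_beta Z (m + 1) (- n)) \<le> (4 ^ nat \<bar>- n - 1\<bar> * Z ^ m) * measure lborel (cbox 0 Z)"
  proof (rule has_integral_bound)
    show "((\<lambda>t. t ^ m * (1 - t) powi (- n - 1)) has_integral inc_beta Z (m + 1) (- n)) (cbox 0 Z)"
      using integrable_integral[OF has_integral_integrable[OF inc_beta_has_integral[of Z m n]]] assms
      by (simp add: inc_beta_def)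
    fix t assume t: "t \<in> cbox 0 Z"
    have "(1 - t) powi (- n - 1) \<le> 4 ^ nat \<bar>- n - 1\<bar>"
    proof (cases "- n - 1 \<ge> 0")
      case True
      then have "(1 - t) powi (- n - 1) \<le> 1" using t assms by (intro power_int_le_one) auto
      also have "\<dots> \<le> 4 ^ nat \<bar>- n - 1\<bar>" by simp
      finally show ?thesis .
    next
      case False
      then have "(1 - t) powi (- n - 1) = inverse (1 - t) ^ nat \<bar>- n - 1\<bar>"
        by (simp add: power_int_def power_inverse)
      also have "inverse (1 - t) \<le> inverse (1/4)" using t assms by (intro le_imp_inverse_le) auto
      then have "inverse (1 - t) ^ nat \<bar>- n - 1\<bar> \<le> 4 ^ nat \<bar>- n - 1\<bar>" using t assms by (intro power_mono) auto
      finally show ?thesis .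
    qed
    moreover have "t ^ m \<le> Z ^ m" using t by (intro power_mono) auto
    moreover have "(1 - t) powi (- n - 1) \<ge> 0" using t assms by (intro zero_le_power_int) auto
    ultimately show "norm (t ^ m * (1 - t) powi (- n - 1)) \<le> 4 ^ nat \<bar>- n - 1\<bar> * Z ^ m"
      using t by (auto simp: abs_mult mult.commute[of "4 ^ _"] intro!: mult_mono)
  qed (use assms in auto)
  then show ?thesis using assms by (simp add: mult_ac)
qed

lemma beta_const_eq: "beta_const (m + 1) (- n) = (\<Sum>i\<in>{i. i \<le> m \<and> int i \<noteq> n}. altbin m i / of_int (int i - n))"
  unfolding beta_const_def altbin_def by simp

text \<open>For \<open>n < 0\<close> the constant is the complete beta integral over
  \<open>{0..1}\<close>. Its positivity matters because the decomposition at a pole divides by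
  it.\<close>

lemma beta_const_pos:
  assumes "n < 0" shows "beta_const (m + 1) (- n) > 0"
proof -
  define W where "W t = (\<Sum>i\<le>m. altbin m i * ((1 - (1 - t) ^ nat (int i - n)) / of_int (int i - n)))" for t :: real
  have e: "nat (int i - n) = Suc (i + nat (- n - 1))" for i using assms by simp
  have der: "(W has_field_derivative t ^ m * (1 - t) ^ nat (- n - 1)) (at t)" for t
  proof -
    have "((\<lambda>t. (1 - (1 - t) ^ nat (int i - n)) / of_int (int i - n)) has_field_derivative (1 - t) ^ (i + nat (- n - 1))) (at t)" for i
    proof -
      have r: "real_of_int (int i - n) = real (Suc (i + nat (- n - 1)))" using assms by simp
      have "((\<lambda>t. (1 - (1 - t) ^ Suc (i + nat (- n - 1))) / real (Suc (i + nat (- n - 1)))) has_field_derivative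
          (0 - real (Suc (i + nat (- n - 1))) * (1 - t) ^ (Suc (i + nat (- n - 1)) - 1) * (0 - 1)) / real (Suc (i + nat (- n - 1)))) (at t)"
        by (rule derivative_eq_intros refl | simp)+
      then show ?thesis unfolding e r by simp
    qed
    then have "(W has_field_derivative (\<Sum>i\<le>m. altbin m i * (1 - t) ^ (i + nat (- n - 1)))) (at t)"
      unfolding W_def by (intro DERIV_sum DERIV_cmult)
    also have "(\<Sum>i\<le>m. altbin m i * (1 - t) ^ (i + nat (- n - 1))) = (\<Sum>i\<le>m. altbin m i * (1 - t) ^ i) * (1 - t) ^ nat (- n - 1)"
      by (simp add: power_add sum_distrib_right mult.assoc)
    also have "\<dots> = t ^ m * (1 - t) ^ nat (- n - 1)" by (simp add: altbin_sum_real)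
    finally show ?thesis .
  qed
  obtain u where u: "0 < u" "u < 1" "W 1 - W 0 = (1 - 0) * (u ^ m * (1 - u) ^ nat (- n - 1))"
    using MVT2[of 0 1 W "\<lambda>t. t ^ m * (1 - t) ^ nat (- n - 1)"] der by auto
  have "W 0 = 0" by (simp add: W_def)
  moreover have "W 1 = beta_const (m + 1) (- n)"
  proof -
    have "{i. i \<le> m \<and> int i \<noteq> n} = {..m}" using assms by auto
    then show ?thesis unfolding beta_const_eq W_def e by simp
  qed
  ultimately show ?thesis using u by simp
qed

text \<open>For linear forms \<open>l\<close>, \<open>u\<close> in \<open>z\<close> the function \<open>ephi m n l u\<close> is expanded in \<open>l ^ (m - i) * u ^ i\<close> with coefficients \<open>Tt\<close>, whose Wirtinger derivatives
  are a holomorphic and an antiholomorphic monomial.\<close>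

definition ephi :: "nat \<Rightarrow> int \<Rightarrow> complex \<Rightarrow> complex \<Rightarrow> complex" where
  "ephi m n l u = l ^ m * of_real (inc_beta (1 - (norm (u / l))\<^sup>2) (m + 1) (- n)) * (u / l) powi n"

definition Tt :: "int \<Rightarrow> complex \<Rightarrow> complex" where
  "Tt e X = X powi (- e) * of_real (tau e ((norm X)\<^sup>2))"

text \<open>For \<open>e \<noteq> 0\<close> the function is
  \<open>(X powi (- e) - cnj X powi e) / e\<close>, already split into a holomorphic and a
  conjugate-holomorphic part; \<open>e = 0\<close> is the limiting case
  \<open>- ln (norm X ^ 2)\<close>.\<close>

lemma has_wirtinger_Tt:
  assumes "X \<noteq> 0"
  shows "has_wirtinger (Tt e) (- (X powi (- e - 1))) (- (cnj X powi (e - 1))) X"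
proof (cases "e = 0")
  case True
  have "has_wirtinger (\<lambda>X. X * cnj X) (X * 0 + 1 * cnj X) (X * cnj 1 + 0 * cnj X) X"
    using has_wirtinger_mult[OF has_wirtinger_holo[OF DERIV_ident] has_wirtinger_cnj[OF has_wirtinger_holo[OF DERIV_ident]]]
    by simp
  then have "has_wirtinger (\<lambda>X. of_real ((norm X)\<^sup>2)) (cnj X) X X"
    by (simp add: complex_norm_square[symmetric])
  moreover have "((\<lambda>s. - ln s) has_field_derivative - (1 / (norm X)\<^sup>2)) (at ((norm X)\<^sup>2))"
    using assms by (auto intro!: derivative_eq_intros)
  ultimately have "has_wirtinger (\<lambda>X. of_real (- ln ((norm X)\<^sup>2))) (of_real (- (1 / (norm X)\<^sup>2)) * cnj X) (of_real (- (1 / (norm X)\<^sup>2)) * X) X"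
    by (rule has_wirtinger_of_real)
  moreover have "of_real (- (1 / (norm X)\<^sup>2)) * cnj X = - (X powi (- e - 1))" "of_real (- (1 / (norm X)\<^sup>2)) * X = - (cnj X powi (e - 1))"
    using assms True by (simp_all add: complex_norm_square power_int_minus_divide field_simps del: of_real_power)
  moreover have "Tt e = (\<lambda>X. of_real (- ln ((norm X)\<^sup>2)))" using True by (simp add: Tt_def tau_def fun_eq_iff)
  ultimately show ?thesis by simp
next
  case False
  have d1: "((\<lambda>X. X powi (- e)) has_field_derivative of_int (- e) * X powi (- e - 1)) (at X)"
    using assms by (auto intro!: derivative_eq_intros)
  have d2: "((\<lambda>X. X powi e) has_field_derivative of_int e * X powi (e - 1)) (at X)"
    using assms by (auto intro!: derivative_eq_intros)
  have "has_wirtinger (\<lambda>X. 1 / of_int e * (X powi (- e) - cnj (X powi e)))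
     (1 / of_int e * (of_int (- e) * X powi (- e - 1) - cnj 0)) (1 / of_int e * (0 - cnj (of_int e * X powi (e - 1)))) X"
    by (intro has_wirtinger_cmult has_wirtinger_diff has_wirtinger_cnj has_wirtinger_holo d1 d2)
  then have "has_wirtinger (\<lambda>X. 1 / of_int e * (X powi (- e) - cnj (X powi e))) (- (X powi (- e - 1))) (- (cnj X powi (e - 1))) X"
    using False by simp
  then show ?thesis
  proof (rule has_wirtinger_cong_open[where S = "- {0}"])
    fix w :: complex assume w: "w \<in> - {0}"
    have "complex_of_real ((norm w)\<^sup>2 powi e) = w powi e * cnj w powi e"
      by (simp add: complex_norm_square power_int_mult_distrib del: of_real_power)
    then have "complex_of_real (tau e ((norm w)\<^sup>2)) = (1 - w powi e * cnj w powi e) / of_int e"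
      using False by (simp add: tau_def)
    moreover have "w powi (- e) * w powi e = 1" using w by (simp add: power_int_minus)
    ultimately show "1 / of_int e * (w powi (- e) - cnj (w powi e)) = Tt e w"
      by (simp add: Tt_def diff_divide_distrib right_diff_distrib mult.assoc[symmetric])
  qed (use assms in auto)
qed

text \<open>The power \<open>X ^ i\<close> of \<open>X = u / l\<close> is split off from
  \<open>X powi n\<close> and combined with \<open>l ^ m\<close> into a polynomial in the forms; the
  remaining power of \<open>X\<close> is the one in \<open>Tt\<close>. The closed form of the beta
  function requires \<open>norm X \<le> 1\<close>.\<close>

lemma ephi_eq_sum:
  assumes "l \<noteq> 0" "u \<noteq> 0" "norm u \<le> norm l"
  shows "ephi m n l u = (\<Sum>i\<le>m. of_real (altbin m i) * (l ^ (m - i) * u ^ i) * Tt (int i - n) (u / l))"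
proof -
  let ?X = "u / l"
  have X: "?X \<noteq> 0" "norm ?X \<le> 1" using assms by (auto simp: norm_divide divide_simps)
  then have "0 < (norm ?X)\<^sup>2" "(norm ?X)\<^sup>2 \<le> 1" by (auto simp: power_le_one)
  then have "inc_beta (1 - (norm ?X)\<^sup>2) (m + 1) (- n) = (\<Sum>i\<le>m. altbin m i * tau (int i - n) ((norm ?X)\<^sup>2))"
    by (rule inc_beta_closed)
  then have "ephi m n l u = (\<Sum>i\<le>m. of_real (altbin m i) * of_real (tau (int i - n) ((norm ?X)\<^sup>2)) * (l ^ m * ?X powi n))"
    unfolding ephi_def by (simp add: sum_distrib_left sum_distrib_right mult_ac)
  also have "\<dots> = (\<Sum>i\<le>m. of_real (altbin m i) * (l ^ (m - i) * u ^ i) * Tt (int i - n) ?X)"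
  proof (rule sum.cong[OF refl])
    fix i assume i: "i \<in> {..m}"
    have "?X powi n = ?X powi (int i + - (int i - n))" by simp
    also have "\<dots> = ?X ^ i * ?X powi (- (int i - n))" by (subst power_int_add) (use X in auto)
    finally have "?X powi n = ?X ^ i * ?X powi (- (int i - n))" .
    moreover have "l ^ m * ?X ^ i = l ^ (m - i) * u ^ i"
      using i assms by (simp add: power_divide power_diff)
    ultimately have "l ^ m * ?X powi n = (l ^ (m - i) * u ^ i) * ?X powi (- (int i - n))" by (simp flip: mult.assoc)
    then show "of_real (altbin m i) * of_real (tau (int i - n) ((norm ?X)\<^sup>2)) * (l ^ m * ?X powi n) =
        of_real (altbin m i) * (l ^ (m - i) * u ^ i) * Tt (int i - n) ?X"
      by (simp add: Tt_def mult_ac)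
  qed
  finally show ?thesis .
qed

text \<open>The power rule for a polynomial that depends affinely on the parameter \<open>z\<close>,
  stated for single coefficients because these are the coefficient functions of the
  \<open>Tt\<close>.\<close>

lemma poly_pow_coeff_deriv:
  fixes A B C :: "complex poly"
  shows "((\<lambda>z. coeff ((A + smult z B) ^ a * C) i) has_field_derivative
     of_nat a * coeff ((A + smult z B) ^ (a - 1) * (B * C)) i) (at z)"
proof (induction a arbitrary: C)
  case (Suc a)
  have e: "(A + smult w B) ^ Suc a * C = (A + smult w B) ^ a * (A * C) + smult w ((A + smult w B) ^ a * (B * C))" for w
    by (simp add: algebra_simps)
  have "((\<lambda>w. coeff ((A + smult w B) ^ a * (A * C)) i + w * coeff ((A + smult w B) ^ a * (B * C)) i) has_field_derivative
      of_nat a * coeff ((A + smult z B) ^ (a - 1) * (B * (A * C))) i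
      + (z * (of_nat a * coeff ((A + smult z B) ^ (a - 1) * (B * (B * C))) i) + 1 * coeff ((A + smult z B) ^ a * (B * C)) i)) (at z)"
    by (intro DERIV_add Suc DERIV_mult' DERIV_ident)
  moreover have "of_nat a * coeff ((A + smult z B) ^ (a - 1) * (B * (A * C))) i
      + (z * (of_nat a * coeff ((A + smult z B) ^ (a - 1) * (B * (B * C))) i) + 1 * coeff ((A + smult z B) ^ a * (B * C)) i)
      = of_nat (Suc a) * coeff ((A + smult z B) ^ (Suc a - 1) * (B * C)) i"
  proof (cases a)
    case (Suc b)
    have "(A + smult z B) ^ Suc b * (B * C) = (A + smult z B) ^ b * (B * (A * C)) + smult z ((A + smult z B) ^ b * (B * (B * C)))"
      by (simp add: algebra_simps)
    then have "coeff ((A + smult z B) ^ Suc b * (B * C)) i =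
        coeff ((A + smult z B) ^ b * (B * (A * C))) i + z * coeff ((A + smult z B) ^ b * (B * (B * C))) i"
      by (metis coeff_add coeff_smult)
    then show ?thesis using Suc by (simp add: algebra_simps)
  qed simp
  ultimately show ?case by (simp only: e coeff_add coeff_smult)
qed simp

lemma poly_eq_sum_le: "degree p \<le> m \<Longrightarrow> poly p x = (\<Sum>i\<le>m. coeff p i * x ^ i)" for p :: "complex poly"
  unfolding poly_altdef by (rule sum.mono_neutral_left) (auto simp: coeff_eq_0)

text \<open>A pair of linear forms \<open>l\<close>, \<open>u\<close> with determinant \<open>e\<close>. The \<open>j\<close>-th \<open>z\<close>-derivative of \<open>ephi\<close> is, up to a
  factor, the combination of the \<open>Tt\<close> with the coefficients of \<open>(l - u s) ^ (m - j) * (\<alpha> - \<gamma> s) ^ j\<close>,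
  as \<open>l - u s\<close> vanishes at \<open>s = l / u\<close>.\<close>

locale linear_pair =
  fixes \<alpha> \<beta> \<gamma> \<delta> :: complex and m :: nat and n :: int
begin

definition l where "l z = \<alpha> * z + \<beta>"
definition u where "u z = \<gamma> * z + \<delta>"
definition e where "e = \<gamma> * \<beta> - \<alpha> * \<delta>"
definition Q where "Q j z = ([:\<beta>, - \<delta>:] + smult z [:\<alpha>, - \<gamma>:]) ^ (m - j) * [:\<alpha>, - \<gamma>:] ^ j"
definition L where "L j z = (\<Sum>i\<le>m. coeff (Q j z) i * Tt (int i - n) (u z / l z))"

lemma poly_Q: "poly (Q j z) s = (l z - u z * s) ^ (m - j) * (\<alpha> - \<gamma> * s) ^ j"
  by (simp add: Q_def l_def u_def algebra_simps)

lemma degree_Q: "j \<le> m \<Longrightarrow> degree (Q j z) \<le> m"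
proof -
  assume j: "j \<le> m"
  have "degree (Q j z) \<le> degree (([:\<beta>, - \<delta>:] + smult z [:\<alpha>, - \<gamma>:]) ^ (m - j)) + degree ([:\<alpha>, - \<gamma>:] ^ j)"
    unfolding Q_def by (rule degree_mult_le)
  also have "\<dots> \<le> 1 * (m - j) + 1 * j"
    by (intro add_mono order_trans[OF degree_power_le] mult_right_mono degree_add_le) auto
  finally show "degree (Q j z) \<le> m" using j by simp
qed

lemma X_deriv: "l z \<noteq> 0 \<Longrightarrow> ((\<lambda>z. u z / l z) has_field_derivative e / (l z)\<^sup>2) (at z)"
  unfolding l_def u_def e_def by (auto intro!: derivative_eq_intros simp: power2_eq_square algebra_simps)

text \<open>Product rule: differentiating the coefficients turns \<open>Q j\<close> into a multiple
  of \<open>Q (j + 1)\<close>, while the monomials from the \<open>Tt\<close> reassemble to values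
  of the polynomial \<open>Q j\<close> at \<open>1 / X\<close> and at \<open>cnj X\<close>.\<close>

lemma L_wirtinger:
  assumes j: "j \<le> m" and z: "l z \<noteq> 0" "u z \<noteq> 0"
  defines "X \<equiv> u z / l z"
  shows "has_wirtinger (L j) (of_nat (m - j) * L (j + 1) z - X powi (n - 1) * poly (Q j z) (1 / X) * (e / (l z)\<^sup>2))
     (- (cnj X powi (- n - 1)) * poly (Q j z) (cnj X) * cnj (e / (l z)\<^sup>2)) z"
proof -
  have X: "X \<noteq> 0" using z by (simp add: X_def)
  have T: "has_wirtinger (\<lambda>z. Tt (int i - n) (u z / l z)) (- (X powi (- (int i - n) - 1)) * (e / (l z)\<^sup>2))
      (- (cnj X powi (int i - n - 1)) * cnj (e / (l z)\<^sup>2)) z" for i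
  proof -
    have "has_wirtinger (Tt (int i - n)) (- (X powi (- (int i - n) - 1))) (- (cnj X powi (int i - n - 1))) (u z / l z)"
      using has_wirtinger_Tt[OF X] unfolding X_def .
    from has_wirtinger_chain[OF this X_deriv[OF z(1)]] show ?thesis .
  qed
  have Qd: "((\<lambda>z. coeff (Q j z) i) has_field_derivative of_nat (m - j) * coeff (Q (j + 1) z) i) (at z)" for i
    unfolding Q_def using poly_pow_coeff_deriv[of "[:\<beta>, - \<delta>:]" "[:\<alpha>, - \<gamma>:]" "m - j" "[:\<alpha>, - \<gamma>:] ^ j" i z]
    by (simp add: diff_diff_eq mult.assoc)
  have "has_wirtinger (L j)
     (\<Sum>i\<le>m. coeff (Q j z) i * (- (X powi (- (int i - n) - 1)) * (e / (l z)\<^sup>2)) + of_nat (m - j) * coeff (Q (j + 1) z) i * Tt (int i - n) X)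
     (\<Sum>i\<le>m. coeff (Q j z) i * (- (cnj X powi (int i - n - 1)) * cnj (e / (l z)\<^sup>2)) + 0 * Tt (int i - n) X) z"
    unfolding L_def[abs_def] X_def
    by (intro has_wirtinger_sum has_wirtinger_mult has_wirtinger_holo Qd T[unfolded X_def])
  moreover have "(\<Sum>i\<le>m. coeff (Q j z) i * (- (X powi (- (int i - n) - 1)) * (e / (l z)\<^sup>2)) + of_nat (m - j) * coeff (Q (j + 1) z) i * Tt (int i - n) X)
     = of_nat (m - j) * L (j + 1) z - X powi (n - 1) * poly (Q j z) (1 / X) * (e / (l z)\<^sup>2)"
  proof -
    have "X powi (- (int i - n) - 1) = X powi (n - 1) * (1 / X) ^ i" for i
    proof -
      have "- (int i - n) - 1 = (n - 1) - int i" by simp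
      then have "X powi (- (int i - n) - 1) = X powi (n - 1) / X powi (int i)"
        using power_int_diff[of X "n - 1" "int i"] X by metis
      then show ?thesis by (simp add: power_one_over)
    qed
    then show ?thesis
      unfolding poly_eq_sum_le[OF degree_Q[OF j]] L_def X_def[symmetric]
      by (simp add: sum.distrib sum_subtractf sum_distrib_left sum_distrib_right sum_negf mult_ac)
  qed
  moreover have "(\<Sum>i\<le>m. coeff (Q j z) i * (- (cnj X powi (int i - n - 1)) * cnj (e / (l z)\<^sup>2)) + 0 * Tt (int i - n) X)
     = - (cnj X powi (- n - 1)) * poly (Q j z) (cnj X) * cnj (e / (l z)\<^sup>2)"
  proof -
    have "cnj X powi (int i - n - 1) = cnj X powi (- n - 1) * cnj X ^ i" for i
    proof -
      have "int i - n - 1 = (- n - 1) + int i" by simp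
      then have "cnj X powi (int i - n - 1) = cnj X powi (- n - 1) * cnj X powi (int i)"
        using X by (metis complex_cnj_zero_iff power_int_add)
      then show ?thesis by simp
    qed
    then show ?thesis
      unfolding poly_eq_sum_le[OF degree_Q[OF j]]
      by (simp add: sum_distrib_left sum_distrib_right sum_negf mult_ac)
  qed
  ultimately show ?thesis by simp
qed

lemma L_0:
  assumes z: "l z \<noteq> 0" "u z \<noteq> 0" "norm (u z) \<le> norm (l z)"
  shows "ephi m n (l z) (u z) = L 0 z"
proof -
  have "coeff (Q 0 z) i = of_real (altbin m i) * (l z ^ (m - i) * u z ^ i)" if "i \<le> m" for i
  proof -
    have "Q 0 z = [:l z, - u z:] ^ m" by (simp add: Q_def l_def u_def algebra_simps)
    also have "\<dots> = (\<Sum>i\<le>m. monom (of_real (altbin m i) * (l z ^ (m - i) * u z ^ i)) i)"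
    proof (rule poly_eq_poly_eq_iff[THEN iffD1], rule ext)
      fix s
      have "poly ([:l z, - u z:] ^ m) s = (- (u z * s) + l z) ^ m" by (simp add: algebra_simps)
      also have "\<dots> = (\<Sum>i\<le>m. of_real (altbin m i) * (l z ^ (m - i) * u z ^ i) * s ^ i)"
        unfolding binomial_ring
      proof (rule sum.cong[OF refl])
        fix i
        have pm: "(- (u z * s)) ^ i = (-1) ^ i * (u z ^ i * s ^ i)"
          by (simp only: power_minus[of "u z * s"] power_mult_distrib)
        show "of_nat (m choose i) * (- (u z * s)) ^ i * l z ^ (m - i) = of_real (altbin m i) * (l z ^ (m - i) * u z ^ i) * s ^ i"
          unfolding pm by (simp add: altbin_def mult_ac)
      qed
      finally show "poly ([:l z, - u z:] ^ m) s = poly (\<Sum>i\<le>m. monom (of_real (altbin m i) * (l z ^ (m - i) * u z ^ i)) i) s"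
        by (simp add: poly_sum poly_monom)
    qed
    finally show ?thesis using that by (simp add: coeff_sum coeff_monom)
  qed
  then show ?thesis unfolding ephi_eq_sum[OF z] L_def by simp
qed

text \<open>For \<open>j < m\<close> the point \<open>1 / X\<close> is a root of \<open>Q j\<close>,
  so each derivative merely raises the index and produces the factor \<open>m - j\<close>; these
  multiply to \<open>fact m\<close>. At \<open>j = m\<close> this factor vanishes, and the value of
  \<open>Q m\<close> at \<open>1 / X\<close> is all that is left.\<close>

lemma D_op_ephi:
  assumes S: "open S" and nz: "\<And>z. z \<in> S \<Longrightarrow> l z \<noteq> 0" "\<And>z. z \<in> S \<Longrightarrow> u z \<noteq> 0"
    "\<And>z. z \<in> S \<Longrightarrow> norm (u z) \<le> norm (l z)" and z: "z \<in> S"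
  shows "(D_op ^^ (m + 1)) (\<lambda>z. ephi m n (l z) (u z)) z =
    - ((1 / (2 * of_real pi * \<i>)) ^ (m + 1) * fact m * (-1) ^ m * e ^ (m + 1) * (u z / l z) powi (n - 1 - int m) / l z ^ (m + 2))"
proof -
  let ?c = "1 / (2 * of_real pi * \<i>) :: complex"
  have it: "(D_op ^^ j) (\<lambda>z. ephi m n (l z) (u z)) z = ?c ^ j * (\<Prod>i<j. of_nat (m - i)) * L j z" if "j \<le> m" "z \<in> S" for j z
    using that
  proof (induction j arbitrary: z)
    case 0
    then show ?case using L_0 nz by simp
  next
    case (Suc j)
    have "poly (Q j z) (1 / (u z / l z)) = 0"
      using nz Suc.prems by (simp add: poly_Q)
    then have "has_wirtinger (L j) (of_nat (m - j) * L (j + 1) z) (- (cnj (u z / l z) powi (- n - 1)) * poly (Q j z) (cnj (u z / l z)) * cnj (e / (l z)\<^sup>2)) z"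
      using L_wirtinger[of j z] Suc.prems nz by simp
    from has_wirtinger_cong_open[OF has_wirtinger_cmult[OF this, of "?c ^ j * (\<Prod>i<j. of_nat (m - i))"] S Suc.prems(2),
        of "(D_op ^^ j) (\<lambda>z. ephi m n (l z) (u z))"]
    have "has_wirtinger ((D_op ^^ j) (\<lambda>z. ephi m n (l z) (u z)))
        (?c ^ j * (\<Prod>i<j. of_nat (m - i)) * (of_nat (m - j) * L (j + 1) z))
        (?c ^ j * (\<Prod>i<j. of_nat (m - i)) * (- (cnj (u z / l z) powi (- n - 1)) * poly (Q j z) (cnj (u z / l z)) * cnj (e / (l z)\<^sup>2))) z"
      using Suc by simp
    from has_wirtinger_D_op[OF this] show ?case by (simp add: power_divide mult_ac)
  qed
  have X: "u z / l z \<noteq> 0" "l z \<noteq> 0" "u z \<noteq> 0" using nz z by auto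
  have "has_wirtinger (L m) (of_nat (m - m) * L (m + 1) z - (u z / l z) powi (n - 1) * poly (Q m z) (1 / (u z / l z)) * (e / (l z)\<^sup>2))
      (- (cnj (u z / l z) powi (- n - 1)) * poly (Q m z) (cnj (u z / l z)) * cnj (e / (l z)\<^sup>2)) z"
    using L_wirtinger[OF order_refl X(2,3)] .
  from has_wirtinger_cong_open[OF has_wirtinger_cmult[OF this, of "?c ^ m * (\<Prod>i<m. of_nat (m - i))"] S z,
        of "(D_op ^^ m) (\<lambda>z. ephi m n (l z) (u z))"] it
  have "has_wirtinger ((D_op ^^ m) (\<lambda>z. ephi m n (l z) (u z)))
      (?c ^ m * (\<Prod>i<m. of_nat (m - i)) * (of_nat (m - m) * L (m + 1) z - (u z / l z) powi (n - 1) * poly (Q m z) (1 / (u z / l z)) * (e / (l z)\<^sup>2)))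
      (?c ^ m * (\<Prod>i<m. of_nat (m - i)) * (- (cnj (u z / l z) powi (- n - 1)) * poly (Q m z) (cnj (u z / l z)) * cnj (e / (l z)\<^sup>2))) z"
    by simp
  from has_wirtinger_D_op[OF this]
  have "(D_op ^^ (m + 1)) (\<lambda>z. ephi m n (l z) (u z)) z =
    - (?c ^ (m + 1) * (\<Prod>i<m. of_nat (m - i)) * ((u z / l z) powi (n - 1) * poly (Q m z) (1 / (u z / l z)) * (e / (l z)\<^sup>2)))"
    by (simp add: power_divide mult_ac)
  also have "(\<Prod>i<m. of_nat (m - i)) = (fact m :: complex)"
    by (simp add: fact_prod_rev atLeast0LessThan)
  also have "(u z / l z) powi (n - 1) * poly (Q m z) (1 / (u z / l z)) * (e / (l z)\<^sup>2)
      = (-1) ^ m * e ^ (m + 1) * (u z / l z) powi (n - 1 - int m) / l z ^ (m + 2)"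
  proof -
    \<comment> \<open>The power \<open>m\<close> of this expression supplies all but one of the
      factors \<open>e\<close>; the last one comes from the derivative of
      \<open>u / l\<close>.\<close>
    have "\<alpha> - \<gamma> * (1 / (u z / l z)) = - e / u z"
      using X by (simp add: field_simps e_def) (simp add: l_def u_def algebra_simps)
    then have "poly (Q m z) (1 / (u z / l z)) = (- e / u z) ^ m" by (simp add: poly_Q)
    also have "\<dots> = (-1) ^ m * e ^ m / (u z / l z) ^ m / l z ^ m"
      using X by (simp add: power_divide power_minus[of "e / u z"])
    finally have "poly (Q m z) (1 / (u z / l z)) = (-1) ^ m * e ^ m / (u z / l z) ^ m / l z ^ m" .
    moreover have "(u z / l z) powi (n - 1 - int m) = (u z / l z) powi (n - 1) / (u z / l z) ^ m"
      using X by (subst power_int_diff) auto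
    ultimately show ?thesis by (simp add: power_add power2_eq_square mult_ac)
  qed
  finally show ?thesis by (simp add: mult_ac)
qed

text \<open>At \<open>s = cnj X\<close> the factor \<open>l - u * s\<close> equals
  \<open>(norm l ^ 2 - norm u ^ 2) / cnj l\<close>, by assumption a multiple of \<open>Im z\<close>;
  its power \<open>m\<close> is the weight.\<close>

lemma ephi_wirtinger:
  assumes S: "open S" and nz: "\<And>z. z \<in> S \<Longrightarrow> l z \<noteq> 0" "\<And>z. z \<in> S \<Longrightarrow> u z \<noteq> 0"
    "\<And>z. z \<in> S \<Longrightarrow> norm (u z) \<le> norm (l z)" and z: "z \<in> S"
    and \<kappa>: "(norm (l z))\<^sup>2 - (norm (u z))\<^sup>2 = \<kappa> * Im z"
  shows "\<exists>p. has_wirtinger (\<lambda>z. ephi m n (l z) (u z)) p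
    (of_real (Im z) ^ m * cnj (- (of_real \<kappa> ^ m * e * (u z / l z) powi (- n - 1) / l z ^ (m + 2)))) z"
proof -
  let ?X = "u z / l z"
  have X: "?X \<noteq> 0" "l z \<noteq> 0" "u z \<noteq> 0" using nz z by auto
  have "has_wirtinger (L 0) (of_nat (m - 0) * L (0 + 1) z - ?X powi (n - 1) * poly (Q 0 z) (1 / ?X) * (e / (l z)\<^sup>2))
     (- (cnj ?X powi (- n - 1)) * poly (Q 0 z) (cnj ?X) * cnj (e / (l z)\<^sup>2)) z"
    by (rule L_wirtinger[OF _ X(2,3)]) simp
  from has_wirtinger_cong_open[OF this S z, of "\<lambda>z. ephi m n (l z) (u z)"] L_0 nz
  have "\<exists>p. has_wirtinger (\<lambda>z. ephi m n (l z) (u z)) p (- (cnj ?X powi (- n - 1)) * poly (Q 0 z) (cnj ?X) * cnj (e / (l z)\<^sup>2)) z"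
    by auto
  moreover have "- (cnj ?X powi (- n - 1)) * poly (Q 0 z) (cnj ?X) * cnj (e / (l z)\<^sup>2) =
      of_real (Im z) ^ m * cnj (- (of_real \<kappa> ^ m * e * ?X powi (- n - 1) / l z ^ (m + 2)))"
  proof -
    have "l z - u z * cnj ?X = (l z * cnj (l z) - u z * cnj (u z)) / cnj (l z)"
      using X by (simp add: field_simps)
    also have "l z * cnj (l z) - u z * cnj (u z) = of_real \<kappa> * of_real (Im z)"
      using arg_cong[OF \<kappa>, of complex_of_real] by (simp add: complex_norm_square[symmetric])
    finally have "poly (Q 0 z) (cnj ?X) = (of_real \<kappa> * of_real (Im z) / cnj (l z)) ^ m" by (simp add: poly_Q)
    then show ?thesis by (simp add: power_divide power_mult_distrib power_add power2_eq_square mult_ac)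
  qed
  ultimately show ?thesis by simp
qed

end

section \<open>Terms indexed by matrices and their bounds\<close>

definition phi :: "nat \<Rightarrow> int \<Rightarrow> complex \<Rightarrow> int^2^2 \<Rightarrow> complex \<Rightarrow> complex" where
  "phi m n \<zz> M z = ephi m n (lin (cnj \<zz>) M z) (lin \<zz> M z)"

text \<open>The holomorphic function that belongs to \<open>phi\<close> in the sense of
  \<open>harm\<close>; up to a constant it is a term of \<open>poincare_Psi\<close> with index
  \<open>- n - 1\<close>. The factor \<open>2 * \<i> * of_real (Im \<zz>)\<close> is the determinant
  of the two forms.\<close>

definition phi_g :: "nat \<Rightarrow> int \<Rightarrow> complex \<Rightarrow> int^2^2 \<Rightarrow> complex \<Rightarrow> complex" where
  "phi_g m n \<zz> M z = - (of_real (4 * Im \<zz>) ^ m * (2 * \<i> * of_real (Im \<zz>)) *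
     (lin \<zz> M z / lin (cnj \<zz>) M z) powi (- n - 1) / lin (cnj \<zz>) M z ^ (m + 2))"

lemma norm_lin_le:
  assumes "M \<in> SL2Z" "\<zz> \<in> uhp" "z \<in> uhp" shows "norm (lin \<zz> M z) \<le> norm (lin (cnj \<zz>) M z)"
proof (rule power2_le_imp_le)
  have "4 * Im \<zz> * Im z \<ge> 0" using assms by (simp add: uhp_iff)
  then show "(norm (lin \<zz> M z))\<^sup>2 \<le> (norm (lin (cnj \<zz>) M z))\<^sup>2"
    using norm_lin_cnj_minus[OF assms(1), of \<zz> z] by linarith
qed simp

lemma linear_pair_det:
  assumes "M \<in> SL2Z"
  shows "linear_pair.e (of_int (M$1$1) - of_int (M$2$1) * cnj \<zz>) (of_int (M$1$2) - of_int (M$2$2) * cnj \<zz>)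
     (of_int (M$1$1) - of_int (M$2$1) * \<zz>) (of_int (M$1$2) - of_int (M$2$2) * \<zz>) = 2 * \<i> * of_real (Im \<zz>)"
proof -
  have d: "of_int (M$1$1) * of_int (M$2$2) - of_int (M$1$2) * of_int (M$2$1) = (1::complex)"
    using assms by (simp add: SL2Z_iff flip: of_int_mult of_int_diff)
  have "linear_pair.e (of_int (M$1$1) - of_int (M$2$1) * cnj \<zz>) (of_int (M$1$2) - of_int (M$2$2) * cnj \<zz>)
     (of_int (M$1$1) - of_int (M$2$1) * \<zz>) (of_int (M$1$2) - of_int (M$2$2) * \<zz>) =
     (of_int (M$1$1) * of_int (M$2$2) - of_int (M$1$2) * of_int (M$2$1)) * (\<zz> - cnj \<zz>)"
    by (simp add: linear_pair.e_def algebra_simps)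
  also have "\<zz> - cnj \<zz> = 2 * \<i> * of_real (Im \<zz>)" by (simp add: complex_eq_iff)
  finally show ?thesis by (simp add: d)
qed

lemma open_lin_nonzero: "open {z \<in> uhp. lin \<zz> M z \<noteq> 0}"
proof -
  have "continuous_on UNIV (lin \<zz> M)" unfolding lin_def by (intro continuous_intros)
  then have "open (lin \<zz> M -` (- {0}))" by (intro open_vimage) auto
  then have "open (uhp \<inter> lin \<zz> M -` (- {0}))" by (intro open_Int open_uhp)
  moreover have "uhp \<inter> lin \<zz> M -` (- {0}) = {z \<in> uhp. lin \<zz> M z \<noteq> 0}" by auto
  ultimately show ?thesis by simp
qed

lemma lin_holomorphic: "lin w M holomorphic_on A"
  unfolding lin_def by (intro holomorphic_intros)

lemma phi_g_holomorphic:
  assumes "M \<in> SL2Z" "\<zz> \<in> uhp" "A \<subseteq> uhp" "n < 0 \<or> (\<forall>z\<in>A. lin \<zz> M z \<noteq> 0)"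
  shows "phi_g m n \<zz> M holomorphic_on A"
proof -
  have nz: "lin (cnj \<zz>) M z \<noteq> 0" if "z \<in> A" for z using lin_cnj_nonzero[OF assms(1,2)] that assms(3) by blast
  have X: "(\<lambda>z. lin \<zz> M z / lin (cnj \<zz>) M z) holomorphic_on A"
    by (intro holomorphic_on_divide lin_holomorphic nz)
  have p: "(\<lambda>z. (lin \<zz> M z / lin (cnj \<zz>) M z) powi (- n - 1)) holomorphic_on A"
  proof (cases "n < 0")
    case True
    then have "(\<lambda>z. (lin \<zz> M z / lin (cnj \<zz>) M z) powi (- n - 1)) = (\<lambda>z. (lin \<zz> M z / lin (cnj \<zz>) M z) ^ nat (- n - 1))"
      by (simp add: power_int_def)
    then show ?thesis using X by (simp add: holomorphic_on_power)
  next
    case False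
    then show ?thesis using X nz assms(4) by (intro holomorphic_on_power_int) auto
  qed
  then show ?thesis unfolding phi_g_def
    by (intro holomorphic_on_minus holomorphic_on_divide holomorphic_on_mult holomorphic_on_const
        holomorphic_on_power lin_holomorphic p) (use nz in auto)
qed

lemma phi_harm:
  assumes "M \<in> SL2Z" "\<zz> \<in> uhp"
  shows "harm m (phi m n \<zz> M) (phi_g m n \<zz> M) {z \<in> uhp. lin \<zz> M z \<noteq> 0}" (is "harm m _ _ ?S")
  unfolding harm_iff
proof (intro conjI ballI open_lin_nonzero phi_g_holomorphic assms)
  interpret linear_pair "of_int (M$1$1) - of_int (M$2$1) * cnj \<zz>" "of_int (M$1$2) - of_int (M$2$2) * cnj \<zz>"
    "of_int (M$1$1) - of_int (M$2$1) * \<zz>" "of_int (M$1$2) - of_int (M$2$2) * \<zz>" m n .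
  have l: "l = lin (cnj \<zz>) M" "u = lin \<zz> M" by (auto simp: fun_eq_iff l_def u_def lin_def)
  fix z assume z: "z \<in> ?S"
  have "\<exists>p. has_wirtinger (\<lambda>z. ephi m n (l z) (u z)) p
    (of_real (Im z) ^ m * cnj (- (of_real (4 * Im \<zz>) ^ m * e * (u z / l z) powi (- n - 1) / l z ^ (m + 2)))) z"
    by (rule ephi_wirtinger[OF open_lin_nonzero[of \<zz> M]])
      (use z assms lin_cnj_nonzero norm_lin_le norm_lin_cnj_minus in \<open>auto simp: l\<close>)
  then show "\<exists>p. has_wirtinger (phi m n \<zz> M) p (of_real (Im z) ^ m * cnj (phi_g m n \<zz> M z)) z"
    unfolding l linear_pair_det[OF assms(1)] phi_def[abs_def] phi_g_def .
qed auto

text \<open>The determinant \<open>2 * \<i> * Im \<zz>\<close> times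
  \<open>1 / (2 * pi * \<i>)\<close> is \<open>Im \<zz> / pi\<close>, and the sign
  \<open>(-1) ^ m\<close> drops out for even \<open>m\<close>.\<close>

lemma phi_D_op:
  assumes "M \<in> SL2Z" "\<zz> \<in> uhp" "z \<in> uhp" "lin \<zz> M z \<noteq> 0" "even m"
  shows "(D_op ^^ (m + 1)) (phi m n \<zz> M) z =
    - fact m * of_real (Im \<zz> / pi) ^ (m + 1) * ((lin \<zz> M z / lin (cnj \<zz>) M z) powi (n - 1 - int m) / lin (cnj \<zz>) M z ^ (m + 2))"
proof -
  interpret linear_pair "of_int (M$1$1) - of_int (M$2$1) * cnj \<zz>" "of_int (M$1$2) - of_int (M$2$2) * cnj \<zz>"
    "of_int (M$1$1) - of_int (M$2$1) * \<zz>" "of_int (M$1$2) - of_int (M$2$2) * \<zz>" m n .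
  have l: "l = lin (cnj \<zz>) M" "u = lin \<zz> M" by (auto simp: fun_eq_iff l_def u_def lin_def)
  have "(D_op ^^ (m + 1)) (\<lambda>z. ephi m n (l z) (u z)) z =
    - ((1 / (2 * of_real pi * \<i>)) ^ (m + 1) * fact m * (-1) ^ m * e ^ (m + 1) * (u z / l z) powi (n - 1 - int m) / l z ^ (m + 2))"
    by (rule D_op_ephi[OF open_lin_nonzero[of \<zz> M]])
      (use assms lin_cnj_nonzero norm_lin_le in \<open>auto simp: l\<close>)
  moreover have "(1 / (2 * of_real pi * \<i>)) ^ (m + 1) * e ^ (m + 1) = of_real (Im \<zz> / pi) ^ (m + 1)"
    unfolding linear_pair_det[OF assms(1)] power_mult_distrib[symmetric] by simp
  moreover have "a = - f * q * (X / L)" if "a = - (c * f * (-1) ^ m * d * X / L)" "c * d = q" for a c f d q X L :: complex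
    using that assms(5) by (auto simp: mult_ac)
  ultimately show ?thesis
    unfolding l phi_def[abs_def] by blast
qed

text \<open>The three factors stem from the integrand of the incomplete beta function, from the
  power of \<open>X\<close>, and from the power \<open>m + 1\<close> of
  \<open>1 - norm X ^ 2\<close>.\<close>

definition phi_bound :: "nat \<Rightarrow> int \<Rightarrow> complex \<Rightarrow> real" where
  "phi_bound m n \<zz> = 4 ^ nat \<bar>- n - 1\<bar> * 2 ^ nat \<bar>n\<bar> * (4 * Im \<zz>) ^ (m + 1)"

lemma norm_powi_le:
  fixes X :: complex
  assumes "1/2 \<le> norm X" "norm X \<le> 1" shows "norm (X powi n) \<le> 2 ^ nat \<bar>n\<bar>"
proof (cases "n \<ge> 0")
  case True
  then have "norm (X powi n) \<le> 1" using assms by (simp add: norm_power_int power_int_le_one)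
  also have "\<dots> \<le> 2 ^ nat \<bar>n\<bar>" by simp
  finally show ?thesis .
next
  case False
  then have "norm (X powi n) = inverse (norm X) ^ nat \<bar>n\<bar>" by (simp add: power_int_def power_inverse norm_inverse norm_power)
  also have "inverse (norm X) \<le> inverse (1/2)" using assms by (intro le_imp_inverse_le) auto
  then have "inverse (norm X) ^ nat \<bar>n\<bar> \<le> 2 ^ nat \<bar>n\<bar>" by (intro power_mono) auto
  finally show ?thesis .
qed

text \<open>Where \<open>norm X \<ge> 1/2\<close>, the beta function contributes the power
  \<open>m + 1\<close> of \<open>1 - norm X ^ 2 = 4 * Im \<zz> * Im z / norm l ^ 2\<close>; against
  the factor \<open>norm l ^ m\<close> this leaves \<open>norm l ^ (m + 2)\<close> in the
  denominator.\<close>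

lemma norm_phi_le:
  assumes M: "M \<in> SL2Z" and \<zz>: "\<zz> \<in> uhp" and z: "z \<in> uhp"
    and X: "norm (lin \<zz> M z) \<ge> norm (lin (cnj \<zz>) M z) / 2"
  shows "norm (phi m n \<zz> M z) \<le> phi_bound m n \<zz> * Im z ^ (m + 1) / norm (lin (cnj \<zz>) M z) ^ (m + 2)"
    and "norm (phi_g m n \<zz> M z) \<le> ((4 * Im \<zz>) ^ m * (2 * Im \<zz>) * 2 ^ nat \<bar>- n - 1\<bar>) / norm (lin (cnj \<zz>) M z) ^ (m + 2)"
proof -
  define l u where "l = lin (cnj \<zz>) M z" and "u = lin \<zz> M z"
  have l: "l \<noteq> 0" using lin_cnj_nonzero[OF M \<zz> z] by (simp add: l_def)
  have X1: "1/2 \<le> norm (u / l)" "norm (u / l) \<le> 1"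
    using X norm_lin_le[OF M \<zz> z] l by (simp_all add: norm_divide l_def u_def divide_simps)
  define Z where "Z = 1 - (norm (u / l))\<^sup>2"
  have Z: "Z = 4 * Im \<zz> * Im z / (norm l)\<^sup>2"
  proof -
    have "Z = ((norm l)\<^sup>2 - (norm u)\<^sup>2) / (norm l)\<^sup>2"
      using l by (simp add: Z_def norm_divide power_divide diff_divide_distrib)
    then show ?thesis unfolding l_def u_def norm_lin_cnj_minus[OF M] .
  qed
  have "(1/2)\<^sup>2 \<le> (norm (u / l))\<^sup>2" using X1 by (intro power_mono) auto
  then have Z1: "Z \<le> 3/4" by (simp add: Z_def power2_eq_square)
  have Z0: "Z \<ge> 0" unfolding Z using \<zz> z by (simp add: uhp_iff)
  have "norm (phi m n \<zz> M z) = norm l ^ m * \<bar>inc_beta Z (m + 1) (- n)\<bar> * norm ((u / l) powi n)"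
    by (simp add: phi_def ephi_def norm_mult norm_power l_def u_def Z_def)
  also have "\<dots> \<le> norm l ^ m * (4 ^ nat \<bar>- n - 1\<bar> * Z ^ (m + 1)) * 2 ^ nat \<bar>n\<bar>"
    using abs_inc_beta_le[OF Z0 Z1] norm_powi_le[OF X1] by (intro mult_mono mult_left_mono) (use Z0 in auto)
  also have "\<dots> = phi_bound m n \<zz> * Im z ^ (m + 1) / norm l ^ (m + 2)"
    unfolding Z phi_bound_def using l by (simp add: power_divide power_mult_distrib power_add power2_eq_square field_simps)
  finally show "norm (phi m n \<zz> M z) \<le> phi_bound m n \<zz> * Im z ^ (m + 1) / norm (lin (cnj \<zz>) M z) ^ (m + 2)"
    by (simp add: l_def)
  have "norm (phi_g m n \<zz> M z) = (4 * Im \<zz>) ^ m * (2 * Im \<zz>) * norm ((u / l) powi (- n - 1)) / norm l ^ (m + 2)"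
    using \<zz> by (simp add: phi_g_def norm_mult norm_power norm_divide l_def u_def uhp_iff)
  also have "\<dots> \<le> (4 * Im \<zz>) ^ m * (2 * Im \<zz>) * 2 ^ nat \<bar>- n - 1\<bar> / norm l ^ (m + 2)"
    using norm_powi_le[OF X1] \<zz> by (intro divide_right_mono mult_left_mono) (auto simp: uhp_iff)
  finally show "norm (phi_g m n \<zz> M z) \<le> ((4 * Im \<zz>) ^ m * (2 * Im \<zz>) * 2 ^ nat \<bar>- n - 1\<bar>) / norm (lin (cnj \<zz>) M z) ^ (m + 2)"
    by (simp add: l_def)
qed

text \<open>The automorphy factor has exponent \<open>2 * k - 2\<close> and merges with the same
  power of \<open>moebius M z - cnj \<zz>\<close> into a power of the linear form.\<close>

lemma slash_P_term:
  assumes M: "M \<in> SL2Z" and z: "z \<in> uhp" and \<zz>: "\<zz> \<in> uhp" and k: "k \<ge> 1"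
  shows "slash (2 - 2 * int k) (\<lambda>w. (w - cnj \<zz>) powi (2 * int k - 2)
      * of_real (inc_beta (1 - (ell_r \<zz> w)\<^sup>2) (2 * k - 1) (- n)) * ell_X \<zz> w powi n) M z = phi (2 * k - 2) n \<zz> M z"
proof -
  have a: "aut M z \<noteq> 0" using aut_nonzero[OF M z] .
  have e: "2 * int k - 2 = int (2 * k - 2)" "2 * k - 1 = (2 * k - 2) + 1" using k by auto
  have X: "ell_X \<zz> (moebius M z) = lin \<zz> M z / lin (cnj \<zz>) M z"
    unfolding ell_X_def lin_eq[OF M z] using a by simp
  have e2: "- (2 - 2 * int k) = int (2 * k - 2)" using k by simp
  have "aut M z powi (- (2 - 2 * int k)) * (moebius M z - cnj \<zz>) powi (2 * int k - 2) = lin (cnj \<zz>) M z ^ (2 * k - 2)"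
    unfolding e2 unfolding e(1) unfolding lin_eq[OF M z] power_int_of_nat power_mult_distrib ..
  then show ?thesis
    unfolding slash_eq phi_def ephi_def X ell_r_def e(2) by (simp add: mult_ac)
qed

lemma slash_Psi_term:
  assumes M: "M \<in> SL2Z" and z: "z \<in> uhp" and \<zz>: "\<zz> \<in> uhp" and k: "k \<ge> 1"
  shows "slash (2 * int k) (\<lambda>w. (w - cnj \<zz>) powi (- 2 * int k) * ell_X \<zz> w powi n) M z =
    (lin \<zz> M z / lin (cnj \<zz>) M z) powi n / lin (cnj \<zz>) M z ^ (2 * k - 2 + 2)"
proof -
  have a: "aut M z \<noteq> 0" using aut_nonzero[OF M z] .
  have X: "ell_X \<zz> (moebius M z) = lin \<zz> M z / lin (cnj \<zz>) M z"
    unfolding ell_X_def lin_eq[OF M z] using a by simp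
  have k2: "2 * k - 2 + 2 = 2 * k" using k by simp
  have e: "- (2 * int k) = - int (2 * k)" "- 2 * int k = - int (2 * k)" by auto
  have "aut M z powi (- (2 * int k)) * (moebius M z - cnj \<zz>) powi (- 2 * int k) = inverse (lin (cnj \<zz>) M z ^ (2 * k))"
    unfolding e unfolding lin_eq[OF M z] power_int_minus power_int_of_nat power_mult_distrib
    by (rule inverse_mult_distrib[symmetric])
  then show ?thesis
    unfolding slash_eq X k2 by (simp add: mult_ac divide_inverse)
qed

lemma poincare_P_eq:
  assumes "z \<in> uhp" "\<zz> \<in> uhp" "k \<ge> 1"
  shows "poincare_P k \<zz> n z = (\<Sum>\<^sub>\<infinity>M\<in>SL2Z. phi (2 * k - 2) n \<zz> M z)"
  unfolding poincare_P_def by (rule infsum_cong) (rule slash_P_term[OF _ assms])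

lemma poincare_Psi_eq:
  assumes "z \<in> uhp" "\<zz> \<in> uhp" "k \<ge> 1"
  shows "poincare_Psi k \<zz> n z = (\<Sum>\<^sub>\<infinity>M\<in>SL2Z. (lin \<zz> M z / lin (cnj \<zz>) M z) powi n / lin (cnj \<zz>) M z ^ (2 * k - 2 + 2))"
  unfolding poincare_Psi_def by (rule infsum_cong) (rule slash_Psi_term[OF _ assms])

text \<open>The series \<open>poincare_P\<close> and the sum of the \<open>phi\<close> are compared
  on the half-plane only, whereas iterates of \<open>D_op\<close> are formed from total functions.
  Both share one local representation, which determines the result.\<close>

lemma wharm_D_op_cong:
  assumes F: "wharm m P F g S" and P: "\<And>j. P j holomorphic_on UNIV" and S: "convex S" "z \<in> S"
    and eq: "\<And>z. z \<in> S \<Longrightarrow> F z = G z"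
  shows "(D_op ^^ (m + 1)) F z = (D_op ^^ (m + 1)) G z"
proof -
  obtain f H where f: "f holomorphic_on S" and H: "\<And>j z. z \<in> S \<Longrightarrow> (H j has_field_derivative P j z * g z) (at z)"
    and rep: "\<And>z. F z = f z + (\<Sum>j\<le>m. z ^ j * cnj (H j z))"
    using wharm_rep_ex[OF F P S] by blast
  have oS: "open S" using wharm_open[OF F] .
  have Hh: "H j holomorphic_on S" for j unfolding holomorphic_on_open[OF oS] using H by blast
  have "(D_op ^^ (m + 1)) F z = (1 / (2 * of_real pi * \<i>)) ^ (m + 1) * (deriv ^^ (m + 1)) f z"
    by (rule wharm_D_op_iterate[OF oS f Hh rep S(2)])
  moreover have "G w = f w + (\<Sum>j\<le>m. w ^ j * cnj (H j w))" if "w \<in> S" for w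
    using rep[of w] eq[OF that] by simp
  then have "(D_op ^^ (m + 1)) G z = (1 / (2 * of_real pi * \<i>)) ^ (m + 1) * (deriv ^^ (m + 1)) f z"
    by (rule wharm_D_op_iterate[OF oS f Hh _ S(2)])
  ultimately show ?thesis by simp
qed

lemma harm_infsum:
  assumes r: "r > 0" "ball z0 r \<subseteq> uhp"
    and harm: "\<And>i. i \<in> I \<Longrightarrow> harm m (\<phi> i) (\<gamma> i) (ball z0 r)"
    and a: "\<And>i z. i \<in> I \<Longrightarrow> z \<in> ball z0 r \<Longrightarrow> norm (\<phi> i z) \<le> a i" "a summable_on I"
    and b: "\<And>i z. i \<in> I \<Longrightarrow> z \<in> ball z0 r \<Longrightarrow> norm (\<gamma> i z) \<le> b i" "b summable_on I"
  shows "harm m (\<lambda>z. \<Sum>\<^sub>\<infinity>i\<in>I. \<phi> i z) (\<lambda>z. \<Sum>\<^sub>\<infinity>i\<in>I. \<gamma> i z) (ball z0 r)"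
    and "z \<in> ball z0 r \<Longrightarrow> ((\<lambda>i. (D_op ^^ (m + 1)) (\<phi> i) z) has_sum (D_op ^^ (m + 1)) (\<lambda>z. \<Sum>\<^sub>\<infinity>i\<in>I. \<phi> i z) z) I"
proof -
  have h: "wharm m (hp_coeff m) (\<phi> i) (\<gamma> i) (ball z0 r)" if "i \<in> I" for i
    using harm[OF that] by (simp add: harm_def)
  show "harm m (\<lambda>z. \<Sum>\<^sub>\<infinity>i\<in>I. \<phi> i z) (\<lambda>z. \<Sum>\<^sub>\<infinity>i\<in>I. \<gamma> i z) (ball z0 r)"
    unfolding harm_def using wharm_infsum(1)[OF r(1) hp_coeff_holomorphic h a b] r(2) by blast
  show "((\<lambda>i. (D_op ^^ (m + 1)) (\<phi> i) z) has_sum (D_op ^^ (m + 1)) (\<lambda>z. \<Sum>\<^sub>\<infinity>i\<in>I. \<phi> i z) z) I" if "z \<in> ball z0 r"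
    using wharm_infsum(2)[OF r(1) hp_coeff_holomorphic h a b that] .
qed

section \<open>Convergence of the Poincare series and boundedness at the cusp\<close>

context
  fixes m :: nat and n :: int and \<zz> :: complex
  assumes m: "m \<ge> 2" and \<zz>: "\<zz> \<in> uhp"
begin

text \<open>The bounds for the terms are transferred to the centre \<open>z0\<close>, so that the
  majorants depend on \<open>M\<close> only; the exponent \<open>m + 2\<close> is at least 4, which
  gives summability.\<close>

lemma far_bounds:
  assumes z0: "z0 \<in> uhp"
  obtains a b where "a summable_on SL2Z" "b summable_on SL2Z"
    "\<And>M z. M \<in> SL2Z - near_set \<zz> z0 \<Longrightarrow> z \<in> ball z0 (Im z0 / 2) \<Longrightarrow> norm (phi m n \<zz> M z) \<le> a M"
    "\<And>M z. M \<in> SL2Z - near_set \<zz> z0 \<Longrightarrow> z \<in> ball z0 (Im z0 / 2) \<Longrightarrow> norm (phi_g m n \<zz> M z) \<le> b M"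
proof -
  define A where "A = phi_bound m n \<zz> * (3 * Im z0 / 2) ^ (m + 1)"
  define B where "B = (4 * Im \<zz>) ^ m * (2 * Im \<zz>) * 2 ^ nat \<bar>- n - 1\<bar>"
  define a where "a M = A * 2 ^ (m + 2) * (1 / norm (lin (cnj \<zz>) M z0) ^ (m + 2))" for M
  define b where "b M = B * 2 ^ (m + 2) * (1 / norm (lin (cnj \<zz>) M z0) ^ (m + 2))" for M
  have s: "(\<lambda>M. 1 / norm (lin (cnj \<zz>) M z0) ^ (m + 2)) summable_on SL2Z"
  proof (rule lin_power_sum_le[OF \<zz>, of "m + 2"])
    assume "\<And>z. z \<in> uhp \<Longrightarrow> (\<lambda>M. 1 / norm (lin (cnj \<zz>) M z) ^ (m + 2)) summable_on SL2Z"
    then show ?thesis using z0 by blast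
  qed (use m in simp)
  have pb: "phi_bound m n \<zz> \<ge> 0" and B: "B \<ge> 0" using \<zz> by (simp_all add: phi_bound_def B_def uhp_iff)
  have le: "1 / norm (lin (cnj \<zz>) M z) ^ (m + 2) \<le> 2 ^ (m + 2) * (1 / norm (lin (cnj \<zz>) M z0) ^ (m + 2))"
    if M: "M \<in> SL2Z" and z: "z \<in> ball z0 (Im z0 / 2)" for M z
  proof -
    have "norm (lin (cnj \<zz>) M z) \<ge> norm (lin (cnj \<zz>) M z0) / 2" using norm_lin_ball(1)[OF M \<zz> z0] z by simp
    then have "norm (lin (cnj \<zz>) M z) ^ (m + 2) \<ge> (norm (lin (cnj \<zz>) M z0) / 2) ^ (m + 2)" by (intro power_mono) auto
    moreover have "norm (lin (cnj \<zz>) M z0) > 0" "norm (lin (cnj \<zz>) M z) > 0"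
      using lin_cnj_nonzero[OF M \<zz>] z0 half_ball_uhp[OF z0 z] by auto
    ultimately have "1 / norm (lin (cnj \<zz>) M z) ^ (m + 2) \<le> 1 / (norm (lin (cnj \<zz>) M z0) / 2) ^ (m + 2)"
      by (intro divide_left_mono mult_pos_pos zero_less_power) auto
    then show ?thesis by (simp add: power_divide)
  qed
  show thesis
  proof (rule that)
    show "a summable_on SL2Z" "b summable_on SL2Z" unfolding a_def b_def by (intro summable_on_cmult_right s)+
    fix M z assume M: "M \<in> SL2Z - near_set \<zz> z0" and z: "z \<in> ball z0 (Im z0 / 2)"
    then have MS: "M \<in> SL2Z" by simp
    have zu: "z \<in> uhp" "Im z \<le> 3 * Im z0 / 2" using half_ball_uhp[OF z0 z] by auto
    have X: "norm (lin \<zz> M z) \<ge> norm (lin (cnj \<zz>) M z) / 2" using M z unfolding near_set_def by force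
    have "norm (phi m n \<zz> M z) \<le> phi_bound m n \<zz> * Im z ^ (m + 1) * (1 / norm (lin (cnj \<zz>) M z) ^ (m + 2))"
      using norm_phi_le(1)[OF MS \<zz> zu(1) X, of m n] by simp
    also have "\<dots> \<le> A * (2 ^ (m + 2) * (1 / norm (lin (cnj \<zz>) M z0) ^ (m + 2)))"
      unfolding A_def using pb zu le[OF MS z] by (intro mult_mono mult_left_mono power_mono) (auto simp: uhp_iff)
    finally show "norm (phi m n \<zz> M z) \<le> a M" by (simp add: a_def mult_ac)
    have "norm (phi_g m n \<zz> M z) \<le> B * (1 / norm (lin (cnj \<zz>) M z) ^ (m + 2))"
      using norm_phi_le(2)[OF MS \<zz> zu(1) X, of m n] by (simp add: B_def)
    also have "\<dots> \<le> B * (2 ^ (m + 2) * (1 / norm (lin (cnj \<zz>) M z0) ^ (m + 2)))"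
      using B le[OF MS z] by (intro mult_left_mono)
    finally show "norm (phi_g m n \<zz> M z) \<le> b M" by (simp add: b_def mult_ac)
  qed
qed

lemma far_nonzero:
  assumes z0: "z0 \<in> uhp" and M: "M \<in> SL2Z - near_set \<zz> z0" and z: "z \<in> ball z0 (Im z0 / 2)"
  shows "z \<in> {z \<in> uhp. lin \<zz> M z \<noteq> 0}"
proof -
  have zu: "z \<in> uhp" using half_ball_uhp[OF z0 z] by auto
  have "norm (lin \<zz> M z) \<ge> norm (lin (cnj \<zz>) M z) / 2" using M z unfolding near_set_def by force
  then have "lin \<zz> M z \<noteq> 0" using lin_cnj_nonzero[of M \<zz> z] M \<zz> zu by auto
  then show ?thesis using zu by simp
qed

lemma poincare_local:
  assumes z0: "z0 \<in> uhp"
  obtains R g where "harm m R g (ball z0 (Im z0 / 2))"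
    "\<And>z. z \<in> ball z0 (Im z0 / 2) \<Longrightarrow> (\<Sum>\<^sub>\<infinity>M\<in>SL2Z. phi m n \<zz> M z) = R z + (\<Sum>M\<in>near_set \<zz> z0. phi m n \<zz> M z)"
proof -
  let ?B = "ball z0 (Im z0 / 2)" let ?I = "SL2Z - near_set \<zz> z0"
  obtain a b where ab: "a summable_on SL2Z" "b summable_on SL2Z"
    "\<And>M z. M \<in> ?I \<Longrightarrow> z \<in> ?B \<Longrightarrow> norm (phi m n \<zz> M z) \<le> a M"
    "\<And>M z. M \<in> ?I \<Longrightarrow> z \<in> ?B \<Longrightarrow> norm (phi_g m n \<zz> M z) \<le> b M"
    by (rule far_bounds[OF z0]) (rule that; assumption)
  have sub: "a summable_on ?I" "b summable_on ?I"
    using ab(1,2) summable_on_subset_banach by blast+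
  have pos: "Im z0 / 2 > 0" using z0 by (simp add: uhp_iff)
  have Bu: "?B \<subseteq> uhp" using half_ball_uhp[OF z0] by blast
  have harm: "harm m (phi m n \<zz> M) (phi_g m n \<zz> M) ?B" if "M \<in> ?I" for M
    using phi_harm[of M \<zz> m n] that \<zz> far_nonzero[OF z0 that] by (intro harm_subset[OF _ open_ball]) blast+
  show thesis
  proof (rule that)
    show "harm m (\<lambda>z. \<Sum>\<^sub>\<infinity>M\<in>?I. phi m n \<zz> M z) (\<lambda>z. \<Sum>\<^sub>\<infinity>M\<in>?I. phi_g m n \<zz> M z) ?B"
      by (rule harm_infsum(1)[OF pos Bu harm ab(3) sub(1) ab(4) sub(2)])
    fix z assume z: "z \<in> ?B"
    have s: "(\<lambda>M. phi m n \<zz> M z) summable_on ?I" by (rule summable_on_dominated[OF sub(1) ab(3)[OF _ z]])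
    have "(\<Sum>\<^sub>\<infinity>M\<in>?I \<union> near_set \<zz> z0. phi m n \<zz> M z) = (\<Sum>\<^sub>\<infinity>M\<in>?I. phi m n \<zz> M z) + (\<Sum>\<^sub>\<infinity>M\<in>near_set \<zz> z0. phi m n \<zz> M z)"
      using finite_near_set[OF \<zz> z0] by (intro infsum_Un_disjoint s) auto
    moreover have "?I \<union> near_set \<zz> z0 = SL2Z" using near_set_subset by blast
    ultimately show "(\<Sum>\<^sub>\<infinity>M\<in>SL2Z. phi m n \<zz> M z) = (\<Sum>\<^sub>\<infinity>M\<in>?I. phi m n \<zz> M z) + (\<Sum>M\<in>near_set \<zz> z0. phi m n \<zz> M z)"
      using finite_near_set[OF \<zz> z0] by simp
  qed
qed

text \<open>Off the orbit the finitely many near terms are regular as well. A compact ball around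
  \<open>z0\<close> bounds them, and changing the majorant at these indices keeps it
  summable.\<close>

lemma poincare_off_orbit:
  assumes z0: "z0 \<in> uhp - modular_orbit \<zz>"
  obtains r where "r > 0" "ball z0 r \<subseteq> uhp - modular_orbit \<zz>"
    "harm m (\<lambda>z. \<Sum>\<^sub>\<infinity>M\<in>SL2Z. phi m n \<zz> M z) (\<lambda>z. \<Sum>\<^sub>\<infinity>M\<in>SL2Z. phi_g m n \<zz> M z) (ball z0 r)"
    "((\<lambda>M. (D_op ^^ (m + 1)) (phi m n \<zz> M) z0) has_sum (D_op ^^ (m + 1)) (\<lambda>z. \<Sum>\<^sub>\<infinity>M\<in>SL2Z. phi m n \<zz> M z) z0) SL2Z"
proof -
  have z0u: "z0 \<in> uhp" using z0 by simp
  let ?B = "ball z0 (Im z0 / 2)" let ?E = "near_set \<zz> z0"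
  obtain a b where ab: "a summable_on SL2Z" "b summable_on SL2Z"
    "\<And>M z. M \<in> SL2Z - ?E \<Longrightarrow> z \<in> ?B \<Longrightarrow> norm (phi m n \<zz> M z) \<le> a M"
    "\<And>M z. M \<in> SL2Z - ?E \<Longrightarrow> z \<in> ?B \<Longrightarrow> norm (phi_g m n \<zz> M z) \<le> b M"
    by (rule far_bounds[OF z0u]) (rule that; assumption)
  obtain r1 where r1: "r1 > 0" "cball z0 r1 \<subseteq> uhp - modular_orbit \<zz>"
    using open_uhp_minus_orbit[OF \<zz>] z0 open_contains_cball by blast
  define r where "r = min r1 (Im z0 / 2)"
  have r: "r > 0" "ball z0 r \<subseteq> ?B" "ball z0 r \<subseteq> cball z0 r1" using r1 z0u by (auto simp: r_def uhp_iff)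
  have sub: "cball z0 r1 \<subseteq> {z \<in> uhp. lin \<zz> M z \<noteq> 0}" if "M \<in> SL2Z" for M
    using r1(2) modular_orbit_iff(2)[OF \<zz>] that by blast
  have harm: "harm m (phi m n \<zz> M) (phi_g m n \<zz> M) (ball z0 r)" if "M \<in> SL2Z" for M
    using sub[OF that] r(3) by (intro harm_subset[OF phi_harm[OF that \<zz>] open_ball]) blast
  have "\<exists>C. \<forall>z\<in>ball z0 r. norm (phi m n \<zz> M z) \<le> C \<and> norm (phi_g m n \<zz> M z) \<le> C" if M: "M \<in> SL2Z" for M
  proof -
    have "continuous_on (cball z0 r1) (phi m n \<zz> M)"
      using harm_isCont[OF phi_harm[OF M \<zz>]] sub[OF M] by (intro continuous_at_imp_continuous_on) blast
    then have 1: "bounded (phi m n \<zz> M ` cball z0 r1)" by (intro compact_imp_bounded compact_continuous_image) auto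
    have "continuous_on (cball z0 r1) (phi_g m n \<zz> M)"
      using harm_holomorphic[OF phi_harm[OF M \<zz>]] sub[OF M] holomorphic_on_imp_continuous_on holomorphic_on_subset by blast
    then have 2: "bounded (phi_g m n \<zz> M ` cball z0 r1)" by (intro compact_imp_bounded compact_continuous_image) auto
    from 1 2 obtain C1 C2 where "\<forall>z\<in>cball z0 r1. norm (phi m n \<zz> M z) \<le> C1" "\<forall>z\<in>cball z0 r1. norm (phi_g m n \<zz> M z) \<le> C2"
      unfolding bounded_iff by auto
    then show ?thesis using r(3) by (intro exI[of _ "max C1 C2"]) (auto simp: le_max_iff_disj)
  qed
  then obtain C where C: "\<And>M z. M \<in> SL2Z \<Longrightarrow> z \<in> ball z0 r \<Longrightarrow> norm (phi m n \<zz> M z) \<le> C M \<and> norm (phi_g m n \<zz> M z) \<le> C M"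
    by metis
  have split: "(\<lambda>M. if M \<in> ?E then C M else h M) summable_on SL2Z" if h: "h summable_on SL2Z" for h
  proof -
    have "(\<lambda>M. if M \<in> ?E then C M else h M) summable_on ((SL2Z - ?E) \<union> ?E)"
    proof (rule summable_on_Un_disjoint)
      have "h summable_on (SL2Z - ?E)" using h summable_on_subset_banach by blast
      then show "(\<lambda>M. if M \<in> ?E then C M else h M) summable_on (SL2Z - ?E)"
        by (rule summable_on_cong[THEN iffD1, rotated]) auto
    qed (use finite_near_set[OF \<zz> z0u] in auto)
    moreover have "(SL2Z - ?E) \<union> ?E = SL2Z" using near_set_subset by blast
    ultimately show ?thesis by simp
  qed
  have b1: "norm (phi m n \<zz> M z) \<le> (if M \<in> ?E then C M else a M)" "norm (phi_g m n \<zz> M z) \<le> (if M \<in> ?E then C M else b M)"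
    if "M \<in> SL2Z" "z \<in> ball z0 r" for M z
    using C[OF that] ab(3,4)[of M z] that r(2) by auto
  have ru: "ball z0 r \<subseteq> uhp - modular_orbit \<zz>" using r(3) r1(2) by blast
  then have ru': "ball z0 r \<subseteq> uhp" by blast
  show thesis
  proof (rule that[OF r(1) ru])
    show "harm m (\<lambda>z. \<Sum>\<^sub>\<infinity>M\<in>SL2Z. phi m n \<zz> M z) (\<lambda>z. \<Sum>\<^sub>\<infinity>M\<in>SL2Z. phi_g m n \<zz> M z) (ball z0 r)"
      by (rule harm_infsum(1)[OF r(1) ru' harm b1(1) split[OF ab(1)] b1(2) split[OF ab(2)]])
    show "((\<lambda>M. (D_op ^^ (m + 1)) (phi m n \<zz> M) z0) has_sum (D_op ^^ (m + 1)) (\<lambda>z. \<Sum>\<^sub>\<infinity>M\<in>SL2Z. phi m n \<zz> M z) z0) SL2Z"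
      by (rule harm_infsum(2)[OF r(1) ru' harm b1(1) split[OF ab(1)] b1(2) split[OF ab(2)]]) (use r in auto)
  qed
qed

lemma poincare_cusp_bounded:
  obtains B Y where "\<And>z. Im z > Y \<Longrightarrow> z \<in> uhp \<Longrightarrow> norm (\<Sum>\<^sub>\<infinity>M\<in>SL2Z. phi m n \<zz> M z) \<le> B"
proof -
  have m4: "m + 2 \<ge> 4" using m by simp
  obtain K where K: "K > 0" "\<And>z F. z \<in> uhp \<Longrightarrow> Im z \<ge> 1 \<Longrightarrow> finite F \<Longrightarrow> F \<subseteq> SL2Z \<Longrightarrow>
    (\<Sum>M\<in>F. 1 / norm (lin (cnj \<zz>) M z) ^ (m + 2)) \<le> K / Im z ^ (m + 2 - 1)"
    and s: "\<And>z. z \<in> uhp \<Longrightarrow> (\<lambda>M. 1 / norm (lin (cnj \<zz>) M z) ^ (m + 2)) summable_on SL2Z"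
    by (rule lin_power_sum_le[OF \<zz> m4]) (rule that; assumption)
  define \<delta> where "\<delta> = min 1 (Im \<zz>)"
  have \<delta>: "\<delta> > 0" using \<zz> by (simp add: \<delta>_def uhp_iff)
  \<comment> \<open>Above this height
    \<open>4 * Im \<zz> * Im z \<le> 3/4 * (\<delta> * Im z)\<^sup>2\<close>, so that every matrix
    satisfies the condition for the far bound.\<close>
  define Y where "Y = max 1 (16 * Im \<zz> / (3 * \<delta>\<^sup>2))"
  have pb: "phi_bound m n \<zz> \<ge> 0" using \<zz> by (simp add: phi_bound_def uhp_iff)
  show thesis
  proof (rule that)
    fix z assume z: "Im z > Y" "z \<in> uhp"
    have z1: "Im z \<ge> 1" using z by (simp add: Y_def)
    let ?c = "phi_bound m n \<zz> * Im z ^ (m + 1)"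
    have le: "norm (phi m n \<zz> M z) \<le> ?c * (1 / norm (lin (cnj \<zz>) M z) ^ (m + 2))" if M: "M \<in> SL2Z" for M
    proof -
      have "(\<delta> * Im z)\<^sup>2 \<le> (norm (lin (cnj \<zz>) M z))\<^sup>2"
        using norm_lin_ge[OF M \<zz> z(2)] \<delta> z1 by (intro power_mono) (auto simp: \<delta>_def)
      moreover have "4 * Im \<zz> * Im z \<le> 3/4 * (\<delta> * Im z)\<^sup>2"
      proof -
        have "16 * Im \<zz> / (3 * \<delta>\<^sup>2) \<le> Im z" using z by (simp add: Y_def)
        then have "16 * Im \<zz> \<le> 3 * \<delta>\<^sup>2 * Im z" using \<delta> by (simp add: field_simps)
        then have "16 * Im \<zz> * Im z \<le> 3 * \<delta>\<^sup>2 * Im z * Im z" using z1 by (intro mult_right_mono) auto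
        then show ?thesis by (simp add: power2_eq_square mult_ac)
      qed
      ultimately have "(norm (lin \<zz> M z))\<^sup>2 \<ge> (norm (lin (cnj \<zz>) M z))\<^sup>2 / 4"
        using norm_lin_cnj_minus[OF M, of \<zz> z] by linarith
      then have "(norm (lin (cnj \<zz>) M z) / 2)\<^sup>2 \<le> (norm (lin \<zz> M z))\<^sup>2" by (simp add: power_divide)
      then have "norm (lin \<zz> M z) \<ge> norm (lin (cnj \<zz>) M z) / 2" by (rule power2_le_imp_le) simp
      from norm_phi_le(1)[OF M \<zz> z(2) this, of m n] show ?thesis by simp
    qed
    have cs: "(\<lambda>M. ?c * (1 / norm (lin (cnj \<zz>) M z) ^ (m + 2))) summable_on SL2Z" by (intro summable_on_cmult_right s z)
    have ss: "(\<lambda>M. phi m n \<zz> M z) summable_on SL2Z" by (rule summable_on_dominated[OF cs le])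
    have "norm (\<Sum>\<^sub>\<infinity>M\<in>SL2Z. phi m n \<zz> M z) \<le> (\<Sum>\<^sub>\<infinity>M\<in>SL2Z. ?c * (1 / norm (lin (cnj \<zz>) M z) ^ (m + 2)))"
      by (rule norm_infsum_le[OF has_sum_infsum[OF ss] has_sum_infsum[OF cs] le])
    also have "\<dots> \<le> phi_bound m n \<zz> * K"
    proof (rule infsum_le_finite_sums[OF cs])
      fix F assume F: "finite F" "F \<subseteq> SL2Z"
      have "(\<Sum>M\<in>F. ?c * (1 / norm (lin (cnj \<zz>) M z) ^ (m + 2))) = ?c * (\<Sum>M\<in>F. 1 / norm (lin (cnj \<zz>) M z) ^ (m + 2))"
        by (simp only: sum_distrib_left)
      also have "\<dots> \<le> ?c * (K / Im z ^ (m + 2 - 1))"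
        using K(2)[OF z(2) z1 F] pb z1 by (intro mult_left_mono) auto
      also have "\<dots> = phi_bound m n \<zz> * K" using z1 by simp
      finally show "(\<Sum>M\<in>F. ?c * (1 / norm (lin (cnj \<zz>) M z) ^ (m + 2))) \<le> phi_bound m n \<zz> * K" .
    qed
    finally show "norm (\<Sum>\<^sub>\<infinity>M\<in>SL2Z. phi m n \<zz> M z) \<le> phi_bound m n \<zz> * K" .
  qed
qed

end

lemma ephi_scale:
  assumes "c \<noteq> 0" shows "ephi m n (c * l) (c * u) = c ^ m * ephi m n l u"
  using assms by (simp add: ephi_def power_mult_distrib)

lemma phi_mult_right:
  assumes "M \<in> SL2Z" "N \<in> SL2Z" "z \<in> uhp"
  shows "phi m n \<zz> (M ** N) z = aut N z ^ m * phi m n \<zz> M (moebius N z)"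
  unfolding phi_def lin_mult[OF assms] using aut_nonzero[OF assms(2,3)] by (rule ephi_scale)

lemma poincare_slash:
  assumes N: "N \<in> SL2Z" and z: "z \<in> uhp"
  shows "aut N z ^ m * (\<Sum>\<^sub>\<infinity>M\<in>SL2Z. phi m n \<zz> M (moebius N z)) = (\<Sum>\<^sub>\<infinity>M\<in>SL2Z. phi m n \<zz> M z)"
proof -
  have "(\<Sum>\<^sub>\<infinity>M\<in>SL2Z. phi m n \<zz> M z) = (\<Sum>\<^sub>\<infinity>M\<in>SL2Z. phi m n \<zz> (M ** N) z)"
    using infsum_reindex_bij_betw[OF bij_betw_SL2Z_right[OF N], of "\<lambda>M. phi m n \<zz> M z"] by simp
  also have "\<dots> = (\<Sum>\<^sub>\<infinity>M\<in>SL2Z. aut N z ^ m * phi m n \<zz> M (moebius N z))"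
    by (rule infsum_cong) (rule phi_mult_right[OF _ N z])
  also have "\<dots> = aut N z ^ m * (\<Sum>\<^sub>\<infinity>M\<in>SL2Z. phi m n \<zz> M (moebius N z))"
    by (rule infsum_cmult_right')
  finally show ?thesis by simp
qed

section \<open>The disc model\<close>

definition disc_coeff :: "nat \<Rightarrow> nat \<Rightarrow> complex \<Rightarrow> complex" where
  "disc_coeff m j X = of_real (altbin m j) * X ^ j"

lemma disc_coeff_weight: "(\<Sum>j\<le>m. X ^ j * cnj (disc_coeff m j X)) = (1 - X * cnj X) ^ m"
proof -
  have "(\<Sum>j\<le>m. X ^ j * cnj (disc_coeff m j X)) = (\<Sum>j\<le>m. of_real (altbin m j) * (X * cnj X) ^ j)"
    by (simp add: disc_coeff_def power_mult_distrib mult_ac)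
  then show ?thesis by (simp only: altbin_sum)
qed

lemma disc_coeff_holomorphic: "disc_coeff m j holomorphic_on A"
  unfolding disc_coeff_def by (intro holomorphic_intros)

text \<open>The inverse of \<open>ell_X z0\<close>; it sends 0 to \<open>z0\<close> and the unit
  disc into the half-plane.\<close>

definition from_disc :: "complex \<Rightarrow> complex \<Rightarrow> complex" where
  "from_disc z0 X = (z0 - cnj z0 * X) / (1 - X)"

lemma from_disc_deriv:
  assumes "X \<noteq> 1"
  shows "(from_disc z0 has_field_derivative 2 * \<i> * of_real (Im z0) / (1 - X)\<^sup>2) (at X)"
proof -
  have e: "(- cnj z0) * (1 - X) - (z0 - cnj z0 * X) * (- 1) = 2 * \<i> * of_real (Im z0)"
    by (simp add: complex_eq_iff algebra_simps)
  have "((\<lambda>X. (z0 - cnj z0 * X) / (1 - X)) has_field_derivative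
     ((- cnj z0) * (1 - X) - (z0 - cnj z0 * X) * (- 1)) / ((1 - X) * (1 - X))) (at X)"
    using assms by (auto intro!: derivative_eq_intros)
  then show ?thesis unfolding e by (simp add: from_disc_def[abs_def] power2_eq_square)
qed

lemma from_disc_minus:
  assumes "X \<noteq> 1" shows "from_disc z0 X - z0 = X * (2 * \<i> * of_real (Im z0)) / (1 - X)"
proof -
  have "z0 - cnj z0 = 2 * \<i> * of_real (Im z0)" by (simp add: complex_eq_iff)
  moreover have "from_disc z0 X - z0 = X * (z0 - cnj z0) / (1 - X)"
    using assms by (simp add: from_disc_def field_simps)
  ultimately show ?thesis by simp
qed

lemma Im_from_disc:
  assumes "X \<noteq> 1" shows "of_real (Im (from_disc z0 X)) * ((1 - X) * cnj (1 - X)) = of_real (Im z0) * (1 - X * cnj X)"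
proof -
  have "(2 * \<i>) * of_real (Im (from_disc z0 X)) = from_disc z0 X - cnj (from_disc z0 X)"
    by (simp add: complex_eq_iff)
  also have "\<dots> = (z0 - cnj z0) * (1 - X * cnj X) / ((1 - X) * cnj (1 - X))"
  proof -
    have n: "1 - X \<noteq> 0" "1 - cnj X \<noteq> 0" using assms by (auto simp: complex_eq_iff)
    have "(z0 - cnj z0 * X) / (1 - X) - (cnj z0 - z0 * cnj X) / (1 - cnj X) =
        ((z0 - cnj z0 * X) * (1 - cnj X) - (cnj z0 - z0 * cnj X) * (1 - X)) / ((1 - X) * (1 - cnj X))"
      by (rule diff_frac_eq[OF n])
    also have "(z0 - cnj z0 * X) * (1 - cnj X) - (cnj z0 - z0 * cnj X) * (1 - X) = (z0 - cnj z0) * (1 - X * cnj X)"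
      by (simp add: algebra_simps)
    finally show ?thesis by (simp add: from_disc_def)
  qed
  also have "z0 - cnj z0 = (2 * \<i>) * of_real (Im z0)" by (simp add: complex_eq_iff)
  finally have "(2 * \<i>) * of_real (Im (from_disc z0 X)) = (2 * \<i>) * (of_real (Im z0) * (1 - X * cnj X) / ((1 - X) * cnj (1 - X)))"
    by simp
  then have "of_real (Im (from_disc z0 X)) = of_real (Im z0) * (1 - X * cnj X) / ((1 - X) * cnj (1 - X))"
    by (subst (asm) mult_left_cancel) auto
  moreover have "(1 - X) * cnj (1 - X) \<noteq> 0" using assms by (auto simp: complex_eq_iff)
  ultimately show ?thesis by (metis nonzero_eq_divide_eq)
qed

lemma Im_from_disc':
  assumes "norm X < 1" shows "Im (from_disc z0 X) * (norm (1 - X))\<^sup>2 = Im z0 * (1 - (norm X)\<^sup>2)"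
proof -
  have X: "X \<noteq> 1" using assms by auto
  have "complex_of_real (Im (from_disc z0 X) * (norm (1 - X))\<^sup>2) = complex_of_real (Im z0 * (1 - (norm X)\<^sup>2))"
    using Im_from_disc[OF X, of z0] unfolding complex_norm_square[symmetric] by simp
  then show ?thesis by (simp only: of_real_eq_iff)
qed

lemma from_disc_uhp:
  assumes "norm X < 1" "z0 \<in> uhp" shows "from_disc z0 X \<in> uhp"
proof -
  have "(norm X)\<^sup>2 < 1" using assms(1) by (simp add: power_less_one_iff abs_square_less_1)
  then have "Im (from_disc z0 X) * (norm (1 - X))\<^sup>2 > 0"
    unfolding Im_from_disc'[OF assms(1)] using assms(2) by (simp add: uhp_iff)
  then show ?thesis by (simp add: uhp_iff zero_less_mult_iff)
qed

text \<open>Since \<open>Im z * norm (1 - X) ^ 2 = Im z0 * (1 - norm X ^ 2)\<close>, the factor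
  \<open>(1 - X) ^ m\<close> turns the weight \<open>Im z ^ m\<close> into the rotation-invariant
  weight \<open>(1 - norm X ^ 2) ^ m\<close>.\<close>

lemma wharm_disc:
  assumes F: "harm m F g S" and \<rho>: "\<rho> \<le> 1" and sub: "\<And>X. norm X < \<rho> \<Longrightarrow> from_disc z0 X \<in> S"
  shows "wharm m (disc_coeff m) (\<lambda>X. F (from_disc z0 X) * (1 - X) ^ m)
    (\<lambda>X. of_real (Im z0) ^ m * g (from_disc z0 X) * (2 * \<i> * of_real (Im z0)) / (1 - X) ^ (m + 2)) (ball 0 \<rho>)"
  unfolding wharm_def
proof (intro conjI ballI)
  have ne1: "\<And>X::complex. X \<in> ball 0 \<rho> \<Longrightarrow> X \<noteq> 1"
    using \<rho> by (auto simp: dist_norm)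
  have "from_disc z0 holomorphic_on ball 0 \<rho>"
    unfolding from_disc_def by (intro holomorphic_intros) (use ne1 in auto)
  then have "(g \<circ> from_disc z0) holomorphic_on ball 0 \<rho>"
    by (rule holomorphic_on_compose_gen[OF _ harm_holomorphic[OF F]]) (use sub in auto)
  then have gh: "(\<lambda>X. g (from_disc z0 X)) holomorphic_on ball 0 \<rho>" by (simp add: o_def)
  show "(\<lambda>X. of_real (Im z0) ^ m * g (from_disc z0 X) * (2 * \<i> * of_real (Im z0)) / (1 - X) ^ (m + 2)) holomorphic_on ball 0 \<rho>"
    by (intro holomorphic_on_divide holomorphic_on_mult holomorphic_on_power holomorphic_on_diff holomorphic_on_const
        holomorphic_on_ident gh) (use ne1 in auto)
  fix X :: complex assume X: "X \<in> ball 0 \<rho>"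
  have n1: "X \<noteq> 1" using ne1[OF X] .
  have zS: "from_disc z0 X \<in> S" using sub X by simp
  let ?z = "from_disc z0 X" let ?d = "2 * \<i> * of_real (Im z0) / (1 - X)\<^sup>2"
  obtain p where p: "has_wirtinger F p (of_real (Im ?z) ^ m * cnj (g ?z)) ?z" using harmE[OF F zS] .
  have "((\<lambda>X. (1 - X) ^ m) has_field_derivative of_nat m * (1 - X) ^ (m - 1) * (0 - 1)) (at X)"
    by (rule derivative_eq_intros refl | simp)+
  from has_wirtinger_mult[OF has_wirtinger_chain[OF p from_disc_deriv[OF n1]] has_wirtinger_holo[OF this]]
  have "\<exists>q. has_wirtinger (\<lambda>X. F (from_disc z0 X) * (1 - X) ^ m) q
     (F ?z * 0 + of_real (Im ?z) ^ m * cnj (g ?z) * cnj ?d * (1 - X) ^ m) X" by blast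
  moreover have "F ?z * 0 + of_real (Im ?z) ^ m * cnj (g ?z) * cnj ?d * (1 - X) ^ m =
     (\<Sum>j\<le>m. X ^ j * cnj (disc_coeff m j X)) * cnj (of_real (Im z0) ^ m * g ?z * (2 * \<i> * of_real (Im z0)) / (1 - X) ^ (m + 2))"
  proof -
    have nz: "(1 - X) * cnj (1 - X) \<noteq> 0" using n1 by (auto simp: complex_eq_iff)
    have eq: "of_real (Im ?z) = of_real (Im z0) * (1 - X * cnj X) / ((1 - X) * cnj (1 - X))"
      using Im_from_disc[OF n1, of z0] nz by (metis nonzero_eq_divide_eq)
    have alg: "C * 0 + (y0 * w / (a * b)) ^ m * G * (E / b\<^sup>2) * a ^ m = w ^ m * (y0 ^ m * G * E / b ^ (m + 2))"
      if "a \<noteq> 0" for a b y0 w G E C :: complex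
      using that by (simp add: power_divide power_mult_distrib power_add power2_eq_square mult_ac)
    show ?thesis
      using alg[of "1 - X" "F ?z" "of_real (Im z0)" "1 - X * cnj X" "cnj (1 - X)" "cnj (g ?z)" "cnj (2 * \<i> * of_real (Im z0))"] n1
      unfolding disc_coeff_weight eq
      by (simp only: complex_cnj_mult complex_cnj_divide complex_cnj_power complex_cnj_complex_of_real
          right_minus_eq not_False_eq_True simp_thms eq_commute[of 1 X])
  qed
  ultimately show "\<exists>p. has_wirtinger (\<lambda>X. F (from_disc z0 X) * (1 - X) ^ m) p
     ((\<Sum>j\<le>m. X ^ j * cnj (disc_coeff m j X)) * cnj (of_real (Im z0) ^ m * g ?z * (2 * \<i> * of_real (Im z0)) / (1 - X) ^ (m + 2))) X"
    by simp
qed simp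

subsection \<open>Circular means\<close>

definition circ :: "real \<Rightarrow> real \<Rightarrow> complex" where
  "circ r t = of_real r * exp (2 * of_real pi * \<i> * of_real t)"

lemma norm_circ: "r \<ge> 0 \<Longrightarrow> norm (circ r t) = r"
  by (simp add: circ_def norm_mult norm_exp_eq_Re)

lemma circ_mean_holomorphic:
  assumes f: "f holomorphic_on ball 0 \<rho>" and r: "0 < r" "r < \<rho>"
  shows "((\<lambda>t. f (circ r t) / circ r t ^ j) has_integral (deriv ^^ j) f 0 / fact j) {0..1}"
proof -
  have "continuous_on (cball 0 r) f" "f holomorphic_on ball 0 r"
    using r by (intro holomorphic_on_imp_continuous_on holomorphic_on_subset[OF f]; auto)+
  then have "((\<lambda>u. f u / (u - 0) ^ Suc j) has_contour_integral (2 * pi * \<i>) / fact j * (deriv ^^ j) f 0) (circlepath 0 r)"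
    by (intro Cauchy_has_contour_integral_higher_derivative_circlepath) (use r in auto)
  then have "((\<lambda>t. f (circlepath 0 r t) / circlepath 0 r t ^ Suc j * vector_derivative (circlepath 0 r) (at t within {0..1}))
      has_integral (2 * pi * \<i>) / fact j * (deriv ^^ j) f 0) {0..1}"
    by (simp add: has_contour_integral_def)
  then have "((\<lambda>t. (2 * of_real pi * \<i>) * (f (circ r t) / circ r t ^ j)) has_integral (2 * pi * \<i>) / fact j * (deriv ^^ j) f 0) {0..1}"
  proof (rule has_integral_eq[rotated])
    fix t :: real assume t: "t \<in> {0..1}"
    have c: "circlepath 0 r t = circ r t" by (simp add: circlepath circ_def)
    have "vector_derivative (circlepath 0 r) (at t within {0..1}) = 2 * of_real pi * \<i> * circ r t"
      using t by (simp add: vector_derivative_circlepath01 circ_def)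
    moreover have "circ r t \<noteq> 0" using r by (simp add: circ_def)
    ultimately show "f (circlepath 0 r t) / circlepath 0 r t ^ Suc j * vector_derivative (circlepath 0 r) (at t within {0..1}) =
        (2 * of_real pi * \<i>) * (f (circ r t) / circ r t ^ j)"
      unfolding c by simp
  qed
  from has_integral_mult_right[OF this, of "1 / (2 * of_real pi * \<i>)"] show ?thesis by simp
qed

text \<open>On the circle \<open>cnj X = r ^ 2 / X\<close>, so the mean is the conjugate of a Taylor
  coefficient, scaled by \<open>r ^ (2 * j)\<close>.\<close>

lemma circ_mean_cnj:
  assumes f: "f holomorphic_on ball 0 \<rho>" and r: "0 < r" "r < \<rho>"
  shows "((\<lambda>t. circ r t ^ j * cnj (f (circ r t))) has_integral of_real (r ^ (2 * j)) * cnj ((deriv ^^ j) f 0 / fact j)) {0..1}"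
proof -
  have "((\<lambda>t. cnj (f (circ r t) / circ r t ^ j)) has_integral cnj ((deriv ^^ j) f 0 / fact j)) {0..1}"
    using has_integral_linear[OF circ_mean_holomorphic[OF assms] bounded_linear_cnj] by (simp add: o_def)
  from has_integral_mult_right[OF this, of "of_real (r ^ (2 * j))"]
  show ?thesis
  proof (rule has_integral_eq[rotated])
    fix t
    have "circ r t * cnj (circ r t) = of_real (r\<^sup>2)"
      using norm_circ[of r t] r by (simp add: complex_norm_square[symmetric])
    then have "circ r t ^ j * cnj (circ r t) ^ j = of_real (r ^ (2 * j))"
      by (metis of_real_power power_mult power_mult_distrib)
    moreover have "circ r t \<noteq> 0" using r by (simp add: circ_def)
    ultimately show "of_real (r ^ (2 * j)) * cnj (f (circ r t) / circ r t ^ j) = circ r t ^ j * cnj (f (circ r t))"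
      by (simp add: field_simps)
  qed
qed

lemma higher_deriv_power_mult:
  assumes G: "G holomorphic_on ball 0 \<rho>" and \<rho>: "\<rho> > 0"
  shows "i < j \<Longrightarrow> (deriv ^^ i) (\<lambda>X. X ^ j * G X) 0 = 0" and "(deriv ^^ j) (\<lambda>X. X ^ j * G X) 0 = fact j * G 0"
proof -
  have p: "(deriv ^^ a) (\<lambda>X. X ^ j) 0 = pochhammer (of_nat (Suc j - a)) a * (0::complex) ^ (j - a)" for a
    using higher_deriv_power[of a 0 j 0] by simp
  have L: "(deriv ^^ i) (\<lambda>X. X ^ j * G X) 0 =
      (\<Sum>a=0..i. of_nat (i choose a) * (deriv ^^ a) (\<lambda>X. X ^ j) 0 * (deriv ^^ (i - a)) G 0)" for i
    by (rule higher_deriv_mult[OF _ G]) (use \<rho> in \<open>auto intro!: holomorphic_intros\<close>)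
  show "(deriv ^^ i) (\<lambda>X. X ^ j * G X) 0 = 0" if "i < j"
    unfolding L p using that by (intro sum.neutral) auto
  have "(deriv ^^ j) (\<lambda>X. X ^ j * G X) 0 = (\<Sum>a\<in>{j}. of_nat (j choose a) * (deriv ^^ a) (\<lambda>X. X ^ j) 0 * (deriv ^^ (j - a)) G 0)"
    unfolding L p by (intro sum.mono_neutral_right) auto
  then show "(deriv ^^ j) (\<lambda>X. X ^ j * G X) 0 = fact j * G 0"
    unfolding p by (simp add: pochhammer_fact[symmetric] add.commute)
qed

text \<open>On a circle around the origin the conjugate-holomorphic parts of a harmonic function have mean
  zero, and after multiplication by \<open>X\<close> they isolate the value of \<open>G\<close> at the centre.\<close>

lemma disc_means:
  assumes \<Phi>: "wharm m (disc_coeff m) \<Phi> G (ball 0 \<rho>)" and r: "0 < r" "r < \<rho>"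
  shows "((\<lambda>t. \<Phi> (circ r t)) has_integral \<Phi> 0) {0..1}"
    and "((\<lambda>t. circ r t * \<Phi> (circ r t)) has_integral of_real (\<Sum>j\<le>m. altbin m j * r ^ (2 * (j + 1)) / real (j + 1)) * cnj (G 0)) {0..1}"
proof -
  have \<rho>: "\<rho> > 0" using r by simp
  have 0: "(0::complex) \<in> ball 0 \<rho>" using \<rho> by simp
  obtain f H where f: "f holomorphic_on ball 0 \<rho>"
    and H: "\<And>j z. z \<in> ball 0 \<rho> \<Longrightarrow> (H j has_field_derivative disc_coeff m j z * G z) (at z)"
    and H0: "\<And>j. H j 0 = 0" and rep: "\<And>z. \<Phi> z = f z + (\<Sum>j\<le>m. z ^ j * cnj (H j z))"
    using wharm_rep_ex[OF \<Phi> disc_coeff_holomorphic convex_ball 0] by blast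
  have Hh: "H j holomorphic_on ball 0 \<rho>" for j
    unfolding holomorphic_on_open[OF open_ball] using H by blast
  have Gh: "G holomorphic_on ball 0 \<rho>" using wharm_holomorphic[OF \<Phi>] .
  \<comment> \<open>The derivative of \<open>H j\<close> is \<open>altbin m j * X ^ j * G X\<close>,
    so the Taylor expansion of \<open>H j\<close> starts in degree \<open>j + 1\<close> with a
    multiple of \<open>G 0\<close>. A circular mean against \<open>X ^ j\<close> misses this term,
    one against \<open>X ^ (j + 1)\<close> picks it out.\<close>
  have Hd: "(deriv ^^ Suc i) (H j) 0 = of_real (altbin m j) * (deriv ^^ i) (\<lambda>X. X ^ j * G X) 0" for i j
  proof -
    have hol: "(\<lambda>X. X ^ j * G X) holomorphic_on ball 0 \<rho>" by (intro holomorphic_intros Gh)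
    have "(deriv ^^ Suc i) (H j) 0 = (deriv ^^ i) (deriv (H j)) 0" by (simp only: funpow_Suc_right o_def)
    also have "\<dots> = (deriv ^^ i) (\<lambda>X. of_real (altbin m j) * (X ^ j * G X)) 0"
    proof (rule higher_deriv_transform_within_open[OF _ _ open_ball 0])
      show "deriv (H j) holomorphic_on ball 0 \<rho>" by (rule holomorphic_deriv[OF Hh open_ball])
      show "(\<lambda>X. of_real (altbin m j) * (X ^ j * G X)) holomorphic_on ball 0 \<rho>" by (intro holomorphic_on_mult holomorphic_on_const hol)
      show "deriv (H j) w = of_real (altbin m j) * (w ^ j * G w)" if "w \<in> ball 0 \<rho>" for w
        using DERIV_imp_deriv[OF H[OF that]] by (simp add: disc_coeff_def)
    qed
    also have "\<dots> = of_real (altbin m j) * (deriv ^^ i) (\<lambda>X. X ^ j * G X) 0"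
      by (rule higher_deriv_cmult[OF hol 0 open_ball])
    finally show ?thesis .
  qed
  have fm: "((\<lambda>t. f (circ r t)) has_integral f 0) {0..1}"
    using circ_mean_holomorphic[OF f r, of 0] by simp
  have Hm: "((\<lambda>t. circ r t ^ j * cnj (H j (circ r t))) has_integral 0) {0..1}" for j
  proof -
    have "(deriv ^^ j) (H j) 0 = 0"
    proof (cases j)
      case (Suc i)
      then show ?thesis using Hd[of i j] higher_deriv_power_mult(1)[OF Gh \<rho>, of i j] by simp
    qed (simp add: H0)
    then show ?thesis using circ_mean_cnj[OF Hh r, of j j] by simp
  qed
  have "((\<lambda>t. f (circ r t) + (\<Sum>j\<le>m. circ r t ^ j * cnj (H j (circ r t)))) has_integral f 0 + (\<Sum>j\<le>m. 0)) {0..1}"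
    by (intro has_integral_add has_integral_sum fm Hm) auto
  moreover have "(\<Sum>j\<le>m. 0 ^ j * cnj (H j 0)) = 0" by (simp add: H0)
  ultimately show "((\<lambda>t. \<Phi> (circ r t)) has_integral \<Phi> 0) {0..1}" by (simp add: rep)
  have fm1: "((\<lambda>t. circ r t * f (circ r t)) has_integral 0) {0..1}"
    using circ_mean_holomorphic[of "\<lambda>X. X * f X", OF _ r, of 0] f by (simp add: holomorphic_intros)
  have Hm1: "((\<lambda>t. circ r t * (circ r t ^ j * cnj (H j (circ r t)))) has_integral of_real (altbin m j * r ^ (2 * (j + 1)) / real (j + 1)) * cnj (G 0)) {0..1}" for j
  proof -
    have "(deriv ^^ Suc j) (H j) 0 / fact (Suc j) = of_real (altbin m j / real (j + 1)) * G 0"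
      unfolding Hd higher_deriv_power_mult(2)[OF Gh \<rho>] by (simp add: field_simps del: of_nat_Suc)
    then show ?thesis using circ_mean_cnj[OF Hh r, of "Suc j" j] by (simp add: mult_ac)
  qed
  have "((\<lambda>t. circ r t * f (circ r t) + (\<Sum>j\<le>m. circ r t * (circ r t ^ j * cnj (H j (circ r t))))) has_integral
      0 + (\<Sum>j\<le>m. of_real (altbin m j * r ^ (2 * (j + 1)) / real (j + 1)) * cnj (G 0))) {0..1}"
    by (intro has_integral_add has_integral_sum fm1 Hm1) auto
  then show "((\<lambda>t. circ r t * \<Phi> (circ r t)) has_integral of_real (\<Sum>j\<le>m. altbin m j * r ^ (2 * (j + 1)) / real (j + 1)) * cnj (G 0)) {0..1}"
    by (simp add: rep distrib_left sum_distrib_left sum_distrib_right)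
qed

text \<open>The sum is the integral of \<open>(1 - s) ^ m\<close> from 0 to
  \<open>r\<^sup>2\<close>, bounded below through the smallest value of the integrand.\<close>

lemma kappa_ge:
  assumes "0 < r" "r < 1"
  shows "(\<Sum>j\<le>m. altbin m j * r ^ (2 * (j + 1)) / real (j + 1)) \<ge> r\<^sup>2 * (1 - r\<^sup>2) ^ m"
proof -
  define W where "W s = (\<Sum>j\<le>m. altbin m j * (s ^ (j + 1) / real (j + 1)))" for s
  have der: "(W has_field_derivative (1 - s) ^ m) (at s)" for s
  proof -
    have "((\<lambda>s. s ^ (j + 1) / real (j + 1)) has_field_derivative s ^ j) (at s)" for j
      by (rule derivative_eq_intros refl | simp)+
    then have "(W has_field_derivative (\<Sum>j\<le>m. altbin m j * s ^ j)) (at s)"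
      unfolding W_def by (intro DERIV_sum DERIV_cmult)
    then show ?thesis by (simp only: altbin_sum_real)
  qed
  have r2: "0 < r\<^sup>2" "r\<^sup>2 < 1" using assms by (auto simp: power_less_one_iff)
  then obtain u where u: "0 < u" "u < r\<^sup>2" "W (r\<^sup>2) - W 0 = (r\<^sup>2 - 0) * (1 - u) ^ m"
    using MVT2[of 0 "r\<^sup>2" W "\<lambda>s. (1 - s) ^ m"] der by auto
  have "(1 - u) ^ m \<ge> (1 - r\<^sup>2) ^ m" using u r2 by (intro power_mono) auto
  then have "r\<^sup>2 * (1 - r\<^sup>2) ^ m \<le> r\<^sup>2 * (1 - u) ^ m" using r2 by (intro mult_left_mono) auto
  moreover have "W 0 = 0" by (simp add: W_def)
  moreover have "W (r\<^sup>2) = (\<Sum>j\<le>m. altbin m j * r ^ (2 * (j + 1)) / real (j + 1))"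
    unfolding W_def power_mult by (simp add: power_mult_distrib power2_eq_square)
  ultimately show ?thesis using u(3) by simp
qed

lemma circ_integral_bound:
  assumes "(f has_integral I) {0..1::real}" "\<And>t. norm (f t) \<le> B" shows "norm (I :: complex) \<le> B"
proof -
  have "B \<ge> 0" using assms(2)[of 0] by (meson norm_ge_zero order_trans)
  then have "norm I \<le> B * measure lborel (cbox 0 (1::real))"
    using assms by (intro has_integral_bound[of B f I 0 1]) auto
  then show ?thesis by simp
qed

text \<open>A Cauchy estimate for \<open>g\<close>: the mean of \<open>X * F * (1 - X) ^ m\<close>
  over a small circle is an explicit positive multiple of the conjugate of the disc version of
  \<open>g\<close> at the centre.\<close>

lemma harm_interior_estimate:
  assumes F: "harm m F g S" and d: "0 < d" "d \<le> Im z0" and S: "cball z0 d \<subseteq> S"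
    and B: "\<And>z. z \<in> cball z0 d \<Longrightarrow> norm (F z) \<le> B"
  shows "norm (g z0) \<le> 2 * (4/3) ^ m * B / (Im z0 ^ m * d)"
proof -
  define y where "y = Im z0"
  have y: "y > 0" using d by (simp add: y_def)
  \<comment> \<open>With this choice the image of the slightly larger disc of radius
    \<open>\<rho>\<close> stays within distance \<open>10/11 * d\<close> of
    \<open>z0\<close>.\<close>
  define r where "r = d / (4 * y)"
  have r: "0 < r" "r \<le> 1/4" using d y by (simp_all add: r_def y_def field_simps)
  define \<rho> where "\<rho> = 5 / 4 * r"
  have \<rho>: "\<rho> \<le> 5/16" "r < \<rho>" using r by (simp_all add: \<rho>_def)
  have sub: "from_disc z0 X \<in> cball z0 d" if "norm X < \<rho>" for X
  proof -
    have n1: "X \<noteq> 1" using that \<rho> by auto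
    have "norm (1 - X) \<ge> 11/16" using norm_triangle_ineq2[of 1 X] that \<rho> by simp
    moreover have "norm (from_disc z0 X - z0) = norm X * (2 * y) / norm (1 - X)"
      unfolding from_disc_minus[OF n1] using y by (simp add: norm_mult norm_divide y_def)
    moreover have "norm X * (2 * y) / norm (1 - X) \<le> \<rho> * (2 * y) / (11/16)"
      using that y \<rho> r calculation(1) by (intro frac_le mult_right_mono) auto
    moreover have "\<rho> * (2 * y) / (11/16) = 10/11 * d" using y by (simp add: \<rho>_def r_def)
    ultimately show ?thesis using d by (simp add: dist_norm norm_minus_commute)
  qed
  have W: "wharm m (disc_coeff m) (\<lambda>X. F (from_disc z0 X) * (1 - X) ^ m)
    (\<lambda>X. of_real (Im z0) ^ m * g (from_disc z0 X) * (2 * \<i> * of_real (Im z0)) / (1 - X) ^ (m + 2)) (ball 0 \<rho>)"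
    by (rule wharm_disc[OF F]) (use \<rho> sub S in auto)
  define K where "K = (\<Sum>j\<le>m. altbin m j * r ^ (2 * (j + 1)) / real (j + 1))"
  have c0: "from_disc z0 0 = z0" by (simp add: from_disc_def)
  have "norm (of_real K * cnj (of_real (Im z0) ^ m * g (from_disc z0 0) * (2 * \<i> * of_real (Im z0)) / (1 - 0) ^ (m + 2))) \<le> r * (B * (5/4) ^ m)"
  proof (rule circ_integral_bound)
    show "((\<lambda>t. circ r t * (F (from_disc z0 (circ r t)) * (1 - circ r t) ^ m)) has_integral
       of_real K * cnj (of_real (Im z0) ^ m * g (from_disc z0 0) * (2 * \<i> * of_real (Im z0)) / (1 - 0) ^ (m + 2))) {0..1}"
      unfolding K_def by (rule disc_means(2)[OF W r(1) \<rho>(2)])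
    fix t
    have n: "norm (circ r t) = r" using norm_circ r by simp
    have "norm (1 - circ r t) \<le> 5/4" using norm_triangle_ineq4[of 1 "circ r t"] n r by simp
    moreover have "norm (F (from_disc z0 (circ r t))) \<le> B" using B sub n \<rho> by simp
    ultimately show "norm (circ r t * (F (from_disc z0 (circ r t)) * (1 - circ r t) ^ m)) \<le> r * (B * (5/4) ^ m)"
      unfolding norm_mult norm_power n using r by (intro mult_left_mono mult_mono power_mono) (auto intro: order_trans[OF norm_ge_zero])
  qed
  then have 1: "\<bar>K\<bar> * (y ^ m * norm (g z0) * (2 * y)) \<le> r * (B * (5/4) ^ m)"
    using y by (simp add: c0 norm_mult norm_power y_def)
  \<comment> \<open>The bound turns \<open>(1 - r\<^sup>2) ^ m\<close> into
    \<open>(15/16) ^ m\<close>; divided into the factor \<open>(5/4) ^ m\<close> from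
    \<open>1 - X\<close> it yields \<open>(4/3) ^ m\<close>.\<close>
  have "r\<^sup>2 \<le> (1/4)\<^sup>2" using r by (intro power_mono) auto
  then have r2: "r\<^sup>2 \<le> 1/16" by (simp add: power2_eq_square)
  have "K \<ge> r\<^sup>2 * (1 - r\<^sup>2) ^ m" unfolding K_def by (rule kappa_ge) (use r in auto)
  moreover have "r\<^sup>2 * (1 - r\<^sup>2) ^ m \<ge> r\<^sup>2 * (15/16) ^ m" using r2 by (intro mult_left_mono power_mono) auto
  ultimately have K: "K \<ge> r\<^sup>2 * (15/16) ^ m" by simp
  then have "r\<^sup>2 * (15/16) ^ m * (y ^ m * norm (g z0) * (2 * y)) \<le> \<bar>K\<bar> * (y ^ m * norm (g z0) * (2 * y))"
    using y by (intro mult_right_mono) auto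
  then have "r\<^sup>2 * (15/16) ^ m * (y ^ m * norm (g z0) * (2 * y)) \<le> r * (B * (5/4) ^ m)" using 1 by (rule order_trans)
  then have "norm (g z0) \<le> r * (B * (5/4) ^ m) / (r\<^sup>2 * (15/16) ^ m * (y ^ m * (2 * y)))"
    using r y by (simp add: pos_le_divide_eq mult_ac)
  also have "\<dots> = B * ((5/4) ^ m / (15/16) ^ m) / (r * (y ^ m * (2 * y)))"
    using r by (simp add: power2_eq_square)
  also have "(5/4) ^ m / (15/16) ^ m = (4/3 :: real) ^ m" by (simp flip: power_divide)
  also have "r * (y ^ m * (2 * y)) = y ^ m * d / 2" using y by (simp add: r_def field_simps)
  finally show ?thesis by (simp add: y_def mult_ac)
qed

text \<open>The mean value property is used on the circle of radius \<open>1/2\<close>. Maximality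
  bounds \<open>norm (F * (1 - X) ^ m)\<close> there by
  \<open>sqrt ((3/4) ^ m) * norm (F z0)\<close>, and a contraction factor below 1 forces the value
  0.\<close>

lemma harm_max_principle:
  assumes F: "harm m F g uhp" and m: "m \<ge> 1" and z0: "z0 \<in> uhp"
    and max: "\<And>z. z \<in> uhp \<Longrightarrow> (norm (F z))\<^sup>2 / Im z ^ m \<le> (norm (F z0))\<^sup>2 / Im z0 ^ m"
  shows "F z0 = 0"
proof -
  have W: "wharm m (disc_coeff m) (\<lambda>X. F (from_disc z0 X) * (1 - X) ^ m)
    (\<lambda>X. of_real (Im z0) ^ m * g (from_disc z0 X) * (2 * \<i> * of_real (Im z0)) / (1 - X) ^ (m + 2)) (ball 0 1)"
    by (rule wharm_disc[OF F]) (use from_disc_uhp z0 in auto)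
  have c0: "from_disc z0 0 = z0" by (simp add: from_disc_def)
  have "norm (F (from_disc z0 0) * (1 - 0) ^ m) \<le> sqrt ((3/4) ^ m) * norm (F z0)"
  proof (rule circ_integral_bound)
    show "((\<lambda>t. F (from_disc z0 (circ (1/2) t)) * (1 - circ (1/2) t) ^ m) has_integral F (from_disc z0 0) * (1 - 0) ^ m) {0..1}"
      by (rule disc_means(1)[OF W]) auto
    fix t
    let ?X = "circ (1/2) t" let ?z = "from_disc z0 ?X"
    have n: "norm ?X = 1/2" by (simp add: norm_circ)
    then have zu: "?z \<in> uhp" using from_disc_uhp z0 by simp
    have Im: "Im ?z * (norm (1 - ?X))\<^sup>2 = Im z0 * (3/4)" using Im_from_disc'[of ?X z0] n by (simp add: power2_eq_square)
    have "(norm (F ?z))\<^sup>2 \<le> (norm (F z0))\<^sup>2 / Im z0 ^ m * Im ?z ^ m"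
      using max[OF zu] zu by (simp add: uhp_iff divide_le_eq)
    then have "(norm (F ?z))\<^sup>2 * ((norm (1 - ?X))\<^sup>2) ^ m \<le> (norm (F z0))\<^sup>2 / Im z0 ^ m * Im ?z ^ m * ((norm (1 - ?X))\<^sup>2) ^ m"
      by (intro mult_right_mono) auto
    also have "\<dots> = (norm (F z0))\<^sup>2 / Im z0 ^ m * (Im z0 * (3/4)) ^ m"
      unfolding Im[symmetric] by (simp only: power_mult_distrib mult.assoc)
    also have "\<dots> = (3/4) ^ m * (norm (F z0))\<^sup>2" using z0 by (simp only: power_mult_distrib) (simp add: uhp_iff)
    finally have "(norm (F ?z * (1 - ?X) ^ m))\<^sup>2 \<le> (3/4) ^ m * (norm (F z0))\<^sup>2"
      by (simp add: norm_mult norm_power power_mult_distrib power_commutes flip: power_mult) (simp add: mult.commute)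
    also have "\<dots> = (sqrt ((3/4) ^ m) * norm (F z0))\<^sup>2" by (simp add: power_mult_distrib)
    finally show "norm (F ?z * (1 - ?X) ^ m) \<le> sqrt ((3/4) ^ m) * norm (F z0)"
      by (rule power2_le_imp_le) simp
  qed
  then have "norm (F z0) \<le> sqrt ((3/4) ^ m) * norm (F z0)" by (simp add: c0)
  moreover have "sqrt ((3/4) ^ m) < 1" using m by (simp add: power_less_one_iff)
  ultimately show ?thesis by (metis mult_less_cancel_right2 norm_le_zero_iff not_le)
qed

section \<open>Local structure near a singularity\<close>

definition bdd_at :: "(complex \<Rightarrow> complex) \<Rightarrow> complex \<Rightarrow> bool" where
  "bdd_at f w \<longleftrightarrow> (\<exists>C. eventually (\<lambda>z. norm (f z) \<le> C) (at w))"

lemma bdd_at_bigo: "f \<in> O[at w](\<lambda>_. 1) \<longleftrightarrow> bdd_at f w"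
proof
  assume "f \<in> O[at w](\<lambda>_. 1)"
  then obtain c where "eventually (\<lambda>z. norm (f z) \<le> c * norm (1::complex)) (at w)" by (auto elim: landau_o.bigE)
  then show "bdd_at f w" by (auto simp: bdd_at_def)
next
  assume "bdd_at f w"
  then obtain C where "eventually (\<lambda>z. norm (f z) \<le> C) (at w)" by (auto simp: bdd_at_def)
  then show "f \<in> O[at w](\<lambda>_. 1)" by (intro bigoI[of _ C]) simp
qed

lemma bdd_at_add: assumes "bdd_at f w" "bdd_at g w" shows "bdd_at (\<lambda>z. f z + g z) w"
proof -
  obtain C D where "eventually (\<lambda>z. norm (f z) \<le> C) (at w)" "eventually (\<lambda>z. norm (g z) \<le> D) (at w)"
    using assms by (auto simp: bdd_at_def)
  then have "eventually (\<lambda>z. norm (f z + g z) \<le> C + D) (at w)"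
    by eventually_elim (rule norm_triangle_mono)
  then show ?thesis by (auto simp: bdd_at_def)
qed

lemma bdd_at_mult: assumes "bdd_at f w" "bdd_at g w" shows "bdd_at (\<lambda>z. f z * g z) w"
proof -
  obtain C D where "eventually (\<lambda>z. norm (f z) \<le> C) (at w)" "eventually (\<lambda>z. norm (g z) \<le> D) (at w)"
    using assms by (auto simp: bdd_at_def)
  then have "eventually (\<lambda>z. norm (f z * g z) \<le> C * D) (at w)"
  proof eventually_elim
    case (elim z)
    then show ?case unfolding norm_mult by (intro mult_mono) (auto intro: order_trans[OF norm_ge_zero])
  qed
  then show ?thesis by (auto simp: bdd_at_def)
qed

lemma bdd_at_tendsto: assumes "(f \<longlongrightarrow> c) (at w)" shows "bdd_at f w"
proof -
  have "eventually (\<lambda>z. dist (f z) c < 1) (at w)" using tendstoD[OF assms, of 1] by simp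
  then have "eventually (\<lambda>z. norm (f z) \<le> norm c + 1) (at w)"
  proof eventually_elim
    case (elim z)
    then show ?case using norm_triangle_ineq2[of "f z" c] by (simp add: dist_norm)
  qed
  then show ?thesis by (auto simp: bdd_at_def)
qed

lemma bdd_at_isCont: "isCont f w \<Longrightarrow> bdd_at f w"
  using bdd_at_tendsto isCont_def by blast

lemma bdd_at_const: "bdd_at (\<lambda>_. c) w" by (rule bdd_at_isCont) simp

lemma bdd_at_cmult: "bdd_at f w \<Longrightarrow> bdd_at (\<lambda>z. c * f z) w"
  using bdd_at_mult[OF bdd_at_const] by blast

lemma bdd_at_diff: "bdd_at f w \<Longrightarrow> bdd_at g w \<Longrightarrow> bdd_at (\<lambda>z. f z - g z) w"
  using bdd_at_add[of f w "\<lambda>z. -1 * g z"] bdd_at_cmult[of g w "-1"] by simp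

lemma bdd_at_sum: "(\<And>i. i \<in> I \<Longrightarrow> bdd_at (f i) w) \<Longrightarrow> bdd_at (\<lambda>z. \<Sum>i\<in>I. f i z) w"
  by (induction I rule: infinite_finite_induct) (auto intro: bdd_at_add bdd_at_const)

lemma bdd_at_cong: assumes "bdd_at f w" "eventually (\<lambda>z. f z = g z) (at w)" shows "bdd_at g w"
proof -
  obtain C where "eventually (\<lambda>z. norm (f z) \<le> C) (at w)" using assms by (auto simp: bdd_at_def)
  with assms(2) have "eventually (\<lambda>z. norm (g z) \<le> C) (at w)" by eventually_elim simp
  then show ?thesis by (auto simp: bdd_at_def)
qed

lemma bdd_at_power_mono:
  assumes "bdd_at (\<lambda>z. (z - w) ^ N * f z) w" "N \<le> K" shows "bdd_at (\<lambda>z. (z - w) ^ K * f z) w"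
proof -
  have "bdd_at (\<lambda>z. (z - w) ^ (K - N) * ((z - w) ^ N * f z)) w"
    by (intro bdd_at_mult assms bdd_at_isCont continuous_intros)
  moreover have "(z - w) ^ (K - N) * ((z - w) ^ N * f z) = (z - w) ^ K * f z" for z
    using assms(2) by (simp flip: mult.assoc power_add)
  ultimately show ?thesis by simp
qed

lemma lin_one [simp]: "lin v (mat 1) z = z - v"
  by (simp add: lin_def mat_def)

lemma uhp_cnj_ne: "w \<in> uhp \<Longrightarrow> z \<in> uhp \<Longrightarrow> z - cnj w \<noteq> 0"
  by (auto simp: uhp_iff complex_eq_iff)

text \<open>A Laurent principal part in powers of \<open>(z - cnj w) / (z - w)\<close> rather than
  \<open>1 / (z - w)\<close>, since the former occur in the terms \<open>phi\<close>. In the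
  induction the leading coefficient is \<open>g1 w\<close>, and the difference quotient of
  \<open>g1\<close> shows that the order drops.\<close>

lemma remove_pole:
  assumes q: "q holomorphic_on ball w e - {w}" and e: "e > 0" "ball w e \<subseteq> uhp"
    and bd: "bdd_at (\<lambda>z. (z - w) ^ N * q z) w"
  shows "\<exists>c h. h holomorphic_on ball w e \<and> (\<forall>z\<in>ball w e - {w}. q z = h z + (\<Sum>j=1..N. c j * ((z - cnj w) / (z - w)) ^ j))"
  using q bd
proof (induction N arbitrary: q)
  case 0
  then have "\<exists>g. g holomorphic_on ball w e \<and> (\<forall>z\<in>ball w e - {w}. g z = q z)"
    using holomorphic_on_extend_bounded[of q "ball w e" w] e by (auto simp: bdd_at_def interior_open)
  then obtain g where "g holomorphic_on ball w e" "\<forall>z\<in>ball w e - {w}. g z = q z" by blast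
  then show ?case by (intro exI[of _ "\<lambda>_. 0"] exI[of _ g]) simp
next
  case (Suc N)
  have wu: "w \<in> uhp" using e by auto
  have ne: "z - cnj w \<noteq> 0" if "z \<in> ball w e" for z using uhp_cnj_ne wu that e(2) by blast
  let ?f = "\<lambda>z. (z - w) ^ Suc N * q z"
  have "?f holomorphic_on ball w e - {w}" by (intro holomorphic_intros Suc.prems)
  then have "\<exists>g. g holomorphic_on ball w e \<and> (\<forall>z\<in>ball w e - {w}. g z = ?f z)"
    using holomorphic_on_extend_bounded[of ?f "ball w e" w] e Suc.prems(2) by (auto simp: bdd_at_def interior_open)
  then obtain g where g: "g holomorphic_on ball w e" "\<And>z. z \<in> ball w e - {w} \<Longrightarrow> g z = ?f z" by blast
  define g1 where "g1 z = g z / (z - cnj w) ^ Suc N" for z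
  have g1: "g1 holomorphic_on ball w e"
    unfolding g1_def by (intro holomorphic_intros g) (use ne in auto)
  have inb: "w \<in> ball w e" using e by simp
  let ?q1 = "\<lambda>z. q z - g1 w * ((z - cnj w) / (z - w)) ^ Suc N"
  have q1: "?q1 holomorphic_on ball w e - {w}"
    by (intro holomorphic_intros Suc.prems) auto
  have "((\<lambda>z. (g1 z - g1 w) / (z - w)) \<longlongrightarrow> deriv g1 w) (at w)"
    using holomorphic_derivI[OF g1 open_ball inb] by (simp add: has_field_derivative_iff)
  moreover have "((\<lambda>z. (z - cnj w) ^ Suc N) \<longlongrightarrow> (w - cnj w) ^ Suc N) (at w)" by (intro tendsto_intros)
  ultimately have "((\<lambda>z. (g1 z - g1 w) / (z - w) * (z - cnj w) ^ Suc N) \<longlongrightarrow> deriv g1 w * (w - cnj w) ^ Suc N) (at w)"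
    by (rule tendsto_mult)
  then have b1: "bdd_at (\<lambda>z. (g1 z - g1 w) / (z - w) * (z - cnj w) ^ Suc N) w" by (rule bdd_at_tendsto)
  have aux: "(a ^ Suc N * Q / b ^ Suc N - G) / a * b ^ Suc N = a ^ N * (Q - G * (b / a) ^ Suc N)"
    if "a \<noteq> 0" "b \<noteq> 0" for a b Q G :: complex
    using that by (simp add: power_divide) (simp add: field_simps)
  have "bdd_at (\<lambda>z. (z - w) ^ N * ?q1 z) w"
  proof (rule bdd_at_cong[OF b1])
    have "eventually (\<lambda>z. z \<in> ball w e - {w}) (at w)"
      using e by (intro eventually_at_in_open) auto
    then show "eventually (\<lambda>z. (g1 z - g1 w) / (z - w) * (z - cnj w) ^ Suc N = (z - w) ^ N * ?q1 z) (at w)"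
    proof eventually_elim
      case (elim z)
      then have n: "z - w \<noteq> 0" "z - cnj w \<noteq> 0" using ne by auto
      have "g1 z = (z - w) ^ Suc N * q z / (z - cnj w) ^ Suc N" using g(2)[OF elim] by (simp only: g1_def)
      then show ?case using aux[OF n, of "q z" "g1 w"] by simp
    qed
  qed
  from Suc.IH[OF q1 this] obtain c h where h: "h holomorphic_on ball w e"
    "\<And>z. z \<in> ball w e - {w} \<Longrightarrow> ?q1 z = h z + (\<Sum>j=1..N. c j * ((z - cnj w) / (z - w)) ^ j)" by blast
  show ?case
  proof (intro exI[of _ "c(Suc N := g1 w)"] exI[of _ h] conjI h(1) ballI)
    fix z assume "z \<in> ball w e - {w}"
    from h(2)[OF this]
    have "q z = h z + (\<Sum>j=1..N. c j * ((z - cnj w) / (z - w)) ^ j) + g1 w * ((z - cnj w) / (z - w)) ^ Suc N" by (simp only: diff_eq_eq)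
    also have "(\<Sum>j=1..N. c j * ((z - cnj w) / (z - w)) ^ j) = (\<Sum>j=1..N. (c(Suc N := g1 w)) j * ((z - cnj w) / (z - w)) ^ j)"
      by (intro sum.cong) auto
    finally show "q z = h z + (\<Sum>j=1..Suc N. (c(Suc N := g1 w)) j * ((z - cnj w) / (z - w)) ^ j)" by simp
  qed
qed

text \<open>The additional exponent 2 absorbs the logarithm of the case \<open>e = 0\<close>, by
  \<open>ln (1 / x\<^sup>2) \<le> 1 / x\<^sup>2\<close>.\<close>

lemma norm_Tt_le:
  assumes "X \<noteq> 0" "norm X \<le> 1" shows "norm (Tt e X) \<le> 1 / norm X ^ (nat \<bar>e\<bar> + 2)"
proof -
  define x where "x = norm X"
  have x: "0 < x" "x \<le> 1" using assms by (auto simp: x_def)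
  have T: "norm (Tt e X) = x powi (- e) * \<bar>tau e (x\<^sup>2)\<bar>"
    by (simp add: Tt_def norm_mult norm_power_int x_def)
  have x2: "1 \<le> 1 / x\<^sup>2" using x by (simp add: power_le_one)
  have le: "1 / x ^ nat \<bar>e\<bar> \<le> 1 / x ^ (nat \<bar>e\<bar> + 2)"
    using x by (intro divide_left_mono power_decreasing mult_pos_pos zero_less_power) auto
  consider "e = 0" | "e > 0" | "e < 0" by linarith
  then have "x powi (- e) * \<bar>tau e (x\<^sup>2)\<bar> \<le> 1 / x ^ (nat \<bar>e\<bar> + 2)"
  proof cases
    case 1
    have "ln (1 / x\<^sup>2) \<le> 1 / x\<^sup>2 - 1" using x by (intro ln_le_minus_one) auto
    moreover have "ln (x\<^sup>2) \<le> 0" using x by (simp add: power_le_one)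
    ultimately have "\<bar>ln (x\<^sup>2)\<bar> \<le> 1 / x\<^sup>2" using x by (simp add: ln_div)
    moreover have "nat \<bar>e\<bar> + 2 = 2" using 1 by simp
    ultimately show ?thesis using 1 by (simp only: tau_def) simp
  next
    case 2
    have "0 \<le> (x\<^sup>2) powi e" "(x\<^sup>2) powi e \<le> 1" using x 2 by (auto intro: power_int_le_one simp: power_le_one)
    then have "\<bar>tau e (x\<^sup>2)\<bar> \<le> 1 / real_of_int e" using 2 by (simp add: tau_def divide_right_mono)
    also have "\<dots> \<le> 1" using 2 by simp
    finally have "x powi (- e) * \<bar>tau e (x\<^sup>2)\<bar> \<le> x powi (- e) * 1" using x by (intro mult_left_mono) auto
    also have "x powi (- e) * 1 = 1 / x ^ nat \<bar>e\<bar>" using 2 by (simp add: power_int_def power_one_over inverse_eq_divide)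
    finally show ?thesis using le by (rule order_trans)
  next
    case 3
    have p: "(x\<^sup>2) powi e = 1 / (x ^ nat \<bar>e\<bar> * x ^ nat \<bar>e\<bar>)"
      using 3 by (simp add: power_int_def power_one_over inverse_eq_divide power_mult_distrib power2_eq_square)
    have "x ^ nat \<bar>e\<bar> * x ^ nat \<bar>e\<bar> \<le> 1" using x by (intro mult_le_one) (auto simp: power_le_one)
    then have p1: "(x\<^sup>2) powi e \<ge> 1" unfolding p using x by simp
    then have "\<bar>tau e (x\<^sup>2)\<bar> = ((x\<^sup>2) powi e - 1) / \<bar>real_of_int e\<bar>" using 3 by (simp add: tau_def abs_div_pos field_simps)
    also have "\<dots> \<le> (x\<^sup>2) powi e / 1" using p1 3 by (intro frac_le) auto
    finally have "x powi (- e) * \<bar>tau e (x\<^sup>2)\<bar> \<le> x powi (- e) * (x\<^sup>2) powi e" using x by (intro mult_left_mono) auto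
    also have "x powi (- e) = x ^ nat \<bar>e\<bar>" using 3 by (simp add: power_int_def)
    also have "x ^ nat \<bar>e\<bar> * (x\<^sup>2) powi e = 1 / x ^ nat \<bar>e\<bar>" using x by (simp add: p)
    finally have "x ^ nat \<bar>e\<bar> * \<bar>tau e (x\<^sup>2)\<bar> \<le> 1 / x ^ nat \<bar>e\<bar>" using 3 by (simp add: power_int_def)
    then have "x ^ nat \<bar>e\<bar> * \<bar>tau e (x\<^sup>2)\<bar> \<le> 1 / x ^ (nat \<bar>e\<bar> + 2)" using le by (rule order_trans)
    then show ?thesis using 3 by (simp add: power_int_def)
  qed
  then show ?thesis unfolding T x_def .
qed

lemma norm_ephi_le:
  assumes l: "l \<noteq> 0" and u: "u \<noteq> 0" "norm u \<le> norm l" and K: "K = m + nat \<bar>n\<bar> + 2"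
  shows "norm (u ^ K * ephi m n l u) \<le> (\<Sum>i\<le>m. \<bar>altbin m i\<bar>) * norm l ^ (m + K)"
proof -
  define x where "x = norm (u / l)"
  have x: "0 < x" "x \<le> 1" using assms by (auto simp: x_def norm_divide divide_simps)
  have "norm (ephi m n l u) \<le> (\<Sum>i\<le>m. \<bar>altbin m i\<bar> * (norm l ^ m * (1 / x ^ K)))"
    unfolding ephi_eq_sum[OF l u]
  proof (rule sum_norm_le)
    fix i assume i: "i \<in> {..m}"
    have "norm (l ^ (m - i) * u ^ i) \<le> norm l ^ (m - i) * norm l ^ i"
      unfolding norm_mult norm_power using u by (intro mult_left_mono power_mono) auto
    also have "\<dots> = norm l ^ m" using i by (simp flip: power_add)
    finally have 1: "norm (l ^ (m - i) * u ^ i) \<le> norm l ^ m" .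
    have "norm (Tt (int i - n) (u / l)) \<le> 1 / x ^ (nat \<bar>int i - n\<bar> + 2)"
      unfolding x_def by (rule norm_Tt_le) (use x l u in \<open>auto simp: x_def\<close>)
    also have "\<dots> \<le> 1 / x ^ K"
      using x i unfolding K by (intro divide_left_mono power_decreasing mult_pos_pos zero_less_power) auto
    finally have 2: "norm (Tt (int i - n) (u / l)) \<le> 1 / x ^ K" .
    have "norm (of_real (altbin m i) * (l ^ (m - i) * u ^ i) * Tt (int i - n) (u / l)) =
      \<bar>altbin m i\<bar> * (norm (l ^ (m - i) * u ^ i) * norm (Tt (int i - n) (u / l)))"
      by (simp only: norm_mult norm_of_real mult.assoc)
    also have "\<dots> \<le> \<bar>altbin m i\<bar> * (norm l ^ m * (1 / x ^ K))"
      using 1 2 by (intro mult_left_mono mult_mono) auto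
    finally show "norm (of_real (altbin m i) * (l ^ (m - i) * u ^ i) * Tt (int i - n) (u / l)) \<le> \<bar>altbin m i\<bar> * (norm l ^ m * (1 / x ^ K))" .
  qed
  then have "norm (u ^ K * ephi m n l u) \<le> norm u ^ K * (\<Sum>i\<le>m. \<bar>altbin m i\<bar> * (norm l ^ m * (1 / x ^ K)))"
    unfolding norm_mult norm_power by (intro mult_left_mono) auto
  also have "\<dots> = (\<Sum>i\<le>m. \<bar>altbin m i\<bar>) * (norm l ^ m * (norm u ^ K / x ^ K))"
    by (simp add: sum_distrib_left sum_distrib_right sum_divide_distrib mult_ac)
  also have "norm u ^ K / x ^ K = norm l ^ K"
    using l u by (simp add: x_def norm_divide power_divide)
  finally show ?thesis by (simp add: power_add)
qed

lemma bdd_at_phi: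
  assumes M: "M \<in> SL2Z" and \<zz>: "\<zz> \<in> uhp" and w: "w \<in> uhp"
  shows "bdd_at (\<lambda>z. (z - w) ^ (m + nat \<bar>n\<bar> + 2) * phi m n \<zz> M z) w"
proof (cases "lin \<zz> M w = 0")
  case False
  have "isCont (phi m n \<zz> M) w" using harm_isCont[OF phi_harm[OF M \<zz>]] w False by blast
  then show ?thesis by (intro bdd_at_mult bdd_at_isCont continuous_intros)
next
  case True
  let ?K = "m + nat \<bar>n\<bar> + 2"
  have s: "slope \<zz> M \<noteq> 0" using slope_nonzero[OF M] \<zz> by (simp add: uhp_iff)
  have u: "lin \<zz> M z = slope \<zz> M * (z - w)" for z using lin_diff[of \<zz> M z w] True by simp
  define A where "A = (\<Sum>i\<le>m. \<bar>altbin m i\<bar>)"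
  have A: "A \<ge> 0" by (simp add: A_def sum_nonneg)
  define f where "f z = of_real A * (lin (cnj \<zz>) M z ^ (m + ?K) / slope \<zz> M ^ ?K)" for z
  have "isCont f w" unfolding f_def lin_def by (intro continuous_intros) (use s in auto)
  then obtain C where C: "eventually (\<lambda>z. norm (f z) \<le> C) (at w)" using bdd_at_isCont by (auto simp: bdd_at_def)
  have "eventually (\<lambda>z. z \<in> uhp - {w}) (at w)" using w open_uhp by (intro eventually_at_in_open)
  with C have "eventually (\<lambda>z. norm ((z - w) ^ ?K * phi m n \<zz> M z) \<le> C) (at w)"
  proof eventually_elim
    case (elim z)
    then have zu: "z \<in> uhp" "z \<noteq> w" by auto
    have "norm (lin \<zz> M z ^ ?K * phi m n \<zz> M z) \<le> A * norm (lin (cnj \<zz>) M z) ^ (m + ?K)"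
      unfolding phi_def A_def by (rule norm_ephi_le) (use zu u s lin_cnj_nonzero[OF M \<zz>] norm_lin_le[OF M \<zz>] in auto)
    also have "\<dots> = norm (f z) * norm (slope \<zz> M ^ ?K)"
      using s A by (simp add: f_def norm_mult norm_power norm_divide)
    also have "lin \<zz> M z ^ ?K * phi m n \<zz> M z = slope \<zz> M ^ ?K * ((z - w) ^ ?K * phi m n \<zz> M z)"
      unfolding u by (simp only: power_mult_distrib mult.assoc)
    finally have "norm (slope \<zz> M ^ ?K) * norm ((z - w) ^ ?K * phi m n \<zz> M z) \<le> norm (slope \<zz> M ^ ?K) * norm (f z)"
      by (simp only: norm_mult mult.commute)
    moreover have "norm (slope \<zz> M ^ ?K) > 0" using s by simp
    ultimately have "norm ((z - w) ^ ?K * phi m n \<zz> M z) \<le> norm (f z)"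
      using mult_le_cancel_left_pos by blast
    then show ?case using elim by simp
  qed
  then show ?thesis by (auto simp: bdd_at_def)
qed

text \<open>For \<open>n < 0\<close> the term \<open>phi\<close> differs from the meromorphic function \<open>(z - cnj w) ^ m * X powi n\<close> by a
  constant factor and a function that is harmonic on the whole half-plane.\<close>

definition psi :: "nat \<Rightarrow> int \<Rightarrow> complex \<Rightarrow> complex \<Rightarrow> complex" where
  "psi m n w z = - (\<Sum>j\<le>m. of_real (altbin m j) * ((z - cnj w) ^ (m - j) * (z - w) ^ j) *
     cnj (((z - w) / (z - cnj w)) ^ nat (int j - n) / of_int (int j - n)))"

text \<open>All exponents \<open>int j - n\<close> are positive for \<open>n < 0\<close>, so nothing
  is singular at \<open>w\<close>. The function \<open>g\<close> is the one of \<open>phi\<close>,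
  hence the difference of \<open>phi\<close> and \<open>psi\<close> is holomorphic away from
  \<open>w\<close>.\<close>

lemma psi_harm:
  assumes n: "n < 0" and w: "w \<in> uhp"
  shows "harm m (psi m n w) (phi_g m n w (mat 1)) uhp"
  unfolding harm_iff
proof (intro conjI open_uhp subset_refl phi_g_holomorphic SL2Z_one w disjI1 n ballI)
  fix z assume z: "z \<in> uhp"
  let ?l = "z - cnj w" let ?u = "z - w" let ?X = "?u / ?l"
  have l: "?l \<noteq> 0" using uhp_cnj_ne[OF w z] .
  define E where "E = 2 * \<i> * of_real (Im w)"
  have wE: "w - cnj w = E" by (simp add: E_def complex_eq_iff)
  have dX: "((\<lambda>z. (z - w) / (z - cnj w)) has_field_derivative E / ?l\<^sup>2) (at z)"
  proof -
    have "((\<lambda>z. (z - w) / (z - cnj w)) has_field_derivative (1 * ?l - ?u * 1) / (?l * ?l)) (at z)"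
      using l by (auto intro!: derivative_eq_intros)
    then show ?thesis by (simp add: wE power2_eq_square)
  qed
  have d: "((\<lambda>z. ((z - w) / (z - cnj w)) ^ nat (int j - n) / of_int (int j - n)) has_field_derivative
      ?X ^ (j + nat (- n - 1)) * (E / ?l\<^sup>2)) (at z)" for j
  proof -
    have e: "nat (int j - n) = Suc (j + nat (- n - 1))" "of_int (int j - n) = (of_nat (Suc (j + nat (- n - 1))) :: complex)"
      using n by auto
    have "((\<lambda>z. ((z - w) / (z - cnj w)) ^ Suc (j + nat (- n - 1)) / of_nat (Suc (j + nat (- n - 1)))) has_field_derivative
      ((1 + of_nat (j + nat (- n - 1))) * (E / ?l\<^sup>2 * ?X ^ (j + nat (- n - 1)))) / of_nat (Suc (j + nat (- n - 1)))) (at z)"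
      by (intro DERIV_cdivide DERIV_power_Suc dX)
    moreover have "((1 + of_nat (j + nat (- n - 1))) * (E / ?l\<^sup>2 * ?X ^ (j + nat (- n - 1)))) / of_nat (Suc (j + nat (- n - 1)))
        = ?X ^ (j + nat (- n - 1)) * (E / ?l\<^sup>2)"
    proof -
      have c: "(1 + of_nat (j + nat (- n - 1))) = (of_nat (Suc (j + nat (- n - 1))) :: complex)" by simp
      have c0: "(of_nat (Suc (j + nat (- n - 1))) :: complex) \<noteq> 0" by (simp del: of_nat_Suc)
      show ?thesis unfolding c using c0 by (simp del: of_nat_Suc add: mult.commute)
    qed
    ultimately show ?thesis unfolding e by simp
  qed
  have "\<exists>p. has_wirtinger (\<lambda>z. of_real (altbin m j) * ((z - cnj w) ^ (m - j) * (z - w) ^ j) *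
     cnj (((z - w) / (z - cnj w)) ^ nat (int j - n) / of_int (int j - n))) p
     (of_real (altbin m j) * (?l ^ (m - j) * ?u ^ j) * cnj (?X ^ (j + nat (- n - 1)) * (E / ?l\<^sup>2))) z" for j
  proof -
    have "\<exists>D. ((\<lambda>z. of_real (altbin m j) * ((z - cnj w) ^ (m - j) * (z - w) ^ j)) has_field_derivative D) (at z)"
      by (rule exI) (rule derivative_eq_intros refl)+
    then obtain D where D: "((\<lambda>z. of_real (altbin m j) * ((z - cnj w) ^ (m - j) * (z - w) ^ j)) has_field_derivative D) (at z)" by blast
    from has_wirtinger_mult[OF has_wirtinger_holo[OF D] has_wirtinger_cnj[OF has_wirtinger_holo[OF d]]]
    show ?thesis by auto
  qed
  then have "\<exists>p. \<forall>j. has_wirtinger (\<lambda>z. of_real (altbin m j) * ((z - cnj w) ^ (m - j) * (z - w) ^ j) *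
     cnj (((z - w) / (z - cnj w)) ^ nat (int j - n) / of_int (int j - n))) (p j)
     (of_real (altbin m j) * (?l ^ (m - j) * ?u ^ j) * cnj (?X ^ (j + nat (- n - 1)) * (E / ?l\<^sup>2))) z"
    by (intro choice allI)
  then obtain p where p: "\<And>j. has_wirtinger (\<lambda>z. of_real (altbin m j) * ((z - cnj w) ^ (m - j) * (z - w) ^ j) *
     cnj (((z - w) / (z - cnj w)) ^ nat (int j - n) / of_int (int j - n))) (p j)
     (of_real (altbin m j) * (?l ^ (m - j) * ?u ^ j) * cnj (?X ^ (j + nat (- n - 1)) * (E / ?l\<^sup>2))) z"
    by blast
  have "has_wirtinger (\<lambda>z. (-1) * (\<Sum>j\<le>m. of_real (altbin m j) * ((z - cnj w) ^ (m - j) * (z - w) ^ j) *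
     cnj (((z - w) / (z - cnj w)) ^ nat (int j - n) / of_int (int j - n)))) ((-1) * (\<Sum>j\<le>m. p j))
     ((-1) * (\<Sum>j\<le>m. of_real (altbin m j) * (?l ^ (m - j) * ?u ^ j) * cnj (?X ^ (j + nat (- n - 1)) * (E / ?l\<^sup>2)))) z"
    by (intro has_wirtinger_cmult has_wirtinger_sum p)
  moreover have "(\<lambda>z. (-1) * (\<Sum>j\<le>m. of_real (altbin m j) * ((z - cnj w) ^ (m - j) * (z - w) ^ j) *
     cnj (((z - w) / (z - cnj w)) ^ nat (int j - n) / of_int (int j - n)))) = psi m n w"
    by (simp add: psi_def fun_eq_iff)
  moreover have "(-1) * (\<Sum>j\<le>m. of_real (altbin m j) * (?l ^ (m - j) * ?u ^ j) * cnj (?X ^ (j + nat (- n - 1)) * (E / ?l\<^sup>2)))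
     = of_real (Im z) ^ m * cnj (phi_g m n w (mat 1) z)"
  proof -
    have "(\<Sum>j\<le>m. of_real (altbin m j) * (?l ^ (m - j) * ?u ^ j) * cnj (?X ^ (j + nat (- n - 1)) * (E / ?l\<^sup>2)))
      = ?l ^ m * (\<Sum>j\<le>m. of_real (altbin m j) * (?X * cnj ?X) ^ j) * cnj (?X ^ nat (- n - 1) * (E / ?l\<^sup>2))"
      unfolding sum_distrib_left sum_distrib_right
    proof (rule sum.cong[OF refl])
      fix j assume j: "j \<in> {..m}"
      have "?l ^ (m - j) * ?u ^ j = ?l ^ m * ?X ^ j" using j l by (simp add: power_divide power_diff)
      then show "of_real (altbin m j) * (?l ^ (m - j) * ?u ^ j) * cnj (?X ^ (j + nat (- n - 1)) * (E / ?l\<^sup>2)) =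
         ?l ^ m * (of_real (altbin m j) * (?X * cnj ?X) ^ j) * cnj (?X ^ nat (- n - 1) * (E / ?l\<^sup>2))"
        by (simp only: power_add power_mult_distrib complex_cnj_mult complex_cnj_power mult_ac)
    qed
    also have "(\<Sum>j\<le>m. of_real (altbin m j) * (?X * cnj ?X) ^ j) = (1 - ?X * cnj ?X) ^ m" by (rule altbin_sum)
    also have "1 - ?X * cnj ?X = of_real (4 * Im w * Im z) / (?l * cnj ?l)"
    proof -
      have aux: "1 - (a / b) * (a' / b') = (b * b' - a * a') / (b * b')" if "b * b' \<noteq> 0" for a b a' b' :: complex
        using that by (simp add: diff_divide_distrib)
      have nz: "?l * cnj ?l \<noteq> 0" using l by (metis complex_cnj_zero_iff mult_eq_0_iff)
      have "?l * cnj ?l - ?u * cnj ?u = of_real (4 * Im w * Im z)"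
        using arg_cong[OF norm_lin_cnj_minus[OF SL2Z_one, of w z], of complex_of_real]
        by (simp only: lin_one of_real_diff complex_norm_square)
      moreover have "1 - ?X * cnj ?X = (?l * cnj ?l - ?u * cnj ?u) / (?l * cnj ?l)"
        unfolding complex_cnj_divide by (rule aux[OF nz])
      ultimately show ?thesis by (simp only:)
    qed
    finally have S: "(\<Sum>j\<le>m. of_real (altbin m j) * (?l ^ (m - j) * ?u ^ j) * cnj (?X ^ (j + nat (- n - 1)) * (E / ?l\<^sup>2)))
      = ?l ^ m * (of_real (4 * Im w * Im z) / (?l * cnj ?l)) ^ m * cnj (?X ^ nat (- n - 1) * (E / ?l\<^sup>2))" .
    have alg: "- 1 * (L ^ m * (a * y / (L * L')) ^ m * (Q * (E' / L'\<^sup>2))) = y ^ m * (- (a ^ m * E' * Q / L' ^ (m + 2)))"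
      if "L \<noteq> 0" for L L' a y Q E' :: complex
      using that by (simp add: power_divide power_mult_distrib power_add power2_eq_square mult_ac)
    have pw: "?X powi (- n - 1) = ?X ^ nat (- n - 1)" using n by (simp add: power_int_def)
    show ?thesis
      unfolding S phi_g_def lin_one pw E_def[symmetric]
      using alg[OF l, of "of_real (4 * Im w)" "of_real (Im z)" "cnj ?l" "cnj (?X ^ nat (- n - 1))" "cnj E"]
      by (simp only: of_real_mult complex_cnj_mult complex_cnj_divide complex_cnj_power complex_cnj_minus complex_cnj_complex_of_real)
  qed
  ultimately show "\<exists>p. has_wirtinger (psi m n w) p (of_real (Im z) ^ m * cnj (phi_g m n w (mat 1) z)) z" by auto
qed

lemma phi_one_closed:
  assumes w: "w \<in> uhp" and z: "z \<in> uhp" "z \<noteq> w"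
  shows "phi m n w (mat 1) z = (\<Sum>j\<le>m. of_real (altbin m j * tau (int j - n) ((norm ((z - w) / (z - cnj w)))\<^sup>2))) *
     ((z - cnj w) ^ m * ((z - w) / (z - cnj w)) powi n)"
proof -
  let ?X = "(z - w) / (z - cnj w)"
  have l: "z - cnj w \<noteq> 0" using uhp_cnj_ne[OF w z(1)] .
  have "norm ?X \<le> 1" using norm_lin_le[OF SL2Z_one w z(1)] l by (simp add: norm_divide divide_le_eq)
  then have "0 < (norm ?X)\<^sup>2" "(norm ?X)\<^sup>2 \<le> 1" using l z by (auto simp: power_le_one)
  from inc_beta_closed[OF this, of m n] show ?thesis
    by (simp add: phi_def ephi_def mult_ac)
qed

text \<open>In \<open>tau e s = (1 - s powi e) / e\<close> the constants 1 add up to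
  \<open>beta_const\<close> and the powers of \<open>s\<close> to \<open>psi\<close>.\<close>

lemma phi_one_neg:
  assumes n: "n < 0" and w: "w \<in> uhp" and z: "z \<in> uhp" "z \<noteq> w"
  shows "phi m n w (mat 1) z = of_real (beta_const (m + 1) (- n)) * ((z - cnj w) ^ m * ((z - cnj w) / (z - w)) ^ nat (- n)) + psi m n w z"
proof -
  let ?X = "(z - w) / (z - cnj w)" let ?s = "(norm ?X)\<^sup>2"
  have l: "z - cnj w \<noteq> 0" "z - w \<noteq> 0" using uhp_cnj_ne[OF w z(1)] z by auto
  then have X: "?X \<noteq> 0" by simp
  have Xn: "?X powi n = ((z - cnj w) / (z - w)) ^ nat (- n)"
    using n by (simp add: power_int_def power_inverse[symmetric] inverse_eq_divide)
  have set: "{i. i \<le> m \<and> int i \<noteq> n} = {..m}" using n by auto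
  have tau: "tau (int j - n) ?s = 1 / of_int (int j - n) - ?s ^ nat (int j - n) / of_int (int j - n)" for j
    using n by (simp add: tau_def power_int_def diff_divide_distrib)
  have "(\<Sum>j\<le>m. complex_of_real (altbin m j * tau (int j - n) ?s)) =
     of_real (beta_const (m + 1) (- n)) - (\<Sum>j\<le>m. of_real (altbin m j * (?s ^ nat (int j - n) / of_int (int j - n))))"
    unfolding beta_const_eq set tau by (simp add: right_diff_distrib sum_subtractf)
  moreover have "(\<Sum>j\<le>m. of_real (altbin m j * (?s ^ nat (int j - n) / of_int (int j - n)))) * ((z - cnj w) ^ m * ?X powi n) = - psi m n w z"
    unfolding psi_def minus_minus sum_distrib_right
  proof (rule sum.cong[OF refl])
    fix j assume j: "j \<in> {..m}"
    have "complex_of_real (?s ^ nat (int j - n)) = ?X ^ nat (int j - n) * cnj ?X ^ nat (int j - n)"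
      unfolding of_real_power[of ?s] complex_norm_square power_mult_distrib ..
    moreover have "?X ^ nat (int j - n) * ?X powi n = ?X ^ j"
    proof -
      have "?X ^ nat (int j - n) = ?X powi (int j - n)" using n by (simp add: power_int_def)
      moreover have "?X powi (int j - n) * ?X powi n = ?X powi (int j)" using X by (simp flip: power_int_add)
      ultimately show ?thesis by simp
    qed
    moreover have "(z - cnj w) ^ m * ?X ^ j = (z - cnj w) ^ (m - j) * (z - w) ^ j"
      using j l by (simp add: power_divide power_diff)
    moreover have "a * (b * c / i) * (d * e) = a * f * (c / i)" if "b * e = g" "d * g = f" for a b c d e f g i :: complex
      using that by (auto simp: mult_ac)
    ultimately show "of_real (altbin m j * (?s ^ nat (int j - n) / of_int (int j - n))) * ((z - cnj w) ^ m * ?X powi n) =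
       of_real (altbin m j) * ((z - cnj w) ^ (m - j) * (z - w) ^ j) * cnj (?X ^ nat (int j - n) / of_int (int j - n))"
      by (simp only: of_real_mult of_real_divide of_real_of_int_eq complex_cnj_divide[of "_ ^ _"] complex_cnj_power complex_cnj_of_int)
  qed
  ultimately show ?thesis
    unfolding phi_one_closed[OF w z] by (simp only: left_diff_distrib Xn) simp
qed

text \<open>The interior estimate on the ball of radius \<open>norm (z0 - w) / 2\<close> around
  \<open>z0\<close> costs one power of the distance to \<open>w\<close>.\<close>

lemma harm_g_growth:
  assumes F: "harm m F g (ball w e - {w})" and e: "e > 0" "ball w e \<subseteq> uhp"
    and bd: "bdd_at (\<lambda>z. (z - w) ^ N * F z) w"
  shows "bdd_at (\<lambda>z. (z - w) ^ (N + 1) * g z) w"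
proof -
  have "w \<in> uhp" using e by auto
  then have wu: "Im w > 0" by (simp add: uhp_iff)
  obtain C0 \<delta> where \<delta>: "\<delta> > 0" "\<And>z. z \<noteq> w \<Longrightarrow> dist z w < \<delta> \<Longrightarrow> norm ((z - w) ^ N * F z) \<le> C0"
    using bd by (auto simp: bdd_at_def eventually_at)
  define C where "C = max C0 0"
  have C: "C \<ge> 0" "\<And>z. z \<noteq> w \<Longrightarrow> dist z w < \<delta> \<Longrightarrow> norm ((z - w) ^ N * F z) \<le> C"
    using \<delta>(2) by (force simp: C_def)+
  \<comment> \<open>For \<open>z0\<close> closer to \<open>w\<close> than \<open>\<eta>\<close> the
    auxiliary ball stays where \<open>F\<close> is controlled, and
    \<open>Im z0 \<ge> Im w / 2\<close>.\<close>
  define \<eta> where "\<eta> = min (min \<delta> e) (Im w) / 2"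
  have \<eta>: "\<eta> > 0" using \<delta> e wu by (simp add: \<eta>_def)
  define K where "K = 4 * (4/3) ^ m * C * 2 ^ N / (Im w / 2) ^ m"
  have "norm ((z0 - w) ^ (N + 1) * g z0) \<le> K" if z0: "z0 \<noteq> w" "dist z0 w < \<eta>" for z0
  proof -
    define t where "t = norm (z0 - w)"
    define d where "d = t / 2"
    have t: "t > 0" "t < \<eta>" using z0 by (auto simp: t_def dist_norm)
    have zt: "t / 2 \<le> norm (z - w) \<and> norm (z - w) \<le> 3 / 2 * t" if "z \<in> cball z0 d" for z
    proof -
      have "norm (z - z0) \<le> t / 2" using that by (simp add: dist_norm norm_minus_commute d_def)
      then show ?thesis
        using norm_triangle_ineq[of "z - z0" "z0 - w"] norm_triangle_ineq2[of "z0 - w" "z0 - z"]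
        by (simp add: t_def norm_minus_commute)
    qed
    have sub: "cball z0 d \<subseteq> ball w e - {w}" and sub2: "\<And>z. z \<in> cball z0 d \<Longrightarrow> dist z w < \<delta>"
      using zt t by (force simp: dist_norm norm_minus_commute \<eta>_def)+
    have "z0 - \<i> * of_real d \<in> cball z0 d" using t by (simp add: dist_norm norm_mult d_def)
    then have "z0 - \<i> * of_real d \<in> uhp" using sub e(2) by blast
    then have dI: "d \<le> Im z0" by (simp add: uhp_iff)
    have "\<bar>Im (z0 - w)\<bar> \<le> t" unfolding t_def by (rule abs_Im_le_cmod)
    moreover have "2 * t < Im w" using t by (simp add: \<eta>_def)
    ultimately have Im: "Im z0 \<ge> Im w / 2" by (simp add: minus_complex.sel)
    have B: "norm (F z) \<le> C / (t / 2) ^ N" if z: "z \<in> cball z0 d" for z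
    proof -
      have zw: "z \<noteq> w" using sub z by blast
      have "norm (z - w) ^ N * norm (F z) \<le> C" using C(2)[OF zw sub2[OF z]] by (simp add: norm_mult norm_power)
      moreover have "(t / 2) ^ N * norm (F z) \<le> norm (z - w) ^ N * norm (F z)"
        using zt[OF z] t by (intro mult_right_mono power_mono) auto
      ultimately have "(t / 2) ^ N * norm (F z) \<le> C" by (rule order_trans[rotated])
      moreover have "(t / 2) ^ N > 0" using t by simp
      ultimately show ?thesis by (simp only: pos_le_divide_eq mult.commute)
    qed
    have "norm (g z0) \<le> 2 * (4/3) ^ m * (C / (t / 2) ^ N) / (Im z0 ^ m * d)"
      by (rule harm_interior_estimate[OF F _ dI sub B]) (use t in \<open>simp add: d_def\<close>)
    also have "\<dots> \<le> 2 * (4/3) ^ m * (C / (t / 2) ^ N) / ((Im w / 2) ^ m * d)"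
      using Im wu t C by (intro divide_left_mono mult_right_mono power_mono mult_pos_pos mult_nonneg_nonneg divide_nonneg_nonneg) (auto simp: d_def)
    also have "\<dots> = K / t ^ (N + 1)"
      using t by (simp add: K_def d_def power_divide mult_ac)
    finally have "norm (g z0) \<le> K / t ^ (N + 1)" .
    then have "t ^ (N + 1) * norm (g z0) \<le> K" using t by (simp add: field_simps)
    then show ?thesis by (simp add: norm_mult norm_power t_def)
  qed
  then have "eventually (\<lambda>z. norm ((z - w) ^ (N + 1) * g z) \<le> K) (at w)"
    unfolding eventually_at using \<eta> by blast
  then show ?thesis by (auto simp: bdd_at_def)
qed

lemma harm_phi_punctured:
  assumes "ball w e \<subseteq> uhp" "w \<in> uhp"
  shows "harm m (phi m n w (mat 1)) (phi_g m n w (mat 1)) (ball w e - {w})"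
  by (rule harm_subset[OF phi_harm[OF SL2Z_one assms(2)]]) (use assms in auto)

text \<open>Only \<open>g\<close> matters here: \<open>g z * (z - cnj w) ^ (m + 2)\<close> has a
  pole of order at most \<open>N + 1\<close>, and \<open>phi_g\<close> with index \<open>n\<close>
  supplies exactly the power \<open>n + 1\<close> of \<open>(z - cnj w) / (z - w)\<close>. The
  coefficients are conjugated because \<open>g\<close> depends antilinearly on
  \<open>F\<close>.\<close>

lemma remove_antiholomorphic_pole:
  assumes F: "harm m F g (ball w e - {w})" and e: "e > 0" "ball w e \<subseteq> uhp"
    and bd: "bdd_at (\<lambda>z. (z - w) ^ N * F z) w"
  shows "\<exists>d h. h holomorphic_on ball w e \<and>
    harm m (\<lambda>z. F z - (\<Sum>n\<le>N. d n * phi m (int n) w (mat 1) z)) h (ball w e - {w})"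
proof -
  have wu: "w \<in> uhp" using e by auto
  have ne: "z - cnj w \<noteq> 0" if "z \<in> ball w e" for z using uhp_cnj_ne wu that e(2) by blast
  define q where "q z = g z * (z - cnj w) ^ (m + 2)" for z
  have "q holomorphic_on ball w e - {w}"
    unfolding q_def by (intro holomorphic_intros harm_holomorphic[OF F])
  moreover have "bdd_at (\<lambda>z. (z - w) ^ (N + 1) * q z) w"
  proof -
    have "bdd_at (\<lambda>z. ((z - w) ^ (N + 1) * g z) * (z - cnj w) ^ (m + 2)) w"
      by (rule bdd_at_mult[OF harm_g_growth[OF F e bd]]) (intro bdd_at_isCont continuous_intros)
    then show ?thesis by (simp add: q_def mult_ac)
  qed
  ultimately obtain c h where h: "h holomorphic_on ball w e"
    "\<And>z. z \<in> ball w e - {w} \<Longrightarrow> q z = h z + (\<Sum>j=1..N+1. c j * ((z - cnj w) / (z - w)) ^ j)"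
    using remove_pole[OF _ e, of q "N + 1"] by blast
  define k0 where "k0 = of_real (4 * Im w) ^ m * (2 * \<i> * of_real (Im w))"
  have k0: "k0 \<noteq> 0" using wu by (simp add: k0_def uhp_iff)
  define d where "d n = cnj (- c (Suc n) / k0)" for n
  have "harm m (\<lambda>z. \<Sum>n\<le>N. d n * phi m (int n) w (mat 1) z) (\<lambda>z. \<Sum>n\<le>N. cnj (d n) * phi_g m (int n) w (mat 1) z) (ball w e - {w})"
    by (intro harm_sum harm_cmult harm_phi_punctured e(2) wu) (use e in auto)
  from harm_add[OF F harm_cmult[OF this, of "-1"]]
  have "harm m (\<lambda>z. F z - (\<Sum>n\<le>N. d n * phi m (int n) w (mat 1) z))
      (\<lambda>z. g z - (\<Sum>n\<le>N. cnj (d n) * phi_g m (int n) w (mat 1) z)) (ball w e - {w})" by simp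
  then have "harm m (\<lambda>z. F z - (\<Sum>n\<le>N. d n * phi m (int n) w (mat 1) z)) (\<lambda>z. h z / (z - cnj w) ^ (m + 2)) (ball w e - {w})"
  proof (rule harm_cong)
    fix z assume z: "z \<in> ball w e - {w}"
    have l: "z - cnj w \<noteq> 0" "z - w \<noteq> 0" using ne z by auto
    have "cnj (d n) * phi_g m (int n) w (mat 1) z = c (Suc n) * ((z - cnj w) / (z - w)) ^ Suc n / (z - cnj w) ^ (m + 2)" for n
    proof -
      have pw: "((z - w) / (z - cnj w)) powi (- int n - 1) = ((z - cnj w) / (z - w)) ^ Suc n"
      proof -
        have "- int n - 1 = - int (Suc n)" by simp
        then show ?thesis by (simp only: power_int_minus power_int_of_nat power_inverse[symmetric] inverse_divide)
      qed
      have pg: "phi_g m (int n) w (mat 1) z = - (k0 * ((z - cnj w) / (z - w)) ^ Suc n / (z - cnj w) ^ (m + 2))"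
        unfolding phi_g_def lin_one pw k0_def ..
      show ?thesis unfolding pg d_def using k0 by (simp del: power_Suc)
    qed
    then have "(\<Sum>n\<le>N. cnj (d n) * phi_g m (int n) w (mat 1) z) = (\<Sum>n\<le>N. c (Suc n) * ((z - cnj w) / (z - w)) ^ Suc n) / (z - cnj w) ^ (m + 2)"
      by (simp only: sum_divide_distrib)
    also have "(\<Sum>n\<le>N. c (Suc n) * ((z - cnj w) / (z - w)) ^ Suc n) = (\<Sum>j=1..N+1. c j * ((z - cnj w) / (z - w)) ^ j)"
      using sum.shift_bounds_cl_Suc_ivl[of "\<lambda>j. c j * ((z - cnj w) / (z - w)) ^ j" 0 N] by (simp add: atMost_atLeast0)
    also have "\<dots> = q z - h z" using h(2)[OF z] by simp
    finally show "g z - (\<Sum>n\<le>N. cnj (d n) * phi_g m (int n) w (mat 1) z) = h z / (z - cnj w) ^ (m + 2)"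
      using l by (simp add: q_def diff_divide_distrib)
  qed simp
  moreover have "(\<lambda>z. h z / (z - cnj w) ^ (m + 2)) holomorphic_on ball w e"
    by (intro holomorphic_intros h) (use ne in auto)
  ultimately show ?thesis by blast
qed

text \<open>As \<open>g\<close> is regular at \<open>w\<close>, the primitives exist on the whole
  ball; hence the singular part \<open>f\<close> is a single-valued holomorphic function on the
  punctured ball.\<close>

lemma split_antiholomorphic:
  assumes F: "harm m F g (ball w e - {w})" and g: "g holomorphic_on ball w e" and e: "e > 0" "ball w e \<subseteq> uhp"
  shows "\<exists>G f. harm m G g (ball w e) \<and> f holomorphic_on ball w e - {w} \<and> (\<forall>z. F z = f z + G z)"
proof -
  have "\<exists>H. \<forall>z\<in>ball w e. (H has_field_derivative hp_coeff m j z * g z) (at z)" for j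
  proof -
    have "(\<lambda>z. hp_coeff m j z * g z) holomorphic_on ball w e"
      by (intro holomorphic_on_mult hp_coeff_holomorphic g)
    from holomorphic_convex_primitive'[OF convex_ball open_ball this] show ?thesis
      by (metis at_within_open open_ball)
  qed
  then have "\<exists>H. \<forall>j. \<forall>z\<in>ball w e. (H j has_field_derivative hp_coeff m j z * g z) (at z)" by (intro choice allI)
  then obtain H where H: "\<And>j z. z \<in> ball w e \<Longrightarrow> (H j has_field_derivative hp_coeff m j z * g z) (at z)" by blast
  define G where "G z = (\<Sum>j\<le>m. z ^ j * cnj (H j z))" for z
  have "wharm m (hp_coeff m) G g (ball w e)"
    by (rule wharmI_rep[where f = "\<lambda>_. 0" and H = H, OF open_ball g _ H]) (auto simp: G_def)
  then have 1: "harm m G g (ball w e)" using e by (simp add: harm_def)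
  have "wharm m (hp_coeff m) F g (ball w e - {w})" using F by (simp add: harm_def)
  from wharm_remainder_holomorphic[OF this, of H] H
  have "(\<lambda>z. F z - G z) holomorphic_on ball w e - {w}" by (simp add: G_def)
  with 1 show ?thesis by (intro exI[of _ G] exI[of _ "\<lambda>z. F z - G z"]) simp
qed

text \<open>The pole of \<open>g\<close> goes first. What remains singular is holomorphic and of
  finite order at \<open>w\<close>, and its principal part is matched by terms with negative index
  up to the regular functions \<open>psi\<close>.\<close>

lemma local_decomposition:
  assumes F: "harm m F g (ball w e - {w})" and e: "e > 0" "ball w e \<subseteq> uhp"
    and bd: "bdd_at (\<lambda>z. (z - w) ^ N * F z) w"
  shows "\<exists>F0 g0 J d. finite (J :: int set) \<and> harm m F0 g0 (ball w e) \<and>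
    (\<forall>z\<in>ball w e - {w}. F z = F0 z + (\<Sum>n\<in>J. d n * phi m n w (mat 1) z))"
proof -
  have wu: "w \<in> uhp" using e by auto
  have ne: "z - cnj w \<noteq> 0" if "z \<in> ball w e" for z using uhp_cnj_ne wu that e(2) by blast
  obtain a h where h: "h holomorphic_on ball w e"
    and F1: "harm m (\<lambda>z. F z - (\<Sum>n\<le>N. a n * phi m (int n) w (mat 1) z)) h (ball w e - {w})"
    using remove_antiholomorphic_pole[OF F e bd] by blast
  obtain G f where G: "harm m G h (ball w e)" and f: "f holomorphic_on ball w e - {w}"
    and FG: "\<And>z. F z - (\<Sum>n\<le>N. a n * phi m (int n) w (mat 1) z) = f z + G z"
    using split_antiholomorphic[OF F1 h e] by blast
  \<comment> \<open>Large enough for the order of \<open>F\<close> and for that of every removed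
    term with index at most \<open>N\<close>.\<close>
  define K where "K = N + m + 2"
  have "bdd_at (\<lambda>z. (z - w) ^ K * F z - (\<Sum>n\<le>N. a n * ((z - w) ^ K * phi m (int n) w (mat 1) z)) - (z - w) ^ K * G z) w"
  proof (intro bdd_at_diff bdd_at_sum bdd_at_cmult)
    show "bdd_at (\<lambda>z. (z - w) ^ K * F z) w" by (rule bdd_at_power_mono[OF bd]) (simp add: K_def)
    show "bdd_at (\<lambda>z. (z - w) ^ K * phi m (int n) w (mat 1) z) w" if "n \<in> {..N}" for n
      by (rule bdd_at_power_mono[OF bdd_at_phi[OF SL2Z_one wu wu]]) (use that in \<open>simp add: K_def\<close>)
    have "isCont G w" using harm_isCont[OF G] e by simp
    then show "bdd_at (\<lambda>z. (z - w) ^ K * G z) w" by (intro bdd_at_isCont continuous_intros)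
  qed
  moreover have "(z - w) ^ K * F z - (\<Sum>n\<le>N. a n * ((z - w) ^ K * phi m (int n) w (mat 1) z)) - (z - w) ^ K * G z = (z - w) ^ K * f z" for z
  proof -
    have "f z = F z - (\<Sum>n\<le>N. a n * phi m (int n) w (mat 1) z) - G z" using FG[of z] by (simp add: algebra_simps)
    then show ?thesis by (simp add: right_diff_distrib sum_distrib_left mult.left_commute)
  qed
  ultimately have fb: "bdd_at (\<lambda>z. (z - w) ^ K * f z) w" by simp
  define q where "q z = f z / (z - cnj w) ^ m" for z
  have qh: "q holomorphic_on ball w e - {w}" unfolding q_def by (intro holomorphic_intros f) (use ne in auto)
  have "bdd_at (\<lambda>z. ((z - w) ^ K * f z) * (1 / (z - cnj w) ^ m)) w"
    by (intro bdd_at_mult fb bdd_at_isCont continuous_intros) (use ne[of w] e in auto)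
  then have "bdd_at (\<lambda>z. (z - w) ^ K * q z) w" by (simp add: q_def)
  from remove_pole[OF qh e this] obtain c h2 where h2: "h2 holomorphic_on ball w e"
    and q: "\<And>z. z \<in> ball w e - {w} \<Longrightarrow> q z = h2 z + (\<Sum>j=1..K. c j * ((z - cnj w) / (z - w)) ^ j)" by blast
  \<comment> \<open>The divisor is the leading constant of the term with index
    \<open>- int j\<close>; it is positive by \<open>beta_const_pos\<close>.\<close>
  define b where "b j = c j / of_real (beta_const (m + 1) (int j))" for j
  define F0 where "F0 z = G z + (z - cnj w) ^ m * h2 z + (-1) * (\<Sum>j\<in>{1..K}. b j * psi m (- int j) w z)" for z
  have "harm m (\<lambda>z. (z - cnj w) ^ m * h2 z) (\<lambda>_. 0) (ball w e)"
    by (intro harm_holo open_ball e holomorphic_intros h2)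
  moreover have "harm m (\<lambda>z. \<Sum>j\<in>{1..K}. b j * psi m (- int j) w z) (\<lambda>z. \<Sum>j\<in>{1..K}. cnj (b j) * phi_g m (- int j) w (mat 1) z) (ball w e)"
    by (intro harm_sum harm_cmult harm_subset[OF psi_harm[OF _ wu]] open_ball e finite_atLeastAtMost) auto
  ultimately obtain g0 where F0: "harm m F0 g0 (ball w e)"
    unfolding F0_def[abs_def] using harm_add[OF harm_add[OF G] harm_cmult] by blast
  have Feq: "F z = F0 z + ((\<Sum>n\<le>N. a n * phi m (int n) w (mat 1) z) + (\<Sum>j\<in>{1..K}. b j * phi m (- int j) w (mat 1) z))"
    if z: "z \<in> ball w e - {w}" for z
  proof -
    have l: "z - cnj w \<noteq> 0" using ne z by auto
    have zu: "z \<in> uhp" "z \<noteq> w" using z e(2) by auto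
    have bj: "c j * ((z - cnj w) / (z - w)) ^ j * (z - cnj w) ^ m = b j * phi m (- int j) w (mat 1) z - b j * psi m (- int j) w z" if "j \<in> {1..K}" for j
    proof -
      have neg: "- int j < 0" using that by simp
      have C: "beta_const (m + 1) (int j) \<noteq> 0" using beta_const_pos[OF neg, of m] by simp
      have e1: "phi m (- int j) w (mat 1) z - psi m (- int j) w z = of_real (beta_const (m + 1) (int j)) * ((z - cnj w) ^ m * ((z - cnj w) / (z - w)) ^ j)"
        using phi_one_neg[OF neg wu zu, of m] by simp
      have "b j * phi m (- int j) w (mat 1) z - b j * psi m (- int j) w z = b j * (phi m (- int j) w (mat 1) z - psi m (- int j) w z)"
        by (simp only: right_diff_distrib)
      also have "\<dots> = c j * ((z - cnj w) / (z - w)) ^ j * (z - cnj w) ^ m"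
        unfolding e1 b_def using C by simp
      finally show ?thesis by simp
    qed
    have "f z = q z * (z - cnj w) ^ m" using l by (simp add: q_def)
    also have "\<dots> = (z - cnj w) ^ m * h2 z + (\<Sum>j=1..K. c j * ((z - cnj w) / (z - w)) ^ j * (z - cnj w) ^ m)"
      unfolding q[OF z] by (simp only: distrib_right sum_distrib_right mult.commute[of "h2 z"])
    also have "(\<Sum>j=1..K. c j * ((z - cnj w) / (z - w)) ^ j * (z - cnj w) ^ m) =
        (\<Sum>j\<in>{1..K}. b j * phi m (- int j) w (mat 1) z) - (\<Sum>j\<in>{1..K}. b j * psi m (- int j) w z)"
      unfolding sum_subtractf[symmetric] by (rule sum.cong[OF refl bj])
    finally have "f z = (z - cnj w) ^ m * h2 z + ((\<Sum>j\<in>{1..K}. b j * phi m (- int j) w (mat 1) z) - (\<Sum>j\<in>{1..K}. b j * psi m (- int j) w z))" .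
    then show ?thesis using FG[of z] by (simp add: F0_def algebra_simps)
  qed
  define J where "J = int ` {..N} \<union> (\<lambda>j. - int j) ` {1..K}"
  define d where "d n = (if n \<ge> 0 then a (nat n) else b (nat (- n)))" for n
  have "(\<Sum>n\<in>J. d n * phi m n w (mat 1) z) = (\<Sum>n\<le>N. a n * phi m (int n) w (mat 1) z) + (\<Sum>j\<in>{1..K}. b j * phi m (- int j) w (mat 1) z)" for z
  proof -
    have "(\<Sum>n\<in>J. d n * phi m n w (mat 1) z) = (\<Sum>n\<in>int ` {..N}. d n * phi m n w (mat 1) z) + (\<Sum>n\<in>(\<lambda>j. - int j) ` {1..K}. d n * phi m n w (mat 1) z)"
      unfolding J_def by (rule sum.union_disjoint) auto
    also have "(\<Sum>n\<in>int ` {..N}. d n * phi m n w (mat 1) z) = (\<Sum>n\<le>N. a n * phi m (int n) w (mat 1) z)"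
      by (subst sum.reindex) (auto simp: d_def)
    also have "(\<Sum>n\<in>(\<lambda>j. - int j) ` {1..K}. d n * phi m n w (mat 1) z) = (\<Sum>j\<in>{1..K}. b j * phi m (- int j) w (mat 1) z)"
      by (subst sum.reindex) (auto simp: d_def inj_on_def)
    finally show ?thesis .
  qed
  then have "\<forall>z\<in>ball w e - {w}. F z = F0 z + (\<Sum>n\<in>J. d n * phi m n w (mat 1) z)" using Feq by simp
  moreover have "finite J" by (simp add: J_def)
  ultimately show ?thesis using F0 by blast
qed

text \<open>For \<open>n = 0\<close> only the summand with index 0 contains a logarithm; the others
  are bounded by \<open>A\<close> in total.\<close>

lemma phi_0_log:
  fixes m :: nat
  assumes w: "w \<in> uhp" and z: "z \<in> uhp" "z \<noteq> w"
  defines "x \<equiv> norm ((z - w) / (z - cnj w))" and "A \<equiv> \<Sum>i\<le>m. \<bar>altbin m i\<bar>"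
  shows "norm (phi m 0 w (mat 1) z) \<le> (- ln (x\<^sup>2) + A) * norm (z - cnj w) ^ m"
    and "norm (phi m 0 w (mat 1) z) \<ge> (- ln (x\<^sup>2) - A) * norm (z - cnj w) ^ m"
    and "0 < x" "x \<le> 1"
proof -
  have l: "z - cnj w \<noteq> 0" using uhp_cnj_ne[OF w z(1)] .
  show x: "0 < x" "x \<le> 1" using norm_lin_le[OF SL2Z_one w z(1)] l z by (auto simp: x_def norm_divide divide_le_eq)
  have s: "0 < x\<^sup>2" "x\<^sup>2 \<le> 1" using x by (auto simp: power_le_one)
  define T where "T = (\<Sum>j\<le>m. altbin m j * tau (int j) (x\<^sup>2))"
  have P: "phi m 0 w (mat 1) z = of_real T * (z - cnj w) ^ m"
    using phi_one_closed[OF w z, of m 0] by (simp add: T_def x_def)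
  define R where "R = (\<Sum>j\<in>{1..m}. altbin m j * tau (int j) (x\<^sup>2))"
  have "{..m} = insert 0 {1..m}" by auto
  then have TR: "T = - ln (x\<^sup>2) + R" by (simp add: T_def R_def altbin_def tau_def)
  have "\<bar>R\<bar> \<le> (\<Sum>j\<in>{1..m}. \<bar>altbin m j\<bar>)"
    unfolding R_def
  proof (rule order_trans[OF sum_abs], rule sum_mono)
    fix j assume j: "j \<in> {1..m}"
    have "0 \<le> (x\<^sup>2) ^ j" "(x\<^sup>2) ^ j \<le> 1" using s by (auto intro: power_le_one)
    then have "\<bar>tau (int j) (x\<^sup>2)\<bar> \<le> 1 / real j" using j by (simp add: tau_def divide_right_mono)
    also have "\<dots> \<le> 1" using j by simp
    finally show "\<bar>altbin m j * tau (int j) (x\<^sup>2)\<bar> \<le> \<bar>altbin m j\<bar>" by (simp add: abs_mult mult_left_le)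
  qed
  also have "\<dots> \<le> A" unfolding A_def by (rule sum_mono2) auto
  finally have R: "\<bar>R\<bar> \<le> A" .
  have ln: "ln (x\<^sup>2) \<le> 0" using s by simp
  have n: "norm (phi m 0 w (mat 1) z) = \<bar>T\<bar> * norm (z - cnj w) ^ m" unfolding P by (simp add: norm_mult norm_power)
  show "norm (phi m 0 w (mat 1) z) \<le> (- ln (x\<^sup>2) + A) * norm (z - cnj w) ^ m"
    unfolding n using R ln TR by (intro mult_right_mono) auto
  show "norm (phi m 0 w (mat 1) z) \<ge> (- ln (x\<^sup>2) - A) * norm (z - cnj w) ^ m"
    unfolding n using R TR by (intro mult_right_mono) auto
qed

lemma phi_0_times_tendsto:
  assumes w: "w \<in> uhp" shows "((\<lambda>z. (z - w) * phi m 0 w (mat 1) z) \<longlongrightarrow> 0) (at w)"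
proof (rule Lim_null_comparison)
  define A where "A = (\<Sum>i\<le>m. \<bar>altbin m i\<bar>)"
  let ?h = "\<lambda>z. (4 * sqrt (norm (z - w) * norm (z - cnj w)) + A * norm (z - w)) * norm (z - cnj w) ^ m"
  have "isCont ?h w" by (intro continuous_intros)
  then show "(?h \<longlongrightarrow> 0) (at w)" by (simp add: isCont_def)
  have "eventually (\<lambda>z. z \<in> uhp - {w}) (at w)" using w open_uhp by (intro eventually_at_in_open)
  then show "eventually (\<lambda>z. norm ((z - w) * phi m 0 w (mat 1) z) \<le> ?h z) (at w)"
  proof eventually_elim
    case (elim z)
    then have z: "z \<in> uhp" "z \<noteq> w" by auto
    define x where "x = norm ((z - w) / (z - cnj w))"
    note * = phi_0_log(1,2)[where m = m, OF w z, folded x_def A_def] phi_0_log(3)[OF w z, folded x_def]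
    have l: "norm (z - cnj w) > 0" using uhp_cnj_ne[OF w z(1)] by simp
    have u: "norm (z - w) = x * norm (z - cnj w)" using l by (simp add: x_def norm_divide)
    \<comment> \<open>The inequality \<open>ln s \<le> s - 1\<close> at
      \<open>s = 1 / sqrt x\<close> shows that the logarithm grows no faster than a multiple of
      \<open>1 / sqrt x\<close>.\<close>
    have "ln (1 / sqrt x) \<le> 1 / sqrt x - 1" using *(3) by (intro ln_le_minus_one) auto
    then have "- ln (x\<^sup>2) \<le> 4 / sqrt x" using *(3) by (simp add: ln_div ln_sqrt ln_realpow)
    then have "x * (- ln (x\<^sup>2)) \<le> x * (4 / sqrt x)" using *(3) by (intro mult_left_mono) auto
    also have "\<dots> = 4 * (x / sqrt x)" by simp
    also have "x / sqrt x = sqrt x" using *(3) by (intro real_div_sqrt) simp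
    finally have x: "x * (- ln (x\<^sup>2)) \<le> 4 * sqrt x" .
    have "norm (z - w) * (- ln (x\<^sup>2)) = norm (z - cnj w) * (x * (- ln (x\<^sup>2)))" by (simp add: u)
    also have "\<dots> \<le> norm (z - cnj w) * (4 * sqrt x)" using x by (intro mult_left_mono) auto
    also have "\<dots> = 4 * sqrt (norm (z - w) * norm (z - cnj w))"
      unfolding u by (simp add: real_sqrt_mult)
    finally have 1: "norm (z - w) * (- ln (x\<^sup>2)) \<le> 4 * sqrt (norm (z - w) * norm (z - cnj w))" .
    have "norm ((z - w) * phi m 0 w (mat 1) z) \<le> norm (z - w) * ((- ln (x\<^sup>2) + A) * norm (z - cnj w) ^ m)"
      unfolding norm_mult using *(1) by (intro mult_left_mono) auto
    also have "\<dots> = (norm (z - w) * (- ln (x\<^sup>2)) + A * norm (z - w)) * norm (z - cnj w) ^ m" by (simp add: algebra_simps)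
    also have "\<dots> \<le> ?h z" using 1 by (intro mult_right_mono add_mono) auto
    finally show ?case .
  qed
qed

lemma phi_0_unbounded:
  assumes w: "w \<in> uhp" shows "\<not> bdd_at (phi m 0 w (mat 1)) w"
proof
  assume "bdd_at (phi m 0 w (mat 1)) w"
  then obtain C where C: "eventually (\<lambda>z. norm (phi m 0 w (mat 1) z) \<le> C) (at w)" by (auto simp: bdd_at_def)
  define A where "A = (\<Sum>i\<le>m. \<bar>altbin m i\<bar>)"
  have wI: "Im w > 0" using w by (simp add: uhp_iff)
  define L where "L = \<bar>C\<bar> / Im w ^ m + A"
  let ?s = "\<lambda>z. (norm ((z - w) / (z - cnj w)))\<^sup>2"
  have "w - cnj w \<noteq> 0" using uhp_cnj_ne[OF w w] .
  then have "isCont ?s w" by (intro continuous_intros)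
  then have "(?s \<longlongrightarrow> 0) (at w)" by (simp add: isCont_def)
  then have "eventually (\<lambda>z. ?s z < exp (- L)) (at w)" by (rule order_tendstoD(2)) simp
  moreover have "eventually (\<lambda>z. z \<in> uhp - {w}) (at w)" using w open_uhp by (intro eventually_at_in_open)
  ultimately have "eventually (\<lambda>z. False) (at w)" using C
  proof eventually_elim
    case (elim z)
    then have z: "z \<in> uhp" "z \<noteq> w" by auto
    define x where "x = norm ((z - w) / (z - cnj w))"
    note * = phi_0_log(1,2)[where m = m, OF w z, folded x_def A_def] phi_0_log(3)[OF w z, folded x_def]
    have x2: "0 < x\<^sup>2" using *(3) by simp
    have "x\<^sup>2 < exp (- L)" using elim(1) by (simp add: x_def)
    then have "ln (x\<^sup>2) < - L" using x2 by (metis exp_gt_zero ln_exp ln_less_cancel_iff)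
    then have 1: "- ln (x\<^sup>2) - A > \<bar>C\<bar> / Im w ^ m" by (simp add: L_def)
    have "Im w \<le> norm (z - cnj w)" using abs_Im_le_cmod[of "z - cnj w"] z w by (simp add: uhp_iff)
    then have "Im w ^ m \<le> norm (z - cnj w) ^ m" using wI by (intro power_mono) auto
    moreover have "\<bar>C\<bar> / Im w ^ m \<ge> 0" using wI by simp
    ultimately have "\<bar>C\<bar> / Im w ^ m * Im w ^ m \<le> \<bar>C\<bar> / Im w ^ m * norm (z - cnj w) ^ m" by (intro mult_left_mono)
    also have "\<dots> < (- ln (x\<^sup>2) - A) * norm (z - cnj w) ^ m"
      using 1 uhp_cnj_ne[OF w z(1)] by (intro mult_strict_right_mono) auto
    also have "\<dots> \<le> C" using *(2) elim(3) by simp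
    finally show False using wI by simp
  qed
  then show False by simp
qed

text \<open>For bounded \<open>F\<close> the function \<open>g\<close> has at most a simple pole, so
  a multiple of \<open>phi\<close> with \<open>n = 0\<close> is the only term to remove. Its growth
  is logarithmic, hence the holomorphic part extends by Riemann's theorem, and then boundedness
  forces the coefficient of the logarithm to be 0.\<close>

lemma harm_bounded_extends:
  assumes F: "harm m F g (ball w e - {w})" and e: "e > 0" "ball w e \<subseteq> uhp" and bd: "bdd_at F w"
  shows "\<exists>F0 g0. harm m F0 g0 (ball w e) \<and> (\<forall>z\<in>ball w e - {w}. F z = F0 z)"
proof -
  have wu: "w \<in> uhp" using e by auto
  have bd0: "bdd_at (\<lambda>z. (z - w) ^ 0 * F z) w" using bd by simp
  obtain a h where h: "h holomorphic_on ball w e"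
    and F1: "harm m (\<lambda>z. F z - (\<Sum>n\<le>0. a n * phi m (int n) w (mat 1) z)) h (ball w e - {w})"
    using remove_antiholomorphic_pole[OF F e bd0] by blast
  obtain G f where G: "harm m G h (ball w e)" and f: "f holomorphic_on ball w e - {w}"
    and FG: "\<And>z. F z - (\<Sum>n\<le>0. a n * phi m (int n) w (mat 1) z) = f z + G z"
    using split_antiholomorphic[OF F1 h e] by blast
  have feq: "f z = F z - a 0 * phi m 0 w (mat 1) z - G z" for z using FG[of z] by (simp add: algebra_simps)
  have winb: "w \<in> ball w e" using e by simp
  have z0: "((\<lambda>z. z - w) \<longlongrightarrow> 0) (at w)" by (rule tendsto_eq_intros refl | simp)+
  have tz: "((\<lambda>z. (z - w) * B z) \<longlongrightarrow> 0) (at w)" if B: "bdd_at B w" for B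
  proof -
    obtain C where "eventually (\<lambda>z. norm (B z) \<le> C) (at w)" using B by (auto simp: bdd_at_def)
    then have "eventually (\<lambda>z. norm ((z - w) * B z) \<le> norm (z - w) * C) (at w)"
      by eventually_elim (simp add: norm_mult mult_left_mono)
    moreover have "((\<lambda>z. norm (z - w) * C) \<longlongrightarrow> 0) (at w)" by (rule tendsto_eq_intros refl | simp)+
    ultimately show ?thesis by (rule Lim_null_comparison)
  qed
  have Gb: "bdd_at G w" using harm_isCont[OF G winb] by (rule bdd_at_isCont)
  have "((\<lambda>z. (z - w) * F z - a 0 * ((z - w) * phi m 0 w (mat 1) z) - (z - w) * G z) \<longlongrightarrow> 0 - a 0 * 0 - 0) (at w)"
    by (intro tendsto_diff tendsto_mult tendsto_const tz bd Gb phi_0_times_tendsto wu)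
  then have "((\<lambda>z. (z - w) * f z) \<longlongrightarrow> 0) (at w)" by (simp add: feq algebra_simps)
  then have "\<exists>g. g holomorphic_on ball w e \<and> (\<forall>z\<in>ball w e - {w}. g z = f z)"
    using holomorphic_on_extend_lim[OF f] winb by (simp add: interior_open)
  then obtain h2 where h2: "h2 holomorphic_on ball w e" "\<And>z. z \<in> ball w e - {w} \<Longrightarrow> h2 z = f z" by blast
  have F0: "harm m (\<lambda>z. h2 z + G z) (\<lambda>z. 0 + h z) (ball w e)"
    by (intro harm_add G harm_holo open_ball e h2)
  have ev: "eventually (\<lambda>z. z \<in> ball w e - {w}) (at w)" using e by (intro eventually_at_in_open) auto
  have "a 0 = 0"
  proof (rule ccontr)
    assume a: "a 0 \<noteq> 0"
    have "isCont (\<lambda>z. h2 z + G z) w" using harm_isCont[OF F0 winb] .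
    then have "bdd_at (\<lambda>z. (1 / a 0) * (F z - (h2 z + G z))) w"
      by (intro bdd_at_cmult bdd_at_diff bd bdd_at_isCont)
    moreover have "eventually (\<lambda>z. (1 / a 0) * (F z - (h2 z + G z)) = phi m 0 w (mat 1) z) (at w)"
      using ev by eventually_elim (use a h2(2) feq in simp)
    ultimately have "bdd_at (phi m 0 w (mat 1)) w" by (rule bdd_at_cong)
    then show False using phi_0_unbounded[OF wu] by blast
  qed
  then have "\<forall>z\<in>ball w e - {w}. F z = h2 z + G z" using h2(2) feq by simp
  with F0 show ?thesis by blast
qed

section \<open>Forms with polar singularities\<close>

definition punct_harm :: "nat \<Rightarrow> (complex \<Rightarrow> complex) \<Rightarrow> complex \<Rightarrow> bool" where
  "punct_harm m F w \<longleftrightarrow> (\<exists>e>0. \<exists>g. ball w e \<subseteq> uhp \<and> harm m F g (ball w e - {w}))"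

definition reg_at :: "nat \<Rightarrow> (complex \<Rightarrow> complex) \<Rightarrow> complex \<Rightarrow> bool" where
  "reg_at m F w \<longleftrightarrow> (\<exists>e>0. \<exists>F0 g. ball w e \<subseteq> uhp \<and> harm m F0 g (ball w e) \<and> (\<forall>z\<in>ball w e - {w}. F z = F0 z))"

text \<open>For \<open>m = 2 * k - 2\<close> these are the members of \<open>maass_space k\<close>,
  expressed through punctured neighbourhoods of single points, with \<open>harm\<close> in place of
  the differential equation.\<close>

definition mform :: "nat \<Rightarrow> (complex \<Rightarrow> complex) \<Rightarrow> bool" where
  "mform m F \<longleftrightarrow> (\<forall>w\<in>uhp. punct_harm m F w) \<and>
     (\<forall>M\<in>SL2Z. \<forall>w\<in>uhp. eventually (\<lambda>z. aut M z ^ m * F (moebius M z) = F z) (at w)) \<and>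
     (\<forall>w\<in>uhp. \<exists>n. bdd_at (\<lambda>z. (z - w) ^ n * F z) w) \<and>
     (\<exists>B Y. \<forall>w\<in>uhp. eventually (\<lambda>z. Im z > Y \<longrightarrow> norm (F z) \<le> B) (at w))"

lemma ball_in_eventually:
  assumes "eventually P (at (w::complex))" "w \<in> uhp"
  obtains e where "e > 0" "ball w e \<subseteq> uhp" "\<And>z. z \<in> ball w e - {w} \<Longrightarrow> P z"
proof -
  obtain d1 where d1: "d1 > 0" "\<And>z. z \<noteq> w \<Longrightarrow> dist z w < d1 \<Longrightarrow> P z" using assms(1) by (auto simp: eventually_at)
  obtain d2 where d2: "d2 > 0" "ball w d2 \<subseteq> uhp" using open_uhp assms(2) open_contains_ball by blast
  show thesis by (rule that[of "min d1 d2"]) (use d1 d2 in \<open>auto simp: dist_commute\<close>)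
qed

lemma eventually_uhp: "w \<in> uhp \<Longrightarrow> eventually (\<lambda>z. z \<in> uhp) (at w)"
  using open_uhp by (intro eventually_at_in_open') auto

lemma punct_harm_iff:
  assumes "w \<in> uhp" "k \<ge> 1"
  shows "punct_harm (2 * k - 2) F w \<longleftrightarrow> eventually (\<lambda>z. real_analytic_at F z \<and> hyp_laplacian (1 - int k) F z = 0) (at w)"
proof
  assume "punct_harm (2 * k - 2) F w"
  then obtain e g where e: "e > 0" "harm (2 * k - 2) F g (ball w e - {w})" by (auto simp: punct_harm_def)
  have "eventually (\<lambda>z. z \<in> ball w e - {w}) (at w)" using e by (intro eventually_at_in_open) auto
  then show "eventually (\<lambda>z. real_analytic_at F z \<and> hyp_laplacian (1 - int k) F z = 0) (at w)"
    by eventually_elim (use harm_real_analytic[OF e(2)] harm_laplacian[OF e(2) _ assms(2)] in blast)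
next
  assume "eventually (\<lambda>z. real_analytic_at F z \<and> hyp_laplacian (1 - int k) F z = 0) (at w)"
  then obtain e where e: "e > 0" "ball w e \<subseteq> uhp" "\<And>z. z \<in> ball w e - {w} \<Longrightarrow> real_analytic_at F z \<and> hyp_laplacian (1 - int k) F z = 0"
    by (rule ball_in_eventually[OF _ assms(1)]) (rule that; blast)
  have "harm (2 * k - 2) F (\<lambda>z. cnj (partial_zbar F z * of_real (1 / Im z ^ (2 * k - 2)))) (ball w e - {w})"
    by (rule harm_of_laplacian[OF _ _ assms(2)]) (use e in auto)
  then show "punct_harm (2 * k - 2) F w" using e unfolding punct_harm_def by blast
qed

text \<open>In the open half-plane a property holds off a set without accumulation points iff it
  holds in a punctured neighbourhood of each point. The exponential growth condition is a
  consequence of boundedness at the cusp.\<close>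

lemma maass_space_iff:
  assumes k: "k \<ge> 1"
  shows "F \<in> maass_space k \<longleftrightarrow> mform (2 * k - 2) F"
proof -
  note ev = eventually_cosparse_open_eq[OF open_uhp]
  have sl: "slash (2 * (1 - int k)) F M z = aut M z ^ (2 * k - 2) * F (moebius M z)" for M z
  proof -
    have "- (2 * (1 - int k)) = int (2 * k - 2)" using k by simp
    then show ?thesis unfolding slash_eq by (simp only: power_int_of_nat)
  qed
  have ph: "(\<forall>w\<in>uhp. eventually (real_analytic_at F) (at w)) \<and> (\<forall>w\<in>uhp. eventually (\<lambda>z. hyp_laplacian (1 - int k) F z = 0) (at w))
      \<longleftrightarrow> (\<forall>w\<in>uhp. punct_harm (2 * k - 2) F w)"
    using punct_harm_iff[OF _ k, of _ F] by (auto simp: eventually_conj_iff)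
  have growth: "\<exists>C>0. \<exists>B Y. \<forall>w\<in>uhp. eventually (\<lambda>z. Im z > Y \<longrightarrow> norm (F z) \<le> B * exp (C * Im z)) (at w)"
    if "\<forall>w\<in>uhp. eventually (\<lambda>z. Im z > Y \<longrightarrow> norm (F z) \<le> B) (at w)" for B Y
  proof -
    \<comment> \<open>The two maxima with 0 make the exponential at least 1 and its coefficient
      nonnegative.\<close>
    have "eventually (\<lambda>z. Im z > max Y 0 \<longrightarrow> norm (F z) \<le> max B 0 * exp (1 * Im z)) (at w)" if w: "w \<in> uhp" for w
  proof -
    from w \<open>\<forall>w\<in>uhp. eventually (\<lambda>z. Im z > Y \<longrightarrow> norm (F z) \<le> B) (at w)\<close> have "eventually (\<lambda>z. Im z > Y \<longrightarrow> norm (F z) \<le> B) (at w)" by blast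
    then show ?thesis
    proof eventually_elim
      case (elim z)
      show ?case
      proof
        assume z: "Im z > max Y 0"
        then have "norm (F z) \<le> max B 0 * 1" using elim by auto
        also have "\<dots> \<le> max B 0 * exp (1 * Im z)" using z by (intro mult_left_mono) auto
        finally show "norm (F z) \<le> max B 0 * exp (1 * Im z)" .
      qed
    qed
  qed
  then show ?thesis using zero_less_one by blast
  qed
  have "F \<in> maass_space k \<longleftrightarrow>
     ((\<forall>w\<in>uhp. eventually (real_analytic_at F) (at w)) \<and> (\<forall>w\<in>uhp. eventually (\<lambda>z. hyp_laplacian (1 - int k) F z = 0) (at w))) \<and>
     (\<forall>M\<in>SL2Z. \<forall>w\<in>uhp. eventually (\<lambda>z. aut M z ^ (2 * k - 2) * F (moebius M z) = F z) (at w)) \<and>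
     (\<forall>w\<in>uhp. \<exists>n. bdd_at (\<lambda>z. (z - w) ^ n * F z) w) \<and>
     (\<exists>B Y. \<forall>w\<in>uhp. eventually (\<lambda>z. Im z > Y \<longrightarrow> norm (F z) \<le> B) (at w))"
    unfolding maass_space_def polar_harmonic_maass_form_def bounded_at_cusp_def ev sl bdd_at_bigo mem_Collect_eq
    using growth by blast
  then show ?thesis unfolding ph mform_def .
qed

section \<open>Invariance, gluing and regular points\<close>

lemma filterlim_moebius:
  assumes M: "M \<in> SL2Z" and w: "w \<in> uhp"
  shows "filterlim (moebius M) (at (moebius M w)) (at w)"
  unfolding filterlim_at
proof
  have ev: "eventually (\<lambda>z. z \<in> uhp - {w}) (at w)" using w open_uhp by (intro eventually_at_in_open)
  then show "eventually (\<lambda>z. moebius M z \<in> UNIV \<and> moebius M z \<noteq> moebius M w) (at w)"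
  proof eventually_elim
    case (elim z)
    then show ?case using moebius_minv(1)[OF M] w by (metis DiffE UNIV_I singletonI)
  qed
  have "isCont (moebius M) w" using moebius_has_derivative[OF M w] DERIV_isCont by blast
  then show "(moebius M \<longlongrightarrow> moebius M w) (at w)" by (simp add: isCont_def)
qed

lemma eventually_moebius:
  assumes "M \<in> SL2Z" "w \<in> uhp" "eventually P (at (moebius M w))"
  shows "eventually (\<lambda>z. P (moebius M z)) (at w)"
  using filterlim_moebius[OF assms(1,2)] assms(3) by (simp add: filterlim_iff)

text \<open>The factors \<open>aut M z\<close> and their conjugates, from
  \<open>Im (moebius M z) = Im z / norm (aut M z) ^ 2\<close> and from the derivative of the Moebius
  map, combine so that \<open>g\<close> transforms with weight \<open>m + 2\<close>.\<close>

lemma harm_slash: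
  assumes F: "harm m F g S" and M: "M \<in> SL2Z" and T: "open T" "T \<subseteq> uhp" "\<And>z. z \<in> T \<Longrightarrow> moebius M z \<in> S"
  shows "harm m (\<lambda>z. aut M z ^ m * F (moebius M z)) (\<lambda>z. g (moebius M z) / aut M z ^ (m + 2)) T"
  unfolding harm_iff
proof (intro conjI T ballI)
  have aut: "aut M holomorphic_on T" unfolding aut_def by (intro holomorphic_intros)
  have ne: "aut M z \<noteq> 0" if "z \<in> T" for z using aut_nonzero[OF M] that T(2) by blast
  have "moebius M holomorphic_on T"
    using moebius_has_derivative[OF M] T by (auto simp: holomorphic_on_open)
  then have "(g \<circ> moebius M) holomorphic_on T"
    by (rule holomorphic_on_compose_gen[OF _ harm_holomorphic[OF F]]) (use T in auto)
  then have gm: "(\<lambda>z. g (moebius M z)) holomorphic_on T" by (simp add: o_def)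
  show "(\<lambda>z. g (moebius M z) / aut M z ^ (m + 2)) holomorphic_on T"
    by (intro holomorphic_on_divide holomorphic_on_power gm aut) (use ne in auto)
  fix z assume z: "z \<in> T"
  have zu: "z \<in> uhp" using z T by blast
  obtain p where p: "has_wirtinger F p (of_real (Im (moebius M z)) ^ m * cnj (g (moebius M z))) (moebius M z)"
    using harmE[OF F T(3)[OF z]] .
  have "((\<lambda>z. aut M z ^ m) has_field_derivative deriv (\<lambda>z. aut M z ^ m) z) (at z)"
    by (rule holomorphic_derivI[OF _ T(1) z]) (intro holomorphic_on_power aut)
  from has_wirtinger_mult[OF has_wirtinger_holo[OF this] has_wirtinger_chain[OF p moebius_has_derivative[OF M zu]]]
  have "\<exists>p. has_wirtinger (\<lambda>z. aut M z ^ m * F (moebius M z)) p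
    (aut M z ^ m * (of_real (Im (moebius M z)) ^ m * cnj (g (moebius M z)) * cnj (1 / (aut M z)\<^sup>2))) z" by auto
  moreover have "aut M z ^ m * (of_real (Im (moebius M z)) ^ m * cnj (g (moebius M z)) * cnj (1 / (aut M z)\<^sup>2)) =
     of_real (Im z) ^ m * cnj (g (moebius M z) / aut M z ^ (m + 2))"
  proof -
    have "complex_of_real (Im (moebius M z)) = of_real (Im z) / (aut M z * cnj (aut M z))"
      unfolding Im_moebius[OF M zu] by (simp only: of_real_divide complex_norm_square)
    then show ?thesis using ne[OF z]
      by (simp add: power_divide power_mult_distrib power_add power2_eq_square mult_ac)
  qed
  ultimately show "\<exists>p. has_wirtinger (\<lambda>z. aut M z ^ m * F (moebius M z)) p (of_real (Im z) ^ m * cnj (g (moebius M z) / aut M z ^ (m + 2))) z"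
    by simp
qed

lemma harm_local:
  assumes "open S" "S \<subseteq> uhp" "\<And>z. z \<in> S \<Longrightarrow> \<exists>T. z \<in> T \<and> harm m F g T"
  shows "harm m F g S"
  unfolding harm_iff
proof (intro conjI assms(1,2) ballI)
  show "g holomorphic_on S"
  proof (unfold holomorphic_on_open[OF assms(1)], intro ballI)
    fix z assume "z \<in> S"
    then obtain T where "z \<in> T" "harm m F g T" using assms(3) by blast
    then show "\<exists>f'. (g has_field_derivative f') (at z)"
      using holomorphic_derivI[OF harm_holomorphic harm_open] by blast
  qed
  fix z assume "z \<in> S"
  then obtain T where T: "z \<in> T" "harm m F g T" using assms(3) by blast
  show "\<exists>p. has_wirtinger F p (of_real (Im z) ^ m * cnj (g z)) z"
    by (rule harmE[OF T(2,1)]) (rule exI)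
qed

text \<open>\<open>g\<close> is determined by \<open>F\<close>. In this form the local functions
  \<open>g\<close> agree on overlaps, so that \<open>harm_local\<close> can glue them.\<close>

lemma harm_canonical:
  assumes F: "harm m F g S"
  shows "harm m F (\<lambda>z. cnj (partial_zbar F z / of_real (Im z) ^ m)) S"
proof (rule harm_cong[OF F])
  fix z assume z: "z \<in> S"
  then have "Im z > 0" using harm_uhp[OF F] by (auto simp: uhp_iff)
  then show "g z = cnj (partial_zbar F z / of_real (Im z) ^ m)"
    unfolding harm_partial_zbar[OF F z] by simp
qed simp

lemma punct_harm_cong:
  assumes "punct_harm m F w" "eventually (\<lambda>z. F z = F' z) (at w)" "w \<in> uhp"
  shows "punct_harm m F' w"
proof -
  obtain e g where e: "e > 0" "ball w e \<subseteq> uhp" "harm m F g (ball w e - {w})" using assms(1) by (auto simp: punct_harm_def)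
  obtain d where d: "d > 0" "\<And>z. z \<in> ball w d - {w} \<Longrightarrow> F z = F' z"
    by (rule ball_in_eventually[OF assms(2,3)]) (rule that; blast)
  have "harm m F g (ball w (min d e) - {w})" by (rule harm_subset[OF e(3)]) auto
  then have "harm m F' g (ball w (min d e) - {w})" by (rule harm_cong) (use d in auto)
  then show ?thesis unfolding punct_harm_def using e d by (intro exI[of _ "min d e"]) auto
qed

lemma reg_atI:
  assumes "harm m F0 g S" "w \<in> S" "eventually (\<lambda>z. F z = F0 z) (at w)"
  shows "reg_at m F w"
proof -
  have wu: "w \<in> uhp" using harm_uhp[OF assms(1)] assms(2) by blast
  obtain d where d: "d > 0" "\<And>z. z \<in> ball w d - {w} \<Longrightarrow> F z = F0 z" "ball w d \<subseteq> uhp"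
    by (rule ball_in_eventually[OF assms(3) wu]) (rule that; blast)
  obtain e where e: "e > 0" "ball w e \<subseteq> S" using harm_open[OF assms(1)] assms(2) open_contains_ball by blast
  have "harm m F0 g (ball w (min d e))" by (rule harm_subset[OF assms(1)]) (use e in auto)
  then show ?thesis unfolding reg_at_def using d e by (intro exI[of _ "min d e"]) auto
qed

lemma reg_atD:
  assumes "reg_at m F w"
  shows "\<exists>e F0 g. e > 0 \<and> ball w e \<subseteq> uhp \<and> harm m F0 g (ball w e) \<and> (\<forall>z\<in>ball w e - {w}. F z = F0 z) \<and>
    eventually (\<lambda>z. F z = F0 z) (at w)"
proof -
  obtain e F0 g where e: "e > 0" "ball w e \<subseteq> uhp" "harm m F0 g (ball w e)" "\<forall>z\<in>ball w e - {w}. F z = F0 z"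
    using assms unfolding reg_at_def by blast
  have "eventually (\<lambda>z. z \<in> ball w e - {w}) (at w)" using e by (intro eventually_at_in_open) auto
  then have "eventually (\<lambda>z. F z = F0 z) (at w)" by eventually_elim (use e(4) in blast)
  with e show ?thesis by blast
qed

lemma reg_at_cong:
  assumes "reg_at m F w" "eventually (\<lambda>z. F z = F' z) (at w)" shows "reg_at m F' w"
proof -
  obtain F0 g e where e: "e > 0" "harm m F0 g (ball w e)" "eventually (\<lambda>z. F z = F0 z) (at w)" using reg_atD[OF assms(1)] by blast
  have "eventually (\<lambda>z. F' z = F0 z) (at w)" using e(3) assms(2) by eventually_elim simp
  then show ?thesis by (rule reg_atI[OF e(2), rotated]) (use e in simp)
qed

lemma reg_at_add: assumes "reg_at m F w" "reg_at m G w" shows "reg_at m (\<lambda>z. F z + G z) w"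
proof -
  obtain F0 f e where e: "e > 0" "harm m F0 f (ball w e)" "eventually (\<lambda>z. F z = F0 z) (at w)" using reg_atD[OF assms(1)] by blast
  obtain G0 g d where d: "d > 0" "harm m G0 g (ball w d)" "eventually (\<lambda>z. G z = G0 z) (at w)" using reg_atD[OF assms(2)] by blast
  have h: "harm m (\<lambda>z. F0 z + G0 z) (\<lambda>z. f z + g z) (ball w (min d e))"
    by (rule harm_add[OF harm_subset[OF e(2)] harm_subset[OF d(2)]]) auto
  have "eventually (\<lambda>z. F z + G z = F0 z + G0 z) (at w)" using e(3) d(3) by eventually_elim simp
  then show ?thesis by (rule reg_atI[OF h, rotated]) (use e d in simp)
qed

lemma reg_at_cmult: assumes "reg_at m F w" shows "reg_at m (\<lambda>z. c * F z) w"
proof -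
  obtain F0 f e where e: "e > 0" "harm m F0 f (ball w e)" "eventually (\<lambda>z. F z = F0 z) (at w)" using reg_atD[OF assms] by blast
  have "eventually (\<lambda>z. c * F z = c * F0 z) (at w)" using e(3) by eventually_elim simp
  then show ?thesis by (rule reg_atI[OF harm_cmult[OF e(2)], rotated]) (use e in simp)
qed

lemma reg_at_bdd: assumes "reg_at m F w" shows "bdd_at F w"
proof -
  obtain F0 f e where e: "e > 0" "harm m F0 f (ball w e)" "eventually (\<lambda>z. F z = F0 z) (at w)" using reg_atD[OF assms] by blast
  have "bdd_at F0 w" by (rule bdd_at_isCont[OF harm_isCont[OF e(2)]]) (use e in simp)
  moreover have "eventually (\<lambda>z. F0 z = F z) (at w)" using e(3) by eventually_elim simp
  ultimately show ?thesis by (rule bdd_at_cong)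
qed

lemma reg_at_of_bdd: assumes "punct_harm m F w" "bdd_at F w" shows "reg_at m F w"
proof -
  obtain e g where e: "e > 0" "ball w e \<subseteq> uhp" "harm m F g (ball w e - {w})" using assms(1) by (auto simp: punct_harm_def)
  from harm_bounded_extends[OF e(3,1,2) assms(2)] show ?thesis unfolding reg_at_def using e by blast
qed

section \<open>Linear structure of the space of forms and vanishing of regular ones\<close>

lemma mform_zero: "mform m (\<lambda>_. 0)"
  unfolding mform_def
proof (intro conjI ballI)
  show "punct_harm m (\<lambda>_. 0) w" if w: "w \<in> uhp" for w
  proof -
    obtain e where "e > 0" "ball w e \<subseteq> uhp" using open_uhp w open_contains_ball by blast
    then show ?thesis unfolding punct_harm_def
      by (intro exI[of _ e] conjI exI[of _ "\<lambda>_. 0"] harm_holo) auto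
  qed
qed (auto intro!: exI[of _ 0] bdd_at_const)

lemma mform_add:
  assumes "mform m F" "mform m G" shows "mform m (\<lambda>z. F z + G z)"
  unfolding mform_def
proof (intro conjI ballI)
  fix w assume w: "w \<in> uhp"
  obtain e f where e: "e > 0" "ball w e \<subseteq> uhp" "harm m F f (ball w e - {w})" using assms(1) w by (auto simp: mform_def punct_harm_def)
  obtain d g where d: "d > 0" "harm m G g (ball w d - {w})" using assms(2) w by (auto simp: mform_def punct_harm_def)
  have "harm m (\<lambda>z. F z + G z) (\<lambda>z. f z + g z) (ball w (min d e) - {w})"
    by (rule harm_add[OF harm_subset[OF e(3)] harm_subset[OF d(2)]]) auto
  then show "punct_harm m (\<lambda>z. F z + G z) w" unfolding punct_harm_def using e d by (intro exI[of _ "min d e"]) auto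
  obtain n1 n2 where n: "bdd_at (\<lambda>z. (z - w) ^ n1 * F z) w" "bdd_at (\<lambda>z. (z - w) ^ n2 * G z) w"
    using assms w unfolding mform_def by blast
  have "bdd_at (\<lambda>z. (z - w) ^ (n1 + n2) * F z + (z - w) ^ (n1 + n2) * G z) w"
    by (intro bdd_at_add bdd_at_power_mono[OF n(1)] bdd_at_power_mono[OF n(2)]) auto
  then show "\<exists>n. bdd_at (\<lambda>z. (z - w) ^ n * (F z + G z)) w" by (auto simp: distrib_left)
next
  fix M w assume M: "M \<in> SL2Z" "w \<in> uhp"
  have "eventually (\<lambda>z. aut M z ^ m * F (moebius M z) = F z) (at w)" "eventually (\<lambda>z. aut M z ^ m * G (moebius M z) = G z) (at w)"
    using assms M unfolding mform_def by blast+
  then show "eventually (\<lambda>z. aut M z ^ m * (F (moebius M z) + G (moebius M z)) = F z + G z) (at w)"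
    by eventually_elim (simp add: distrib_left)
next
  obtain B1 Y1 B2 Y2 where BY: "\<And>w. w \<in> uhp \<Longrightarrow> eventually (\<lambda>z. Im z > Y1 \<longrightarrow> norm (F z) \<le> B1) (at w)"
    "\<And>w. w \<in> uhp \<Longrightarrow> eventually (\<lambda>z. Im z > Y2 \<longrightarrow> norm (G z) \<le> B2) (at w)"
    using assms unfolding mform_def by blast
  have "eventually (\<lambda>z. Im z > max Y1 Y2 \<longrightarrow> norm (F z + G z) \<le> B1 + B2) (at w)" if w: "w \<in> uhp" for w
    using BY(1)[OF w] BY(2)[OF w] by eventually_elim (auto intro: norm_triangle_mono)
  then show "\<exists>B Y. \<forall>w\<in>uhp. eventually (\<lambda>z. Im z > Y \<longrightarrow> norm (F z + G z) \<le> B) (at w)" by blast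
qed

lemma mform_cmult:
  assumes "mform m F" shows "mform m (\<lambda>z. c * F z)"
  unfolding mform_def
proof (intro conjI ballI)
  fix w assume w: "w \<in> uhp"
  obtain e f where e: "e > 0" "ball w e \<subseteq> uhp" "harm m F f (ball w e - {w})" using assms(1) w by (auto simp: mform_def punct_harm_def)
  from harm_cmult[OF e(3), of c] show "punct_harm m (\<lambda>z. c * F z) w" unfolding punct_harm_def using e by blast
  obtain n where n: "bdd_at (\<lambda>z. (z - w) ^ n * F z) w" using assms w unfolding mform_def by blast
  from bdd_at_cmult[OF n, of c] show "\<exists>n. bdd_at (\<lambda>z. (z - w) ^ n * (c * F z)) w" by (auto simp: mult.left_commute)
next
  fix M w assume M: "M \<in> SL2Z" "w \<in> uhp"
  have "eventually (\<lambda>z. aut M z ^ m * F (moebius M z) = F z) (at w)" using assms M unfolding mform_def by blast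
  then show "eventually (\<lambda>z. aut M z ^ m * (c * F (moebius M z)) = c * F z) (at w)"
    by eventually_elim (simp add: mult.left_commute)
next
  obtain B Y where BY: "\<And>w. w \<in> uhp \<Longrightarrow> eventually (\<lambda>z. Im z > Y \<longrightarrow> norm (F z) \<le> B) (at w)"
    using assms unfolding mform_def by blast
  have "eventually (\<lambda>z. Im z > Y \<longrightarrow> norm (c * F z) \<le> norm c * B) (at w)" if w: "w \<in> uhp" for w
    using BY(1)[OF w] by eventually_elim (auto simp: norm_mult mult_left_mono)
  then show "\<exists>B Y. \<forall>w\<in>uhp. eventually (\<lambda>z. Im z > Y \<longrightarrow> norm (c * F z) \<le> B) (at w)" by blast
qed

lemma mform_cong:
  assumes F: "mform m F" and eq: "\<And>w. w \<in> uhp \<Longrightarrow> eventually (\<lambda>z. F z = F' z) (at w)"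
  shows "mform m F'"
  unfolding mform_def
proof (intro conjI ballI)
  fix w assume w: "w \<in> uhp"
  show "punct_harm m F' w" using punct_harm_cong[OF _ eq[OF w] w] F w by (auto simp: mform_def)
  obtain n where n: "bdd_at (\<lambda>z. (z - w) ^ n * F z) w" using F w unfolding mform_def by blast
  have "eventually (\<lambda>z. (z - w) ^ n * F z = (z - w) ^ n * F' z) (at w)" using eq[OF w] by eventually_elim simp
  from bdd_at_cong[OF n this] show "\<exists>n. bdd_at (\<lambda>z. (z - w) ^ n * F' z) w" by blast
next
  fix M w assume M: "M \<in> SL2Z" "w \<in> uhp"
  have "eventually (\<lambda>z. aut M z ^ m * F (moebius M z) = F z) (at w)" using F M unfolding mform_def by blast
  with eq[OF M(2)] eventually_moebius[OF M eq[OF moebius_uhp[OF M]]]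
  show "eventually (\<lambda>z. aut M z ^ m * F' (moebius M z) = F' z) (at w)"
    by eventually_elim simp
next
  obtain B Y where BY: "\<And>w. w \<in> uhp \<Longrightarrow> eventually (\<lambda>z. Im z > Y \<longrightarrow> norm (F z) \<le> B) (at w)"
    using F unfolding mform_def by blast
  have "eventually (\<lambda>z. Im z > Y \<longrightarrow> norm (F' z) \<le> B) (at w)" if w: "w \<in> uhp" for w
    using BY(1)[OF w] eq[OF w] by eventually_elim simp
  then show "\<exists>B Y. \<forall>w\<in>uhp. eventually (\<lambda>z. Im z > Y \<longrightarrow> norm (F' z) \<le> B) (at w)" by blast
qed

lemma mform_sum:
  "finite I \<Longrightarrow> (\<And>i. i \<in> I \<Longrightarrow> mform m (F i)) \<Longrightarrow> mform m (\<lambda>z. \<Sum>i\<in>I. F i z)"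
  by (induction I rule: finite_induct) (auto intro: mform_zero mform_add)

lemma mform_reg_at_moebius:
  assumes F: "mform m F" and M: "M \<in> SL2Z" and w: "w \<in> uhp" and reg: "reg_at m F (moebius M w)"
  shows "reg_at m F w"
proof -
  obtain F0 g e where e: "e > 0" "harm m F0 g (ball (moebius M w) e)" "eventually (\<lambda>z. F z = F0 z) (at (moebius M w))"
    using reg_atD[OF reg] by blast
  define T where "T = uhp \<inter> moebius M -` ball (moebius M w) e"
  have T: "open T" unfolding T_def by (rule continuous_open_preimage[OF continuous_on_moebius[OF M] open_uhp open_ball])
  have "harm m (\<lambda>z. aut M z ^ m * F0 (moebius M z)) (\<lambda>z. g (moebius M z) / aut M z ^ (m + 2)) T"
    by (rule harm_slash[OF e(2) M T]) (auto simp: T_def)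
  moreover have "w \<in> T" using w e by (simp add: T_def)
  moreover have "eventually (\<lambda>z. F z = aut M z ^ m * F0 (moebius M z)) (at w)"
  proof -
    have "eventually (\<lambda>z. aut M z ^ m * F (moebius M z) = F z) (at w)" using F M w unfolding mform_def by blast
    with eventually_moebius[OF M w e(3)] show ?thesis by eventually_elim simp
  qed
  ultimately show ?thesis by (rule reg_atI)
qed

lemma mform_vanish:
  assumes F: "mform m F" and m: "m \<ge> 1" and reg: "\<And>w. w \<in> uhp \<Longrightarrow> reg_at m F w" and w: "w \<in> uhp"
  shows "eventually (\<lambda>z. F z = 0) (at w)"
proof -
  \<comment> \<open>Taking limits repairs the arbitrary values of \<open>F\<close> on the
    exceptional set, so that harmonicity and invariance hold at every point.\<close>
  define G where "G w = Lim (at w) F" for w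
  have G: "\<exists>e g. e > 0 \<and> harm m G g (ball w e) \<and> (\<forall>z\<in>ball w e - {w}. F z = G z) \<and> (F \<longlongrightarrow> G w) (at w)" if w: "w \<in> uhp" for w
  proof -
    obtain F0 g e where e: "e > 0" "ball w e \<subseteq> uhp" "harm m F0 g (ball w e)" "\<forall>z\<in>ball w e - {w}. F z = F0 z"
      using reg_atD[OF reg[OF w]] by blast
    have lim: "(F \<longlongrightarrow> F0 z) (at z)" if z: "z \<in> ball w e" for z
    proof -
      have "(F0 \<longlongrightarrow> F0 z) (at z)" using harm_isCont[OF e(3) z] by (simp add: isCont_def)
      moreover have "eventually (\<lambda>x. F0 x = F x) (at z)"
      proof -
        have "eventually (\<lambda>x. x \<in> ball w e) (at z)" using z by (intro eventually_at_in_open') auto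
        moreover have "eventually (\<lambda>x. x \<noteq> w) (at z)"
          using eventually_not_finite[of "{w}" z] by simp
        ultimately show ?thesis by eventually_elim (use e(4) in auto)
      qed
      ultimately show ?thesis using tendsto_cong by fast
    qed
    have Geq: "G z = F0 z" if "z \<in> ball w e" for z
      unfolding G_def by (rule tendsto_Lim[OF _ lim[OF that]]) simp
    have "harm m G g (ball w e)" by (rule harm_cong[OF e(3)]) (use Geq in auto)
    moreover have "\<forall>z\<in>ball w e - {w}. F z = G z" using e(4) Geq by auto
    moreover have "(F \<longlongrightarrow> G w) (at w)" using lim[of w] Geq[of w] e(1) by simp
    ultimately show ?thesis using e(1) by blast
  qed
  have Gh: "harm m G (\<lambda>z. cnj (partial_zbar G z / of_real (Im z) ^ m)) uhp"
  proof (rule harm_local[OF open_uhp subset_refl])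
    fix z assume "z \<in> uhp"
    then obtain e g where "e > 0" "harm m G g (ball z e)" using G by blast
    then show "\<exists>T. z \<in> T \<and> harm m G (\<lambda>z. cnj (partial_zbar G z / of_real (Im z) ^ m)) T"
      using harm_canonical by (intro exI[of _ "ball z e"]) auto
  qed
  have Gs: "aut M z ^ m * G (moebius M z) = G z" if M: "M \<in> SL2Z" and z: "z \<in> uhp" for M z
  proof -
    have 1: "(F \<longlongrightarrow> G z) (at z)" using G[OF z] by blast
    have "(F \<longlongrightarrow> G (moebius M z)) (at (moebius M z))" using G[OF moebius_uhp[OF M z]] by blast
    then have "((\<lambda>x. F (moebius M x)) \<longlongrightarrow> G (moebius M z)) (at z)"
      by (rule filterlim_compose[OF _ filterlim_moebius[OF M z]])
    moreover have "(aut M \<longlongrightarrow> aut M z) (at z)" unfolding aut_def by (intro tendsto_intros)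
    ultimately have "((\<lambda>x. aut M x ^ m * F (moebius M x)) \<longlongrightarrow> aut M z ^ m * G (moebius M z)) (at z)"
      by (intro tendsto_mult tendsto_power)
    moreover have "eventually (\<lambda>x. aut M x ^ m * F (moebius M x) = F x) (at z)" using F M z unfolding mform_def by blast
    ultimately have "(F \<longlongrightarrow> aut M z ^ m * G (moebius M z)) (at z)" using tendsto_cong by fast
    then show ?thesis using tendsto_unique[OF _ _ 1] by simp
  qed
  obtain B0 Y where BY: "\<And>w. w \<in> uhp \<Longrightarrow> eventually (\<lambda>z. Im z > Y \<longrightarrow> norm (F z) \<le> B0) (at w)"
    using F unfolding mform_def by blast
  have GB: "norm (G z) \<le> B0" if z: "z \<in> uhp" "Im z > Y" for z
  proof -
    have "open {z. Im z > Y}" by (rule open_halfspace_Im_gt)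
    then have "eventually (\<lambda>x. x \<in> {z. Im z > Y}) (at z)" using z by (intro eventually_at_in_open') auto
    with BY[OF z(1)] have "eventually (\<lambda>x. norm (F x) \<le> B0) (at z)" by eventually_elim simp
    moreover have "(F \<longlongrightarrow> G z) (at z)" using G[OF z(1)] by blast
    ultimately show ?thesis using Lim_norm_ubound[of "at z" F "G z" B0] by simp
  qed
  define u where "u z = (norm (G z))\<^sup>2 / Im z ^ m" for z
  have us: "u (moebius M z) = u z" if M: "M \<in> SL2Z" and z: "z \<in> uhp" for M z
  proof -
    have a: "norm (aut M z) > 0" using aut_nonzero[OF M z] by simp
    have "u z = (norm (aut M z) ^ m * norm (G (moebius M z)))\<^sup>2 / Im z ^ m"
      unfolding u_def Gs[OF M z, symmetric] by (simp add: norm_mult norm_power)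
    also have "\<dots> = (norm (G (moebius M z)))\<^sup>2 / (Im z / (norm (aut M z))\<^sup>2) ^ m"
      by (simp add: power_mult_distrib power_divide mult.commute flip: power_mult)
    finally show ?thesis unfolding u_def Im_moebius[OF M z] by simp
  qed
  have G0: "G z1 = 0" if z1: "z1 \<in> uhp" for z1
  proof (rule ccontr)
    assume nz: "G z1 \<noteq> 0"
    have u1: "u z1 > 0" using nz z1 by (simp add: u_def uhp_iff)
    \<comment> \<open>Above this height \<open>B0\<^sup>2 / Im z < u z1\<close>, so points high in
      the cusp cannot compete with \<open>z1\<close>.\<close>
    define Y' where "Y' = max (max Y 1) (B0\<^sup>2 / u z1 + 1)"
    have small: "u z < u z1" if z: "z \<in> uhp" "Im z > Y'" for z
    proof -
      have z': "Im z > Y" "Im z \<ge> 1" "Im z > B0\<^sup>2 / u z1" using z(2) by (auto simp: Y'_def)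
      have "Im z ^ 1 \<le> Im z ^ m" using z'(2) m by (intro power_increasing)
      have "(norm (G z))\<^sup>2 \<le> B0\<^sup>2" using GB[OF z(1) z'(1)] by (intro power_mono) auto
      then have "u z \<le> B0\<^sup>2 / Im z ^ m" unfolding u_def using z(1) by (intro divide_right_mono) (auto simp: uhp_iff)
      also have "\<dots> \<le> B0\<^sup>2 / Im z" using \<open>Im z ^ 1 \<le> Im z ^ m\<close> z'(2) by (intro divide_left_mono) auto
      also have "\<dots> < u z1" using z' u1 by (simp add: field_simps)
      finally show ?thesis .
    qed
    define K where "K = {z. \<bar>Re z\<bar> \<le> 1/2 \<and> 1/2 \<le> Im z \<and> Im z \<le> Y'}"
    have "K = cbox (Complex (-1/2) (1/2)) (Complex (1/2) Y')"
      by (auto simp: K_def in_cbox_complex_iff abs_le_iff)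
    then have K: "compact K" by simp
    have Ku: "K \<subseteq> uhp" by (auto simp: K_def uhp_iff)
    \<comment> \<open>Every value of \<open>u\<close> is attained on the compact set
      \<open>K\<close> or is smaller than \<open>u z1\<close>. As \<open>u z1\<close> itself is
      attained on \<open>K\<close>, a maximum over \<open>K\<close> is a maximum over the
      half-plane.\<close>
    have red: "\<exists>z'\<in>uhp. u z' = u z \<and> (z' \<in> K \<or> u z' < u z1)" if z: "z \<in> uhp" for z
    proof -
      obtain M where M: "M \<in> SL2Z" "\<bar>Re (moebius M z)\<bar> \<le> 1 / 2" "Im (moebius M z) \<ge> 1 / 2"
        using reduction[OF z] .
      show ?thesis
      proof (intro bexI[of _ "moebius M z"] conjI us[OF M(1) z] moebius_uhp[OF M(1) z])
        show "moebius M z \<in> K \<or> u (moebius M z) < u z1"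
          using M(2,3) small[OF moebius_uhp[OF M(1) z]] by (cases "Im (moebius M z) > Y'") (auto simp: K_def)
      qed
    qed
    obtain z1' where z1': "z1' \<in> K" "u z1' = u z1" using red[OF z1] by force
    have "continuous_on K u"
      unfolding u_def
    proof (intro continuous_intros)
      show "continuous_on K G" using harm_isCont[OF Gh] Ku by (intro continuous_at_imp_continuous_on) blast
      show "\<forall>z\<in>K. Im z ^ m \<noteq> 0" by (auto simp: K_def)
    qed
    then obtain z0 where z0: "z0 \<in> K" "\<And>z. z \<in> K \<Longrightarrow> u z \<le> u z0"
      using continuous_attains_sup[OF K, of u] z1' by blast
    have z0u: "z0 \<in> uhp" using z0 Ku by blast
    have max: "u z \<le> u z0" if z: "z \<in> uhp" for z
    proof -
      obtain z' where "u z' = u z" "z' \<in> K \<or> u z' < u z1" using red[OF z] by blast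
      then show ?thesis using z0(2) z0(2)[OF z1'(1)] z1'(2) by force
    qed
    have "G z0 = 0" by (rule harm_max_principle[OF Gh m z0u]) (use max in \<open>simp add: u_def\<close>)
    then have "u z0 = 0" by (simp add: u_def)
    then show False using max[OF z1] u1 by simp
  qed
  obtain e where e: "e > 0" "\<forall>z\<in>ball w e - {w}. F z = G z" using G[OF w] by blast
  have "eventually (\<lambda>z. z \<in> ball w e - {w}) (at w)" using e by (intro eventually_at_in_open) auto
  with eventually_uhp[OF w] show ?thesis by eventually_elim (use e(2) G0 in auto)
qed

section \<open>The Poincare series as polar harmonic forms\<close>

definition pser :: "nat \<Rightarrow> int \<Rightarrow> complex \<Rightarrow> complex \<Rightarrow> complex" where
  "pser m n \<zz> z = (\<Sum>\<^sub>\<infinity>M\<in>SL2Z. phi m n \<zz> M z)"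

lemma pser_harm:
  assumes m: "m \<ge> 2" and \<zz>: "\<zz> \<in> uhp"
  shows "harm m (pser m n \<zz>) (\<lambda>z. \<Sum>\<^sub>\<infinity>M\<in>SL2Z. phi_g m n \<zz> M z) (uhp - modular_orbit \<zz>)"
proof (rule harm_local[OF open_uhp_minus_orbit[OF \<zz>]])
  fix z0 assume z0: "z0 \<in> uhp - modular_orbit \<zz>"
  show "\<exists>T. z0 \<in> T \<and> harm m (pser m n \<zz>) (\<lambda>z. \<Sum>\<^sub>\<infinity>M\<in>SL2Z. phi_g m n \<zz> M z) T"
  proof (rule poincare_off_orbit[OF m \<zz> z0, of n])
    fix r :: real
    assume "r > 0" "harm m (\<lambda>z. \<Sum>\<^sub>\<infinity>M\<in>SL2Z. phi m n \<zz> M z) (\<lambda>z. \<Sum>\<^sub>\<infinity>M\<in>SL2Z. phi_g m n \<zz> M z) (ball z0 r)"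
    then show ?thesis unfolding pser_def[abs_def] by (intro exI[of _ "ball z0 r"]) simp
  qed
qed auto

lemma pser_local:
  assumes m: "m \<ge> 2" and \<zz>: "\<zz> \<in> uhp" and z0: "z0 \<in> uhp"
  shows "\<exists>R g. harm m R g (ball z0 (Im z0 / 2)) \<and>
    (\<forall>z\<in>ball z0 (Im z0 / 2). pser m n \<zz> z = R z + (\<Sum>M\<in>near_set \<zz> z0. phi m n \<zz> M z))"
proof (rule poincare_local[OF m \<zz> z0, of n])
  fix R g assume "harm m R g (ball z0 (Im z0 / 2))"
    "\<And>z. z \<in> ball z0 (Im z0 / 2) \<Longrightarrow> (\<Sum>\<^sub>\<infinity>M\<in>SL2Z. phi m n \<zz> M z) = R z + (\<Sum>M\<in>near_set \<zz> z0. phi m n \<zz> M z)"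
  then show ?thesis unfolding pser_def by blast
qed

lemma pser_mform:
  assumes m: "m \<ge> 2" and \<zz>: "\<zz> \<in> uhp"
  shows "mform m (pser m n \<zz>)"
  unfolding mform_def
proof (intro conjI ballI)
  fix w assume w: "w \<in> uhp"
  obtain e where e: "e > 0" "ball w e \<subseteq> uhp" "\<And>z. z \<in> ball w e - {w} \<Longrightarrow> z \<notin> modular_orbit \<zz>"
    by (rule ball_in_eventually[OF eventually_not_orbit[OF \<zz> w] w]) (rule that; blast)
  have "harm m (pser m n \<zz>) (\<lambda>z. \<Sum>\<^sub>\<infinity>M\<in>SL2Z. phi_g m n \<zz> M z) (ball w e - {w})"
    by (rule harm_subset[OF pser_harm[OF m \<zz>]]) (use e in auto)
  then show "punct_harm m (pser m n \<zz>) w" unfolding punct_harm_def using e by blast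
  obtain R g where R: "harm m R g (ball w (Im w / 2))"
    "\<And>z. z \<in> ball w (Im w / 2) \<Longrightarrow> pser m n \<zz> z = R z + (\<Sum>M\<in>near_set \<zz> w. phi m n \<zz> M z)"
    using pser_local[OF m \<zz> w, of n] by blast
  let ?K = "m + nat \<bar>n\<bar> + 2"
  have pos: "Im w / 2 > 0" using w by (simp add: uhp_iff)
  have "bdd_at (\<lambda>z. (z - w) ^ ?K * R z + (\<Sum>M\<in>near_set \<zz> w. (z - w) ^ ?K * phi m n \<zz> M z)) w"
  proof (intro bdd_at_add bdd_at_sum)
    show "bdd_at (\<lambda>z. (z - w) ^ ?K * R z) w"
      by (intro bdd_at_mult bdd_at_isCont continuous_intros harm_isCont[OF R(1)]) (use pos in simp)
    show "bdd_at (\<lambda>z. (z - w) ^ ?K * phi m n \<zz> M z) w" if "M \<in> near_set \<zz> w" for M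
      using bdd_at_phi[OF _ \<zz> w] near_set_subset that by blast
  qed
  moreover have "eventually (\<lambda>z. (z - w) ^ ?K * R z + (\<Sum>M\<in>near_set \<zz> w. (z - w) ^ ?K * phi m n \<zz> M z) = (z - w) ^ ?K * pser m n \<zz> z) (at w)"
  proof -
    have "eventually (\<lambda>z. z \<in> ball w (Im w / 2)) (at w)" using pos by (intro eventually_at_in_open') auto
    then show ?thesis by eventually_elim (simp only: R(2) distrib_left sum_distrib_left)
  qed
  ultimately have "bdd_at (\<lambda>z. (z - w) ^ ?K * pser m n \<zz> z) w" by (rule bdd_at_cong)
  then show "\<exists>n'. bdd_at (\<lambda>z. (z - w) ^ n' * pser m n \<zz> z) w" by blast
next
  fix M w assume M: "M \<in> SL2Z" "w \<in> uhp"
  show "eventually (\<lambda>z. aut M z ^ m * pser m n \<zz> (moebius M z) = pser m n \<zz> z) (at w)"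
    using eventually_uhp[OF M(2)] unfolding pser_def by eventually_elim (rule poincare_slash[OF M(1)])
next
  show "\<exists>B Y. \<forall>w\<in>uhp. eventually (\<lambda>z. Im z > Y \<longrightarrow> norm (pser m n \<zz> z) \<le> B) (at w)"
  proof (rule poincare_cusp_bounded[OF m \<zz>, of n])
    fix B Y assume BY: "\<And>z. Im z > Y \<Longrightarrow> z \<in> uhp \<Longrightarrow> norm (\<Sum>\<^sub>\<infinity>M\<in>SL2Z. phi m n \<zz> M z) \<le> B"
    have "eventually (\<lambda>z. Im z > Y \<longrightarrow> norm (pser m n \<zz> z) \<le> B) (at w)" if "w \<in> uhp" for w
      using eventually_uhp[OF that] by eventually_elim (use BY in \<open>auto simp: pser_def\<close>)
    then show ?thesis by blast
  qed
qed

lemma pser_reg_at: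
  assumes "m \<ge> 2" "\<zz> \<in> uhp" "w \<in> uhp - modular_orbit \<zz>"
  shows "reg_at m (pser m n \<zz>) w"
  by (rule reg_atI[OF pser_harm[OF assms(1,2), of n] assms(3)]) simp

lemma stabilizer_iff:
  assumes "\<zz> \<in> uhp" shows "M \<in> stabilizer \<zz> \<longleftrightarrow> M \<in> SL2Z \<and> lin \<zz> M \<zz> = 0"
  unfolding stabilizer_def using lin_eq[OF _ assms] aut_nonzero[OF _ assms] by auto

lemma stabilizer_near: "\<zz> \<in> uhp \<Longrightarrow> stabilizer \<zz> \<subseteq> near_set \<zz> \<zz>"
proof
  fix M assume \<zz>: "\<zz> \<in> uhp" and "M \<in> stabilizer \<zz>"
  then have M: "M \<in> SL2Z" "lin \<zz> M \<zz> = 0" by (auto simp: stabilizer_iff)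
  have "\<zz> \<in> ball \<zz> (Im \<zz> / 2)" using \<zz> by (simp add: uhp_iff)
  then show "M \<in> near_set \<zz> \<zz>" unfolding near_set_def
    using M lin_cnj_nonzero[OF M(1) \<zz> \<zz>] by (intro CollectI conjI bexI[of _ \<zz>]) auto
qed

lemma finite_stabilizer: "\<zz> \<in> uhp \<Longrightarrow> finite (stabilizer \<zz>)"
  using finite_subset[OF stabilizer_near finite_near_set] by blast

lemma one_stabilizer: "mat 1 \<in> stabilizer \<zz>"
  by (simp add: stabilizer_def SL2Z_one)

text \<open>For the near matrices outside the stabilizer the form \<open>lin \<zz> M\<close> does
  not vanish at \<open>\<zz>\<close>, so these finitely many terms are regular there.\<close>

lemma pser_at_pole:
  assumes m: "m \<ge> 2" and \<zz>: "\<zz> \<in> uhp"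
  shows "\<exists>R. reg_at m R \<zz> \<and> eventually (\<lambda>z. pser m n \<zz> z = R z + (\<Sum>M\<in>stabilizer \<zz>. phi m n \<zz> M z)) (at \<zz>)"
proof -
  let ?E = "near_set \<zz> \<zz>" let ?S = "stabilizer \<zz>"
  obtain R g where R: "harm m R g (ball \<zz> (Im \<zz> / 2))"
    "\<And>z. z \<in> ball \<zz> (Im \<zz> / 2) \<Longrightarrow> pser m n \<zz> z = R z + (\<Sum>M\<in>?E. phi m n \<zz> M z)"
    using pser_local[OF m \<zz> \<zz>, of n] by blast
  have pos: "Im \<zz> / 2 > 0" using \<zz> by (simp add: uhp_iff)
  have "reg_at m (\<lambda>z. \<Sum>M\<in>I. phi m n \<zz> M z) \<zz>" if "finite I" "I \<subseteq> ?E - ?S" for I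
    using that
  proof (induction I rule: finite_induct)
    case empty
    show ?case by (rule reg_atI[OF harm_holo[OF open_uhp subset_refl holomorphic_on_const[of 0]] \<zz>]) simp
  next
    case (insert M I)
    then have M: "M \<in> SL2Z" "lin \<zz> M \<zz> \<noteq> 0" using near_set_subset stabilizer_iff[OF \<zz>] by blast+
    have "reg_at m (phi m n \<zz> M) \<zz>" by (rule reg_atI[OF phi_harm[OF M(1) \<zz>, of m n]]) (use M \<zz> in auto)
    then show ?case using reg_at_add insert by simp
  qed
  then have 1: "reg_at m (\<lambda>z. \<Sum>M\<in>?E - ?S. phi m n \<zz> M z) \<zz>" using finite_near_set[OF \<zz> \<zz>] by blast
  have "reg_at m R \<zz>" by (rule reg_atI[OF R(1)]) (use pos in auto)
  from reg_at_add[OF this 1] have "reg_at m (\<lambda>z. R z + (\<Sum>M\<in>?E - ?S. phi m n \<zz> M z)) \<zz>" .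
  moreover have "eventually (\<lambda>z. pser m n \<zz> z = R z + (\<Sum>M\<in>?E - ?S. phi m n \<zz> M z) + (\<Sum>M\<in>?S. phi m n \<zz> M z)) (at \<zz>)"
  proof -
    have "eventually (\<lambda>z. z \<in> ball \<zz> (Im \<zz> / 2)) (at \<zz>)" using pos by (intro eventually_at_in_open') auto
    then show ?thesis
    proof eventually_elim
      case (elim z)
      have "(\<Sum>M\<in>?E. phi m n \<zz> M z) = (\<Sum>M\<in>?E - ?S. phi m n \<zz> M z) + (\<Sum>M\<in>?S. phi m n \<zz> M z)"
        by (rule sum.subset_diff[OF stabilizer_near[OF \<zz>] finite_near_set[OF \<zz> \<zz>]])
      then show ?case using R(2)[OF elim] by simp
    qed
  qed
  ultimately show ?thesis by blast
qed

lemma reg_at_sum: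
  assumes "finite I" "\<And>i. i \<in> I \<Longrightarrow> reg_at m (F i) w" "w \<in> uhp"
  shows "reg_at m (\<lambda>z. \<Sum>i\<in>I. F i z) w"
  using assms(1,2)
proof (induction I rule: finite_induct)
  case empty
  show ?case by (rule reg_atI[OF harm_holo[OF open_uhp subset_refl holomorphic_on_const[of 0]] assms(3)]) simp
qed (use reg_at_add in simp)

text \<open>Averaging the local decomposition at \<open>\<zz>\<close> over the stabilizer turns the singular terms of an invariant
  form into the singular parts of Poincare series.\<close>

lemma remove_singularity:
  assumes m: "m \<ge> 2" and \<zz>: "\<zz> \<in> uhp" and F: "mform m F"
  shows "\<exists>J d. finite (J :: int set) \<and> reg_at m (\<lambda>z. F z - (\<Sum>n\<in>J. d n * pser m n \<zz> z)) \<zz>"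
proof -
  let ?S = "stabilizer \<zz>"
  obtain e g where e: "e > 0" "ball \<zz> e \<subseteq> uhp" "harm m F g (ball \<zz> e - {\<zz>})"
    using F \<zz> unfolding mform_def punct_harm_def by blast
  obtain N where N: "bdd_at (\<lambda>z. (z - \<zz>) ^ N * F z) \<zz>" using F \<zz> unfolding mform_def by blast
  obtain F0 g0 J d where J: "finite (J :: int set)" and F0: "harm m F0 g0 (ball \<zz> e)"
    and dec: "\<And>z. z \<in> ball \<zz> e - {\<zz>} \<Longrightarrow> F z = F0 z + (\<Sum>n\<in>J. d n * phi m n \<zz> (mat 1) z)"
    using local_decomposition[OF e(3,1,2) N] by blast
  have S: "finite ?S" "card ?S \<noteq> 0"
    using finite_stabilizer[OF \<zz>] one_stabilizer by auto
  have ev0: "eventually (\<lambda>z. F z = F0 z + (\<Sum>n\<in>J. d n * phi m n \<zz> (mat 1) z)) (at \<zz>)"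
  proof -
    have "eventually (\<lambda>z. z \<in> ball \<zz> e - {\<zz>}) (at \<zz>)" using e by (intro eventually_at_in_open) auto
    then show ?thesis by eventually_elim (rule dec)
  qed
  \<comment> \<open>For \<open>M\<close> in the stabilizer, invariance of \<open>F\<close> carries
    the decomposition at \<open>\<zz>\<close> to another one at the same point, with
    \<open>phi m n \<zz> M\<close> in place of the term of the identity.\<close>
  define A where "A M z = aut M z ^ m * F0 (moebius M z)" for M z
  have evM: "eventually (\<lambda>z. F z = A M z + (\<Sum>n\<in>J. d n * phi m n \<zz> M z)) (at \<zz>)" if "M \<in> ?S" for M
  proof -
    have M: "M \<in> SL2Z" "moebius M \<zz> = \<zz>" using that by (auto simp: stabilizer_def)
    have "eventually (\<lambda>z. aut M z ^ m * F (moebius M z) = F z) (at \<zz>)" using F M \<zz> unfolding mform_def by blast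
    moreover have "eventually (\<lambda>z. F (moebius M z) = F0 (moebius M z) + (\<Sum>n\<in>J. d n * phi m n \<zz> (mat 1) (moebius M z))) (at \<zz>)"
      using eventually_moebius[OF M(1) \<zz>] ev0 M(2) by simp
    ultimately show ?thesis using eventually_uhp[OF \<zz>]
    proof eventually_elim
      case (elim z)
      have "phi m n \<zz> M z = aut M z ^ m * phi m n \<zz> (mat 1) (moebius M z)" for n
        using phi_mult_right[OF SL2Z_one M(1) elim(3), of m n \<zz>] by simp
      then show ?case unfolding elim(1)[symmetric] elim(2) A_def by (simp add: distrib_left sum_distrib_left mult.left_commute)
    qed
  qed
  have regA: "reg_at m (A M) \<zz>" if "M \<in> ?S" for M
  proof -
    have M: "M \<in> SL2Z" "moebius M \<zz> = \<zz>" using that by (auto simp: stabilizer_def)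
    define T where "T = uhp \<inter> moebius M -` ball \<zz> e"
    have T: "open T" unfolding T_def by (rule continuous_open_preimage[OF continuous_on_moebius[OF M(1)] open_uhp open_ball])
    have "harm m (A M) (\<lambda>z. g0 (moebius M z) / aut M z ^ (m + 2)) T"
      unfolding A_def by (rule harm_slash[OF F0 M(1) T]) (auto simp: T_def)
    then show ?thesis by (rule reg_atI) (use \<zz> M e in \<open>auto simp: T_def\<close>)
  qed
  have "\<exists>R. \<forall>n. reg_at m (R n) \<zz> \<and> eventually (\<lambda>z. pser m n \<zz> z = R n z + (\<Sum>M\<in>?S. phi m n \<zz> M z)) (at \<zz>)"
    by (intro choice allI pser_at_pole m \<zz>)
  then obtain R where R: "\<And>n. reg_at m (R n) \<zz>"
    "\<And>n. eventually (\<lambda>z. pser m n \<zz> z = R n z + (\<Sum>M\<in>?S. phi m n \<zz> M z)) (at \<zz>)" by blast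
  \<comment> \<open>Summation over the stabilizer counts \<open>F\<close> as often as the group has
    elements.\<close>
  define c where "c = 1 / of_nat (card ?S) * (1::complex)"
  have c: "c * of_nat (card ?S) = 1" using S(2) unfolding c_def by (simp del: card_0_eq card_eq_0_iff)
  let ?G = "\<lambda>z. c * (\<Sum>M\<in>?S. A M z) + (-1) * (\<Sum>n\<in>J. (c * d n) * R n z)"
  have "reg_at m ?G \<zz>"
    by (intro reg_at_add reg_at_cmult reg_at_sum S J regA R \<zz>)
  moreover have "eventually (\<lambda>z. ?G z = F z - (\<Sum>n\<in>J. (c * d n) * pser m n \<zz> z)) (at \<zz>)"
  proof -
    have "eventually (\<lambda>z. \<forall>M\<in>?S. F z = A M z + (\<Sum>n\<in>J. d n * phi m n \<zz> M z)) (at \<zz>)"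
      using S(1) evM by (intro eventually_ball_finite) auto
    moreover have "eventually (\<lambda>z. \<forall>n\<in>J. pser m n \<zz> z = R n z + (\<Sum>M\<in>?S. phi m n \<zz> M z)) (at \<zz>)"
      using J R(2) by (intro eventually_ball_finite) auto
    ultimately show ?thesis
    proof eventually_elim
      case (elim z)
      have "of_nat (card ?S) * F z = (\<Sum>M\<in>?S. F z)" by simp
      also have "\<dots> = (\<Sum>M\<in>?S. A M z + (\<Sum>n\<in>J. d n * phi m n \<zz> M z))" using elim(1) by (intro sum.cong) auto
      also have "\<dots> = (\<Sum>M\<in>?S. A M z) + (\<Sum>n\<in>J. d n * (\<Sum>M\<in>?S. phi m n \<zz> M z))"
        by (simp only: sum.distrib sum_distrib_left sum.swap[of _ J])
      finally have "c * (of_nat (card ?S) * F z) = c * (\<Sum>M\<in>?S. A M z) + c * (\<Sum>n\<in>J. d n * (\<Sum>M\<in>?S. phi m n \<zz> M z))"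
        by (simp only: distrib_left)
      then have Feq: "F z = c * (\<Sum>M\<in>?S. A M z) + (\<Sum>n\<in>J. (c * d n) * (\<Sum>M\<in>?S. phi m n \<zz> M z))"
        unfolding mult.assoc[symmetric] c by (simp add: sum_distrib_left mult.assoc)
      have "(\<Sum>n\<in>J. (c * d n) * pser m n \<zz> z) = (\<Sum>n\<in>J. (c * d n) * (R n z + (\<Sum>M\<in>?S. phi m n \<zz> M z)))"
        using elim(2) by (intro sum.cong) auto
      also have "\<dots> = (\<Sum>n\<in>J. (c * d n) * R n z) + (\<Sum>n\<in>J. (c * d n) * (\<Sum>M\<in>?S. phi m n \<zz> M z))"
        by (simp only: distrib_left sum.distrib)
      finally show ?case unfolding Feq by simp
    qed
  qed
  ultimately have "reg_at m (\<lambda>z. F z - (\<Sum>n\<in>J. (c * d n) * pser m n \<zz> z)) \<zz>" by (rule reg_at_cong)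
  with J show ?thesis by (intro exI[of _ J] exI[of _ "\<lambda>n. c * d n"]) simp
qed

text \<open>No singularity lies above the height \<open>Y\<close>, since bounded singularities are
  removable. By reduction every singular orbit meets a compact set, in which discreteness leaves
  only finitely many singular points.\<close>

lemma finite_singular_orbits:
  assumes F: "mform m F"
  shows "\<exists>A. finite A \<and> A \<subseteq> uhp \<and> (\<forall>w\<in>uhp. \<not> reg_at m F w \<longrightarrow> (\<exists>a\<in>A. w \<in> modular_orbit a))"
proof -
  obtain B Y where BY: "\<And>w. w \<in> uhp \<Longrightarrow> eventually (\<lambda>z. Im z > Y \<longrightarrow> norm (F z) \<le> B) (at w)"
    using F unfolding mform_def by blast
  define Sg where "Sg = {w\<in>uhp. \<not> reg_at m F w}"
  have SgY: "Im w \<le> Y" if w: "w \<in> Sg" for w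
  proof (rule ccontr)
    assume "\<not> Im w \<le> Y"
    have wu: "w \<in> uhp" using w by (simp add: Sg_def)
    have "eventually (\<lambda>x. x \<in> {z. Im z > Y}) (at w)"
      by (intro eventually_at_in_open' open_halfspace_Im_gt) (use \<open>\<not> Im w \<le> Y\<close> in simp)
    with BY[OF wu] have "eventually (\<lambda>x. norm (F x) \<le> B) (at w)" by eventually_elim simp
    then have "bdd_at F w" by (auto simp: bdd_at_def)
    then have "reg_at m F w" using reg_at_of_bdd F wu unfolding mform_def by blast
    then show False using w by (simp add: Sg_def)
  qed
  define K where "K = {z. \<bar>Re z\<bar> \<le> 1/2 \<and> 1/2 \<le> Im z \<and> Im z \<le> Y}"
  have "K = cbox (Complex (-1/2) (1/2)) (Complex (1/2) Y)"
    by (auto simp: K_def in_cbox_complex_iff abs_le_iff)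
  then have K: "compact K" by simp
  have Ku: "K \<subseteq> uhp" by (auto simp: K_def uhp_iff)
  have fin: "finite (Sg \<inter> K)"
  proof (rule ccontr)
    assume "infinite (Sg \<inter> K)"
    then obtain x where x: "x \<in> K" "x islimpt (Sg \<inter> K)" using K compact_eq_Bolzano_Weierstrass[of K] by blast
    obtain e g where e: "e > 0" "harm m F g (ball x e - {x})" using F x Ku unfolding mform_def punct_harm_def by blast
    have "eventually (\<lambda>z. z \<in> ball x e - {x}) (at x)" using e by (intro eventually_at_in_open) auto
    then have "eventually (\<lambda>z. z \<notin> Sg \<inter> K) (at x)"
    proof eventually_elim
      case (elim z)
      have "reg_at m F z" by (rule reg_atI[OF e(2) elim]) simp
      then show ?case by (simp add: Sg_def)
    qed
    then show False using x(2) by (simp add: islimpt_iff_eventually)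
  qed
  have "\<exists>a\<in>Sg \<inter> K. w \<in> modular_orbit a" if w: "w \<in> uhp" "\<not> reg_at m F w" for w
  proof -
    obtain M where M: "M \<in> SL2Z" "\<bar>Re (moebius M w)\<bar> \<le> 1 / 2" "Im (moebius M w) \<ge> 1 / 2" using reduction[OF w(1)] .
    have "\<not> reg_at m F (moebius M w)" using mform_reg_at_moebius[OF F M(1) w(1)] w(2) by blast
    then have Sg: "moebius M w \<in> Sg" using moebius_uhp[OF M(1) w(1)] by (simp add: Sg_def)
    then have "moebius M w \<in> Sg \<inter> K" using SgY[OF Sg] M by (simp add: K_def)
    moreover have "w \<in> modular_orbit (moebius M w)"
      using modular_orbit_iff(1)[OF moebius_uhp[OF M(1) w(1)] w(1)] M(1) by blast
    ultimately show ?thesis by blast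
  qed
  then show ?thesis using fin Ku by (intro exI[of _ "Sg \<inter> K"]) blast
qed

section \<open>Linear combinations of Poincare series\<close>

lemma span_lincomb:
  assumes "finite J" "\<And>n. n \<in> J \<Longrightarrow> f n \<in> complex_fun.span S"
  shows "(\<lambda>z. \<Sum>n\<in>J. d n * f n z) \<in> complex_fun.span S"
  using assms
proof (induction J rule: finite_induct)
  case empty
  show ?case using complex_fun.span_zero[of S] by (simp add: zero_fun_def)
next
  case (insert n J)
  have "(\<lambda>z. d n * f n z) + (\<lambda>z. \<Sum>n\<in>J. d n * f n z) \<in> complex_fun.span S"
    by (intro complex_fun.span_add complex_fun.span_scale insert) (use insert in auto)
  then show ?case using insert by (simp add: plus_fun_def)
qed

text \<open>Induction on the orbits: by invariance, regularity achieved at one point holds along its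
  orbit, and the subtracted series are regular elsewhere, so no new singular orbit arises. The
  functions \<open>P\<close> stand for \<open>poincare_P\<close>, whose equality with
  \<open>pser\<close> is available on the half-plane.\<close>

lemma span_of_singular_orbits:
  assumes m: "m \<ge> 2" and A: "finite A" "A \<subseteq> uhp" and F: "mform m F"
    and sing: "\<And>w. w \<in> uhp \<Longrightarrow> \<not> reg_at m F w \<Longrightarrow> \<exists>a\<in>A. w \<in> modular_orbit a"
    and P: "\<And>a n z. a \<in> A \<Longrightarrow> z \<in> uhp \<Longrightarrow> P a n z = pser m n a z"
  shows "\<exists>G\<in>complex_fun.span {P a n | a n. a \<in> A}. \<forall>w\<in>uhp. eventually (\<lambda>z. F z = G z) (at w)"
  using A F sing P
proof (induction A arbitrary: F rule: finite_induct)
  case empty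
  have "eventually (\<lambda>z. F z = 0) (at w)" if "w \<in> uhp" for w
    by (rule mform_vanish[OF empty(2)]) (use m empty(3) that in auto)
  then show ?case by (intro bexI[of _ "\<lambda>_. 0"]) (auto simp: zero_fun_def)
next
  case (insert a A)
  have a: "a \<in> uhp" using insert by simp
  obtain J d where J: "finite (J :: int set)" and reg: "reg_at m (\<lambda>z. F z - (\<Sum>n\<in>J. d n * pser m n a z)) a"
    using remove_singularity[OF m a insert.prems(2)] by blast
  define F' where "F' z = F z + (-1) * (\<Sum>n\<in>J. d n * pser m n a z)" for z
  have F': "mform m F'" unfolding F'_def[abs_def]
    by (intro mform_add mform_cmult mform_sum insert.prems J pser_mform m a)
  have rega: "reg_at m F' a" using reg by (simp add: F'_def[abs_def])
  have "\<exists>b\<in>A. w \<in> modular_orbit b" if w: "w \<in> uhp" "\<not> reg_at m F' w" for w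
  proof -
    have wa: "w \<notin> modular_orbit a"
    proof
      assume "w \<in> modular_orbit a"
      then obtain M where "M \<in> SL2Z" "moebius M w = a" using modular_orbit_iff(1)[OF a w(1)] by blast
      then show False using mform_reg_at_moebius[OF F' _ w(1)] rega w(2) by blast
    qed
    have "\<not> reg_at m F w"
    proof
      assume "reg_at m F w"
      then have "reg_at m F' w" unfolding F'_def[abs_def]
        by (intro reg_at_add reg_at_cmult reg_at_sum J pser_reg_at m a w) (use w wa in auto)
      then show False using w by blast
    qed
    then show ?thesis using insert.prems(3)[OF w(1)] wa by blast
  qed
  then obtain G where G: "G \<in> complex_fun.span {P b n | b n. b \<in> A}" "\<And>w. w \<in> uhp \<Longrightarrow> eventually (\<lambda>z. F' z = G z) (at w)"
    using insert.IH[OF _ F'] insert.prems(1,4) by auto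
  let ?S = "{P b n | b n. b \<in> insert a A}"
  have "G \<in> complex_fun.span ?S" using G(1) complex_fun.span_mono[of "{P b n | b n. b \<in> A}" ?S] by blast
  moreover have "(\<lambda>z. \<Sum>n\<in>J. d n * P a n z) \<in> complex_fun.span ?S"
    by (intro span_lincomb J complex_fun.span_base) blast
  ultimately have "G + (\<lambda>z. \<Sum>n\<in>J. d n * P a n z) \<in> complex_fun.span ?S" by (rule complex_fun.span_add)
  moreover have "eventually (\<lambda>z. F z = (G + (\<lambda>z. \<Sum>n\<in>J. d n * P a n z)) z) (at w)" if w: "w \<in> uhp" for w
    using G(2)[OF w] eventually_uhp[OF w]
  proof eventually_elim
    case (elim z)
    have "(\<Sum>n\<in>J. d n * P a n z) = (\<Sum>n\<in>J. d n * pser m n a z)" using insert.prems(4) elim(2) by simp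
    then show ?case using elim(1) by (simp add: F'_def plus_fun_def algebra_simps)
  qed
  ultimately show ?case by blast
qed

section \<open>The action of the stabilizer\<close>

text \<open>\<open>N\<close> has real entries and fixes both \<open>\<zz>\<close> and
  \<open>cnj \<zz>\<close>. Each of its two forms vanishes at the corresponding point and is
  therefore its slope times a difference.\<close>

lemma lin_stabilizer:
  assumes \<zz>: "\<zz> \<in> uhp" and N: "N \<in> stabilizer \<zz>" and M: "M \<in> SL2Z" and z: "z \<in> uhp"
  shows "lin \<zz> (N ** M) z = slope \<zz> N * lin \<zz> M z"
    and "lin (cnj \<zz>) (N ** M) z = cnj (slope \<zz> N) * lin (cnj \<zz>) M z"
proof -
  have N': "N \<in> SL2Z" "lin \<zz> N \<zz> = 0" using N stabilizer_iff[OF \<zz>] by auto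
  have "lin (cnj \<zz>) N (cnj \<zz>) = cnj (lin \<zz> N \<zz>)" by (simp add: lin_def)
  then have 1: "lin (cnj \<zz>) N (cnj \<zz>) = 0" using N' by simp
  have 2: "slope (cnj \<zz>) N = cnj (slope \<zz> N)" by (simp add: slope_def)
  show "lin \<zz> (N ** M) z = slope \<zz> N * lin \<zz> M z"
    using lin_diff[of \<zz> N "moebius M z" \<zz>] N' by (simp add: lin_mult[OF N'(1) M z] lin_eq[OF M z])
  show "lin (cnj \<zz>) (N ** M) z = cnj (slope \<zz> N) * lin (cnj \<zz>) M z"
    using lin_diff[of "cnj \<zz>" N "moebius M z" "cnj \<zz>"] 1 2 by (simp add: lin_mult[OF N'(1) M z] lin_eq[OF M z])
qed

lemma norm_slope_stabilizer:
  assumes \<zz>: "\<zz> \<in> uhp" and N: "N \<in> stabilizer \<zz>" shows "norm (slope \<zz> N) = 1"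
proof -
  have N': "N \<in> SL2Z" "lin \<zz> N \<zz> = 0" using N stabilizer_iff[OF \<zz>] by auto
  have "lin (cnj \<zz>) N \<zz> = cnj (slope \<zz> N) * (\<zz> - cnj \<zz>)"
    using lin_stabilizer(2)[OF \<zz> N SL2Z_one \<zz>] by simp
  then have "norm (lin (cnj \<zz>) N \<zz>) = norm (slope \<zz> N) * (2 * Im \<zz>)"
    using \<zz> by (simp add: norm_mult complex_diff_cnj uhp_iff)
  then have "(norm (slope \<zz> N))\<^sup>2 * (4 * Im \<zz> * Im \<zz>) = 1 * (4 * Im \<zz> * Im \<zz>)"
    using norm_lin_cnj_minus[OF N'(1), of \<zz> \<zz>] N'(2) by (simp add: power2_eq_square algebra_simps)
  moreover have "4 * Im \<zz> * Im \<zz> \<noteq> 0" using \<zz> by (simp add: uhp_iff)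
  ultimately have "(norm (slope \<zz> N))\<^sup>2 = 1" using mult_right_cancel by blast
  then show ?thesis using norm_ge_zero[of "slope \<zz> N"] by (simp add: power2_eq_1_iff)
qed

text \<open>The slope \<open>v\<close> has modulus 1, so \<open>cnj v\<close> is its inverse: the
  quotient \<open>X\<close> of the forms is multiplied by \<open>v powi 2\<close> with unchanged
  modulus, and \<open>l ^ m\<close> by \<open>v powi (- m)\<close>.\<close>

lemma phi_stabilizer:
  assumes \<zz>: "\<zz> \<in> uhp" and N: "N \<in> stabilizer \<zz>" and M: "M \<in> SL2Z" and z: "z \<in> uhp"
  shows "phi m n \<zz> (N ** M) z = slope \<zz> N powi (2 * n - int m) * phi m n \<zz> M z"
proof -
  let ?v = "slope \<zz> N"
  have v: "norm ?v = 1" by (rule norm_slope_stabilizer[OF \<zz> N])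
  then have v0: "?v \<noteq> 0" by auto
  have "?v * cnj ?v = 1" using v by (simp add: complex_norm_square[symmetric])
  then have cv: "cnj ?v = inverse ?v" using inverse_unique[of ?v "cnj ?v"] by simp
  have q: "(?v * lin \<zz> M z) / (cnj ?v * lin (cnj \<zz>) M z) = ?v powi 2 * (lin \<zz> M z / lin (cnj \<zz>) M z)"
    using v0 by (simp add: cv power_int_numeral power2_eq_square field_simps)
  have n: "norm (?v powi 2 * (lin \<zz> M z / lin (cnj \<zz>) M z)) = norm (lin \<zz> M z / lin (cnj \<zz>) M z)"
    unfolding norm_mult norm_power_int v by simp
  have p: "cnj ?v ^ m * (?v powi 2) powi n = ?v powi (2 * n - int m)"
    using v0 by (simp add: cv power_int_diff power_int_mult power_inverse divide_inverse)
  have "phi m n \<zz> (N ** M) z = (cnj ?v ^ m * (?v powi 2) powi n) * phi m n \<zz> M z"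
    unfolding phi_def ephi_def lin_stabilizer[OF assms] q n by (simp only: power_mult_distrib power_int_mult_distrib mult_ac)
  then show ?thesis unfolding p .
qed

text \<open>As \<open>Im \<zz> \<noteq> 0\<close>, the real and imaginary parts of the slope
  determine the first column of the matrix, and those of the vanishing form then determine the
  second.\<close>

lemma inj_on_slope_stabilizer:
  assumes \<zz>: "\<zz> \<in> uhp" shows "inj_on (slope \<zz>) (stabilizer \<zz>)"
proof (rule inj_onI)
  fix M N assume "M \<in> stabilizer \<zz>" "N \<in> stabilizer \<zz>" and eq: "slope \<zz> M = slope \<zz> N"
  then have 0: "lin \<zz> M \<zz> = 0" "lin \<zz> N \<zz> = 0" using stabilizer_iff[OF \<zz>] by auto
  have y: "Im \<zz> \<noteq> 0" using \<zz> by (simp add: uhp_iff)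
  have "Im (slope \<zz> M) = Im (slope \<zz> N)" "Re (slope \<zz> M) = Re (slope \<zz> N)" using eq by auto
  then have 1: "M$2$1 = N$2$1" "M$1$1 = N$1$1" using y by (auto simp: slope_def)
  have "Im (lin \<zz> M \<zz>) = Im (lin \<zz> N \<zz>)" "Re (lin \<zz> M \<zz>) = Re (lin \<zz> N \<zz>)" using 0 by auto
  then have "M$2$2 = N$2$2" "M$1$2 = N$1$2" using y 1 by (auto simp: lin_def)
  then show "M = N" using 1 by (simp add: mat2_eq_iff)
qed

lemma card_stabilizer:
  assumes \<zz>: "\<zz> \<in> uhp" shows "card (stabilizer \<zz>) = 2 * PSL_stabilizer_order \<zz>"
proof -
  let ?R = "{(M, N). N = M \<or> N = - M} :: (int^2^2) rel"
  have um: "- M \<in> stabilizer \<zz>" if "M \<in> stabilizer \<zz>" for M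
    using that unfolding stabilizer_iff[OF \<zz>] by (simp add: SL2Z_uminus lin_def algebra_simps)
  have im: "?R `` {M} = {M, - M}" for M by auto
  have ne: "M \<noteq> - M" if "M \<in> stabilizer \<zz>" for M
  proof
    assume "M = - M"
    then have "M = 0" by (auto simp: mat2_eq_iff)
    then show False using that by (simp add: stabilizer_def SL2Z_iff)
  qed
  have U: "\<Union>(stabilizer \<zz> // ?R) = stabilizer \<zz>"
    unfolding quotient_def im using um by auto
  have "2 * card (stabilizer \<zz> // ?R) = card (\<Union>(stabilizer \<zz> // ?R))"
  proof (rule card_partition)
    show "finite (stabilizer \<zz> // ?R)" unfolding quotient_def using finite_stabilizer[OF \<zz>] by auto
    show "finite (\<Union>(stabilizer \<zz> // ?R))" unfolding U by (rule finite_stabilizer[OF \<zz>])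
    show "card c = 2" if "c \<in> stabilizer \<zz> // ?R" for c
      using that ne unfolding quotient_def im by auto
    show "c1 \<inter> c2 = {}" if "c1 \<in> stabilizer \<zz> // ?R" "c2 \<in> stabilizer \<zz> // ?R" "c1 \<noteq> c2" for c1 c2
      using that unfolding quotient_def im by auto
  qed
  then show ?thesis unfolding U PSL_stabilizer_order_def by simp
qed

text \<open>A finite group of nonzero complex numbers consists of all roots of unity of its order.\<close>

lemma slope_image_stabilizer:
  assumes \<zz>: "\<zz> \<in> uhp"
  shows "PSL_stabilizer_order \<zz> > 0" "slope \<zz> ` stabilizer \<zz> = {v. v ^ (2 * PSL_stabilizer_order \<zz>) = 1}"
proof -
  let ?w = "PSL_stabilizer_order \<zz>" let ?V = "slope \<zz> ` stabilizer \<zz>"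
  have fin: "finite ?V" using finite_stabilizer[OF \<zz>] by simp
  have card: "card ?V = 2 * ?w" using card_image[OF inj_on_slope_stabilizer[OF \<zz>]] card_stabilizer[OF \<zz>] by simp
  have "card ?V \<noteq> 0" using fin one_stabilizer[of \<zz>] by auto
  then show w: "?w > 0" using card by simp
  have mult: "u * v \<in> ?V" if uv: "u \<in> ?V" "v \<in> ?V" for u v
  proof -
    obtain M N where MN: "M \<in> stabilizer \<zz>" "N \<in> stabilizer \<zz>" "u = slope \<zz> M" "v = slope \<zz> N" using uv by blast
    have N: "N \<in> SL2Z" using MN by (simp add: stabilizer_def)
    have M: "M \<in> SL2Z" using MN by (simp add: stabilizer_def)
    have "lin \<zz> (M ** N) \<zz> = 0"
      using lin_stabilizer(1)[OF \<zz> MN(1) N \<zz>] MN(2) stabilizer_iff[OF \<zz>] by simp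
    then have "M ** N \<in> stabilizer \<zz>" using SL2Z_mult[OF M N] stabilizer_iff[OF \<zz>] by blast
    moreover have "slope \<zz> (M ** N) * (2 * \<i> - \<i>) = u * v * (2 * \<i> - \<i>)"
      unfolding lin_diff[symmetric] using lin_stabilizer(1)[OF \<zz> MN(1) N, of "2 * \<i>"]
        lin_stabilizer(1)[OF \<zz> MN(1) N, of \<i>] lin_diff[of \<zz> N "2 * \<i>" \<i>] MN(3,4)
      by (simp add: uhp_iff) (simp add: right_diff_distrib[symmetric])
    then have "slope \<zz> (M ** N) = u * v" by simp
    ultimately show ?thesis by (metis image_eqI)
  qed
  have nz: "v \<noteq> 0" if "v \<in> ?V" for v using that norm_slope_stabilizer[OF \<zz>] by force
  have "v ^ (2 * ?w) = 1" if v: "v \<in> ?V" for v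
  proof -
    \<comment> \<open>Multiplication by \<open>v\<close> permutes the finite set; comparing the
      products of all its elements gives \<open>v ^ card = 1\<close>.\<close>
    have inj: "inj_on (\<lambda>u. v * u) ?V" using nz[OF v] by (auto simp: inj_on_def)
    have "(\<lambda>u. v * u) ` ?V = ?V"
      by (rule card_subset_eq[OF fin]) (use mult[OF v] card_image[OF inj] in auto)
    then have "\<Prod>?V = (\<Prod>u\<in>?V. v * u)" using prod.reindex[OF inj, of "\<lambda>x. x"] by simp
    also have "\<dots> = v ^ (2 * ?w) * \<Prod>?V" unfolding prod.distrib using card by simp
    finally have "1 * \<Prod>?V = v ^ (2 * ?w) * \<Prod>?V" by simp
    moreover have "\<Prod>?V \<noteq> 0" using nz fin by auto
    ultimately show ?thesis by simp
  qed
  then show "?V = {v. v ^ (2 * ?w) = 1}"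
    using card card_roots_unity_eq[of "2 * ?w"] finite_roots_unity[of "2 * ?w", where 'a = complex] w by (intro card_subset_eq) auto
qed

text \<open>The exponent \<open>q\<close> may be replaced by its remainder \<open>r\<close> modulo
  \<open>PSL_stabilizer_order \<zz>\<close>. If \<open>r\<close> were positive, all slopes would be
  roots of unity of order \<open>2 * r\<close>, and there are too few of these.\<close>

lemma slope_powi_eq_1_iff:
  assumes \<zz>: "\<zz> \<in> uhp"
  shows "(\<forall>N\<in>stabilizer \<zz>. slope \<zz> N powi (2 * q) = 1) \<longleftrightarrow> int (PSL_stabilizer_order \<zz>) dvd q"
proof -
  let ?w = "PSL_stabilizer_order \<zz>" let ?V = "{v :: complex. v ^ (2 * ?w) = 1}"
  have w: "?w > 0" and V: "slope \<zz> ` stabilizer \<zz> = ?V" using slope_image_stabilizer[OF \<zz>] by auto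
  define r where "r = nat (q mod int ?w)"
  have r: "int r = q mod int ?w" "r < ?w"
    using w pos_mod_bound[of "int ?w" q] pos_mod_sign[of "int ?w" q] by (simp_all add: r_def nat_less_iff)
  have pw: "v powi (2 * q) = v ^ (2 * r)" if "v \<in> ?V" for v
  proof -
    have v: "v \<noteq> 0" "v powi int (2 * ?w) = 1" using that w by (auto simp del: of_nat_mult simp: power_int_of_nat zero_power)
    have "2 * q = 2 * (int ?w * (q div int ?w) + q mod int ?w)" by simp
    then have "2 * q = int (2 * ?w) * (q div int ?w) + int (2 * r)"
      unfolding r(1)[symmetric] by (simp only: of_nat_mult of_nat_numeral distrib_left mult.assoc)
    then have "v powi (2 * q) = (v powi int (2 * ?w)) powi (q div int ?w) * v powi int (2 * r)"
      using v(1) by (simp only: power_int_add power_int_mult simp_thms)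
    then show ?thesis unfolding v(2) by (simp only: power_int_of_nat power_int_1_left mult_1)
  qed
  have "(\<forall>N\<in>stabilizer \<zz>. slope \<zz> N powi (2 * q) = 1) \<longleftrightarrow> (\<forall>v\<in>?V. v ^ (2 * r) = 1)"
    unfolding V[symmetric] using pw unfolding V[symmetric] by simp
  also have "\<dots> \<longleftrightarrow> r = 0"
  proof
    assume *: "\<forall>v\<in>?V. v ^ (2 * r) = 1"
    show "r = 0"
    proof (rule ccontr)
      assume r0: "r \<noteq> 0"
      have "card ?V \<le> card {v :: complex. v ^ (2 * r) = 1}"
        by (rule card_mono) (use * r0 finite_roots_unity[of "2 * r", where 'a = complex] in auto)
      then show False using card_roots_unity_eq[of "2 * r"] card_roots_unity_eq[of "2 * ?w"] r0 w r(2) by simp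
    qed
  qed simp
  also have "\<dots> \<longleftrightarrow> int ?w dvd q" using r(1) by (auto simp: dvd_eq_mod_eq_0)
  finally show ?thesis .
qed

lemma sum_phi_stabilizer:
  assumes \<zz>: "\<zz> \<in> uhp" and z: "z \<in> uhp" and n: "\<And>N. N \<in> stabilizer \<zz> \<Longrightarrow> slope \<zz> N powi (2 * n - int m) = 1"
  shows "(\<Sum>M\<in>stabilizer \<zz>. phi m n \<zz> M z) = 2 * of_nat (PSL_stabilizer_order \<zz>) * phi m n \<zz> (mat 1) z"
proof -
  have "(\<Sum>M\<in>stabilizer \<zz>. phi m n \<zz> M z) = (\<Sum>M\<in>stabilizer \<zz>. phi m n \<zz> (mat 1) z)"
    by (rule sum.cong) (use phi_stabilizer[OF \<zz> _ SL2Z_one z, of _ m n] n in auto)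
  then show ?thesis using card_stabilizer[OF \<zz>] by simp
qed

text \<open>Reindexing by left multiplication with \<open>N\<close> shows that the series equals
  itself times a number different from 1.\<close>

lemma pser_eq_0:
  assumes \<zz>: "\<zz> \<in> uhp" and z: "z \<in> uhp" and N: "N \<in> stabilizer \<zz>" "slope \<zz> N powi (2 * n - int m) \<noteq> 1"
  shows "pser m n \<zz> z = 0"
proof -
  have N': "N \<in> SL2Z" using N by (simp add: stabilizer_def)
  have "pser m n \<zz> z = (\<Sum>\<^sub>\<infinity>M\<in>SL2Z. phi m n \<zz> (N ** M) z)"
    unfolding pser_def using infsum_reindex_bij_betw[OF bij_betw_SL2Z_left[OF N'], of "\<lambda>M. phi m n \<zz> M z"] by simp
  also have "\<dots> = (\<Sum>\<^sub>\<infinity>M\<in>SL2Z. slope \<zz> N powi (2 * n - int m) * phi m n \<zz> M z)"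
    by (rule infsum_cong) (rule phi_stabilizer[OF \<zz> N(1) _ z])
  also have "\<dots> = slope \<zz> N powi (2 * n - int m) * pser m n \<zz> z"
    unfolding pser_def by (rule infsum_cmult_right')
  finally have "(1 - slope \<zz> N powi (2 * n - int m)) * pser m n \<zz> z = 0" by (simp add: left_diff_distrib)
  then show ?thesis using N(2) by simp
qed

section \<open>Principal parts\<close>

lemma phi_one_eq:
  "phi m n w (mat 1) z = (z - cnj w) ^ m * of_real (inc_beta (1 - (ell_r w z)\<^sup>2) (m + 1) (- n)) * ell_X w z powi n"
  by (simp add: phi_def ephi_def ell_r_def ell_X_def)

text \<open>For \<open>n > m\<close> the two functions differ by \<open>beta_const\<close> times a
  term with a nonnegative power of \<open>X\<close>, for \<open>0 \<le> n \<le> m\<close> they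
  coincide, and for \<open>n < 0\<close> the difference is \<open>psi\<close>.\<close>

lemma bdd_at_phi_one_minus:
  assumes w: "w \<in> uhp"
  shows "bdd_at (\<lambda>z. phi m n w (mat 1) z - (z - cnj w) ^ m * ell_X w z powi n *
     of_real (if n > int m then inc_beta0 (1 - (ell_r w z)\<^sup>2) (m + 1) (- n)
         else if n \<ge> 0 then inc_beta (1 - (ell_r w z)\<^sup>2) (m + 1) (- n)
         else beta_const (m + 1) (- n))) w"
proof -
  consider "n > int m" | "0 \<le> n" "n \<le> int m" | "n < 0" by linarith
  then show ?thesis
  proof cases
    case 1
    then have n: "n > int m" "n \<ge> 0" by auto
    have "isCont (\<lambda>z. of_real (beta_const (m + 1) (- n)) * ((z - cnj w) ^ m * ((z - w) / (z - cnj w)) ^ nat n)) w"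
      by (intro continuous_intros) (use uhp_cnj_ne[OF w w] in auto)
    then have "bdd_at (\<lambda>z. of_real (beta_const (m + 1) (- n)) * ((z - cnj w) ^ m * ((z - w) / (z - cnj w)) ^ nat n)) w"
      by (rule bdd_at_isCont)
    then show ?thesis
      by (rule bdd_at_cong) (use n in \<open>simp add: phi_one_eq inc_beta0_def ell_X_def power_int_def algebra_simps\<close>)
  next
    case 2
    have "bdd_at (\<lambda>_. 0) w" by (intro bdd_at_isCont continuous_const)
    then show ?thesis by (rule bdd_at_cong) (use 2 in \<open>simp add: phi_one_eq\<close>)
  next
    case 3
    have "bdd_at (psi m n w) w" by (rule bdd_at_isCont[OF harm_isCont[OF psi_harm[OF 3 w] w]])
    moreover have "eventually (\<lambda>z. z \<in> uhp \<and> z \<noteq> w) (at w)"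
      using eventually_uhp[OF w] by (auto simp: eventually_at_filter elim: eventually_mono)
    then have "eventually (\<lambda>z. psi m n w z = phi m n w (mat 1) z - (z - cnj w) ^ m * ell_X w z powi n *
      of_real (if n > int m then inc_beta0 (1 - (ell_r w z)\<^sup>2) (m + 1) (- n)
         else if n \<ge> 0 then inc_beta (1 - (ell_r w z)\<^sup>2) (m + 1) (- n)
         else beta_const (m + 1) (- n))) (at w)"
    proof eventually_elim
      case (elim z)
      have "((z - cnj w) / (z - w)) ^ nat (- n) = ell_X w z powi n"
        using 3 by (simp add: ell_X_def power_int_def power_inverse[symmetric])
      then show ?case using phi_one_neg[OF 3 w, of z m] elim 3 by (simp add: mult_ac)
    qed
    ultimately show ?thesis by (rule bdd_at_cong)
  qed
qed

lemma principal_part: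
  assumes k: "k > 1" and \<zz>: "\<zz> \<in> uhp" and n: "int (PSL_stabilizer_order \<zz>) dvd n - (int k - 1)"
  shows "has_principal_part_at (poincare_P k \<zz> n) (poincare_P_principal_part k \<zz> n) \<zz>"
proof -
  let ?m = "2 * k - 2" let ?c = "2 * of_nat (PSL_stabilizer_order \<zz>) :: complex"
  have m: "?m \<ge> 2" "?m + 1 = 2 * k - 1" "int ?m = 2 * int k - 2" using k by auto
  \<comment> \<open>The exponent of the slope is twice the difference in the congruence, the shape
    that \<open>slope_powi_eq_1_iff\<close> requires.\<close>
  have "2 * n - int ?m = 2 * (n - (int k - 1))" using m by simp
  then have v: "slope \<zz> N powi (2 * n - int ?m) = 1" if "N \<in> stabilizer \<zz>" for N
    using n that unfolding slope_powi_eq_1_iff[OF \<zz>, symmetric] by simp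
  obtain R where R: "reg_at ?m R \<zz>"
    "eventually (\<lambda>z. pser ?m n \<zz> z = R z + (\<Sum>M\<in>stabilizer \<zz>. phi ?m n \<zz> M z)) (at \<zz>)"
    using pser_at_pole[OF m(1) \<zz>, of n] by blast
  let ?B = "\<lambda>z. (z - cnj \<zz>) ^ ?m * ell_X \<zz> z powi n *
     of_real (if n > int ?m then inc_beta0 (1 - (ell_r \<zz> z)\<^sup>2) (?m + 1) (- n)
         else if n \<ge> 0 then inc_beta (1 - (ell_r \<zz> z)\<^sup>2) (?m + 1) (- n)
         else beta_const (?m + 1) (- n))"
  have pp: "poincare_P_principal_part k \<zz> n z = ?c * ?B z" for z
  proof -
    have "(z - cnj \<zz>) powi (2 * int k - 2) = (z - cnj \<zz>) ^ ?m" unfolding m(3)[symmetric] power_int_of_nat ..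
    then show ?thesis unfolding poincare_P_principal_part_def m(2,3) by (simp only: mult.assoc)
  qed
  have "bdd_at (\<lambda>z. R z + ?c * (phi ?m n \<zz> (mat 1) z - ?B z)) \<zz>"
    by (intro bdd_at_add reg_at_bdd[OF R(1)] bdd_at_cmult bdd_at_phi_one_minus \<zz>)
  moreover have "eventually (\<lambda>z. R z + ?c * (phi ?m n \<zz> (mat 1) z - ?B z) = poincare_P k \<zz> n z - poincare_P_principal_part k \<zz> n z) (at \<zz>)"
    using R(2) eventually_uhp[OF \<zz>]
  proof eventually_elim
    case (elim z)
    have "poincare_P k \<zz> n z = R z + ?c * phi ?m n \<zz> (mat 1) z"
      using elim poincare_P_eq[OF elim(2) \<zz>, of k n] sum_phi_stabilizer[OF \<zz> elim(2) v] k by (simp add: pser_def)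
    then show ?case unfolding pp right_diff_distrib by simp
  qed
  ultimately show ?thesis unfolding has_principal_part_at_def bdd_at_bigo by (rule bdd_at_cong)
qed

section \<open>Differential operators and spans\<close>

lemma poincare_D_op:
  assumes k: "k > 1" and \<zz>: "\<zz> \<in> uhp" and z: "z \<in> uhp - modular_orbit \<zz>"
  shows "(D_op ^^ (2 * k - 1)) (poincare_P k \<zz> n) z
    = - fact (2 * k - 2) * of_real (Im \<zz> / pi) ^ (2 * k - 1) * poincare_Psi k \<zz> (n + 1 - 2 * int k) z"
proof -
  let ?m = "2 * k - 2" let ?S = "\<lambda>z. \<Sum>\<^sub>\<infinity>M\<in>SL2Z. phi ?m n \<zz> M z"
  let ?c = "- fact ?m * of_real (Im \<zz> / pi) ^ (?m + 1) :: complex"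
  have m: "?m \<ge> 2" "?m + 1 = 2 * k - 1" "n - 1 - int ?m = n + 1 - 2 * int k" "even ?m" using k by auto
  have zu: "z \<in> uhp" using z by blast
  obtain r where r: "r > 0" "ball z r \<subseteq> uhp - modular_orbit \<zz>"
    "harm ?m ?S (\<lambda>z. \<Sum>\<^sub>\<infinity>M\<in>SL2Z. phi_g ?m n \<zz> M z) (ball z r)"
    "((\<lambda>M. (D_op ^^ (?m + 1)) (phi ?m n \<zz> M) z) has_sum (D_op ^^ (?m + 1)) ?S z) SL2Z"
    by (rule poincare_off_orbit[OF m(1) \<zz> z, of n])
  have "(D_op ^^ (?m + 1)) ?S z = (D_op ^^ (?m + 1)) (poincare_P k \<zz> n) z"
  proof (rule wharm_D_op_cong[where S = "ball z r" and P = "hp_coeff ?m"])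
    show "wharm ?m (hp_coeff ?m) ?S (\<lambda>z. \<Sum>\<^sub>\<infinity>M\<in>SL2Z. phi_g ?m n \<zz> M z) (ball z r)"
      using r(3) by (simp add: harm_def)
    show "?S x = poincare_P k \<zz> n x" if "x \<in> ball z r" for x
      using poincare_P_eq[of x \<zz> k n] that r(2) \<zz> k by auto
  qed (use r hp_coeff_holomorphic in auto)
  also have "(D_op ^^ (?m + 1)) ?S z = (\<Sum>\<^sub>\<infinity>M\<in>SL2Z. (D_op ^^ (?m + 1)) (phi ?m n \<zz> M) z)"
    using infsumI[OF r(4)] by (rule sym)
  also have "\<dots> = (\<Sum>\<^sub>\<infinity>M\<in>SL2Z. ?c * ((lin \<zz> M z / lin (cnj \<zz>) M z) powi (n - 1 - int ?m) / lin (cnj \<zz>) M z ^ (?m + 2)))"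
    by (rule infsum_cong) (rule phi_D_op[OF _ \<zz> zu _ m(4)], use z modular_orbit_iff(2)[OF \<zz> zu] in auto)
  also have "\<dots> = ?c * poincare_Psi k \<zz> (n - 1 - int ?m) z"
    using poincare_Psi_eq[OF zu \<zz>, of k "n - 1 - int ?m"] k by (simp only: infsum_cmult_right')
  finally show ?thesis unfolding m(2,3) by simp
qed

lemma poincare_xi_op:
  assumes k: "k > 1" and \<zz>: "\<zz> \<in> uhp" and z: "z \<in> uhp - modular_orbit \<zz>"
  shows "xi_op (1 - int k) (poincare_P k \<zz> n) z = of_real (4 * Im \<zz>) ^ (2 * k - 1) * poincare_Psi k \<zz> (- n - 1) z"
proof -
  let ?m = "2 * k - 2" let ?G = "\<lambda>z. \<Sum>\<^sub>\<infinity>M\<in>SL2Z. phi_g ?m n \<zz> M z"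
  have m: "?m \<ge> 2" "?m + 1 = 2 * k - 1" using k by auto
  have zu: "z \<in> uhp" using z by blast
  have ii: "\<i> * \<i> = -1" by simp
  \<comment> \<open>The factor \<open>2 * \<i>\<close> of \<open>xi_op\<close> and the determinant
    \<open>2 * \<i> * Im \<zz>\<close> multiply to \<open>- 4 * Im \<zz>\<close>; the sign cancels
    that of \<open>phi_g\<close>, which leaves one more power of
    \<open>4 * Im \<zz>\<close>.\<close>
  have factor: "2 * \<i> * - (c * (2 * \<i> * of_real y) * A / B) = c * of_real (4 * y) * (A / B)" for c A B y
    unfolding divide_inverse of_real_mult of_real_numeral using ii by algebra
  have "harm ?m (poincare_P k \<zz> n) ?G (uhp - modular_orbit \<zz>)"
    by (rule harm_cong[OF pser_harm[OF m(1) \<zz>, of n]]) (use poincare_P_eq[of _ \<zz> k n] \<zz> k in \<open>auto simp: pser_def\<close>)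
  then have "xi_op (1 - int k) (poincare_P k \<zz> n) z = 2 * \<i> * ?G z" using harm_xi z k by simp
  also have "\<dots> = (\<Sum>\<^sub>\<infinity>M\<in>SL2Z. 2 * \<i> * phi_g ?m n \<zz> M z)" by (rule infsum_cmult_right'[symmetric])
  also have "\<dots> = (\<Sum>\<^sub>\<infinity>M\<in>SL2Z. of_real (4 * Im \<zz>) ^ (?m + 1) *
      ((lin \<zz> M z / lin (cnj \<zz>) M z) powi (- n - 1) / lin (cnj \<zz>) M z ^ (?m + 2)))"
    unfolding phi_g_def by (rule infsum_cong) (simp only: factor power_add power_one_right)
  also have "\<dots> = of_real (4 * Im \<zz>) ^ (?m + 1) * poincare_Psi k \<zz> (- n - 1) z"
    using poincare_Psi_eq[OF zu \<zz>, of k "- n - 1"] k by (simp only: infsum_cmult_right')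
  finally show ?thesis unfolding m(2) .
qed

lemma same_on_uhp_iff: "same_on_uhp F G \<longleftrightarrow> (\<forall>w\<in>uhp. eventually (\<lambda>z. F z = G z) (at w))"
  unfolding same_on_uhp_def eventually_cosparse_open_eq[OF open_uhp] ..

text \<open>Boundedness links the two notions: a real analytic extension is continuous, so
  \<open>F\<close> is bounded near \<open>w\<close> and extends harmonically; conversely a harmonic
  extension is real analytic.\<close>

lemma singular_at_iff:
  assumes F: "mform m F" and w: "w \<in> uhp" shows "singular_at F w \<longleftrightarrow> \<not> reg_at m F w"
proof -
  have "reg_at m F w" if G: "real_analytic_at G w" "eventually (\<lambda>z. F z = G z) (at w)" for G
  proof -
    have "isCont G w"
      using G(1) ra_expansion_has_wirtinger has_wirtinger_isCont unfolding real_analytic_at_iff by blast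
    then have "bdd_at F w" by (rule bdd_at_cong[OF bdd_at_isCont]) (use G(2) in \<open>auto elim: eventually_mono\<close>)
    then show ?thesis using reg_at_of_bdd F w unfolding mform_def by blast
  qed
  moreover have "\<exists>G. real_analytic_at G w \<and> eventually (\<lambda>z. F z = G z) (at w)" if reg: "reg_at m F w"
  proof -
    obtain e F0 g where e: "e > 0" "harm m F0 g (ball w e)" "eventually (\<lambda>z. F z = F0 z) (at w)"
      using reg_atD[OF reg] by blast
    have "real_analytic_at F0 w" by (rule harm_real_analytic[OF e(2)]) (use e(1) in simp)
    then show ?thesis using e(3) by blast
  qed
  ultimately show ?thesis unfolding singular_at_def by blast
qed

text \<open>The two properties define a subspace that contains the generators and hence their span;
  both are insensitive to the values on an exceptional set.\<close>

lemma spanned_forms_poincare: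
  assumes k: "k > 1" and A: "A \<subseteq> uhp" and F: "F \<in> spanned_forms {poincare_P k a n | a n. a \<in> A}"
  shows "mform (2 * k - 2) F" and "\<And>w. w \<in> uhp \<Longrightarrow> \<forall>a\<in>A. w \<notin> modular_orbit a \<Longrightarrow> reg_at (2 * k - 2) F w"
proof -
  let ?m = "2 * k - 2"
  have m: "?m \<ge> 2" using k by simp
  define H where "H = {G. mform ?m G \<and> (\<forall>w\<in>uhp. (\<forall>a\<in>A. w \<notin> modular_orbit a) \<longrightarrow> reg_at ?m G w)}"
  have 0: "reg_at ?m (\<lambda>_. 0) w" if "w \<in> uhp" for w
    using reg_at_sum[of "{} :: nat set" ?m "\<lambda>_ _. 0" w] that by simp
  have "complex_fun.subspace H"
  proof (rule complex_fun.subspaceI)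
    show "0 \<in> H" using mform_zero 0 by (simp add: H_def zero_fun_def)
    show "F + G \<in> H" if "F \<in> H" "G \<in> H" for F G
      using that mform_add reg_at_add by (simp add: H_def plus_fun_def)
    show "(\<lambda>z. c * F z) \<in> H" if "F \<in> H" for c F
      using that mform_cmult reg_at_cmult by (simp add: H_def)
  qed
  moreover have "{poincare_P k a n | a n. a \<in> A} \<subseteq> H"
  proof
    fix G assume "G \<in> {poincare_P k a n | a n. a \<in> A}"
    then obtain a n where a: "a \<in> A" "a \<in> uhp" and G: "G = poincare_P k a n" using A by blast
    have eq: "eventually (\<lambda>z. pser ?m n a z = G z) (at w)" if "w \<in> uhp" for w
      using eventually_uhp[OF that] by eventually_elim (use poincare_P_eq[of _ a k n] a k in \<open>auto simp: pser_def G\<close>)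
    have "mform ?m G" by (rule mform_cong[OF pser_mform[OF m a(2)] eq])
    moreover have "reg_at ?m G w" if "w \<in> uhp" "\<forall>a\<in>A. w \<notin> modular_orbit a" for w
      by (rule reg_at_cong[OF pser_reg_at[OF m a(2)] eq]) (use that a in auto)
    ultimately show "G \<in> H" by (simp add: H_def)
  qed
  ultimately have span: "complex_fun.span {poincare_P k a n | a n. a \<in> A} \<subseteq> H" by (intro complex_fun.span_minimal)
  obtain G where G: "G \<in> H" "\<And>w. w \<in> uhp \<Longrightarrow> eventually (\<lambda>z. G z = F z) (at w)"
    using F span unfolding spanned_forms_def same_on_uhp_iff by (auto simp: eq_commute)
  show "mform ?m F" by (rule mform_cong[OF _ G(2)]) (use G(1) in \<open>auto simp: H_def\<close>)
  show "reg_at ?m F w" if "w \<in> uhp" "\<forall>a\<in>A. w \<notin> modular_orbit a" for w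
    by (rule reg_at_cong[OF _ G(2)]) (use that G(1) in \<open>auto simp: H_def\<close>)
qed

text \<open>The finite set \<open>A'\<close> of points representing the singular orbits depends on
  \<open>F\<close>, while the span is taken over the whole of \<open>A\<close>.\<close>

lemma in_spanned_forms_poincare:
  assumes k: "k > 1" and A: "A \<subseteq> uhp" and F: "mform (2 * k - 2) F" and A': "finite A'" "A' \<subseteq> A"
    and sing: "\<And>w. w \<in> uhp \<Longrightarrow> \<not> reg_at (2 * k - 2) F w \<Longrightarrow> \<exists>a\<in>A'. w \<in> modular_orbit a"
  shows "F \<in> spanned_forms {poincare_P k a n | a n. a \<in> A}"
proof -
  have m: "2 * k - 2 \<ge> 2" and A'u: "A' \<subseteq> uhp" using k A A' by auto
  have P: "poincare_P k a n z = pser (2 * k - 2) n a z" if "a \<in> A'" "z \<in> uhp" for a n z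
    using poincare_P_eq[OF that(2), of a k n] that A'u k by (auto simp: pser_def)
  obtain G where G: "G \<in> complex_fun.span {poincare_P k a n | a n. a \<in> A'}" "\<forall>w\<in>uhp. eventually (\<lambda>z. F z = G z) (at w)"
    using span_of_singular_orbits[OF m A'(1) A'u F sing, where P = "poincare_P k"] P by blast
  have "complex_fun.span {poincare_P k a n | a n. a \<in> A'} \<subseteq> complex_fun.span {poincare_P k a n | a n. a \<in> A}"
    by (rule complex_fun.span_mono) (use A'(2) in blast)
  then show ?thesis using G unfolding spanned_forms_def same_on_uhp_iff by blast
qed

lemma maass_space_spanned:
  assumes k: "k > 1"
  shows "maass_space k = spanned_forms {poincare_P k \<zz> n | \<zz> n. \<zz> \<in> uhp}"
proof -
  have "F \<in> spanned_forms {poincare_P k \<zz> n | \<zz> n. \<zz> \<in> uhp}" if F: "mform (2 * k - 2) F" for F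
  proof -
    obtain A where "finite A" "A \<subseteq> uhp" "\<forall>w\<in>uhp. \<not> reg_at (2 * k - 2) F w \<longrightarrow> (\<exists>a\<in>A. w \<in> modular_orbit a)"
      using finite_singular_orbits[OF F] by blast
    then show ?thesis by (intro in_spanned_forms_poincare[OF k subset_refl F]) auto
  qed
  then show ?thesis using spanned_forms_poincare(1)[OF k subset_refl] maass_space_iff[of k] k by (intro set_eqI) (auto dest: less_imp_le)
qed

lemma maass_space_at_spanned:
  assumes k: "k > 1" and \<zz>: "\<zz> \<in> uhp"
  shows "maass_space_at k \<zz> = spanned_forms {poincare_P k \<zz> n | n. True}"
proof -
  have S: "{poincare_P k \<zz> n | n. True} = {poincare_P k a n | a n. a \<in> {\<zz>}}" by auto
  have \<zz>': "{\<zz>} \<subseteq> uhp" using \<zz> by simp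
  have iff: "F \<in> maass_space_at k \<zz> \<longleftrightarrow> mform (2 * k - 2) F \<and> (\<forall>w\<in>uhp. \<not> reg_at (2 * k - 2) F w \<longrightarrow> w \<in> modular_orbit \<zz>)" for F
    using maass_space_iff[of k F] k by (auto simp: maass_space_at_def singular_at_iff)
  show ?thesis unfolding S
  proof (intro set_eqI iffI)
    fix F assume "F \<in> maass_space_at k \<zz>"
    then show "F \<in> spanned_forms {poincare_P k a n | a n. a \<in> {\<zz>}}"
      unfolding iff by (intro in_spanned_forms_poincare[OF k \<zz>', of F "{\<zz>}"]) auto
  next
    fix F assume F: "F \<in> spanned_forms {poincare_P k a n | a n. a \<in> {\<zz>}}"
    show "F \<in> maass_space_at k \<zz>"
      unfolding iff using spanned_forms_poincare[OF k \<zz>' F] by auto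
  qed
qed

lemma poincare_P_eq_0:
  assumes k: "k > 1" and \<zz>: "\<zz> \<in> uhp" and z: "z \<in> uhp" and n: "\<not> int (PSL_stabilizer_order \<zz>) dvd n - (int k - 1)"
  shows "poincare_P k \<zz> n z = 0"
proof -
  have e: "2 * (n - (int k - 1)) = 2 * n - int (2 * k - 2)" using k by simp
  obtain N where "N \<in> stabilizer \<zz>" "slope \<zz> N powi (2 * n - int (2 * k - 2)) \<noteq> 1"
    using n unfolding slope_powi_eq_1_iff[OF \<zz>, symmetric] e by blast
  then have "pser (2 * k - 2) n \<zz> z = 0" by (rule pser_eq_0[OF \<zz> z])
  then show ?thesis using poincare_P_eq[OF z \<zz>, of k n] k by (simp add: pser_def)
qed

theorem theorem4p3:
  fixes k :: nat
  assumes "k > 1"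
  shows
    "maass_space k = spanned_forms {poincare_P k \<zz> n | \<zz> n. \<zz> \<in> uhp} \<and>
     (\<forall>\<zz>\<in>uhp. maass_space_at k \<zz> = spanned_forms {poincare_P k \<zz> n | n. True}) \<and>
     (\<forall>\<zz>\<in>uhp. \<forall>n::int. \<forall>z \<in> uhp - modular_orbit \<zz>.
        (D_op ^^ (2 * k - 1)) (poincare_P k \<zz> n) z
          = - fact (2 * k - 2) * of_real (Im \<zz> / pi) ^ (2 * k - 1)
              * poincare_Psi k \<zz> (n + 1 - 2 * int k) z \<and>
        xi_op (1 - int k) (poincare_P k \<zz> n) z
          = of_real (4 * Im \<zz>) ^ (2 * k - 1) * poincare_Psi k \<zz> (- n - 1) z) \<and>
     (\<forall>\<zz>\<in>uhp. \<forall>n::int.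
        (\<not> [n = int k - 1] (mod int (PSL_stabilizer_order \<zz>)) \<longrightarrow>
           (\<forall>z \<in> uhp - modular_orbit \<zz>. poincare_P k \<zz> n z = 0)) \<and>
        ([n = int k - 1] (mod int (PSL_stabilizer_order \<zz>)) \<longrightarrow>
           has_principal_part_at (poincare_P k \<zz> n) (poincare_P_principal_part k \<zz> n) \<zz>))"
  using maass_space_spanned[OF assms] maass_space_at_spanned[OF assms] poincare_D_op[OF assms] poincare_xi_op[OF assms]
    poincare_P_eq_0[OF assms] principal_part[OF assms]
  by (intro conjI ballI allI impI) (auto simp: cong_iff_dvd_diff)

end
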